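(* Over Bishop-style constructive mathematics (BISH), the statement "( * ) every weak-permutably convergent series of real numbers is absolutely convergent" implies the principle BD-$\mathbf{N}$.
   Context: BISH is Bishop-style constructive mathematics: mathematics with intuitionistic logic (together with dependent choice). $\mathbf{N}^+$ denotes the set of positive integers. A bracketing of a real series $\sum a_n$ is a strictly increasing map $f:\mathbf{N}^+\to\mathbf{N}^+$ with $f(1)=1$ together with the sequence $b_k=\sum_{i=f(k)}^{f(k+1)-1} a_i$ ($k\geq 1$); the bracketing converges if $\sum_k b_k$ converges. A series $\sum a_n$ is weak-permutably convergent if it converges and, for every permutation $\sigma$ of $\mathbf{N}^+$, there exists a convergent bracketing of $\sum a_{\sigma(n)}$. A series is absolutely convergent if $\sum |a_n|$ converges. A subset $S$ of $\mathbf{N}$ is pseudobounded if for every sequence $(s_n)_{n\geq1}$ in $S$ there exists $N$ such that $s_n/n<1$ for all $n\geq N$. BD-$\mathbf{N}$ is the principle: every inhabited, countable, pseudobounded subset of $\mathbf{N}^+$ (equivalently of $\mathbf{N}$) is bounded. *)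

theory Defs
  imports Main
begin

text \<open>
  HOL is classical, and read classically both statements related by the theorem are simply true.
  ``BISH proves \<phi>'' is therefore rendered as derivability in an explicit formal system:
  intuitionistic many-sorted predicate logic over the finite types generated by the natural numbers
  and the real numbers, with extensional functions, products and sets, full induction, predicative
  comprehension, unique choice and dependent choice. The reals are given by the usual constructive
  axioms for an Archimedean, Cauchy complete ordered Heyting field. Excluded middle is not available.
\<close>

section \<open>Syntax\<close>

datatype ty = Nat | Real | Fun ty ty | Prod ty ty | Pow ty

text \<open>\<open>CRec \<sigma>\<close> is primitive recursion with values in \<open>\<sigma>\<close>.\<close>

datatype cst =
    CZero | CSuc | CRec ty
  | CPair ty ty | CFst ty ty | CSnd ty ty
  | CRZero | CROne | CRAdd | CRNeg | CRMul | CRAbs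

text \<open>Bound variables are de Bruijn indices, both in terms and in formulas.\<close>

datatype tm = Var nat | Con cst | App tm tm | Lam ty tm

datatype fm =
    Eq ty tm tm | Mem tm tm | Less tm tm
  | Bot | Conj fm fm | Disj fm fm | Imp fm fm
  | Forall ty fm | Exists ty fm

abbreviation Iff :: "fm \<Rightarrow> fm \<Rightarrow> fm" where
  "Iff p q \<equiv> Conj (Imp p q) (Imp q p)"

primrec cty :: "cst \<Rightarrow> ty" where
  "cty CZero = Nat"
| "cty CSuc = Fun Nat Nat"
| "cty (CRec \<sigma>) = Fun \<sigma> (Fun (Fun Nat (Fun \<sigma> \<sigma>)) (Fun Nat \<sigma>))"
| "cty (CPair \<sigma> \<tau>) = Fun \<sigma> (Fun \<tau> (Prod \<sigma> \<tau>))"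
| "cty (CFst \<sigma> \<tau>) = Fun (Prod \<sigma> \<tau>) \<sigma>"
| "cty (CSnd \<sigma> \<tau>) = Fun (Prod \<sigma> \<tau>) \<tau>"
| "cty CRZero = Real"
| "cty CROne = Real"
| "cty CRAdd = Fun Real (Fun Real Real)"
| "cty CRNeg = Fun Real Real"
| "cty CRMul = Fun Real (Fun Real Real)"
| "cty CRAbs = Fun Real Real"

primrec wt :: "ty list \<Rightarrow> tm \<Rightarrow> ty \<Rightarrow> bool" where
  "wt \<Delta> (Var i) \<tau> \<longleftrightarrow> i < length \<Delta> \<and> \<Delta> ! i = \<tau>"
| "wt \<Delta> (Con c) \<tau> \<longleftrightarrow> cty c = \<tau>"
| "wt \<Delta> (App s t) \<tau> \<longleftrightarrow> (\<exists>\<sigma>. wt \<Delta> s (Fun \<sigma> \<tau>) \<and> wt \<Delta> t \<sigma>)"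
| "wt \<Delta> (Lam \<sigma> t) \<rho> \<longleftrightarrow> (\<exists>\<tau>. \<rho> = Fun \<sigma> \<tau> \<and> wt (\<sigma> # \<Delta>) t \<tau>)"

primrec wff :: "ty list \<Rightarrow> fm \<Rightarrow> bool" where
  "wff \<Delta> (Eq \<sigma> s t) \<longleftrightarrow> wt \<Delta> s \<sigma> \<and> wt \<Delta> t \<sigma>"
| "wff \<Delta> (Mem s t) \<longleftrightarrow> (\<exists>\<sigma>. wt \<Delta> s \<sigma> \<and> wt \<Delta> t (Pow \<sigma>))"
| "wff \<Delta> (Less s t) \<longleftrightarrow> wt \<Delta> s Real \<and> wt \<Delta> t Real"
| "wff \<Delta> Bot \<longleftrightarrow> True"
| "wff \<Delta> (Conj p q) \<longleftrightarrow> wff \<Delta> p \<and> wff \<Delta> q"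
| "wff \<Delta> (Disj p q) \<longleftrightarrow> wff \<Delta> p \<and> wff \<Delta> q"
| "wff \<Delta> (Imp p q) \<longleftrightarrow> wff \<Delta> p \<and> wff \<Delta> q"
| "wff \<Delta> (Forall \<sigma> p) \<longleftrightarrow> wff (\<sigma> # \<Delta>) p"
| "wff \<Delta> (Exists \<sigma> p) \<longleftrightarrow> wff (\<sigma> # \<Delta>) p"

definition up_ren :: "(nat \<Rightarrow> nat) \<Rightarrow> nat \<Rightarrow> nat" where
  "up_ren r = case_nat 0 (\<lambda>i. Suc (r i))"

primrec ren :: "(nat \<Rightarrow> nat) \<Rightarrow> tm \<Rightarrow> tm" where
  "ren r (Var i) = Var (r i)"
| "ren r (Con c) = Con c"
| "ren r (App s t) = App (ren r s) (ren r t)"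
| "ren r (Lam \<sigma> t) = Lam \<sigma> (ren (up_ren r) t)"

definition up_sub :: "(nat \<Rightarrow> tm) \<Rightarrow> nat \<Rightarrow> tm" where
  "up_sub s = case_nat (Var 0) (\<lambda>i. ren Suc (s i))"

primrec sub :: "(nat \<Rightarrow> tm) \<Rightarrow> tm \<Rightarrow> tm" where
  "sub s (Var i) = s i"
| "sub s (Con c) = Con c"
| "sub s (App t u) = App (sub s t) (sub s u)"
| "sub s (Lam \<sigma> t) = Lam \<sigma> (sub (up_sub s) t)"

primrec fsub :: "(nat \<Rightarrow> tm) \<Rightarrow> fm \<Rightarrow> fm" where
  "fsub s (Eq \<sigma> t u) = Eq \<sigma> (sub s t) (sub s u)"
| "fsub s (Mem t u) = Mem (sub s t) (sub s u)"
| "fsub s (Less t u) = Less (sub s t) (sub s u)"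
| "fsub s Bot = Bot"
| "fsub s (Conj p q) = Conj (fsub s p) (fsub s q)"
| "fsub s (Disj p q) = Disj (fsub s p) (fsub s q)"
| "fsub s (Imp p q) = Imp (fsub s p) (fsub s q)"
| "fsub s (Forall \<sigma> p) = Forall \<sigma> (fsub (up_sub s) p)"
| "fsub s (Exists \<sigma> p) = Exists \<sigma> (fsub (up_sub s) p)"

definition lift :: "nat \<Rightarrow> tm \<Rightarrow> tm" where
  "lift k t = ren (\<lambda>i. i + k) t"

definition flift :: "fm \<Rightarrow> fm" where
  "flift p = fsub (\<lambda>i. Var (Suc i)) p"

text \<open>Replace index 0 by \<open>t\<close> and lower the other indices.\<close>

definition inst :: "tm \<Rightarrow> tm \<Rightarrow> tm" where
  "inst u t = sub (case_nat t Var) u"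

definition finst :: "fm \<Rightarrow> tm \<Rightarrow> fm" where
  "finst p t = fsub (case_nat t Var) p"


section \<open>Binder notation for the object language\<close>

text \<open>
  To write object formulas with named variables, terms and formulas are given as functions of the
  number \<open>d\<close> of enclosing binders: the variable introduced by a binder at depth \<open>d\<close> has, at a
  later depth \<open>e\<close>, the de Bruijn index \<open>e - Suc d\<close>. A closed formula is obtained at depth 0.
\<close>

type_synonym btm = "nat \<Rightarrow> tm"
type_synonym bfm = "nat \<Rightarrow> fm"

definition bvar :: "nat \<Rightarrow> btm" where
  "bvar d = (\<lambda>e. Var (e - Suc d))"

definition bcon :: "cst \<Rightarrow> btm" where
  "bcon c = (\<lambda>d. Con c)"

definition bapp :: "btm \<Rightarrow> btm \<Rightarrow> btm" (infixl "\<cdot>" 95) where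
  "s \<cdot> t = (\<lambda>d. App (s d) (t d))"

definition blam :: "ty \<Rightarrow> (btm \<Rightarrow> btm) \<Rightarrow> btm" ("\<^bold>\<lambda>\<^bsub>_\<^esub> _" [0, 0] 10) where
  "(\<^bold>\<lambda>\<^bsub>\<sigma>\<^esub> F) = (\<lambda>d. Lam \<sigma> (F (bvar d) (Suc d)))"

definition ball :: "ty \<Rightarrow> (btm \<Rightarrow> bfm) \<Rightarrow> bfm" ("\<^bold>\<forall>\<^bsub>_\<^esub> _" [0, 0] 10) where
  "(\<^bold>\<forall>\<^bsub>\<sigma>\<^esub> F) = (\<lambda>d. Forall \<sigma> (F (bvar d) (Suc d)))"

definition bex :: "ty \<Rightarrow> (btm \<Rightarrow> bfm) \<Rightarrow> bfm" ("\<^bold>\<exists>\<^bsub>_\<^esub> _" [0, 0] 10) where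
  "(\<^bold>\<exists>\<^bsub>\<sigma>\<^esub> F) = (\<lambda>d. Exists \<sigma> (F (bvar d) (Suc d)))"

definition bimp :: "bfm \<Rightarrow> bfm \<Rightarrow> bfm" (infixr "\<^bold>\<longrightarrow>" 25) where
  "(p \<^bold>\<longrightarrow> q) = (\<lambda>d. Imp (p d) (q d))"

definition bconj :: "bfm \<Rightarrow> bfm \<Rightarrow> bfm" (infixr "\<^bold>\<and>" 35) where
  "(p \<^bold>\<and> q) = (\<lambda>d. Conj (p d) (q d))"

definition bdisj :: "bfm \<Rightarrow> bfm \<Rightarrow> bfm" (infixr "\<^bold>\<or>" 30) where
  "(p \<^bold>\<or> q) = (\<lambda>d. Disj (p d) (q d))"

definition bnot :: "bfm \<Rightarrow> bfm" ("\<^bold>\<not> _" [40] 40) where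
  "(\<^bold>\<not> p) = (\<lambda>d. Imp (p d) Bot)"

definition biff :: "bfm \<Rightarrow> bfm \<Rightarrow> bfm" (infixr "\<^bold>\<longleftrightarrow>" 25) where
  "(p \<^bold>\<longleftrightarrow> q) = (\<lambda>d. Iff (p d) (q d))"

definition beq :: "btm \<Rightarrow> ty \<Rightarrow> btm \<Rightarrow> bfm" ("_ =\<^bsub>_\<^esub> _" [51, 0, 51] 50) where
  "(s =\<^bsub>\<sigma>\<^esub> t) = (\<lambda>d. Eq \<sigma> (s d) (t d))"

definition bmem :: "btm \<Rightarrow> btm \<Rightarrow> bfm" (infix "\<^bold>\<in>" 50) where
  "(s \<^bold>\<in> t) = (\<lambda>d. Mem (s d) (t d))"

definition bless :: "btm \<Rightarrow> btm \<Rightarrow> bfm" (infix "<\<^sub>R" 50) where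
  "(s <\<^sub>R t) = (\<lambda>d. Less (s d) (t d))"

definition close :: "bfm \<Rightarrow> fm" where
  "close p = p 0"

abbreviation zeroN :: btm ("0\<^sub>N") where "0\<^sub>N \<equiv> bcon CZero"
abbreviation sucN :: "btm \<Rightarrow> btm" where "sucN t \<equiv> bcon CSuc \<cdot> t"
abbreviation oneN :: btm ("1\<^sub>N") where "1\<^sub>N \<equiv> sucN 0\<^sub>N"

definition recN :: "ty \<Rightarrow> btm \<Rightarrow> btm \<Rightarrow> btm \<Rightarrow> btm" where
  "recN \<sigma> a g n = bcon (CRec \<sigma>) \<cdot> a \<cdot> g \<cdot> n"

definition addN :: "btm \<Rightarrow> btm \<Rightarrow> btm" (infixl "+\<^sub>N" 65) where
  "m +\<^sub>N n = recN Nat m (\<^bold>\<lambda>\<^bsub>Nat\<^esub> \<lambda>i. \<^bold>\<lambda>\<^bsub>Nat\<^esub> \<lambda>r. sucN r) n"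

definition predN :: "btm \<Rightarrow> btm" where
  "predN n = recN Nat 0\<^sub>N (\<^bold>\<lambda>\<^bsub>Nat\<^esub> \<lambda>i. \<^bold>\<lambda>\<^bsub>Nat\<^esub> \<lambda>r. i) n"

text \<open>Truncated subtraction.\<close>

definition monusN :: "btm \<Rightarrow> btm \<Rightarrow> btm" (infixl "-\<^sub>N" 65) where
  "m -\<^sub>N n = recN Nat m (\<^bold>\<lambda>\<^bsub>Nat\<^esub> \<lambda>i. \<^bold>\<lambda>\<^bsub>Nat\<^esub> \<lambda>r. predN r) n"

definition leN :: "btm \<Rightarrow> btm \<Rightarrow> bfm" (infix "\<le>\<^sub>N" 50) where
  "(m \<le>\<^sub>N n) = (\<^bold>\<exists>\<^bsub>Nat\<^esub> \<lambda>k. m +\<^sub>N k =\<^bsub>Nat\<^esub> n)"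

definition lessN :: "btm \<Rightarrow> btm \<Rightarrow> bfm" (infix "<\<^sub>N" 50) where
  "(m <\<^sub>N n) = (sucN m \<le>\<^sub>N n)"

abbreviation zeroR :: btm ("0\<^sub>R") where "0\<^sub>R \<equiv> bcon CRZero"
abbreviation oneR :: btm ("1\<^sub>R") where "1\<^sub>R \<equiv> bcon CROne"

abbreviation addR :: "btm \<Rightarrow> btm \<Rightarrow> btm" (infixl "+\<^sub>R" 65) where
  "x +\<^sub>R y \<equiv> bcon CRAdd \<cdot> x \<cdot> y"
abbreviation mulR :: "btm \<Rightarrow> btm \<Rightarrow> btm" (infixl "*\<^sub>R" 70) where
  "x *\<^sub>R y \<equiv> bcon CRMul \<cdot> x \<cdot> y"
abbreviation negR :: "btm \<Rightarrow> btm" where "negR x \<equiv> bcon CRNeg \<cdot> x"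
abbreviation absR :: "btm \<Rightarrow> btm" where "absR x \<equiv> bcon CRAbs \<cdot> x"
abbreviation diffR :: "btm \<Rightarrow> btm \<Rightarrow> btm" (infixl "-\<^sub>R" 65) where
  "x -\<^sub>R y \<equiv> x +\<^sub>R negR y"

definition natR :: "btm \<Rightarrow> btm" where
  "natR n = recN Real 0\<^sub>R (\<^bold>\<lambda>\<^bsub>Nat\<^esub> \<lambda>i. \<^bold>\<lambda>\<^bsub>Real\<^esub> \<lambda>r. r +\<^sub>R 1\<^sub>R) n"

definition seq_tendsto :: "btm \<Rightarrow> btm \<Rightarrow> bfm" where
  "seq_tendsto x l = (\<^bold>\<forall>\<^bsub>Real\<^esub> \<lambda>e. 0\<^sub>R <\<^sub>R e \<^bold>\<longrightarrow>
     (\<^bold>\<exists>\<^bsub>Nat\<^esub> \<lambda>N. \<^bold>\<forall>\<^bsub>Nat\<^esub> \<lambda>n. N \<le>\<^sub>N n \<^bold>\<longrightarrow> absR (x \<cdot> n -\<^sub>R l) <\<^sub>R e))"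

definition seq_cauchy :: "btm \<Rightarrow> bfm" where
  "seq_cauchy x = (\<^bold>\<forall>\<^bsub>Real\<^esub> \<lambda>e. 0\<^sub>R <\<^sub>R e \<^bold>\<longrightarrow>
     (\<^bold>\<exists>\<^bsub>Nat\<^esub> \<lambda>N. \<^bold>\<forall>\<^bsub>Nat\<^esub> \<lambda>m. \<^bold>\<forall>\<^bsub>Nat\<^esub> \<lambda>n.
        N \<le>\<^sub>N m \<^bold>\<and> N \<le>\<^sub>N n \<^bold>\<longrightarrow> absR (x \<cdot> m -\<^sub>R x \<cdot> n) <\<^sub>R e))"


section \<open>Axioms and intuitionistic derivability\<close>

text \<open>
  The absolute value is determined by \<open>\<bar>x\<bar> < y \<longleftrightarrow> x < y \<and> - x < y\<close>, that is,
  \<open>\<bar>x\<bar>\<close> is the supremum of \<open>x\<close> and \<open>- x\<close>.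
\<close>

definition real_axioms :: "fm set" where
  "real_axioms = close ` {
     \<^bold>\<forall>\<^bsub>Real\<^esub> \<lambda>x. \<^bold>\<forall>\<^bsub>Real\<^esub> \<lambda>y. \<^bold>\<forall>\<^bsub>Real\<^esub> \<lambda>z. (x +\<^sub>R y) +\<^sub>R z =\<^bsub>Real\<^esub> x +\<^sub>R (y +\<^sub>R z),
     \<^bold>\<forall>\<^bsub>Real\<^esub> \<lambda>x. \<^bold>\<forall>\<^bsub>Real\<^esub> \<lambda>y. x +\<^sub>R y =\<^bsub>Real\<^esub> y +\<^sub>R x,
     \<^bold>\<forall>\<^bsub>Real\<^esub> \<lambda>x. 0\<^sub>R +\<^sub>R x =\<^bsub>Real\<^esub> x,
     \<^bold>\<forall>\<^bsub>Real\<^esub> \<lambda>x. x +\<^sub>R negR x =\<^bsub>Real\<^esub> 0\<^sub>R,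
     \<^bold>\<forall>\<^bsub>Real\<^esub> \<lambda>x. \<^bold>\<forall>\<^bsub>Real\<^esub> \<lambda>y. \<^bold>\<forall>\<^bsub>Real\<^esub> \<lambda>z. (x *\<^sub>R y) *\<^sub>R z =\<^bsub>Real\<^esub> x *\<^sub>R (y *\<^sub>R z),
     \<^bold>\<forall>\<^bsub>Real\<^esub> \<lambda>x. \<^bold>\<forall>\<^bsub>Real\<^esub> \<lambda>y. x *\<^sub>R y =\<^bsub>Real\<^esub> y *\<^sub>R x,
     \<^bold>\<forall>\<^bsub>Real\<^esub> \<lambda>x. 1\<^sub>R *\<^sub>R x =\<^bsub>Real\<^esub> x,
     \<^bold>\<forall>\<^bsub>Real\<^esub> \<lambda>x. \<^bold>\<forall>\<^bsub>Real\<^esub> \<lambda>y. \<^bold>\<forall>\<^bsub>Real\<^esub> \<lambda>z. x *\<^sub>R (y +\<^sub>R z) =\<^bsub>Real\<^esub> x *\<^sub>R y +\<^sub>R x *\<^sub>R z,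
     \<^bold>\<forall>\<^bsub>Real\<^esub> \<lambda>x. x <\<^sub>R 0\<^sub>R \<^bold>\<or> 0\<^sub>R <\<^sub>R x \<^bold>\<longrightarrow> (\<^bold>\<exists>\<^bsub>Real\<^esub> \<lambda>y. x *\<^sub>R y =\<^bsub>Real\<^esub> 1\<^sub>R),
     0\<^sub>R <\<^sub>R 1\<^sub>R,
     \<^bold>\<forall>\<^bsub>Real\<^esub> \<lambda>x. \<^bold>\<forall>\<^bsub>Real\<^esub> \<lambda>y. \<^bold>\<not> (x <\<^sub>R y \<^bold>\<and> y <\<^sub>R x),
     \<^bold>\<forall>\<^bsub>Real\<^esub> \<lambda>x. \<^bold>\<forall>\<^bsub>Real\<^esub> \<lambda>y. x <\<^sub>R y \<^bold>\<longrightarrow> (\<^bold>\<forall>\<^bsub>Real\<^esub> \<lambda>z. x <\<^sub>R z \<^bold>\<or> z <\<^sub>R y),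
     \<^bold>\<forall>\<^bsub>Real\<^esub> \<lambda>x. \<^bold>\<forall>\<^bsub>Real\<^esub> \<lambda>y. \<^bold>\<not> (x <\<^sub>R y \<^bold>\<or> y <\<^sub>R x) \<^bold>\<longrightarrow> x =\<^bsub>Real\<^esub> y,
     \<^bold>\<forall>\<^bsub>Real\<^esub> \<lambda>x. \<^bold>\<forall>\<^bsub>Real\<^esub> \<lambda>y. \<^bold>\<forall>\<^bsub>Real\<^esub> \<lambda>z. x <\<^sub>R y \<^bold>\<longrightarrow> x +\<^sub>R z <\<^sub>R y +\<^sub>R z,
     \<^bold>\<forall>\<^bsub>Real\<^esub> \<lambda>x. \<^bold>\<forall>\<^bsub>Real\<^esub> \<lambda>y. 0\<^sub>R <\<^sub>R x \<^bold>\<and> 0\<^sub>R <\<^sub>R y \<^bold>\<longrightarrow> 0\<^sub>R <\<^sub>R x *\<^sub>R y,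
     \<^bold>\<forall>\<^bsub>Real\<^esub> \<lambda>x. \<^bold>\<forall>\<^bsub>Real\<^esub> \<lambda>y. absR x <\<^sub>R y \<^bold>\<longleftrightarrow> x <\<^sub>R y \<^bold>\<and> negR x <\<^sub>R y,
     \<^bold>\<forall>\<^bsub>Real\<^esub> \<lambda>x. \<^bold>\<exists>\<^bsub>Nat\<^esub> \<lambda>n. x <\<^sub>R natR n,
     \<^bold>\<forall>\<^bsub>Fun Nat Real\<^esub> \<lambda>x. seq_cauchy x \<^bold>\<longrightarrow> (\<^bold>\<exists>\<^bsub>Real\<^esub> \<lambda>l. seq_tendsto x l) }"

text \<open>Formulas that refer to no totality of sets; set parameters are allowed.\<close>

primrec set_free :: "ty \<Rightarrow> bool" where
  "set_free Nat \<longleftrightarrow> True"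
| "set_free Real \<longleftrightarrow> True"
| "set_free (Fun \<sigma> \<tau>) \<longleftrightarrow> set_free \<sigma> \<and> set_free \<tau>"
| "set_free (Prod \<sigma> \<tau>) \<longleftrightarrow> set_free \<sigma> \<and> set_free \<tau>"
| "set_free (Pow \<sigma>) \<longleftrightarrow> False"

primrec predicative :: "fm \<Rightarrow> bool" where
  "predicative (Eq \<sigma> s t) \<longleftrightarrow> set_free \<sigma>"
| "predicative (Mem s t) \<longleftrightarrow> True"
| "predicative (Less s t) \<longleftrightarrow> True"
| "predicative Bot \<longleftrightarrow> True"
| "predicative (Conj p q) \<longleftrightarrow> predicative p \<and> predicative q"
| "predicative (Disj p q) \<longleftrightarrow> predicative p \<and> predicative q"
| "predicative (Imp p q) \<longleftrightarrow> predicative p \<and> predicative q"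
| "predicative (Forall \<sigma> p) \<longleftrightarrow> set_free \<sigma> \<and> predicative p"
| "predicative (Exists \<sigma> p) \<longleftrightarrow> set_free \<sigma> \<and> predicative p"

text \<open>
  \<open>axiom \<Delta> p\<close>: \<open>p\<close> is a non-logical axiom in the context \<open>\<Delta>\<close> of free variables. In the schemes:
  \<^item> \<open>induction\<close>, \<open>comprehension\<close>: index 0 of \<open>p\<close> is the number, resp. the element;
  \<^item> \<open>unique_choice\<close>: \<open>p\<close> is \<open>p(x, y)\<close> with \<open>y\<close> at index 0 and \<open>x\<close> at index 1, and the scheme is
    \<open>(\<forall>x. \<exists>!y. p(x, y)) \<longrightarrow> (\<exists>f. \<forall>x. p(x, f x))\<close>;
  \<^item> \<open>dependent_choice\<close>: \<open>p\<close> is \<open>p(x, y)\<close> as before, \<open>D\<close> is a set, and the scheme is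
    \<open>(\<forall>x\<in>D. \<exists>y\<in>D. p(x, y)) \<longrightarrow> (\<forall>x\<in>D. \<exists>f. f 0 = x \<and> (\<forall>n. f n \<in> D \<and> p(f n, f (n + 1))))\<close>.
\<close>

inductive axiom :: "ty list \<Rightarrow> fm \<Rightarrow> bool" where
  beta: "wt (\<sigma> # \<Delta>) t \<tau> \<Longrightarrow> wt \<Delta> s \<sigma> \<Longrightarrow> axiom \<Delta> (Eq \<tau> (App (Lam \<sigma> t) s) (inst t s))"
| fun_ext: "axiom \<Delta> (close (\<^bold>\<forall>\<^bsub>Fun \<sigma> \<tau>\<^esub> \<lambda>f. \<^bold>\<forall>\<^bsub>Fun \<sigma> \<tau>\<^esub> \<lambda>g.
    (\<^bold>\<forall>\<^bsub>\<sigma>\<^esub> \<lambda>x. f \<cdot> x =\<^bsub>\<tau>\<^esub> g \<cdot> x) \<^bold>\<longrightarrow> f =\<^bsub>Fun \<sigma> \<tau>\<^esub> g))"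
| set_ext: "axiom \<Delta> (close (\<^bold>\<forall>\<^bsub>Pow \<sigma>\<^esub> \<lambda>A. \<^bold>\<forall>\<^bsub>Pow \<sigma>\<^esub> \<lambda>B.
    (\<^bold>\<forall>\<^bsub>\<sigma>\<^esub> \<lambda>x. x \<^bold>\<in> A \<^bold>\<longleftrightarrow> x \<^bold>\<in> B) \<^bold>\<longrightarrow> A =\<^bsub>Pow \<sigma>\<^esub> B))"
| fst_pair: "axiom \<Delta> (close (\<^bold>\<forall>\<^bsub>\<sigma>\<^esub> \<lambda>x. \<^bold>\<forall>\<^bsub>\<tau>\<^esub> \<lambda>y.
    bcon (CFst \<sigma> \<tau>) \<cdot> (bcon (CPair \<sigma> \<tau>) \<cdot> x \<cdot> y) =\<^bsub>\<sigma>\<^esub> x))"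
| snd_pair: "axiom \<Delta> (close (\<^bold>\<forall>\<^bsub>\<sigma>\<^esub> \<lambda>x. \<^bold>\<forall>\<^bsub>\<tau>\<^esub> \<lambda>y.
    bcon (CSnd \<sigma> \<tau>) \<cdot> (bcon (CPair \<sigma> \<tau>) \<cdot> x \<cdot> y) =\<^bsub>\<tau>\<^esub> y))"
| pair_surj: "axiom \<Delta> (close (\<^bold>\<forall>\<^bsub>Prod \<sigma> \<tau>\<^esub> \<lambda>z.
    bcon (CPair \<sigma> \<tau>) \<cdot> (bcon (CFst \<sigma> \<tau>) \<cdot> z) \<cdot> (bcon (CSnd \<sigma> \<tau>) \<cdot> z) =\<^bsub>Prod \<sigma> \<tau>\<^esub> z))"
| suc_not_zero: "axiom \<Delta> (close (\<^bold>\<forall>\<^bsub>Nat\<^esub> \<lambda>n. \<^bold>\<not> (sucN n =\<^bsub>Nat\<^esub> 0\<^sub>N)))"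
| suc_inj: "axiom \<Delta> (close (\<^bold>\<forall>\<^bsub>Nat\<^esub> \<lambda>m. \<^bold>\<forall>\<^bsub>Nat\<^esub> \<lambda>n.
    sucN m =\<^bsub>Nat\<^esub> sucN n \<^bold>\<longrightarrow> m =\<^bsub>Nat\<^esub> n))"
| rec_zero: "axiom \<Delta> (close (\<^bold>\<forall>\<^bsub>\<sigma>\<^esub> \<lambda>a. \<^bold>\<forall>\<^bsub>Fun Nat (Fun \<sigma> \<sigma>)\<^esub> \<lambda>g.
    recN \<sigma> a g 0\<^sub>N =\<^bsub>\<sigma>\<^esub> a))"
| rec_suc: "axiom \<Delta> (close (\<^bold>\<forall>\<^bsub>\<sigma>\<^esub> \<lambda>a. \<^bold>\<forall>\<^bsub>Fun Nat (Fun \<sigma> \<sigma>)\<^esub> \<lambda>g. \<^bold>\<forall>\<^bsub>Nat\<^esub> \<lambda>n.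
    recN \<sigma> a g (sucN n) =\<^bsub>\<sigma>\<^esub> g \<cdot> n \<cdot> recN \<sigma> a g n))"
| induction: "wff (Nat # \<Delta>) p \<Longrightarrow> axiom \<Delta>
    (Imp (finst p (Con CZero))
    (Imp (Forall Nat (Imp p (fsub (case_nat (App (Con CSuc) (Var 0)) (\<lambda>i. Var (Suc i))) p)))
         (Forall Nat p)))"
| comprehension: "wff (\<sigma> # \<Delta>) p \<Longrightarrow> predicative p \<Longrightarrow> axiom \<Delta>
    (Exists (Pow \<sigma>) (Forall \<sigma>
      (Iff (Mem (Var 0) (Var 1)) (fsub (case_nat (Var 0) (\<lambda>i. Var (i + 2))) p))))"
| unique_choice: "wff (\<tau> # \<sigma> # \<Delta>) p \<Longrightarrow> axiom \<Delta>
    (Imp (Forall \<sigma> (Exists \<tau> (Conj p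
            (Forall \<tau> (Imp (fsub (case_nat (Var 0) (\<lambda>i. Var (i + 2))) p) (Eq \<tau> (Var 0) (Var 1)))))))
         (Exists (Fun \<sigma> \<tau>) (Forall \<sigma>
            (fsub (case_nat (App (Var 1) (Var 0)) (case_nat (Var 0) (\<lambda>i. Var (i + 2)))) p))))"
| dependent_choice: "wt \<Delta> D (Pow \<sigma>) \<Longrightarrow> wff (\<sigma> # \<sigma> # \<Delta>) p \<Longrightarrow> axiom \<Delta>
    (Imp (Forall \<sigma> (Imp (Mem (Var 0) (lift 1 D)) (Exists \<sigma> (Conj (Mem (Var 0) (lift 2 D)) p))))
         (Forall \<sigma> (Imp (Mem (Var 0) (lift 1 D))
            (Exists (Fun Nat \<sigma>) (Conj (Eq \<sigma> (App (Var 0) (Con CZero)) (Var 1))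
               (Forall Nat (Conj (Mem (App (Var 1) (Var 0)) (lift 3 D))
                 (fsub (case_nat (App (Var 1) (App (Con CSuc) (Var 0)))
                         (case_nat (App (Var 1) (Var 0)) (\<lambda>i. Var (i + 3)))) p))))))))"
| real: "p \<in> real_axioms \<Longrightarrow> axiom \<Delta> p"

text \<open>Natural deduction for intuitionistic logic: \<open>\<Delta>\<close> types the free variables, \<open>\<Gamma>\<close> is the set of
  hypotheses.\<close>

inductive derives :: "ty list \<Rightarrow> fm set \<Rightarrow> fm \<Rightarrow> bool" where
  Ax: "axiom \<Delta> p \<Longrightarrow> derives \<Delta> \<Gamma> p"
| Hyp: "p \<in> \<Gamma> \<Longrightarrow> wff \<Delta> p \<Longrightarrow> derives \<Delta> \<Gamma> p"
| BotE: "derives \<Delta> \<Gamma> Bot \<Longrightarrow> wff \<Delta> p \<Longrightarrow> derives \<Delta> \<Gamma> p"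
| ConjI: "derives \<Delta> \<Gamma> p \<Longrightarrow> derives \<Delta> \<Gamma> q \<Longrightarrow> derives \<Delta> \<Gamma> (Conj p q)"
| ConjE1: "derives \<Delta> \<Gamma> (Conj p q) \<Longrightarrow> derives \<Delta> \<Gamma> p"
| ConjE2: "derives \<Delta> \<Gamma> (Conj p q) \<Longrightarrow> derives \<Delta> \<Gamma> q"
| DisjI1: "derives \<Delta> \<Gamma> p \<Longrightarrow> wff \<Delta> q \<Longrightarrow> derives \<Delta> \<Gamma> (Disj p q)"
| DisjI2: "derives \<Delta> \<Gamma> q \<Longrightarrow> wff \<Delta> p \<Longrightarrow> derives \<Delta> \<Gamma> (Disj p q)"
| DisjE: "derives \<Delta> \<Gamma> (Disj p q) \<Longrightarrow> derives \<Delta> (insert p \<Gamma>) r \<Longrightarrow> derives \<Delta> (insert q \<Gamma>) r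
    \<Longrightarrow> derives \<Delta> \<Gamma> r"
| ImpI: "wff \<Delta> p \<Longrightarrow> derives \<Delta> (insert p \<Gamma>) q \<Longrightarrow> derives \<Delta> \<Gamma> (Imp p q)"
| ImpE: "derives \<Delta> \<Gamma> (Imp p q) \<Longrightarrow> derives \<Delta> \<Gamma> p \<Longrightarrow> derives \<Delta> \<Gamma> q"
| ForallI: "derives (\<sigma> # \<Delta>) (flift ` \<Gamma>) p \<Longrightarrow> derives \<Delta> \<Gamma> (Forall \<sigma> p)"
| ForallE: "derives \<Delta> \<Gamma> (Forall \<sigma> p) \<Longrightarrow> wt \<Delta> t \<sigma> \<Longrightarrow> derives \<Delta> \<Gamma> (finst p t)"
| ExistsI: "derives \<Delta> \<Gamma> (finst p t) \<Longrightarrow> wt \<Delta> t \<sigma> \<Longrightarrow> wff (\<sigma> # \<Delta>) p \<Longrightarrow> derives \<Delta> \<Gamma> (Exists \<sigma> p)"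
| ExistsE: "derives \<Delta> \<Gamma> (Exists \<sigma> p) \<Longrightarrow> derives (\<sigma> # \<Delta>) (insert p (flift ` \<Gamma>)) (flift q)
    \<Longrightarrow> wff \<Delta> q \<Longrightarrow> derives \<Delta> \<Gamma> q"
| EqRefl: "wt \<Delta> t \<sigma> \<Longrightarrow> derives \<Delta> \<Gamma> (Eq \<sigma> t t)"
| EqSubst: "derives \<Delta> \<Gamma> (Eq \<sigma> s t) \<Longrightarrow> derives \<Delta> \<Gamma> (finst p s) \<Longrightarrow> wff (\<sigma> # \<Delta>) p
    \<Longrightarrow> derives \<Delta> \<Gamma> (finst p t)"

definition BISH_proves :: "bfm \<Rightarrow> bool" where
  "BISH_proves p \<longleftrightarrow> derives [] {} (close p)"


section \<open>Series and the principle BD-N, in the object language\<close>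

text \<open>
  A map on the positive integers is represented by a function on the natural numbers of which only
  the values at \<open>n \<ge> 1\<close> are used.
\<close>

definition pos :: "btm \<Rightarrow> bfm" where
  "pos n = (1\<^sub>N \<le>\<^sub>N n)"

text \<open>\<open>sumR a m n\<close> is the sum of \<open>a i\<close> for \<open>m \<le> i < n\<close>.\<close>

definition sumR :: "btm \<Rightarrow> btm \<Rightarrow> btm \<Rightarrow> btm" where
  "sumR a m n = recN Real 0\<^sub>R (\<^bold>\<lambda>\<^bsub>Nat\<^esub> \<lambda>j. \<^bold>\<lambda>\<^bsub>Real\<^esub> \<lambda>s. s +\<^sub>R a \<cdot> (m +\<^sub>N j)) (n -\<^sub>N m)"

definition series_converges :: "btm \<Rightarrow> bfm" where
  "series_converges a =
     (\<^bold>\<exists>\<^bsub>Real\<^esub> \<lambda>l. seq_tendsto (\<^bold>\<lambda>\<^bsub>Nat\<^esub> \<lambda>n. sumR a 1\<^sub>N (sucN n)) l)"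

definition absolutely_convergent :: "btm \<Rightarrow> bfm" where
  "absolutely_convergent a = series_converges (\<^bold>\<lambda>\<^bsub>Nat\<^esub> \<lambda>n. absR (a \<cdot> n))"

definition permutation :: "btm \<Rightarrow> bfm" where
  "permutation \<pi> =
     ((\<^bold>\<forall>\<^bsub>Nat\<^esub> \<lambda>n. pos n \<^bold>\<longrightarrow> pos (\<pi> \<cdot> n)) \<^bold>\<and>
      (\<^bold>\<forall>\<^bsub>Nat\<^esub> \<lambda>m. \<^bold>\<forall>\<^bsub>Nat\<^esub> \<lambda>n.
         pos m \<^bold>\<and> pos n \<^bold>\<and> \<pi> \<cdot> m =\<^bsub>Nat\<^esub> \<pi> \<cdot> n \<^bold>\<longrightarrow> m =\<^bsub>Nat\<^esub> n) \<^bold>\<and>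
      (\<^bold>\<forall>\<^bsub>Nat\<^esub> \<lambda>m. pos m \<^bold>\<longrightarrow> (\<^bold>\<exists>\<^bsub>Nat\<^esub> \<lambda>n. pos n \<^bold>\<and> \<pi> \<cdot> n =\<^bsub>Nat\<^esub> m)))"

definition bracketing_map :: "btm \<Rightarrow> bfm" where
  "bracketing_map f =
     ((\<^bold>\<forall>\<^bsub>Nat\<^esub> \<lambda>n. pos n \<^bold>\<longrightarrow> pos (f \<cdot> n)) \<^bold>\<and>
      (\<^bold>\<forall>\<^bsub>Nat\<^esub> \<lambda>m. \<^bold>\<forall>\<^bsub>Nat\<^esub> \<lambda>n. pos m \<^bold>\<and> m <\<^sub>N n \<^bold>\<longrightarrow> f \<cdot> m <\<^sub>N f \<cdot> n) \<^bold>\<and>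
      f \<cdot> 1\<^sub>N =\<^bsub>Nat\<^esub> 1\<^sub>N)"

definition bracketing :: "btm \<Rightarrow> btm \<Rightarrow> btm" where
  "bracketing a f = (\<^bold>\<lambda>\<^bsub>Nat\<^esub> \<lambda>k. sumR a (f \<cdot> k) (f \<cdot> sucN k))"

definition weak_permutably_convergent :: "btm \<Rightarrow> bfm" where
  "weak_permutably_convergent a =
     (series_converges a \<^bold>\<and>
      (\<^bold>\<forall>\<^bsub>Fun Nat Nat\<^esub> \<lambda>\<pi>. permutation \<pi> \<^bold>\<longrightarrow>
         (\<^bold>\<exists>\<^bsub>Fun Nat Nat\<^esub> \<lambda>f. bracketing_map f \<^bold>\<and>
            series_converges (bracketing (\<^bold>\<lambda>\<^bsub>Nat\<^esub> \<lambda>n. a \<cdot> (\<pi> \<cdot> n)) f))))"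

definition weak_permutable_implies_absolute :: bfm where
  "weak_permutable_implies_absolute =
     (\<^bold>\<forall>\<^bsub>Fun Nat Real\<^esub> \<lambda>a. weak_permutably_convergent a \<^bold>\<longrightarrow> absolutely_convergent a)"

definition inhabited :: "btm \<Rightarrow> bfm" where
  "inhabited S = (\<^bold>\<exists>\<^bsub>Nat\<^esub> \<lambda>x. x \<^bold>\<in> S)"

definition detachable :: "btm \<Rightarrow> bfm" where
  "detachable D = (\<^bold>\<forall>\<^bsub>Nat\<^esub> \<lambda>n. n \<^bold>\<in> D \<^bold>\<or> \<^bold>\<not> (n \<^bold>\<in> D))"

text \<open>Constructively, a countable set is the image of a detachable set of natural numbers.\<close>

definition countable :: "btm \<Rightarrow> bfm" where
  "countable S =
     (\<^bold>\<exists>\<^bsub>Pow Nat\<^esub> \<lambda>D. \<^bold>\<exists>\<^bsub>Fun Nat Nat\<^esub> \<lambda>f. detachable D \<^bold>\<and>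
        (\<^bold>\<forall>\<^bsub>Nat\<^esub> \<lambda>x. x \<^bold>\<in> S \<^bold>\<longleftrightarrow> (\<^bold>\<exists>\<^bsub>Nat\<^esub> \<lambda>n. n \<^bold>\<in> D \<^bold>\<and> f \<cdot> n =\<^bsub>Nat\<^esub> x)))"

text \<open>For \<open>n \<ge> 1\<close>, \<open>s n / n < 1\<close> is \<open>s n < n\<close>.\<close>

definition pseudobounded :: "btm \<Rightarrow> bfm" where
  "pseudobounded S =
     (\<^bold>\<forall>\<^bsub>Fun Nat Nat\<^esub> \<lambda>s. (\<^bold>\<forall>\<^bsub>Nat\<^esub> \<lambda>n. pos n \<^bold>\<longrightarrow> s \<cdot> n \<^bold>\<in> S) \<^bold>\<longrightarrow>
        (\<^bold>\<exists>\<^bsub>Nat\<^esub> \<lambda>N. pos N \<^bold>\<and> (\<^bold>\<forall>\<^bsub>Nat\<^esub> \<lambda>n. N \<le>\<^sub>N n \<^bold>\<longrightarrow> s \<cdot> n <\<^sub>N n)))"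

definition bounded :: "btm \<Rightarrow> bfm" where
  "bounded S = (\<^bold>\<exists>\<^bsub>Nat\<^esub> \<lambda>N. \<^bold>\<forall>\<^bsub>Nat\<^esub> \<lambda>x. x \<^bold>\<in> S \<^bold>\<longrightarrow> x \<le>\<^sub>N N)"

definition BD_N :: bfm where
  "BD_N =
     (\<^bold>\<forall>\<^bsub>Pow Nat\<^esub> \<lambda>S. (\<^bold>\<forall>\<^bsub>Nat\<^esub> \<lambda>x. x \<^bold>\<in> S \<^bold>\<longrightarrow> pos x) \<^bold>\<and>
        inhabited S \<^bold>\<and> countable S \<^bold>\<and> pseudobounded S \<^bold>\<longrightarrow> bounded S)"

end

theory Submission
  imports Defs "HOL-Library.Countable_Set"
begin

text \<open>
  Derivability is established through a canonical Kripke model: the worlds are prime theories with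
  witnesses, so a closed formula forced at every world is derivable, and at a single world
  disjunctions, existential statements and facts about natural numbers can be handled classically.

  Inside the model the argument is the following. Let \<open>s\<close> enumerate \<open>S\<close> and let \<open>M\<close> be its running
  maximum. Stage \<open>k\<close> is a block of \<open>k + 2\<close> consecutive indices. Let \<open>z n = 1/(k+1)\<close> if \<open>n\<close> is an odd
  index of a stage \<open>k\<close> with \<open>M k < M (k+1)\<close>, and \<open>z n = 0\<close> otherwise, and let \<open>a n = z n - z (n-1)\<close>.
  The partial sums of \<open>a\<close> are the \<open>z n\<close>, which tend to 0, whereas each jump of \<open>M\<close> contributes 1 to
  the sum of the absolute values; so absolute convergence makes \<open>M\<close> eventually constant.

  For a permutation \<open>\<pi>\<close> let \<open>q m\<close> be so large that \<open>\<pi>\<close> maps \<open>1, \<dots>, q m\<close> onto a superset of all indices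
  below stage \<open>m\<close>, and let \<open>Q m\<close> bound the values of \<open>\<pi>\<close> there. If \<open>M\<close> is constant from \<open>m\<close> to \<open>Q m + 1\<close>
  then the first \<open>q m\<close> terms of the rearranged series add up to 0. To choose the end of the \<open>k\<close>-th
  bracket, replace \<open>m\<close> by \<open>Q m + 1\<close> at most \<open>k\<close> times until this happens; if it never does, \<open>M\<close> has
  reached an element of \<open>S\<close> that is at least \<open>k\<close>, which pseudoboundedness excludes for large \<open>k\<close>.
\<close>

section \<open>Substitution\<close>

text \<open>The model spares long derivations in the calculus, but it dictates how the argument is
  run. Quantifiers over functions range over terms of the object language, so every auxiliary
  sequence (\<open>runmax\<close>, \<open>stage\<close>, \<open>cover\<close>,
  \<open>search\<close>, the bracket ends) must be a term built from recursors or come from unique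
  choice. Implications and universal statements speak of all later worlds, so facts have to be
  carried along together with proofs that they persist. Induction is the sharpest case: equations
  between natural numbers are decided at each world, equations between reals are not, hence two
  kinds of induction.

  The block length \<open>k + 2\<close> leaves room for \<open>k + 1\<close> consecutive steps of
  size \<open>1/(k+1)\<close> inside one stage, of total 1, while the terms themselves tend to 0;
  alternating signs hide this from the partial sums. Whether \<open>M\<close> will ever jump again
  cannot be decided, so the search for a bracket end is cut off after \<open>k\<close> rounds. The
  values of \<open>M\<close> at its outcomes form a sequence in \<open>S\<close>, and it is this
  sequence to which pseudoboundedness is applied.\<close>

lemma up_ren_simps [simp]: "up_ren r 0 = 0" "up_ren r (Suc i) = Suc (r i)"
  by (simp_all add: up_ren_def)

lemma up_sub_simps [simp]: "up_sub s 0 = Var 0" "up_sub s (Suc i) = ren Suc (s i)"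
  by (simp_all add: up_sub_def)

lemma nat_fun_eqI: "f 0 = g 0 \<Longrightarrow> (\<And>i. f (Suc i) = g (Suc i)) \<Longrightarrow> f = g"
  by (rule ext, case_tac x) auto

lemma ren_ren: "ren r (ren r' t) = ren (\<lambda>i. r (r' i)) t"
proof (induction t arbitrary: r r')
  case (Lam \<sigma> t)
  have "(\<lambda>i. up_ren r (up_ren r' i)) = up_ren (\<lambda>i. r (r' i))" by (rule nat_fun_eqI) auto
  with Lam show ?case by simp
qed auto

lemma sub_ren: "sub s (ren r t) = sub (\<lambda>i. s (r i)) t"
proof (induction t arbitrary: s r)
  case (Lam \<sigma> t)
  have "(\<lambda>i. up_sub s (up_ren r i)) = up_sub (\<lambda>i. s (r i))" by (rule nat_fun_eqI) auto
  with Lam show ?case by simp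
qed auto

lemma ren_sub: "ren r (sub s t) = sub (\<lambda>i. ren r (s i)) t"
proof (induction t arbitrary: s r)
  case (Lam \<sigma> t)
  have "(\<lambda>i. ren (up_ren r) (up_sub s i)) = up_sub (\<lambda>i. ren r (s i))"
    by (rule nat_fun_eqI) (auto simp: ren_ren comp_def)
  with Lam show ?case by simp
qed auto

lemma sub_up_sub: "(\<lambda>i. sub (up_sub s) (up_sub s' i)) = up_sub (\<lambda>i. sub s (s' i))"
  by (rule nat_fun_eqI) (auto simp: sub_ren ren_sub comp_def)

lemma sub_sub: "sub s (sub s' t) = sub (\<lambda>i. sub s (s' i)) t"
  by (induction t arbitrary: s s') (auto simp: sub_up_sub)

lemma up_sub_Var [simp]: "up_sub Var = Var"
  by (rule nat_fun_eqI) auto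

lemma sub_Var [simp]: "sub Var t = t"
  by (induction t) auto

abbreviation (input) rv :: "(nat \<Rightarrow> nat) \<Rightarrow> nat \<Rightarrow> tm" where "rv r \<equiv> \<lambda>i. Var (r i)"

lemma up_sub_rename: "up_sub (rv r) = rv (up_ren r)"
  by (rule nat_fun_eqI) auto

lemma ren_eq_sub: "ren r t = sub (rv r) t"
  by (induction t arbitrary: r) (auto simp: up_sub_rename)

lemma fsub_fsub: "fsub s (fsub s' p) = fsub (\<lambda>i. sub s (s' i)) p"
  by (induction p arbitrary: s s') (auto simp: sub_up_sub sub_sub)

lemma fsub_Var [simp]: "fsub Var p = p"
  by (induction p) auto

lemma flift_eq: "flift p = fsub (rv Suc) p"
  by (simp add: flift_def comp_def)

text \<open>Extends an environment of terms, a partial typing context or a substitution at index 0.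
  The object-level schemes use \<open>case_nat\<close>; a constant of its own has its own
  simplification and splitting rules.\<close>

definition econs :: "'a \<Rightarrow> (nat \<Rightarrow> 'a) \<Rightarrow> nat \<Rightarrow> 'a" where
  "econs a f = case_nat a f"

lemma econs_simps [simp]: "econs a f 0 = a" "econs a f (Suc i) = f i"
  "econs a f (numeral k) = f (pred_numeral k)" "econs a f 1 = f 0"
  by (simp_all add: econs_def)

lemma econs_split: "P (econs a f i) \<longleftrightarrow> (i = 0 \<longrightarrow> P a) \<and> (\<forall>j. i = Suc j \<longrightarrow> P (f j))"
  by (cases i) auto

lemma econs_split_asm: "P (econs a f i) \<longleftrightarrow> \<not> (i = 0 \<and> \<not> P a \<or> (\<exists>j. i = Suc j \<and> \<not> P (f j)))"
  by (cases i) auto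

lemmas econs_splits = econs_split econs_split_asm

lemma finst_eq: "finst p t = fsub (econs t Var) p"
  by (simp add: finst_def econs_def)

lemma inst_eq: "inst u t = sub (econs t Var) u"
  by (simp add: inst_def econs_def)

text \<open>Substituting under a binder and then instantiating it is one environment extension. In
  this form the quantifier clauses of \<open>forc\<close> meet the quantifier rules of the
  calculus.\<close>

lemma fsub_up_finst: "finst (fsub (up_sub s) p) t = fsub (econs t s) p"
  unfolding finst_eq fsub_fsub
  by (rule arg_cong[where f="\<lambda>s. fsub s p"], rule nat_fun_eqI) (auto simp: sub_ren comp_def)

lemma inst_up: "inst (sub (up_sub s) u) t = sub (econs t s) u"
  unfolding inst_eq sub_sub
  by (rule arg_cong[where f="\<lambda>s. sub s u"], rule nat_fun_eqI) (auto simp: sub_ren comp_def)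

lemma fsub_finst: "fsub s (finst p t) = fsub (econs (sub s t) s) p"
  unfolding finst_eq fsub_fsub
  by (rule arg_cong[where f="\<lambda>s. fsub s p"], rule nat_fun_eqI) auto

lemma sub_inst: "sub s (inst u t) = sub (econs (sub s t) s) u"
  unfolding inst_eq sub_sub
  by (rule arg_cong[where f="\<lambda>s. sub s u"], rule nat_fun_eqI) auto

lemma fsub_finst': "fsub s (finst p t) = finst (fsub (up_sub s) p) (sub s t)"
  by (simp add: fsub_finst fsub_up_finst)

lemma fsub_up_flift: "fsub (up_sub s) (flift p) = flift (fsub s p)"
  unfolding flift_eq fsub_fsub
  by (rule arg_cong[where f="\<lambda>s. fsub s p"]) (auto simp: ren_eq_sub)

section \<open>Type inference\<close>

text \<open>\<open>wt\<close> and \<open>wff\<close> take lists, which cannot describe the variables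
  of a saturated theory: in general infinitely many indices are typed, with infinitely many untyped
  ones in between.\<close>

primrec tyc :: "(nat \<Rightarrow> ty option) \<Rightarrow> tm \<Rightarrow> ty option" where
  "tyc C (Var i) = C i"
| "tyc C (Con c) = Some (cty c)"
| "tyc C (App s t) = (case tyc C s of Some (Fun \<sigma> \<tau>) \<Rightarrow> (if tyc C t = Some \<sigma> then Some \<tau> else None)
     | _ \<Rightarrow> None)"
| "tyc C (Lam \<sigma> t) = map_option (Fun \<sigma>) (tyc (econs (Some \<sigma>) C) t)"

primrec fok :: "(nat \<Rightarrow> ty option) \<Rightarrow> fm \<Rightarrow> bool" where
  "fok C (Eq \<sigma> s t) \<longleftrightarrow> tyc C s = Some \<sigma> \<and> tyc C t = Some \<sigma>"
| "fok C (Mem s t) \<longleftrightarrow> (\<exists>\<sigma>. tyc C s = Some \<sigma> \<and> tyc C t = Some (Pow \<sigma>))"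
| "fok C (Less s t) \<longleftrightarrow> tyc C s = Some Real \<and> tyc C t = Some Real"
| "fok C Bot \<longleftrightarrow> True"
| "fok C (Conj p q) \<longleftrightarrow> fok C p \<and> fok C q"
| "fok C (Disj p q) \<longleftrightarrow> fok C p \<and> fok C q"
| "fok C (Imp p q) \<longleftrightarrow> fok C p \<and> fok C q"
| "fok C (Forall \<sigma> p) \<longleftrightarrow> fok (econs (Some \<sigma>) C) p"
| "fok C (Exists \<sigma> p) \<longleftrightarrow> fok (econs (Some \<sigma>) C) p"

definition lctx :: "ty list \<Rightarrow> nat \<Rightarrow> ty option" where
  "lctx \<Delta> i = (if i < length \<Delta> then Some (\<Delta> ! i) else None)"

lemma lctx_Cons [simp]: "lctx (\<sigma> # \<Delta>) = econs (Some \<sigma>) (lctx \<Delta>)"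
  by (rule nat_fun_eqI) (auto simp: lctx_def)

lemma tyc_App_Some: "tyc C (App s t) = Some \<tau> \<longleftrightarrow> (\<exists>\<sigma>. tyc C s = Some (Fun \<sigma> \<tau>) \<and> tyc C t = Some \<sigma>)"
  by (auto split: option.splits ty.splits)

lemma wt_tyc: "wt \<Delta> t \<tau> \<longleftrightarrow> tyc (lctx \<Delta>) t = Some \<tau>"
proof (induction t arbitrary: \<Delta> \<tau>)
  case (App s t) then show ?case by (simp only: wt.simps tyc_App_Some)
next
  case (Lam \<sigma> t) then show ?case by (auto simp: map_option_case split: option.splits)
qed (auto simp: lctx_def)

lemma wff_fok: "wff \<Delta> p \<longleftrightarrow> fok (lctx \<Delta>) p"
  by (induction p arbitrary: \<Delta>) (auto simp: wt_tyc)

text \<open>Typability in \<open>C\<close> bounds the free variables, so freshness of a variable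
  \<open>c\<close> can be expressed as \<open>C c = None\<close>.\<close>

lemma tyc_cong_on: "tyc C t = Some \<tau> \<Longrightarrow> (\<And>i. C i \<noteq> None \<Longrightarrow> s i = s' i) \<Longrightarrow> sub s t = sub s' t"
proof (induction t arbitrary: C \<tau> s s')
  case (App t u)
  then show ?case by (metis tyc_App_Some sub.simps(3))
next
  case (Lam \<sigma> t)
  from Lam.prems(1) obtain \<rho> where "tyc (econs (Some \<sigma>) C) t = Some \<rho>" by auto
  then have "sub (up_sub s) t = sub (up_sub s') t"
    by (rule Lam.IH) (auto simp: Lam.prems(2) up_sub_def split: econs_splits nat.splits)
  then show ?case by simp
qed auto

lemma fok_cong_on: "fok C p \<Longrightarrow> (\<And>i. C i \<noteq> None \<Longrightarrow> s i = s' i) \<Longrightarrow> fsub s p = fsub s' p"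
proof (induction p arbitrary: C s s')
  case (Forall \<sigma> p)
  have "fsub (up_sub s) p = fsub (up_sub s') p"
    by (rule Forall.IH[of "econs (Some \<sigma>) C"])
      (use Forall.prems in \<open>auto simp: up_sub_def split: econs_splits nat.splits\<close>)
  then show ?case by simp
next
  case (Exists \<sigma> p)
  have "fsub (up_sub s) p = fsub (up_sub s') p"
    by (rule Exists.IH[of "econs (Some \<sigma>) C"])
      (use Exists.prems in \<open>auto simp: up_sub_def split: econs_splits nat.splits\<close>)
  then show ?case by simp
next
  case (Eq \<sigma> t u) then show ?case by (auto intro: tyc_cong_on)
next
  case (Mem t u) then show ?case by (auto intro: tyc_cong_on)
next
  case (Less t u) then show ?case by (auto intro: tyc_cong_on)
next
  case (Conj p q) then show ?case by (metis fok.simps(5) fsub.simps(5))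
next
  case (Disj p q) then show ?case by (metis fok.simps(6) fsub.simps(6))
next
  case (Imp p q) then show ?case by (metis fok.simps(7) fsub.simps(7))
qed auto

lemma tyc_ren: "tyc C t = Some \<tau> \<Longrightarrow> (\<And>i \<tau>. C i = Some \<tau> \<Longrightarrow> C' (r i) = Some \<tau>) \<Longrightarrow> tyc C' (ren r t) = Some \<tau>"
proof (induction t arbitrary: C C' r \<tau>)
  case (App s t)
  from App.prems(1) obtain \<sigma> where "tyc C s = Some (Fun \<sigma> \<tau>)" "tyc C t = Some \<sigma>" using tyc_App_Some by metis
  then have "tyc C' (ren r s) = Some (Fun \<sigma> \<tau>)" "tyc C' (ren r t) = Some \<sigma>"
    using App.IH App.prems(2) by blast+
  then show ?case by simp
next
  case (Lam \<sigma> t)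
  from Lam.prems(1) obtain \<rho> where *: "tyc (econs (Some \<sigma>) C) t = Some \<rho>" and \<rho>: "\<tau> = Fun \<sigma> \<rho>" by auto
  from * have "tyc (econs (Some \<sigma>) C') (ren (up_ren r) t) = Some \<rho>"
    by (rule Lam.IH) (auto simp: Lam.prems(2) split: econs_splits nat.splits)
  with \<rho> show ?case by simp
qed auto

lemma tyc_ren_Suc: "tyc C t = Some \<tau> \<Longrightarrow> tyc (econs c C) (ren Suc t) = Some \<tau>"
  by (rule tyc_ren) auto

lemma tyc_sub: "tyc C t = Some \<tau> \<Longrightarrow> (\<And>i \<tau>. C i = Some \<tau> \<Longrightarrow> tyc C' (s i) = Some \<tau>) \<Longrightarrow> tyc C' (sub s t) = Some \<tau>"
proof (induction t arbitrary: C C' s \<tau>)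
  case (App t u)
  from App.prems(1) obtain \<sigma> where "tyc C t = Some (Fun \<sigma> \<tau>)" "tyc C u = Some \<sigma>" using tyc_App_Some by metis
  then have "tyc C' (sub s t) = Some (Fun \<sigma> \<tau>)" "tyc C' (sub s u) = Some \<sigma>"
    using App.IH App.prems(2) by blast+
  then show ?case by simp
next
  case (Lam \<sigma> t)
  from Lam.prems(1) obtain \<rho> where *: "tyc (econs (Some \<sigma>) C) t = Some \<rho>" and \<rho>: "\<tau> = Fun \<sigma> \<rho>" by auto
  from * have "tyc (econs (Some \<sigma>) C') (sub (up_sub s) t) = Some \<rho>"
    by (rule Lam.IH) (auto simp: Lam.prems(2) intro: tyc_ren_Suc split: econs_splits nat.splits)
  with \<rho> show ?case by simp
qed auto

lemma tyc_mono: "tyc C t = Some \<tau> \<Longrightarrow> C \<subseteq>\<^sub>m C' \<Longrightarrow> tyc C' t = Some \<tau>"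
  using tyc_sub[of C t \<tau> C' Var] by (auto simp: map_le_def dom_def)

lemma fok_sub: "fok C p \<Longrightarrow> (\<And>i \<tau>. C i = Some \<tau> \<Longrightarrow> tyc C' (s i) = Some \<tau>) \<Longrightarrow> fok C' (fsub s p)"
proof (induction p arbitrary: C C' s)
  case (Forall \<sigma> p)
  have "fok (econs (Some \<sigma>) C') (fsub (up_sub s) p)"
    by (rule Forall.IH[of "econs (Some \<sigma>) C"])
      (use Forall.prems in \<open>auto simp: intro: tyc_ren_Suc split: econs_splits nat.splits\<close>)
  then show ?case by simp
next
  case (Exists \<sigma> p)
  have "fok (econs (Some \<sigma>) C') (fsub (up_sub s) p)"
    by (rule Exists.IH[of "econs (Some \<sigma>) C"])
      (use Exists.prems in \<open>auto simp: intro: tyc_ren_Suc split: econs_splits nat.splits\<close>)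
  then show ?case by simp
qed (force intro: tyc_sub)+

lemma fok_mono: "fok C p \<Longrightarrow> C \<subseteq>\<^sub>m C' \<Longrightarrow> fok C' p"
  using fok_sub[of C p C' Var] by (auto simp: map_le_def dom_def)

text \<open>A term inspects finitely many entries of its context. This is the way back from infinite
  contexts to the lists of the calculus (\<open>fok_rctx_wff\<close>).\<close>

lemma tyc_finite: "tyc C t = Some \<tau> \<Longrightarrow> \<exists>n. \<forall>C'. (\<forall>i<n. C' i = C i) \<longrightarrow> tyc C' t = Some \<tau>"
proof (induction t arbitrary: C \<tau>)
  case (Var i) then show ?case by (intro exI[of _ "Suc i"]) auto
next
  case (App s t)
  then obtain \<sigma> where "tyc C s = Some (Fun \<sigma> \<tau>)" "tyc C t = Some \<sigma>" using tyc_App_Some by metis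
  then obtain m n where "\<forall>C'. (\<forall>i<m. C' i = C i) \<longrightarrow> tyc C' s = Some (Fun \<sigma> \<tau>)"
    "\<forall>C'. (\<forall>i<n. C' i = C i) \<longrightarrow> tyc C' t = Some \<sigma>" using App.IH by metis
  then show ?case by (intro exI[of _ "max m n"]) auto
next
  case (Lam \<sigma> t)
  from Lam.prems(1) obtain \<rho> where "tyc (econs (Some \<sigma>) C) t = Some \<rho>" and \<rho>: "\<tau> = Fun \<sigma> \<rho>" by auto
  with Lam.IH obtain n where n: "\<forall>C'. (\<forall>i<n. C' i = econs (Some \<sigma>) C i) \<longrightarrow> tyc C' t = Some \<rho>" by metis
  show ?case
    by (rule exI[of _ n]) (use n \<rho> in \<open>auto split: econs_splits nat.splits\<close>)
qed auto

lemma fok_finite: "fok C p \<Longrightarrow> \<exists>n. \<forall>C'. (\<forall>i<n. C' i = C i) \<longrightarrow> fok C' p"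
proof (induction p arbitrary: C)
  case (Forall \<sigma> p)
  then obtain n where n: "\<forall>C'. (\<forall>i<n. C' i = econs (Some \<sigma>) C i) \<longrightarrow> fok C' p"
    by (metis fok.simps(8))
  show ?case by (rule exI[of _ n]) (use n in \<open>auto split: econs_splits nat.splits\<close>)
next
  case (Exists \<sigma> p)
  then obtain n where n: "\<forall>C'. (\<forall>i<n. C' i = econs (Some \<sigma>) C i) \<longrightarrow> fok C' p"
    by (metis fok.simps(9))
  show ?case by (rule exI[of _ n]) (use n in \<open>auto split: econs_splits nat.splits\<close>)
next
  case (Eq \<sigma> s t)
  then obtain m n where "\<forall>C'. (\<forall>i<m. C' i = C i) \<longrightarrow> tyc C' s = Some \<sigma>"
    "\<forall>C'. (\<forall>i<n. C' i = C i) \<longrightarrow> tyc C' t = Some \<sigma>" using tyc_finite by (metis fok.simps(1))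
  then show ?case by (intro exI[of _ "max m n"]) auto
next
  case (Mem s t)
  then obtain \<sigma> where "tyc C s = Some \<sigma>" "tyc C t = Some (Pow \<sigma>)" by auto
  then obtain m n where "\<forall>C'. (\<forall>i<m. C' i = C i) \<longrightarrow> tyc C' s = Some \<sigma>"
    "\<forall>C'. (\<forall>i<n. C' i = C i) \<longrightarrow> tyc C' t = Some (Pow \<sigma>)" using tyc_finite by metis
  then show ?case by (intro exI[of _ "max m n"]) auto
next
  case (Less s t)
  then obtain m n where "\<forall>C'. (\<forall>i<m. C' i = C i) \<longrightarrow> tyc C' s = Some Real"
    "\<forall>C'. (\<forall>i<n. C' i = C i) \<longrightarrow> tyc C' t = Some Real" using tyc_finite by (metis fok.simps(3))
  then show ?case by (intro exI[of _ "max m n"]) auto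
next
  case (Conj p q)
  then obtain m n where "\<forall>C'. (\<forall>i<m. C' i = C i) \<longrightarrow> fok C' p"
    "\<forall>C'. (\<forall>i<n. C' i = C i) \<longrightarrow> fok C' q" by (metis fok.simps(5))
  then show ?case by (intro exI[of _ "max m n"]) auto
next
  case (Disj p q)
  then obtain m n where "\<forall>C'. (\<forall>i<m. C' i = C i) \<longrightarrow> fok C' p"
    "\<forall>C'. (\<forall>i<n. C' i = C i) \<longrightarrow> fok C' q" by (metis fok.simps(6))
  then show ?case by (intro exI[of _ "max m n"]) auto
next
  case (Imp p q)
  then obtain m n where "\<forall>C'. (\<forall>i<m. C' i = C i) \<longrightarrow> fok C' p"
    "\<forall>C'. (\<forall>i<n. C' i = C i) \<longrightarrow> fok C' q" by (metis fok.simps(7))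
  then show ?case by (intro exI[of _ "max m n"]) auto
qed auto

section \<open>Structural rules\<close>

lemma predicative_fsub [simp]: "predicative (fsub s p) = predicative p"
  by (induction p arbitrary: s) auto

definition rok :: "ty list \<Rightarrow> (nat \<Rightarrow> nat) \<Rightarrow> ty list \<Rightarrow> bool" where
  "rok \<Delta> r \<Delta>' \<longleftrightarrow> (\<forall>i \<tau>. lctx \<Delta> i = Some \<tau> \<longrightarrow> lctx \<Delta>' (r i) = Some \<tau>)"

lemma rok_up: "rok \<Delta> r \<Delta>' \<Longrightarrow> rok (\<sigma> # \<Delta>) (up_ren r) (\<sigma> # \<Delta>')"
  by (auto simp: rok_def up_ren_def split: econs_splits nat.splits)

lemma wt_rename: "rok \<Delta> r \<Delta>' \<Longrightarrow> wt \<Delta> t \<tau> \<Longrightarrow> wt \<Delta>' (sub (rv r) t) \<tau>"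
  by (auto simp: wt_tyc rok_def intro: tyc_sub)

lemma wff_rename: "rok \<Delta> r \<Delta>' \<Longrightarrow> wff \<Delta> p \<Longrightarrow> wff \<Delta>' (fsub (rv r) p)"
  by (auto simp: wff_fok rok_def intro: fok_sub)

lemma fsub_eq_cong: "s = s' \<Longrightarrow> fsub s p = fsub s' p" by simp

lemmas bdefs = bvar_def bcon_def bapp_def blam_def ball_def bex_def bimp_def bconj_def bdisj_def
  bnot_def biff_def beq_def bmem_def bless_def close_def recN_def addN_def predN_def monusN_def
  leN_def lessN_def natR_def seq_tendsto_def seq_cauchy_def

lemma real_axioms_closed: "p \<in> real_axioms \<Longrightarrow> fsub s p = p"
  unfolding real_axioms_def by (auto simp: bdefs eval_nat_numeral)

lemma axiom_rename: "axiom \<Delta> p \<Longrightarrow> rok \<Delta> r \<Delta>' \<Longrightarrow> axiom \<Delta>' (fsub (rv r) p)"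
proof (induction rule: axiom.induct)
  case (beta \<sigma> \<Delta> t \<tau> s)
  have "axiom \<Delta>' (Eq \<tau> (App (Lam \<sigma> (sub (rv (up_ren r)) t)) (sub (rv r) s))
     (inst (sub (rv (up_ren r)) t) (sub (rv r) s)))"
    by (rule axiom.beta) (use beta in \<open>auto intro: wt_rename rok_up\<close>)
  then show ?case by (simp add: up_sub_rename sub_inst inst_up flip: up_sub_rename)
next
  case (induction \<Delta> p)
  have *: "fsub (up_sub (rv r)) (fsub (case_nat (App (Con CSuc) (Var 0)) (\<lambda>i. Var (Suc i))) p)
    = fsub (case_nat (App (Con CSuc) (Var 0)) (\<lambda>i. Var (Suc i))) (fsub (rv (up_ren r)) p)"
    unfolding fsub_fsub by (rule fsub_eq_cong, rule nat_fun_eqI) auto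
  show ?case
    using axiom.induction[OF wff_rename[OF rok_up[OF induction(2)] induction(1)]]
    by (simp add: fsub_finst' *[unfolded up_sub_rename] up_sub_rename)
next
  case (comprehension \<sigma> \<Delta> p)
  have *: "fsub (up_sub (up_sub (rv r))) (fsub (case_nat (Var 0) (\<lambda>i. Var (i + 2))) p)
    = fsub (case_nat (Var 0) (\<lambda>i. Var (i + 2))) (fsub (rv (up_ren r)) p)"
    unfolding fsub_fsub by (rule fsub_eq_cong, rule nat_fun_eqI) auto
  show ?case
    using axiom.comprehension[OF wff_rename[OF rok_up[OF comprehension(3)] comprehension(1)]] comprehension(2) *
    by (simp add: up_sub_rename)
next
  case (unique_choice \<tau> \<sigma> \<Delta> p)
  have *: "fsub (up_sub (up_sub (up_sub (rv r)))) (fsub (case_nat (Var 0) (\<lambda>i. Var (i + 2))) p)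
    = fsub (case_nat (Var 0) (\<lambda>i. Var (i + 2))) (fsub (rv (up_ren (up_ren r))) p)"
    unfolding fsub_fsub by (rule fsub_eq_cong, rule nat_fun_eqI) (auto simp: up_ren_def up_sub_def split: nat.splits)
  have **: "fsub (up_sub (up_sub (rv r))) (fsub (case_nat (App (Var 1) (Var 0)) (case_nat (Var 0) (\<lambda>i. Var (i + 2)))) p)
    = fsub (case_nat (App (Var 1) (Var 0)) (case_nat (Var 0) (\<lambda>i. Var (i + 2)))) (fsub (rv (up_ren (up_ren r))) p)"
    unfolding fsub_fsub by (rule fsub_eq_cong, rule nat_fun_eqI) (auto simp: up_ren_def up_sub_def split: nat.splits)
  show ?case
    using axiom.unique_choice[OF wff_rename[OF rok_up[OF rok_up[OF unique_choice(2)]] unique_choice(1)]] * **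
    by (simp add: up_sub_rename)
next
  case (dependent_choice \<Delta> D \<sigma> p)
  \<comment> \<open>\<open>D\<close> is lifted past \<open>k\<close> binders, under which the
    renaming has become \<open>up_ren\<close> iterated \<open>k\<close> times; the two shifts
    commute.\<close>
  have l: "sub (rv ((up_ren ^^ k) r)) (lift k D) = lift k (sub (rv r) D)" for k
  proof -
    have "(up_ren ^^ k) r (i + k) = r i + k" for i by (induction k arbitrary: i) auto
    then show ?thesis
      by (simp add: lift_def ren_eq_sub sub_sub comp_def)
  qed
  have **: "fsub (up_sub (up_sub (up_sub (rv r)))) (fsub (case_nat (App (Var 1) (App (Con CSuc) (Var 0)))
                         (case_nat (App (Var 1) (Var 0)) (\<lambda>i. Var (i + 3)))) p)
    = fsub (case_nat (App (Var 1) (App (Con CSuc) (Var 0)))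
                         (case_nat (App (Var 1) (Var 0)) (\<lambda>i. Var (i + 3)))) (fsub (rv (up_ren (up_ren r))) p)"
    unfolding fsub_fsub by (rule fsub_eq_cong, rule nat_fun_eqI)
     (auto simp: up_ren_def up_sub_def numeral_3_eq_3 split: nat.splits)
  show ?case
    using axiom.dependent_choice[OF wt_rename[OF dependent_choice(3,1)]
       wff_rename[OF rok_up[OF rok_up[OF dependent_choice(3)]] dependent_choice(2)]]
      l[of 1] l[of 2] l[of 3] **
    by (simp add: up_sub_rename numeral_2_eq_2 numeral_3_eq_3)
next
  case (real p)
  then show ?case by (simp add: real_axioms_closed axiom.real)
next
  case (fun_ext \<Delta> \<sigma> \<tau>)
  show ?case using axiom.fun_ext[of \<Delta>' \<sigma> \<tau>] by (simp add: bdefs eval_nat_numeral)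
next
  case (set_ext \<Delta> \<sigma>)
  show ?case using axiom.set_ext[of \<Delta>' \<sigma>] by (simp add: bdefs eval_nat_numeral)
next
  case (fst_pair \<Delta> \<sigma> \<tau>)
  show ?case using axiom.fst_pair[of \<Delta>' \<sigma> \<tau>] by (simp add: bdefs eval_nat_numeral)
next
  case (snd_pair \<Delta> \<sigma> \<tau>)
  show ?case using axiom.snd_pair[of \<Delta>' \<sigma> \<tau>] by (simp add: bdefs eval_nat_numeral)
next
  case (pair_surj \<Delta> \<sigma> \<tau>)
  show ?case using axiom.pair_surj[of \<Delta>' \<sigma> \<tau>] by (simp add: bdefs eval_nat_numeral)
next
  case (suc_not_zero \<Delta>)
  show ?case using axiom.suc_not_zero[of \<Delta>'] by (simp add: bdefs eval_nat_numeral)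
next
  case (suc_inj \<Delta>)
  show ?case using axiom.suc_inj[of \<Delta>'] by (simp add: bdefs eval_nat_numeral)
next
  case (rec_zero \<Delta> \<sigma>)
  show ?case using axiom.rec_zero[of \<Delta>' \<sigma>] by (simp add: bdefs eval_nat_numeral)
next
  case (rec_suc \<Delta> \<sigma>)
  show ?case using axiom.rec_suc[of \<Delta>' \<sigma>] by (simp add: bdefs eval_nat_numeral)
qed

text \<open>Two operations are instances: enlarging the context (\<open>derives_append\<close>), and
  turning a fresh free variable into the eigenvariable at index 0 (\<open>swap_in\<close>).\<close>

lemma derives_rename:
  "derives \<Delta> \<Gamma> p \<Longrightarrow> rok \<Delta> r \<Delta>' \<Longrightarrow> derives \<Delta>' (fsub (rv r) ` \<Gamma>) (fsub (rv r) p)"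
proof (induction arbitrary: \<Delta>' r rule: derives.induct)
  case (Ax \<Delta> p \<Gamma>) then show ?case by (auto intro: derives.Ax axiom_rename)
next
  case (Hyp p \<Gamma> \<Delta>) then show ?case by (auto intro: derives.Hyp wff_rename)
next
  case (BotE \<Delta> \<Gamma> p) then show ?case by (auto intro: derives.BotE wff_rename)
next
  case (DisjE \<Delta> \<Gamma> p q r')
  from DisjE.IH[OF DisjE.prems] show ?case by (auto intro: derives.DisjE)
next
  case (ImpI \<Delta> p \<Gamma> q) then show ?case by (auto intro: derives.ImpI wff_rename)
next
  case (ForallI \<sigma> \<Delta> \<Gamma> p)
  have "fsub (rv (up_ren r)) ` flift ` \<Gamma> = flift ` fsub (rv r) ` \<Gamma>"
    by (simp add: image_image fsub_up_flift flip: up_sub_rename)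
  then show ?case using ForallI.IH[OF rok_up[OF ForallI.prems]]
    by (auto intro: derives.ForallI simp: up_sub_rename)
next
  case (ForallE \<Delta> \<Gamma> \<sigma> p t)
  then have "derives \<Delta>' (fsub (rv r) ` \<Gamma>) (Forall \<sigma> (fsub (up_sub (rv r)) p))" by simp
  then show ?case unfolding fsub_finst'
    by (rule derives.ForallE) (use ForallE in \<open>auto intro: wt_rename\<close>)
next
  case (ExistsI \<Delta> \<Gamma> p t \<sigma>)
  have "derives \<Delta>' (fsub (rv r) ` \<Gamma>) (Exists \<sigma> (fsub (up_sub (rv r)) p))"
    by (rule derives.ExistsI[of _ _ _ "sub (rv r) t"])
      (use ExistsI.IH[OF ExistsI.prems] ExistsI.hyps ExistsI.prems fsub_finst'[of "rv r" p t] in \<open>auto intro: wt_rename wff_rename rok_up simp: up_sub_rename\<close>)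
  then show ?case by simp
next
  case (ExistsE \<Delta> \<Gamma> \<sigma> p q)
  have *: "fsub (rv (up_ren r)) ` flift ` \<Gamma> = flift ` fsub (rv r) ` \<Gamma>"
    by (simp add: image_image fsub_up_flift flip: up_sub_rename)
  have "derives \<Delta>' (fsub (rv r) ` \<Gamma>) (Exists \<sigma> (fsub (rv (up_ren r)) p))"
    using ExistsE.IH(1)[OF ExistsE.prems] by (simp add: up_sub_rename)
  moreover have "derives (\<sigma> # \<Delta>') (insert (fsub (rv (up_ren r)) p) (flift ` fsub (rv r) ` \<Gamma>))
      (flift (fsub (rv r) q))"
    using ExistsE.IH(2)[OF rok_up[OF ExistsE.prems]] fsub_up_flift[of "rv r" q] * by (simp add: up_sub_rename)
  ultimately show ?case
    by (rule derives.ExistsE) (use ExistsE in \<open>auto intro: wff_rename\<close>)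
next
  case (EqRefl \<Delta> t \<sigma> \<Gamma>) then show ?case by (auto intro: derives.EqRefl wt_rename)
next
  case (EqSubst \<Delta> \<Gamma> \<sigma> s t p)
  have "derives \<Delta>' (fsub (rv r) ` \<Gamma>) (finst (fsub (up_sub (rv r)) p) (sub (rv r) t))"
    by (rule derives.EqSubst[of _ _ \<sigma> "sub (rv r) s"])
      (use EqSubst.IH[OF EqSubst.prems] EqSubst.hyps EqSubst.prems fsub_finst'[of "rv r" p s] in \<open>auto intro: wff_rename rok_up simp: up_sub_rename\<close>)
  then show ?case by (simp add: fsub_finst')
next
  case (DisjI1 \<Delta> \<Gamma> p q) then show ?case by (simp add: derives.DisjI1 wff_rename)
next
  case (DisjI2 \<Delta> \<Gamma> q p) then show ?case by (simp add: derives.DisjI2 wff_rename)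
next
  case (ImpE \<Delta> \<Gamma> p q)
  show ?case using ImpE.IH[OF ImpE.prems] by (auto intro: derives.ImpE)
qed (auto intro: derives.intros)

lemma derives_append: "derives \<Delta> \<Gamma> p \<Longrightarrow> derives (\<Delta> @ \<Delta>') \<Gamma> p"
proof -
  assume "derives \<Delta> \<Gamma> p"
  moreover have "rok \<Delta> id (\<Delta> @ \<Delta>')" by (auto simp: rok_def lctx_def nth_append split: if_splits)
  ultimately have "derives (\<Delta> @ \<Delta>') (fsub (rv id) ` \<Gamma>) (fsub (rv id) p)" by (rule derives_rename)
  then show ?thesis by simp
qed

lemma derives_mono: "derives \<Delta> \<Gamma> p \<Longrightarrow> \<Gamma> \<subseteq> \<Gamma>' \<Longrightarrow> derives \<Delta> \<Gamma>' p"
proof (induction arbitrary: \<Gamma>' rule: derives.induct)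
  case (DisjE \<Delta> \<Gamma> p q r)
  then show ?case by (meson derives.DisjE insert_mono)
next
  case (ImpI \<Delta> p \<Gamma> q)
  then show ?case by (meson derives.ImpI insert_mono)
next
  case (ForallI \<sigma> \<Delta> \<Gamma> p)
  then show ?case by (meson derives.ForallI image_mono)
next
  case (ExistsE \<Delta> \<Gamma> \<sigma> p q)
  then show ?case by (meson derives.ExistsE image_mono insert_mono)
next
  case (EqSubst \<Delta> \<Gamma> \<sigma> s t p)
  then show ?case by (meson derives.EqSubst)
next
  case (ImpE \<Delta> \<Gamma> p q)
  then show ?case by (meson derives.ImpE)
qed (auto intro: derives.intros)

text \<open>Makes the union of the chain in \<open>saturated_extension\<close> prove no more than
  its stages do. Under a binder the finite set is pulled back along \<open>flift\<close>.\<close>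

lemma derives_compact: "derives \<Delta> \<Gamma> p \<Longrightarrow> \<exists>\<Gamma>0\<subseteq>\<Gamma>. finite \<Gamma>0 \<and> derives \<Delta> \<Gamma>0 p"
proof (induction rule: derives.induct)
  case (Hyp p \<Gamma> \<Delta>) then show ?case by (intro exI[of _ "{p}"]) (auto intro: derives.Hyp)
next
  case (ConjI \<Delta> \<Gamma> p q)
  then obtain A B where "A \<subseteq> \<Gamma>" "finite A" "derives \<Delta> A p" "B \<subseteq> \<Gamma>" "finite B" "derives \<Delta> B q" by metis
  then show ?case by (intro exI[of _ "A \<union> B"]) (auto intro!: derives.ConjI elim: derives_mono)
next
  case (ImpE \<Delta> \<Gamma> p q)
  then obtain A B where AB: "A \<subseteq> \<Gamma>" "finite A" "derives \<Delta> A (Imp p q)" "B \<subseteq> \<Gamma>" "finite B" "derives \<Delta> B p" by metis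
  then have "derives \<Delta> (A \<union> B) (Imp p q)" "derives \<Delta> (A \<union> B) p" by (auto elim: derives_mono)
  with AB show ?case by (intro exI[of _ "A \<union> B"]) (auto intro: derives.ImpE)
next
  case (DisjE \<Delta> \<Gamma> p q r)
  then obtain A B C where ABC: "A \<subseteq> \<Gamma>" "finite A" "derives \<Delta> A (Disj p q)" "B \<subseteq> insert p \<Gamma>" "finite B" "derives \<Delta> B r"
    "C \<subseteq> insert q \<Gamma>" "finite C" "derives \<Delta> C r" by metis
  \<comment> \<open>The rule discharges \<open>p\<close> and \<open>q\<close>; removing them keeps
    the finite set inside \<open>\<Gamma>\<close>.\<close>
  let ?D = "A \<union> (B - {p}) \<union> (C - {q})"
  have "derives \<Delta> ?D (Disj p q)" "derives \<Delta> (insert p ?D) r" "derives \<Delta> (insert q ?D) r"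
    using derives_mono[OF ABC(3), of ?D] derives_mono[OF ABC(6), of "insert p ?D"]
      derives_mono[OF ABC(9), of "insert q ?D"] by auto
  with ABC show ?case by (intro exI[of _ ?D]) (auto intro: derives.DisjE)
next
  case (ImpI \<Delta> p \<Gamma> q)
  then obtain B where "B \<subseteq> insert p \<Gamma>" "finite B" "derives \<Delta> B q" by metis
  then show ?case using ImpI.hyps by (intro exI[of _ "B - {p}"]) (auto intro!: derives.ImpI elim: derives_mono)
next
  case (ForallI \<sigma> \<Delta> \<Gamma> p)
  then obtain B where B: "B \<subseteq> flift ` \<Gamma>" "finite B" "derives (\<sigma> # \<Delta>) B p" by metis
  then obtain A where "A \<subseteq> \<Gamma>" "finite A" "B = flift ` A" by (meson finite_subset_image)
  with B show ?case by (auto intro: derives.ForallI)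
next
  case (ExistsE \<Delta> \<Gamma> \<sigma> p q)
  then obtain A B where AB: "A \<subseteq> \<Gamma>" "finite A" "derives \<Delta> A (Exists \<sigma> p)"
    "B \<subseteq> insert p (flift ` \<Gamma>)" "finite B" "derives (\<sigma> # \<Delta>) B (flift q)" by metis
  have "B - {p} \<subseteq> flift ` \<Gamma>" using AB by auto
  then obtain C where C: "C \<subseteq> \<Gamma>" "finite C" "B - {p} = flift ` C" using AB(5) by (meson finite_Diff finite_subset_image)
  have "derives \<Delta> (A \<union> C) (Exists \<sigma> p)" using AB by (auto elim: derives_mono)
  moreover have "derives (\<sigma> # \<Delta>) (insert p (flift ` (A \<union> C))) (flift q)"
    using AB(6) by (rule derives_mono) (use C in auto)
  ultimately have "derives \<Delta> (A \<union> C) q" using ExistsE.hyps by (blast intro: derives.ExistsE)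
  with AB C show ?case by (intro exI[of _ "A \<union> C"]) auto
next
  case (EqSubst \<Delta> \<Gamma> \<sigma> s t p)
  then obtain A B where AB: "A \<subseteq> \<Gamma>" "finite A" "derives \<Delta> A (Eq \<sigma> s t)" "B \<subseteq> \<Gamma>" "finite B" "derives \<Delta> B (finst p s)" by metis
  then have "derives \<Delta> (A \<union> B) (Eq \<sigma> s t)" "derives \<Delta> (A \<union> B) (finst p s)" by (auto elim: derives_mono)
  with AB EqSubst.hyps show ?case by (intro exI[of _ "A \<union> B"]) (auto intro: derives.EqSubst)
next
  case (Ax \<Delta> p \<Gamma>)
  then show ?case by (intro exI[of _ "{}"]) (auto intro: derives.Ax)
next
  case (EqRefl \<Delta> t \<sigma> \<Gamma>)
  then show ?case by (intro exI[of _ "{}"]) (auto intro: derives.EqRefl)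
qed (auto intro: derives.intros)

section \<open>Saturated theories\<close>

instance ty :: countable by countable_datatype
instance cst :: countable by countable_datatype
instance tm :: countable by countable_datatype
instance fm :: countable by countable_datatype

text \<open>All theories live over one infinite context. The variable \<open>i\<close> has a type and a rank, there are
  infinitely many variables of each type and rank, and a theory of rank \<open>r\<close> uses variables of rank
  less than \<open>r\<close> only; passing to a larger theory supplies the witnesses of the next rank.\<close>

definition rnk :: "nat \<Rightarrow> nat" where "rnk i = fst (prod_decode i)"
definition vty :: "nat \<Rightarrow> ty" where "vty i = from_nat (fst (prod_decode (snd (prod_decode i))))"
definition ctx :: "nat \<Rightarrow> ty list" where "ctx n = map vty [0..<n]"
definition rctx :: "nat \<Rightarrow> nat \<Rightarrow> ty option" where "rctx r i = (if rnk i < r then Some (vty i) else None)"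
definition kctx :: "nat \<Rightarrow> nat \<Rightarrow> nat \<Rightarrow> ty option" where
  "kctx r k i = (if rnk i < r \<or> rnk i = r \<and> i < k then Some (vty i) else None)"

text \<open>Provability over the infinite context. Derivations have finite contexts, so some initial
  segment of the variables is chosen; a longer one proves at least as much.\<close>

definition prv :: "fm set \<Rightarrow> fm \<Rightarrow> bool" where "prv T p \<longleftrightarrow> (\<exists>n. derives (ctx n) T p)"

lemma lctx_ctx: "lctx (ctx n) i = (if i < n then Some (vty i) else None)"
  by (auto simp: lctx_def ctx_def)

lemma derives_ctx_mono: "derives (ctx m) T p \<Longrightarrow> m \<le> n \<Longrightarrow> derives (ctx n) T p"
proof -
  assume *: "derives (ctx m) T p" "m \<le> n"
  then have "ctx n = ctx m @ map vty [m..<n]"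
    using upt_add_eq_append[of 0 m "n - m"] by (simp add: ctx_def)
  with derives_append[OF *(1)] show ?thesis by simp
qed

lemma ex_fresh: "\<exists>c\<ge>k. rnk c = r \<and> vty c = \<sigma>"
proof -
  let ?f = "\<lambda>j. prod_encode (r, prod_encode (to_nat \<sigma>, j))"
  have "inj ?f" by (auto simp: inj_def)
  then have "infinite (range ?f)" using range_inj_infinite by blast
  then obtain j where "?f j \<ge> k" by (metis (mono_tags, lifting) finite_nat_set_iff_bounded linorder_not_less rangeE)
  then show ?thesis by (intro exI[of _ "?f j"]) (simp add: rnk_def vty_def)
qed

lemma map_le_rctx_Suc: "rctx r \<subseteq>\<^sub>m rctx (Suc r)"
  by (auto simp: map_le_def rctx_def dom_def)

lemma map_le_rctx: "r \<le> r' \<Longrightarrow> rctx r \<subseteq>\<^sub>m rctx r'"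
  by (auto simp: map_le_def rctx_def dom_def split: if_splits)

lemma map_le_kctx: "k \<le> k' \<Longrightarrow> kctx r k \<subseteq>\<^sub>m kctx r k'"
  by (auto simp: map_le_def kctx_def dom_def split: if_splits)

lemma map_le_rctx_kctx: "rctx r \<subseteq>\<^sub>m kctx r k"
  by (auto simp: map_le_def kctx_def rctx_def dom_def split: if_splits)

lemma map_le_kctx_rctx: "kctx r k \<subseteq>\<^sub>m rctx (Suc r)"
  by (auto simp: map_le_def kctx_def rctx_def dom_def split: if_splits)

lemma fok_rctx_wff: "fok (rctx r) p \<Longrightarrow> \<exists>n. \<forall>m\<ge>n. wff (ctx m) p"
proof -
  assume "fok (rctx r) p"
  then obtain n where n: "\<forall>C'. (\<forall>i<n. C' i = rctx r i) \<longrightarrow> fok C' p" using fok_finite by blast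
  have "wff (ctx m) p" if "m \<ge> n" for m
  proof -
    have "fok (\<lambda>i. if i < n then rctx r i else None) p" using n by simp
    then show ?thesis unfolding wff_fok
      by (rule fok_mono) (use that in \<open>auto simp: map_le_def dom_def lctx_ctx rctx_def split: if_splits\<close>)
  qed
  then show ?thesis by blast
qed

lemma tyc_rctx_wt: "tyc (rctx r) t = Some \<tau> \<Longrightarrow> \<exists>n. \<forall>m\<ge>n. wt (ctx m) t \<tau>"
  using fok_rctx_wff[of r "Eq \<tau> t t"] by simp

lemma fok_rctx_kctx: "fok (rctx (Suc r)) p \<Longrightarrow> \<exists>k. fok (kctx r k) p"
proof -
  assume "fok (rctx (Suc r)) p"
  then obtain n where n: "\<forall>C'. (\<forall>i<n. C' i = rctx (Suc r) i) \<longrightarrow> fok C' p" using fok_finite by blast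
  have "fok (kctx r n) p" using n by (auto simp: kctx_def rctx_def less_Suc_eq)
  then show ?thesis ..
qed

section \<open>Rules of the calculus over the infinite context\<close>

lemma prv_mono: "prv T p \<Longrightarrow> T \<subseteq> T' \<Longrightarrow> prv T' p"
  by (auto simp: prv_def intro: derives_mono)

lemma prv_cut: "prv T p \<Longrightarrow> prv (insert p T) q \<Longrightarrow> fok (rctx r) p \<Longrightarrow> prv T q"
proof -
  assume a: "prv T p" "prv (insert p T) q" "fok (rctx r) p"
  then obtain n1 n2 n3 where "derives (ctx n1) T p" "derives (ctx n2) (insert p T) q" "\<forall>m\<ge>n3. wff (ctx m) p"
    by (meson prv_def fok_rctx_wff)
  then have "derives (ctx (max n1 (max n2 n3))) T p" "derives (ctx (max n1 (max n2 n3))) (insert p T) q"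
    "wff (ctx (max n1 (max n2 n3))) p" by (auto elim!: derives_ctx_mono)
  then show ?thesis unfolding prv_def by (meson derives.ImpI derives.ImpE)
qed

lemma prv_hyp: "p \<in> T \<Longrightarrow> fok (rctx r) p \<Longrightarrow> prv T p"
  unfolding prv_def by (meson derives.Hyp fok_rctx_wff order_refl)

lemma prv_DisjE: "prv T (Disj p p') \<Longrightarrow> prv (insert p T) q \<Longrightarrow> prv (insert p' T) q \<Longrightarrow> prv T q"
proof -
  assume a: "prv T (Disj p p')" "prv (insert p T) q" "prv (insert p' T) q"
  then obtain n1 n2 n3 where "derives (ctx n1) T (Disj p p')" "derives (ctx n2) (insert p T) q" "derives (ctx n3) (insert p' T) q"
    by (meson prv_def)
  then have "derives (ctx (max n1 (max n2 n3))) T (Disj p p')" "derives (ctx (max n1 (max n2 n3))) (insert p T) q"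
    "derives (ctx (max n1 (max n2 n3))) (insert p' T) q" by (auto elim!: derives_ctx_mono)
  then show ?thesis unfolding prv_def by (meson derives.DisjE)
qed

text \<open>Sends the free variable \<open>c\<close> to index 0 and shifts the others, as the rules
  \<open>ForallI\<close> and \<open>ExistsE\<close> expect of an eigenvariable. On formulas that do
  not contain \<open>c\<close> it acts as \<open>flift\<close>.\<close>

definition swap_in :: "nat \<Rightarrow> nat \<Rightarrow> nat" where "swap_in c i = (if i = c then 0 else Suc i)"

lemma rok_swap: "vty c = \<sigma> \<Longrightarrow> rok (ctx n) (swap_in c) (\<sigma> # ctx n)"
  by (auto simp: rok_def lctx_ctx swap_in_def split: if_splits)

lemma swap_flift: "fok C p \<Longrightarrow> C c = None \<Longrightarrow> fsub (\<lambda>i. Var (swap_in c i)) p = flift p"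
  unfolding flift_def by (erule fok_cong_on) (auto simp: swap_in_def)

lemma swap_finst: "fok (econs (Some \<sigma>) C) A \<Longrightarrow> C c = None \<Longrightarrow>
   fsub (\<lambda>i. Var (swap_in c i)) (finst A (Var c)) = A"
proof -
  assume a: "fok (econs (Some \<sigma>) C) A" "C c = None"
  have "fsub (econs (Var 0) (\<lambda>i. Var (swap_in c i))) A = fsub Var A"
    using a(1) by (rule fok_cong_on) (use a(2) in \<open>auto simp: swap_in_def split: econs_splits nat.splits\<close>)
  then show ?thesis by (simp add: fsub_finst swap_in_def)
qed

lemma prv_ExistsE:
  assumes "prv (insert (finst A (Var c)) T) q" "Exists \<sigma> A \<in> T" "vty c = \<sigma>" "C c = None" "C \<subseteq>\<^sub>m rctx r"
    "\<And>p. p \<in> T \<Longrightarrow> fok C p" "fok C q"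
  shows "prv T q"
proof -
  have okA: "fok (rctx r) (Exists \<sigma> A)" "fok (rctx r) q" using assms by (blast intro: fok_mono)+
  obtain n1 where 1: "derives (ctx n1) (insert (finst A (Var c)) T) q" using assms by (auto simp: prv_def)
  obtain n2 n3 where "\<forall>m\<ge>n2. wff (ctx m) (Exists \<sigma> A)" "\<forall>m\<ge>n3. wff (ctx m) q"
    using okA fok_rctx_wff by meson
  moreover define n where "n = max n1 (max n2 n3)"
  ultimately have wf: "wff (ctx n) (Exists \<sigma> A)" "wff (ctx n) q" by auto
  have "derives (ctx n) (insert (finst A (Var c)) T) q" using derives_ctx_mono[OF 1] n_def by simp
  from derives_rename[OF this rok_swap[OF assms(3)]]
  have "derives (\<sigma> # ctx n) (insert (fsub (\<lambda>i. Var (swap_in c i)) (finst A (Var c)))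
     ((\<lambda>p. fsub (\<lambda>i. Var (swap_in c i)) p) ` T)) (fsub (\<lambda>i. Var (swap_in c i)) q)" by simp
  moreover have "fsub (\<lambda>i. Var (swap_in c i)) (finst A (Var c)) = A"
    using assms(6)[OF assms(2)] assms(4) by (simp add: swap_finst)
  moreover have "(\<lambda>p. fsub (\<lambda>i. Var (swap_in c i)) p) ` T = flift ` T"
    using assms swap_flift by (intro image_cong) auto
  moreover have "fsub (\<lambda>i. Var (swap_in c i)) q = flift q" using assms swap_flift by auto
  ultimately have "derives (\<sigma> # ctx n) (insert A (flift ` T)) (flift q)" by simp
  moreover have "derives (ctx n) T (Exists \<sigma> A)" using assms(2) wf by (auto intro: derives.Hyp)
  ultimately show ?thesis using wf unfolding prv_def by (blast intro: derives.ExistsE)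
qed

lemma prv_ForallI:
  assumes "prv T (finst A (Var c))" "vty c = \<sigma>" "C c = None"
    "\<And>p. p \<in> T \<Longrightarrow> fok C p" "fok (econs (Some \<sigma>) C) A"
  shows "prv T (Forall \<sigma> A)"
proof -
  obtain n where 1: "derives (ctx n) T (finst A (Var c))" using assms by (auto simp: prv_def)
  from derives_rename[OF this rok_swap[OF assms(2)]]
  have "derives (\<sigma> # ctx n) ((\<lambda>p. fsub (\<lambda>i. Var (swap_in c i)) p) ` T) (fsub (\<lambda>i. Var (swap_in c i)) (finst A (Var c)))" by simp
  moreover have "fsub (\<lambda>i. Var (swap_in c i)) (finst A (Var c)) = A"
    using assms by (simp add: swap_finst)
  moreover have "(\<lambda>p. fsub (\<lambda>i. Var (swap_in c i)) p) ` T = flift ` T"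
    using assms swap_flift by (intro image_cong) auto
  ultimately have "derives (\<sigma> # ctx n) (flift ` T) A" by simp
  then show ?thesis unfolding prv_def by (blast intro: derives.ForallI)
qed

definition saturated :: "nat \<Rightarrow> fm set \<Rightarrow> bool" where
  "saturated r T \<longleftrightarrow> (\<forall>p\<in>T. fok (rctx r) p) \<and> (\<forall>p. fok (rctx r) p \<longrightarrow> prv T p \<longrightarrow> p \<in> T) \<and> Bot \<notin> T
    \<and> (\<forall>p q. Disj p q \<in> T \<longrightarrow> p \<in> T \<or> q \<in> T)
    \<and> (\<forall>\<sigma> p. Exists \<sigma> p \<in> T \<longrightarrow> (\<exists>t. tyc (rctx r) t = Some \<sigma> \<and> finst p t \<in> T))"

lemma fok_finst: "fok (econs (Some \<sigma>) C) p \<Longrightarrow> tyc C t = Some \<sigma> \<Longrightarrow> fok C (finst p t)"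
  unfolding finst_eq by (erule fok_sub) (auto split: econs_splits nat.splits)

text \<open>When \<open>kctx r k\<close> types all formulas in use, a variable of rank
  \<open>r\<close> with index at least \<open>k\<close> is untyped there, hence fresh.\<close>

definition witness :: "nat \<Rightarrow> fm \<Rightarrow> nat \<Rightarrow> fm set" where
  "witness r p k = (case p of Exists \<sigma> A \<Rightarrow> {finst A (Var (SOME c. c \<ge> k \<and> rnk c = r \<and> vty c = \<sigma>))} | _ \<Rightarrow> {})"

text \<open>A Lindenbaum construction relative to a fixed formula \<open>q\<close> that must stay
  unprovable. Maximality with respect to \<open>q\<close> yields primeness; intuitionistically,
  maximal consistency would only decide negations and produce too few worlds. An existential formula
  receives its witness in the same step.\<close>

primrec sat_step :: "nat \<Rightarrow> fm \<Rightarrow> fm set \<Rightarrow> nat \<Rightarrow> fm set" where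
  "sat_step r q T 0 = T"
| "sat_step r q T (Suc n) = (let p = from_nat n; G = sat_step r q T n in
     if fok (rctx (Suc r)) p \<and> \<not> prv (insert p G) q
     then insert p G \<union> witness r p (SOME k. \<forall>x\<in>insert q (insert p G). fok (kctx r k) x) else G)"

text \<open>The bound \<open>kctx r k\<close> belongs to the invariant because it supplies the fresh
  witness of the next step; adding such a witness cannot make \<open>q\<close> provable, by
  \<open>prv_ExistsE\<close>.\<close>

lemma sat_step_invariant:
  assumes "\<forall>p\<in>T. fok (rctx r) p" "fok (rctx r) q" "\<not> prv T q"
  shows "\<not> prv (sat_step r q T n) q \<and> (\<exists>k. \<forall>x\<in>insert q (sat_step r q T n). fok (kctx r k) x)"
proof (induction n)
  case 0
  have "\<forall>x\<in>insert q T. fok (kctx r 0) x" using assms map_le_rctx_kctx fok_mono by blast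
  with assms show ?case by auto
next
  case (Suc n)
  define p where "p = (from_nat n :: fm)"
  define G where "G = sat_step r q T n"
  show ?case
  proof (cases "fok (rctx (Suc r)) p \<and> \<not> prv (insert p G) q")
    case False
    then show ?thesis using Suc by (auto simp: p_def G_def Let_def)
  next
    case True
    obtain k1 where k1: "\<forall>x\<in>insert q G. fok (kctx r k1) x" using Suc G_def by blast
    obtain k2 where k2: "fok (kctx r k2) p" using True fok_rctx_kctx by blast
    have "\<forall>x\<in>insert q (insert p G). fok (kctx r (max k1 k2)) x"
      using k1 k2 map_le_kctx[of k1 "max k1 k2"] map_le_kctx[of k2 "max k1 k2"] fok_mono by auto
    then have ex: "\<exists>k. \<forall>x\<in>insert q (insert p G). fok (kctx r k) x" by blast
    define k where "k = (SOME k. \<forall>x\<in>insert q (insert p G). fok (kctx r k) x)"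
    have k: "\<forall>x\<in>insert q (insert p G). fok (kctx r k) x" using someI_ex[OF ex] k_def by blast
    have G': "sat_step r q T (Suc n) = insert p G \<union> witness r p k"
      using True by (simp add: p_def G_def Let_def k_def)
    show ?thesis
    proof (cases "\<exists>\<sigma> A. p = Exists \<sigma> A")
      case False
      then have "witness r p k = {}" by (auto simp: witness_def split: fm.splits)
      then show ?thesis using G' k True by auto
    next
      case True2: True
      then obtain \<sigma> A where p: "p = Exists \<sigma> A" by auto
      define c where "c = (SOME c. c \<ge> k \<and> rnk c = r \<and> vty c = \<sigma>)"
      have c: "c \<ge> k \<and> rnk c = r \<and> vty c = \<sigma>" unfolding c_def by (rule someI_ex) (use ex_fresh in blast)
      have G'': "sat_step r q T (Suc n) = insert (finst A (Var c)) (insert p G)"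
        using G' p by (simp add: witness_def c_def insert_commute)
      have "\<not> prv (insert (finst A (Var c)) (insert p G)) q"
      proof
        assume "prv (insert (finst A (Var c)) (insert p G)) q"
        then have "prv (insert p G) q"
          by (rule prv_ExistsE[where C="kctx r k" and r="Suc r"]) (use k c p map_le_kctx_rctx in \<open>auto simp: kctx_def\<close>)
        with True show False by blast
      qed
      moreover have "\<forall>x\<in>insert q (insert (finst A (Var c)) (insert p G)). fok (kctx r (Suc c)) x"
      proof -
        have "kctx r k \<subseteq>\<^sub>m kctx r (Suc c)" using c map_le_kctx by simp
        then have *: "\<forall>x\<in>insert q (insert p G). fok (kctx r (Suc c)) x" using k fok_mono by blast
        moreover have "fok (kctx r (Suc c)) (finst A (Var c))"
          by (rule fok_finst[of \<sigma>]) (use * p c in \<open>auto simp: kctx_def\<close>)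
        ultimately show ?thesis by blast
      qed
      ultimately show ?thesis using G'' by auto
    qed
  qed
qed

lemma saturated_extension:
  assumes "\<forall>p\<in>T. fok (rctx r) p" "fok (rctx r) q" "\<not> prv T q"
  shows "\<exists>T'. saturated (Suc r) T' \<and> T \<subseteq> T' \<and> q \<notin> T'"
proof -
  let ?G = "sat_step r q T"
  define U where "U = (\<Union>n. ?G n)"
  note inv = sat_step_invariant[OF assms]
  have mono: "m \<le> n \<Longrightarrow> ?G m \<subseteq> ?G n" for m n
    by (rule lift_Suc_mono_le[of ?G]) (auto simp: Let_def)
  have fin: "\<exists>n. A \<subseteq> ?G n" if "finite A" "A \<subseteq> U" for A using that
  proof (induction)
    case (insert x A)
    then obtain m n where "x \<in> ?G m" "A \<subseteq> ?G n" by (auto simp: U_def)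
    then have "insert x A \<subseteq> ?G (max m n)" using mono[of m "max m n"] mono[of n "max m n"] by auto
    then show ?case by blast
  qed auto
  have nq: "\<not> prv U q"
  proof
    assume "prv U q"
    then obtain n where "derives (ctx n) U q" by (auto simp: prv_def)
    from derives_compact[OF this] obtain A where A: "A \<subseteq> U" "finite A" "derives (ctx n) A q" by blast
    then obtain m where "A \<subseteq> ?G m" using fin by blast
    with A(3) have "prv (?G m) q" unfolding prv_def using derives_mono by blast
    then show False using inv by blast
  qed
  have okU: "\<forall>p\<in>U. fok (rctx (Suc r)) p" using inv map_le_kctx_rctx fok_mono unfolding U_def by blast
  have okq: "fok (rctx (Suc r)) q" using assms(2) map_le_rctx_Suc fok_mono by blast
  have GU: "?G n \<subseteq> U" for n by (auto simp: U_def)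
  \<comment> \<open>\<open>p\<close> is considered at step \<open>to_nat p\<close>, when the theory
    was still contained in \<open>U\<close>; if even \<open>U\<close> with \<open>p\<close> does not
    prove \<open>q\<close>, then \<open>p\<close> was accepted.\<close>
  have max: "p \<in> U" if "fok (rctx (Suc r)) p" "\<not> prv (insert p U) q" for p
  proof -
    have "\<not> prv (insert p (?G (to_nat p))) q" using that(2) prv_mono GU by (meson insert_mono)
    then have "p \<in> ?G (Suc (to_nat p))" using that(1) by (simp add: Let_def)
    then show ?thesis using GU by blast
  qed
  have closed: "p \<in> U" if "fok (rctx (Suc r)) p" "prv U p" for p
    using max that nq prv_cut by blast
  have "Bot \<notin> U"
  proof
    assume "Bot \<in> U"
    then have "prv U Bot" using prv_hyp okU by blast
    then obtain n where 1: "derives (ctx n) U Bot" by (auto simp: prv_def)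
    obtain m where 2: "\<forall>k\<ge>m. wff (ctx k) q" using okq fok_rctx_wff by blast
    have "derives (ctx (max m n)) U Bot" using derives_ctx_mono[OF 1] by simp
    then have "derives (ctx (max m n)) U q" using 2 by (auto intro: derives.BotE)
    then show False using nq by (auto simp: prv_def)
  qed
  moreover have "p \<in> U \<or> p' \<in> U" if "Disj p p' \<in> U" for p p'
  proof (rule ccontr)
    assume a: "\<not> (p \<in> U \<or> p' \<in> U)"
    have "fok (rctx (Suc r)) (Disj p p')" using okU that by blast
    \<comment> \<open>By maximality a rejected disjunct proves \<open>q\<close> together with
      \<open>U\<close>, so two rejected disjuncts would let the disjunction prove
      \<open>q\<close>.\<close>
    then have "prv (insert p U) q" "prv (insert p' U) q" "prv U (Disj p p')" using a max prv_hyp[OF that] by auto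
    then show False using nq prv_DisjE by blast
  qed
  moreover have "\<exists>t. tyc (rctx (Suc r)) t = Some \<sigma> \<and> finst A t \<in> U" if "Exists \<sigma> A \<in> U" for \<sigma> A
  proof -
    let ?p = "Exists \<sigma> A"
    \<comment> \<open>A member of \<open>U\<close> never makes \<open>q\<close> provable, so it was
      accepted at its own step too, and there its witness was added.\<close>
    have "\<not> prv (insert ?p (?G (to_nat ?p))) q" using that nq GU prv_mono by (meson insert_subsetI)
    moreover have "fok (rctx (Suc r)) ?p" using okU that by blast
    ultimately obtain k where "?G (Suc (to_nat ?p)) = insert ?p (?G (to_nat ?p)) \<union> witness r ?p k"
      by (simp only: sat_step.simps Let_def from_nat_to_nat simp_thms if_True)
    then have "witness r ?p k \<subseteq> U" using GU by (metis le_sup_iff)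
    moreover define c where "c = (SOME c. c \<ge> k \<and> rnk c = r \<and> vty c = \<sigma>)"
    ultimately have "finst A (Var c) \<in> U" by (simp add: witness_def)
    moreover have "c \<ge> k \<and> rnk c = r \<and> vty c = \<sigma>" unfolding c_def by (rule someI_ex) (use ex_fresh in blast)
    ultimately show ?thesis by (intro exI[of _ "Var c"]) (simp add: rctx_def)
  qed
  ultimately have "saturated (Suc r) U" unfolding saturated_def using okU closed by blast
  moreover have "T \<subseteq> U" using GU[of 0] by simp
  moreover have "q \<notin> U" using nq prv_hyp okq by blast
  ultimately show ?thesis by blast
qed

section \<open>The canonical Kripke model\<close>

text \<open>The second disjunct only makes the type inhabited without a consistency proof.\<close>

typedef world = "{w. saturated (fst w) (snd w) \<or> (\<forall>r T. \<not> saturated r T)}"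
  by auto

definition Th :: "world \<Rightarrow> fm set" where "Th w = snd (Rep_world w)"
definition wrk :: "world \<Rightarrow> nat" where "wrk w = fst (Rep_world w)"
definition wle :: "world \<Rightarrow> world \<Rightarrow> bool" (infix "\<sqsubseteq>" 50) where
  "w \<sqsubseteq> w' \<longleftrightarrow> wrk w \<le> wrk w' \<and> Th w \<subseteq> Th w'"
definition tyw :: "world \<Rightarrow> tm \<Rightarrow> ty option" where "tyw w = tyc (rctx (wrk w))"

lemma wle_refl [simp]: "w \<sqsubseteq> w" and wle_trans [trans]: "w \<sqsubseteq> w' \<Longrightarrow> w' \<sqsubseteq> w'' \<Longrightarrow> w \<sqsubseteq> w''"
  by (auto simp: wle_def)

lemma tyw_mono: "tyw w t = Some \<tau> \<Longrightarrow> w \<sqsubseteq> w' \<Longrightarrow> tyw w' t = Some \<tau>"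
  unfolding tyw_def by (erule tyc_mono) (simp add: wle_def map_le_rctx)

lemma tyw_simps [simp]:
  "tyw w (Con c) = Some (cty c)"
  "tyw w (App s t) = (case tyw w s of Some (Fun \<sigma> \<tau>) \<Rightarrow> (if tyw w t = Some \<sigma> then Some \<tau> else None) | _ \<Rightarrow> None)"
  by (simp_all add: tyw_def cong: option.case_cong ty.case_cong)

lemma tyw_sub: "tyc (\<lambda>i. tyw w (\<rho> i)) t = Some \<tau> \<Longrightarrow> tyw w (sub \<rho> t) = Some \<tau>"
  unfolding tyw_def by (erule tyc_sub) auto

lemma econs_app [simp]: "(\<lambda>i. tyw w (econs a g i)) = econs (tyw w a) (\<lambda>i. tyw w (g i))"
  by (rule nat_fun_eqI) auto

text \<open>Atomic formulas are read off the theory, connectives and quantifiers follow Kripke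
  semantics; \<open>truth\<close> shows that the theory and the semantics agree on all formulas.
  Environments consist of terms, so they act as substitutions.\<close>

primrec forc :: "world \<Rightarrow> (nat \<Rightarrow> tm) \<Rightarrow> fm \<Rightarrow> bool" where
  "forc w \<rho> (Eq \<sigma> s t) \<longleftrightarrow> Eq \<sigma> (sub \<rho> s) (sub \<rho> t) \<in> Th w"
| "forc w \<rho> (Mem s t) \<longleftrightarrow> Mem (sub \<rho> s) (sub \<rho> t) \<in> Th w"
| "forc w \<rho> (Less s t) \<longleftrightarrow> Less (sub \<rho> s) (sub \<rho> t) \<in> Th w"
| "forc w \<rho> Bot \<longleftrightarrow> False"
| "forc w \<rho> (Conj p q) \<longleftrightarrow> forc w \<rho> p \<and> forc w \<rho> q"
| "forc w \<rho> (Disj p q) \<longleftrightarrow> forc w \<rho> p \<or> forc w \<rho> q"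
| "forc w \<rho> (Imp p q) \<longleftrightarrow> (\<forall>w'. w \<sqsubseteq> w' \<longrightarrow> forc w' \<rho> p \<longrightarrow> forc w' \<rho> q)"
| "forc w \<rho> (Forall \<sigma> p) \<longleftrightarrow> (\<forall>w' t. w \<sqsubseteq> w' \<longrightarrow> tyw w' t = Some \<sigma> \<longrightarrow> forc w' (econs t \<rho>) p)"
| "forc w \<rho> (Exists \<sigma> p) \<longleftrightarrow> (\<exists>t. tyw w t = Some \<sigma> \<and> forc w (econs t \<rho>) p)"

text \<open>Excludes the degenerate disjunct of \<open>world\<close>, so that every world carries a
  saturated theory. The saturated theory demanded here comes from an underivable formula in
  \<open>derives_of_forcing\<close>; consistency itself is never proved.\<close>

locale consistent =
  assumes consistent: "\<exists>r T. saturated r T"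
begin

lemma saturated_Th: "saturated (wrk w) (Th w)"
  using Rep_world[of w] consistent by (auto simp: Th_def wrk_def)

lemma world_extension:
  assumes "T \<supseteq> Th w" "\<forall>p\<in>T. fok (rctx r) p" "fok (rctx r) q" "\<not> prv T q" "wrk w \<le> r"
  shows "\<exists>w'. w \<sqsubseteq> w' \<and> T \<subseteq> Th w' \<and> q \<notin> Th w' \<and> wrk w' = Suc r"
proof -
  obtain T' where T': "saturated (Suc r) T'" "T \<subseteq> T'" "q \<notin> T'" using saturated_extension[OF assms(2-4)] by blast
  define w' where "w' = Abs_world (Suc r, T')"
  have "Rep_world w' = (Suc r, T')" unfolding w'_def using T' by (simp add: Abs_world_inverse)
  then show ?thesis using T' assms by (intro exI[of _ w']) (auto simp: wle_def Th_def wrk_def)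
qed

section \<open>Theories of worlds under connectives and quantifiers\<close>

lemma Th_fok: "p \<in> Th w \<Longrightarrow> fok (rctx (wrk w)) p"
  using saturated_Th[of w] unfolding saturated_def by blast

lemma Th_closed: "prv (Th w) p \<Longrightarrow> fok (rctx (wrk w)) p \<Longrightarrow> p \<in> Th w"
  using saturated_Th[of w] unfolding saturated_def by blast

lemma Th_prv: "p \<in> Th w \<Longrightarrow> prv (Th w) p"
  using prv_hyp Th_fok by blast

lemma Th_Bot [simp]: "Bot \<notin> Th w"
  using saturated_Th[of w] unfolding saturated_def by blast

lemma prv_both: "prv T p \<Longrightarrow> prv T q \<Longrightarrow> \<exists>n. derives (ctx n) T p \<and> derives (ctx n) T q"
proof -
  assume "prv T p" "prv T q"
  then obtain m n where "derives (ctx m) T p" "derives (ctx n) T q" by (auto simp: prv_def)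
  then have "derives (ctx (max m n)) T p" "derives (ctx (max m n)) T q" by (auto elim!: derives_ctx_mono)
  then show ?thesis by blast
qed

lemma prv_wff: "prv T p \<Longrightarrow> fok (rctx r) q \<Longrightarrow> \<exists>n. derives (ctx n) T p \<and> wff (ctx n) q"
proof -
  assume "prv T p" "fok (rctx r) q"
  then obtain m n where "derives (ctx m) T p" "\<forall>k\<ge>n. wff (ctx k) q" by (meson prv_def fok_rctx_wff)
  then have "derives (ctx (max m n)) T p" "wff (ctx (max m n)) q" by (auto elim!: derives_ctx_mono)
  then show ?thesis by blast
qed

lemma Th_Conj: "fok (rctx (wrk w)) (Conj p q) \<Longrightarrow> Conj p q \<in> Th w \<longleftrightarrow> p \<in> Th w \<and> q \<in> Th w"
proof
  assume ok: "fok (rctx (wrk w)) (Conj p q)"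
  { assume "Conj p q \<in> Th w"
    then obtain n where "derives (ctx n) (Th w) (Conj p q)" using Th_prv prv_def by blast
    then have "prv (Th w) p" "prv (Th w) q" unfolding prv_def by (blast intro: derives.ConjE1 derives.ConjE2)+
    with ok show "p \<in> Th w \<and> q \<in> Th w" by (auto intro: Th_closed) }
  { assume "p \<in> Th w \<and> q \<in> Th w"
    then have "prv (Th w) (Conj p q)" using prv_both[of "Th w" p q] Th_prv unfolding prv_def by (blast intro: derives.ConjI)
    with ok show "Conj p q \<in> Th w" by (auto intro: Th_closed) }
qed

lemma Th_Disj: "fok (rctx (wrk w)) (Disj p q) \<Longrightarrow> Disj p q \<in> Th w \<longleftrightarrow> p \<in> Th w \<or> q \<in> Th w"
proof
  assume ok: "fok (rctx (wrk w)) (Disj p q)"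
  { assume "Disj p q \<in> Th w"
    then show "p \<in> Th w \<or> q \<in> Th w" using saturated_Th[of w] unfolding saturated_def by blast }
  { assume "p \<in> Th w \<or> q \<in> Th w"
    then have "prv (Th w) (Disj p q)"
    proof
      assume "p \<in> Th w"
      then show ?thesis using prv_wff[of "Th w" p "wrk w" q] Th_prv ok unfolding prv_def by (auto intro: derives.DisjI1)
    next
      assume "q \<in> Th w"
      then show ?thesis using prv_wff[of "Th w" q "wrk w" p] Th_prv ok unfolding prv_def by (auto intro: derives.DisjI2)
    qed
    with ok show "Disj p q \<in> Th w" by (auto intro: Th_closed) }
qed

lemma Th_mp: "Imp p q \<in> Th w \<Longrightarrow> p \<in> Th w \<Longrightarrow> q \<in> Th w"
proof -
  assume a: "Imp p q \<in> Th w" "p \<in> Th w"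
  then have "prv (Th w) q" using prv_both[of "Th w" "Imp p q" p] Th_prv unfolding prv_def by (blast intro: derives.ImpE)
  with Th_fok[OF a(1)] show ?thesis by (auto intro: Th_closed)
qed

text \<open>If \<open>p\<close> and \<open>Th w\<close> do not prove \<open>q\<close>, a saturated
  extension containing \<open>p\<close> and omitting \<open>q\<close> is a later world refuting the
  right-hand side.\<close>

lemma Th_Imp:
  assumes ok: "fok (rctx (wrk w)) (Imp p q)"
  shows "Imp p q \<in> Th w \<longleftrightarrow> (\<forall>w'. w \<sqsubseteq> w' \<longrightarrow> p \<in> Th w' \<longrightarrow> q \<in> Th w')"
proof
  assume "Imp p q \<in> Th w"
  then show "\<forall>w'. w \<sqsubseteq> w' \<longrightarrow> p \<in> Th w' \<longrightarrow> q \<in> Th w'" using Th_mp by (auto simp: wle_def)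
next
  assume r: "\<forall>w'. w \<sqsubseteq> w' \<longrightarrow> p \<in> Th w' \<longrightarrow> q \<in> Th w'"
  show "Imp p q \<in> Th w"
  proof (rule ccontr)
    assume "Imp p q \<notin> Th w"
    then have n: "\<not> prv (Th w) (Imp p q)" using ok Th_closed by blast
    have "\<not> prv (insert p (Th w)) q"
    proof
      assume "prv (insert p (Th w)) q"
      then obtain n where "derives (ctx n) (insert p (Th w)) q" "wff (ctx n) p" using prv_wff ok by fastforce
      then show False using n unfolding prv_def by (blast intro: derives.ImpI)
    qed
    then obtain w' where "w \<sqsubseteq> w'" "insert p (Th w) \<subseteq> Th w'" "q \<notin> Th w'"
      using world_extension[of w "insert p (Th w)" "wrk w" q] ok Th_fok by auto
    with r show False by blast
  qed
qed

lemma Th_Forall: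
  assumes ok: "fok (rctx (wrk w)) (Forall \<sigma> p)"
  shows "Forall \<sigma> p \<in> Th w \<longleftrightarrow> (\<forall>w' t. w \<sqsubseteq> w' \<longrightarrow> tyw w' t = Some \<sigma> \<longrightarrow> finst p t \<in> Th w')"
proof (intro iffI allI impI)
  fix w' t assume a: "Forall \<sigma> p \<in> Th w" "w \<sqsubseteq> w'" "tyw w' t = Some \<sigma>"
  then have 1: "Forall \<sigma> p \<in> Th w'" by (auto simp: wle_def)
  obtain n where "derives (ctx n) (Th w') (Forall \<sigma> p)" "wff (ctx n) (Eq \<sigma> t t)"
    using prv_wff[OF Th_prv[OF 1], of "wrk w'" "Eq \<sigma> t t"] a(3) by (auto simp: tyw_def)
  then have "prv (Th w') (finst p t)" unfolding prv_def by (auto intro: derives.ForallE)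
  moreover have "fok (rctx (wrk w')) (finst p t)"
    using Th_fok[OF 1] a(3) by (auto intro: fok_finst simp: tyw_def)
  ultimately show "finst p t \<in> Th w'" by (rule Th_closed)
next
  assume r: "\<forall>w' t. w \<sqsubseteq> w' \<longrightarrow> tyw w' t = Some \<sigma> \<longrightarrow> finst p t \<in> Th w'"
  show "Forall \<sigma> p \<in> Th w"
  proof (rule ccontr)
    assume "Forall \<sigma> p \<notin> Th w"
    then have n: "\<not> prv (Th w) (Forall \<sigma> p)" using ok Th_closed by blast
    \<comment> \<open>A variable of rank \<open>wrk w\<close> does not occur in \<open>Th w\<close>.
      It is typed from rank \<open>Suc (wrk w)\<close> on, so the extension is taken over that rank
      and lands one rank higher.\<close>
    obtain c where c: "rnk c = wrk w" "vty c = \<sigma>" using ex_fresh by blast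
    have "\<not> prv (Th w) (finst p (Var c))"
    proof
      assume "prv (Th w) (finst p (Var c))"
      then have "prv (Th w) (Forall \<sigma> p)"
        by (rule prv_ForallI[where C="rctx (wrk w)"]) (use c ok Th_fok in \<open>auto simp: rctx_def\<close>)
      with n show False ..
    qed
    moreover have tc: "tyc (rctx (Suc (wrk w))) (Var c) = Some \<sigma>" using c by (simp add: rctx_def)
    moreover have "fok (rctx (Suc (wrk w))) (Forall \<sigma> p)" using ok map_le_rctx_Suc fok_mono by blast
    then have "fok (rctx (Suc (wrk w))) (finst p (Var c))" using tc by (auto intro: fok_finst)
    moreover have "\<forall>p\<in>Th w. fok (rctx (Suc (wrk w))) p" using Th_fok map_le_rctx_Suc fok_mono by blast
    ultimately obtain w' where w': "w \<sqsubseteq> w'" "finst p (Var c) \<notin> Th w'" "wrk w' = Suc (Suc (wrk w))"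
      using world_extension[of w "Th w" "Suc (wrk w)" "finst p (Var c)"] by auto
    moreover have "tyw w' (Var c) = Some \<sigma>" using c w'(3) by (simp add: tyw_def rctx_def)
    ultimately show False using r by blast
  qed
qed

lemma Th_Exists:
  assumes ok: "fok (rctx (wrk w)) (Exists \<sigma> p)"
  shows "Exists \<sigma> p \<in> Th w \<longleftrightarrow> (\<exists>t. tyw w t = Some \<sigma> \<and> finst p t \<in> Th w)"
proof
  assume "Exists \<sigma> p \<in> Th w"
  then show "\<exists>t. tyw w t = Some \<sigma> \<and> finst p t \<in> Th w"
    using saturated_Th[of w] unfolding saturated_def tyw_def by blast
next
  assume "\<exists>t. tyw w t = Some \<sigma> \<and> finst p t \<in> Th w"
  then obtain t where t: "tyw w t = Some \<sigma>" "finst p t \<in> Th w" by blast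
  have "fok (rctx (wrk w)) (Conj (Eq \<sigma> t t) (Exists \<sigma> p))" using ok t by (simp add: tyw_def)
  then obtain n where "derives (ctx n) (Th w) (finst p t)" "wff (ctx n) (Conj (Eq \<sigma> t t) (Exists \<sigma> p))"
    using prv_wff[OF Th_prv[OF t(2)]] by blast
  then have "prv (Th w) (Exists \<sigma> p)" unfolding prv_def by (auto intro: derives.ExistsI)
  then show "Exists \<sigma> p \<in> Th w" using ok by (rule Th_closed)
qed

lemma fok_fsub: "fok (\<lambda>i. tyw w (\<rho> i)) p \<Longrightarrow> fok (rctx (wrk w)) (fsub \<rho> p)"
  by (erule fok_sub) (simp add: tyw_def)

lemma fok_env_mono: "fok (\<lambda>i. tyw w (\<rho> i)) p \<Longrightarrow> w \<sqsubseteq> w' \<Longrightarrow> fok (\<lambda>i. tyw w' (\<rho> i)) p"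
  by (erule fok_mono) (auto simp: map_le_def dom_def intro: tyw_mono[symmetric])

text \<open>Well-typedness in the environment is carried through the induction, since a theory is
  closed only under formulas over variables of its own rank.\<close>

lemma truth: "fok (\<lambda>i. tyw w (\<rho> i)) p \<Longrightarrow> fsub \<rho> p \<in> Th w \<longleftrightarrow> forc w \<rho> p"
proof (induction p arbitrary: w \<rho>)
  case (Conj p q)
  then show ?case using Th_Conj[of w "fsub \<rho> p" "fsub \<rho> q"] fok_fsub[OF Conj.prems] by simp
next
  case (Disj p q)
  then show ?case using Th_Disj[of w "fsub \<rho> p" "fsub \<rho> q"] fok_fsub[OF Disj.prems] by simp
next
  case (Imp p q)
  then have "\<And>w'. w \<sqsubseteq> w' \<Longrightarrow> fok (\<lambda>i. tyw w' (\<rho> i)) p \<and> fok (\<lambda>i. tyw w' (\<rho> i)) q"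
    using fok_env_mono by (metis fok.simps(7))
  then show ?case using Th_Imp[of w "fsub \<rho> p" "fsub \<rho> q"] fok_fsub[OF Imp.prems] Imp.IH by simp
next
  case (Forall \<sigma> p)
  have "fsub (econs t \<rho>) p \<in> Th w' \<longleftrightarrow> forc w' (econs t \<rho>) p" if "w \<sqsubseteq> w'" "tyw w' t = Some \<sigma>" for w' t
  proof (rule Forall.IH)
    show "fok (\<lambda>i. tyw w' (econs t \<rho> i)) p"
      using fok_env_mono[OF Forall.prems that(1)] that(2) by simp
  qed
  then show ?case using Th_Forall[of w \<sigma> "fsub (up_sub \<rho>) p"] fok_fsub[OF Forall.prems] by (simp add: fsub_up_finst)
next
  case (Exists \<sigma> p)
  have "fsub (econs t \<rho>) p \<in> Th w \<longleftrightarrow> forc w (econs t \<rho>) p" if "tyw w t = Some \<sigma>" for t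
  proof (rule Exists.IH)
    show "fok (\<lambda>i. tyw w (econs t \<rho> i)) p"
      using Exists.prems that by simp
  qed
  then show ?case using Th_Exists[of w \<sigma> "fsub (up_sub \<rho>) p"] fok_fsub[OF Exists.prems] by (auto simp: fsub_up_finst)
qed auto

lemma forc_mono: "forc w \<rho> p \<Longrightarrow> fok (\<lambda>i. tyw w (\<rho> i)) p \<Longrightarrow> w \<sqsubseteq> w' \<Longrightarrow> forc w' \<rho> p"
  using truth[of w \<rho> p] truth[of w' \<rho> p] fok_env_mono by (auto simp: wle_def)

section \<open>The axiom schemes as rules about forcing\<close>

lemma axiom_Th: "axiom (ctx n) p \<Longrightarrow> fok (rctx (wrk w)) p \<Longrightarrow> p \<in> Th w"
  by (rule Th_closed) (auto simp: prv_def intro: derives.Ax)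

lemma axiom_forc:
  assumes "axiom [] p" "\<And>s. fsub s p = p" "fok (\<lambda>_. None) p"
  shows "forc w \<rho> p"
proof -
  have 1: "fok (\<lambda>i. tyw w (\<rho> i)) p" "fok (rctx (wrk w)) p"
    using assms(3) by (auto elim!: fok_mono simp: map_le_def)
  have "p \<in> Th w" using axiom_Th[of 0 p w] assms(1) 1 by (simp add: ctx_def)
  then show ?thesis using truth[OF 1(1)] assms(2) by simp
qed

lemma fok_up: "fok (econs (Some \<sigma>) (\<lambda>i. tyw w (\<rho> i))) p \<Longrightarrow> fok (econs (Some \<sigma>) (rctx (wrk w))) (fsub (up_sub \<rho>) p)"
  by (erule fok_sub) (auto simp: up_sub_def tyw_def intro: tyc_ren_Suc split: econs_splits nat.splits)

lemma fok_up2: "fok (econs (Some \<tau>) (econs (Some \<sigma>) (\<lambda>i. tyw w (\<rho> i)))) p \<Longrightarrow>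
   fok (econs (Some \<tau>) (econs (Some \<sigma>) (rctx (wrk w)))) (fsub (up_sub (up_sub \<rho>)) p)"
  by (erule fok_sub) (auto simp: up_sub_def tyw_def intro!: tyc_ren_Suc split: econs_splits nat.splits)

lemma fok_up_wff:
  assumes "fok (econs (Some \<sigma>) (rctx r)) p"
  shows "\<exists>n. wff (\<sigma> # ctx n) p"
  using fok_rctx_wff[of r "Forall \<sigma> p"] assms by auto

lemma fok_up2_wff:
  assumes "fok (econs (Some \<tau>) (econs (Some \<sigma>) (rctx r))) p"
  shows "\<exists>n. wff (\<tau> # \<sigma> # ctx n) p"
  using fok_rctx_wff[of r "Forall \<sigma> (Forall \<tau> p)"] assms by auto

lemma tyw_Var: "(\<lambda>i. tyw w (Var i)) = rctx (wrk w)" by (simp add: tyw_def)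

text \<open>The step is demanded at every later world because the induction axiom contains an
  implication under a universal quantifier. Parameters of \<open>p\<close> are terms in
  \<open>\<rho>\<close>, so they can be evaluated at those worlds as well.\<close>

lemma forc_induct [consumes 1, case_names zero suc]:
  assumes n: "tyw w n = Some Nat"
    and ok: "fok (econs (Some Nat) (\<lambda>i. tyw w (\<rho> i))) p"
    and 0: "forc w (econs (Con CZero) \<rho>) p"
    and S: "\<And>w' t. w \<sqsubseteq> w' \<Longrightarrow> tyw w' t = Some Nat \<Longrightarrow> forc w' (econs t \<rho>) p \<Longrightarrow>
        forc w' (econs (App (Con CSuc) t) \<rho>) p"
  shows "forc w (econs n \<rho>) p"
proof -
  define p' where "p' = fsub (up_sub \<rho>) p"
  have ok': "fok (econs (Some Nat) (rctx (wrk w))) p'" unfolding p'_def using ok by (rule fok_up)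
  let ?\<theta> = "case_nat (App (Con CSuc) (Var 0)) (\<lambda>i. Var (Suc i))"
  let ?q = "Imp (finst p' (Con CZero)) (Imp (Forall Nat (Imp p' (fsub ?\<theta> p'))) (Forall Nat p'))"
  obtain m where "wff (Nat # ctx m) p'" using ok' fok_up_wff by blast
  then have "axiom (ctx m) ?q" by (rule axiom.induction)
  moreover have ok1: "fok (rctx (wrk w)) (finst p' (Con CZero))" using ok' by (auto intro: fok_finst)
  moreover have ok2: "fok (econs (Some Nat) (rctx (wrk w))) (fsub ?\<theta> p')"
    using ok' by (rule fok_sub) (auto split: econs_splits nat.splits)
  ultimately have "?q \<in> Th w" using ok' by (intro axiom_Th) auto
  moreover have f: "finst p' t = fsub (econs t \<rho>) p" for t by (simp add: p'_def fsub_up_finst)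
  have fS: "finst (fsub ?\<theta> p') t = fsub (econs (App (Con CSuc) t) \<rho>) p" for t
  proof -
    have "finst (fsub ?\<theta> p') t = finst p' (App (Con CSuc) t)"
      unfolding finst_eq fsub_fsub by (rule fsub_eq_cong, rule nat_fun_eqI) auto
    then show ?thesis by (simp add: f)
  qed
  have okw: "fok (\<lambda>i. tyw w' (econs t \<rho> i)) p" if "w \<sqsubseteq> w'" "tyw w' t = Some Nat" for w' t
    using fok_env_mono[of w \<rho> "Forall Nat p" w'] ok that by simp
  have 1: "finst p' (Con CZero) \<in> Th w" using 0 truth[OF okw[of w "Con CZero"]] by (simp add: f)
  have 2: "Forall Nat (Imp p' (fsub ?\<theta> p')) \<in> Th w"
  proof (subst Th_Forall; (intro allI impI)?)
    show "fok (rctx (wrk w)) (Forall Nat (Imp p' (fsub ?\<theta> p')))" using ok' ok2 by simp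
    fix w' t assume a: "w \<sqsubseteq> w'" "tyw w' t = Some Nat"
    have e: "finst (Imp p' (fsub ?\<theta> p')) t = Imp (fsub (econs t \<rho>) p) (fsub (econs (App (Con CSuc) t) \<rho>) p)"
      using f[of t] fS[of t] by (simp add: finst_eq)
    show "finst (Imp p' (fsub ?\<theta> p')) t \<in> Th w'"
      unfolding e
    proof (subst Th_Imp; (intro allI impI)?)
      show "fok (rctx (wrk w')) (Imp (fsub (econs t \<rho>) p) (fsub (econs (App (Con CSuc) t) \<rho>) p))"
        using okw[OF a] okw[of w' "App (Con CSuc) t"] a by (simp add: fok_fsub)
      fix w'' assume b: "w' \<sqsubseteq> w''" "fsub (econs t \<rho>) p \<in> Th w''"
      have c: "w \<sqsubseteq> w''" "tyw w'' t = Some Nat" using a b wle_trans tyw_mono by blast+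
      have "forc w'' (econs t \<rho>) p" using truth[OF okw[OF c]] b by simp
      from S[OF c this] show "fsub (econs (App (Con CSuc) t) \<rho>) p \<in> Th w''"
        using truth[OF okw[OF c(1), of "App (Con CSuc) t"]] c(2) by simp
    qed
  qed
  ultimately have "Forall Nat p' \<in> Th w" using 1 2 Th_mp by blast
  then have "finst p' n \<in> Th w" using Th_Forall[of w Nat p'] ok' n by auto
  then show ?thesis using truth[OF okw[of w n]] n by (simp add: f)
qed

text \<open>The source of all function terms that no recursor yields: reciprocals
  (\<open>ex_recips\<close>), the inverse of a permutation (\<open>forc_permutation\<close>) and the
  enumeration of a countable set (\<open>forc_countable\<close>). One term \<open>f\<close> serves
  all later worlds.\<close>

lemma forc_unique_choice:
  assumes ok: "fok (econs (Some \<tau>) (econs (Some \<sigma>) (\<lambda>i. tyw w (\<rho> i)))) p"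
    and ex: "\<And>w' x. w \<sqsubseteq> w' \<Longrightarrow> tyw w' x = Some \<sigma> \<Longrightarrow> \<exists>y. tyw w' y = Some \<tau> \<and> forc w' (econs y (econs x \<rho>)) p"
    and uniq: "\<And>w' x y y'. w \<sqsubseteq> w' \<Longrightarrow> tyw w' x = Some \<sigma> \<Longrightarrow> tyw w' y = Some \<tau> \<Longrightarrow> tyw w' y' = Some \<tau> \<Longrightarrow>
       forc w' (econs y (econs x \<rho>)) p \<Longrightarrow> forc w' (econs y' (econs x \<rho>)) p \<Longrightarrow> Eq \<tau> y' y \<in> Th w'"
  shows "\<exists>f. tyw w f = Some (Fun \<sigma> \<tau>) \<and>
     (\<forall>w' x. w \<sqsubseteq> w' \<longrightarrow> tyw w' x = Some \<sigma> \<longrightarrow> forc w' (econs (App f x) (econs x \<rho>)) p)"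
proof -
  define p' where "p' = fsub (up_sub (up_sub \<rho>)) p"
  have ok': "fok (econs (Some \<tau>) (econs (Some \<sigma>) (rctx (wrk w)))) p'" unfolding p'_def using ok by (rule fok_up2)
  let ?\<theta> = "case_nat (Var 0) (\<lambda>i. Var (i + 2))"
  let ?\<eta> = "case_nat (App (Var 1) (Var 0)) (case_nat (Var 0) (\<lambda>i. Var (i + 2)))"
  let ?A = "Forall \<sigma> (Exists \<tau> (Conj p' (Forall \<tau> (Imp (fsub ?\<theta> p') (Eq \<tau> (Var 0) (Var 1))))))"
  let ?B = "Exists (Fun \<sigma> \<tau>) (Forall \<sigma> (fsub ?\<eta> p'))"
  obtain m where "wff (\<tau> # \<sigma> # ctx m) p'" using ok' fok_up2_wff by blast
  then have ax: "axiom (ctx m) (Imp ?A ?B)" by (rule axiom.unique_choice)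
  have ok1: "fok (econs (Some \<tau>) (econs (Some \<tau>) (econs (Some \<sigma>) (rctx (wrk w'))))) (fsub ?\<theta> p')" if "w \<sqsubseteq> w'" for w'
  proof -
    have "fok (econs (Some \<tau>) (econs (Some \<sigma>) (rctx (wrk w')))) p'"
      using ok' by (rule fok_mono) (use that map_le_rctx[of "wrk w" "wrk w'"] in \<open>auto simp: wle_def map_le_def dom_def split: econs_splits nat.splits\<close>)
    then show ?thesis by (rule fok_sub) (auto split: econs_splits nat.splits)
  qed
  have ok2: "fok (econs (Some \<sigma>) (econs (Some (Fun \<sigma> \<tau>)) (rctx (wrk w)))) (fsub ?\<eta> p')"
    using ok' by (rule fok_sub) (auto split: econs_splits nat.splits)
  have okw: "fok (\<lambda>i. tyw w' (econs y (econs x \<rho>) i)) p" if "w \<sqsubseteq> w'" "tyw w' x = Some \<sigma>" "tyw w' y = Some \<tau>" for w' x y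
    using fok_env_mono[of w \<rho> "Forall \<sigma> (Forall \<tau> p)" w'] ok that by simp
  have okA: "fok (rctx (wrk w)) ?A" using ok' ok1[of w] by simp
  have okB: "fok (rctx (wrk w)) ?B" using ok2 by simp
  have i: "Imp ?A ?B \<in> Th w" using ax okA okB by (intro axiom_Th) auto
  have s1: "fsub (econs y (econs x Var)) p' = fsub (econs y (econs x \<rho>)) p" for x y
    unfolding p'_def fsub_fsub
    by (rule fsub_eq_cong, rule nat_fun_eqI) (auto simp: up_sub_def sub_ren split: econs_splits nat.splits)
  have s2: "fsub (econs y' (econs y (econs x Var))) (fsub ?\<theta> p') = fsub (econs y' (econs x \<rho>)) p" for x y y'
    unfolding s1[symmetric] fsub_fsub[of _ ?\<theta>]
    by (rule fsub_eq_cong, rule nat_fun_eqI) (auto split: econs_splits nat.splits)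
  have s3: "fsub (econs x (econs f Var)) (fsub ?\<eta> p') = fsub (econs (App f x) (econs x \<rho>)) p" for x f
    unfolding s1[symmetric] fsub_fsub[of _ ?\<eta>]
    by (rule fsub_eq_cong, rule nat_fun_eqI) (auto split: econs_splits nat.splits)
  have "forc w Var ?A"
    unfolding forc.simps(8)
  proof (intro allI impI)
    fix w' x assume a: "w \<sqsubseteq> w'" "tyw w' x = Some \<sigma>"
    then obtain y where y: "tyw w' y = Some \<tau>" "forc w' (econs y (econs x \<rho>)) p" using ex by blast
    have "fok (\<lambda>i. tyw w' (econs y (econs x Var) i)) p'"
      using ok' by (rule fok_mono) (use a y map_le_rctx[of "wrk w" "wrk w'"] in
        \<open>auto simp: tyw_def wle_def map_le_def dom_def split: econs_splits nat.splits\<close>)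
    then have "forc w' (econs y (econs x Var)) p'"
      using truth s1[of y x] y(2) truth[OF okw[OF a y(1)]] by metis
    moreover have "Eq \<tau> y' y \<in> Th w''"
      if b: "w' \<sqsubseteq> w''" "tyw w'' y' = Some \<tau>" and c: "forc w'' (econs y' (econs y (econs x Var))) (fsub ?\<theta> p')" for w'' y'
    proof -
      have t: "w \<sqsubseteq> w''" "tyw w'' x = Some \<sigma>" "tyw w'' y = Some \<tau>" using a y b wle_trans tyw_mono by blast+
      have "fok (\<lambda>i. tyw w'' (econs y' (econs y (econs x Var)) i)) (fsub ?\<theta> p')"
        using ok1[OF t(1)] t b by (simp add: tyw_Var)
      then have "forc w'' (econs y' (econs x \<rho>)) p"
        using truth c s2 truth[OF okw[OF t(1,2) b(2)]] by metis
      moreover have "forc w'' (econs y (econs x \<rho>)) p" using forc_mono[OF y(2) okw[OF a y(1)] b(1)] .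
      ultimately show ?thesis using uniq t b by blast
    qed
    then have "\<forall>w'' w''' y'. w' \<sqsubseteq> w'' \<longrightarrow> tyw w'' y' = Some \<tau> \<longrightarrow> w'' \<sqsubseteq> w''' \<longrightarrow>
        forc w''' (econs y' (econs y (econs x Var))) (fsub ?\<theta> p') \<longrightarrow> Eq \<tau> y' y \<in> Th w'''"
      using wle_trans tyw_mono by blast
    ultimately show "forc w' (econs x Var) (Exists \<tau> (Conj p' (Forall \<tau> (Imp (fsub ?\<theta> p') (Eq \<tau> (Var 0) (Var 1))))))"
      using y(1) by auto
  qed
  then have "?A \<in> Th w" using truth[of w Var ?A] okA by (simp add: tyw_Var)
  then have "?B \<in> Th w" using i Th_mp by blast
  then have "forc w Var ?B" using truth[of w Var ?B] okB by (simp add: tyw_Var)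
  then obtain f where f: "tyw w f = Some (Fun \<sigma> \<tau>)"
    and fo: "\<forall>w' x. w \<sqsubseteq> w' \<longrightarrow> tyw w' x = Some \<sigma> \<longrightarrow> forc w' (econs x (econs f Var)) (fsub ?\<eta> p')" by auto
  have "forc w' (econs (App f x) (econs x \<rho>)) p" if a: "w \<sqsubseteq> w'" "tyw w' x = Some \<sigma>" for w' x
  proof -
    have f': "tyw w' f = Some (Fun \<sigma> \<tau>)" using f a tyw_mono by blast
    have "fok (econs (Some \<sigma>) (econs (Some (Fun \<sigma> \<tau>)) (rctx (wrk w')))) (fsub ?\<eta> p')"
      using ok2 by (rule fok_mono) (use a map_le_rctx[of "wrk w" "wrk w'"] in
        \<open>auto simp: wle_def map_le_def dom_def split: econs_splits nat.splits\<close>)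
    then have "fok (\<lambda>i. tyw w' (econs x (econs f Var) i)) (fsub ?\<eta> p')"
      using a f' by (simp add: tyw_Var)
    then have "fsub (econs (App f x) (econs x \<rho>)) p \<in> Th w'"
      using truth fo a s3 by metis
    then show ?thesis using truth[OF okw[OF a]] f' a by simp
  qed
  with f show ?thesis by blast
qed

section \<open>Provable equality as a congruence\<close>

lemma Eq_refl: "tyw w t = Some \<sigma> \<Longrightarrow> Eq \<sigma> t t \<in> Th w"
proof (rule Th_closed)
  assume "tyw w t = Some \<sigma>"
  then obtain n where "wt (ctx n) t \<sigma>" unfolding tyw_def using tyc_rctx_wt by blast
  then show "prv (Th w) (Eq \<sigma> t t)" unfolding prv_def by (blast intro: derives.EqRefl)
qed (simp add: tyw_def)

lemma forc_Eq_subst: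
  assumes e: "Eq \<sigma> s t \<in> Th w" and f: "forc w (econs s \<rho>) p" and ok: "fok (econs (Some \<sigma>) (\<lambda>i. tyw w (\<rho> i))) p"
  shows "forc w (econs t \<rho>) p"
proof -
  define p' where "p' = fsub (up_sub \<rho>) p"
  have ok': "fok (econs (Some \<sigma>) (rctx (wrk w))) p'" unfolding p'_def using ok by (rule fok_up)
  have st: "tyw w s = Some \<sigma>" "tyw w t = Some \<sigma>" using Th_fok[OF e] by (simp_all add: tyw_def)
  have i: "finst p' t = fsub (econs t \<rho>) p" for t by (simp add: p'_def fsub_up_finst)
  have okw: "fok (\<lambda>i. tyw w (econs t \<rho> i)) p" if "tyw w t = Some \<sigma>" for t using ok that by simp
  have "finst p' s \<in> Th w" using f truth[OF okw[OF st(1)]] by (simp add: i)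
  then obtain n where n: "derives (ctx n) (Th w) (Eq \<sigma> s t)" "derives (ctx n) (Th w) (finst p' s)"
    using prv_both[OF Th_prv[OF e]] Th_prv by blast
  obtain m where m: "\<forall>k\<ge>m. wff (ctx k) (Forall \<sigma> p')" using ok' fok_rctx_wff[of "wrk w" "Forall \<sigma> p'"] by auto
  have "derives (ctx (max m n)) (Th w) (Eq \<sigma> s t)" "derives (ctx (max m n)) (Th w) (finst p' s)" "wff (\<sigma> # ctx (max m n)) p'"
    using n m derives_ctx_mono by auto
  then have "prv (Th w) (finst p' t)" unfolding prv_def by (blast intro: derives.EqSubst)
  then have "finst p' t \<in> Th w" using ok' st(2) by (auto intro!: Th_closed fok_finst simp: tyw_def)
  then show ?thesis using truth[OF okw[OF st(2)]] by (simp add: i)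
qed

lemma Eq_ty: "Eq \<sigma> s t \<in> Th w \<Longrightarrow> tyw w s = Some \<sigma> \<and> tyw w t = Some \<sigma>"
  using Th_fok[of "Eq \<sigma> s t" w] by (simp add: tyw_def)

lemma Eq_sym: "Eq \<sigma> s t \<in> Th w \<Longrightarrow> Eq \<sigma> t s \<in> Th w"
  using forc_Eq_subst[of \<sigma> s t w "\<lambda>_. s" "Eq \<sigma> (Var 0) (Var 1)"] Eq_ty[of \<sigma> s t w] Eq_refl[of w s \<sigma>] by simp

lemma Eq_trans: "Eq \<sigma> s t \<in> Th w \<Longrightarrow> Eq \<sigma> t u \<in> Th w \<Longrightarrow> Eq \<sigma> s u \<in> Th w"
  using forc_Eq_subst[of \<sigma> t u w "\<lambda>_. s" "Eq \<sigma> (Var 1) (Var 0)"] Eq_ty[of \<sigma> s t w] by simp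

lemma Eq_cong: "Eq \<sigma> s t \<in> Th w \<Longrightarrow> tyc (econs (Some \<sigma>) (\<lambda>i. tyw w (\<rho> i))) u = Some \<tau> \<Longrightarrow>
   Eq \<tau> (sub (econs s \<rho>) u) (sub (econs t \<rho>) u) \<in> Th w"
proof -
  assume a: "Eq \<sigma> s t \<in> Th w" and u: "tyc (econs (Some \<sigma>) (\<lambda>i. tyw w (\<rho> i))) u = Some \<tau>"
  let ?v = "sub (econs s \<rho>) u"
  let ?\<rho> = "econs ?v \<rho>"
  \<comment> \<open>Index 1 of the enlarged environment stores the fixed left-hand side, so the
    parameters of \<open>u\<close> move up by one place.\<close>
  let ?r = "econs (Var 0) (\<lambda>i. Var (Suc (Suc i)))"
  have e: "sub (econs x ?\<rho>) (sub ?r u) = sub (econs x \<rho>) u" for x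
    unfolding sub_sub by (rule arg_cong[where f="\<lambda>s. sub s u"], rule nat_fun_eqI) auto
  have ts: "tyw w s = Some \<sigma>" using Eq_ty[OF a] by simp
  have tv: "tyw w ?v = Some \<tau>" by (rule tyw_sub) (use u ts in \<open>simp\<close>)
  have tr: "tyc (econs (Some \<sigma>) (\<lambda>i. tyw w (?\<rho> i))) (sub ?r u) = Some \<tau>"
    using u by (rule tyc_sub) (auto split: econs_splits nat.splits)
  have "forc w (econs t ?\<rho>) (Eq \<tau> (Var 1) (sub ?r u))"
    by (rule forc_Eq_subst[OF a]) (use tv tr Eq_refl[OF tv] in \<open>simp_all add: e\<close>)
  then show ?thesis by (simp add: e)
qed

lemma Eq_App: "Eq (Fun \<sigma> \<tau>) f g \<in> Th w \<Longrightarrow> Eq \<sigma> s t \<in> Th w \<Longrightarrow> Eq \<tau> (App f s) (App g t) \<in> Th w"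
  using Eq_cong[of "Fun \<sigma> \<tau>" f g w "\<lambda>_. s" "App (Var 0) (Var 1)" \<tau>]
    Eq_cong[of \<sigma> s t w "\<lambda>_. g" "App (Var 1) (Var 0)" \<tau>] Eq_ty[of \<sigma> s t w] Eq_ty[of "Fun \<sigma> \<tau>" f g w] Eq_trans
  by (simp add: tyw_simps)

text \<open>Stated for a lambda under an environment: contraction then simply extends the
  environment, with no shifted substitution left over.\<close>

lemma Eq_beta:
  assumes "tyc (econs (Some \<sigma>) (\<lambda>i. tyw w (\<rho> i))) t = Some \<tau>" "tyw w s = Some \<sigma>"
  shows "Eq \<tau> (App (sub \<rho> (Lam \<sigma> t)) s) (sub (econs s \<rho>) t) \<in> Th w"
proof -
  let ?t = "sub (up_sub \<rho>) t"
  have t': "tyc (econs (Some \<sigma>) (rctx (wrk w))) ?t = Some \<tau>"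
    using assms(1) by (rule tyc_sub) (auto simp: up_sub_def tyw_def intro: tyc_ren_Suc split: econs_splits nat.splits)
  have "fok (rctx (wrk w)) (Conj (Forall \<sigma> (Eq \<tau> ?t ?t)) (Eq \<sigma> s s))" using t' assms(2) by (simp add: tyw_def)
  then obtain n where "wff (ctx n) (Conj (Forall \<sigma> (Eq \<tau> ?t ?t)) (Eq \<sigma> s s))" using fok_rctx_wff by blast
  then have "axiom (ctx n) (Eq \<tau> (App (Lam \<sigma> ?t) s) (inst ?t s))" by (intro axiom.beta) auto
  moreover have "tyc (rctx (wrk w)) (inst ?t s) = Some \<tau>"
    unfolding inst_eq using t' by (rule tyc_sub) (use assms(2) in \<open>auto simp: tyw_def split: econs_splits nat.splits\<close>)
  ultimately have "Eq \<tau> (App (Lam \<sigma> ?t) s) (inst ?t s) \<in> Th w"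
    using t' assms(2) by (intro axiom_Th) (auto simp: tyw_def)
  then show ?thesis by (simp add: inst_up)
qed

end

section \<open>Completeness for closed formulas\<close>

lemma derives_ExistsI_simple: "wt \<Delta> t \<sigma> \<Longrightarrow> derives \<Delta> \<Gamma> (Exists \<sigma> (Eq \<sigma> (Var 0) (Var 0)))"
  by (rule derives.ExistsI[of _ _ _ t]) (auto simp: finst_eq intro: derives.EqRefl)

text \<open>A derivation over \<open>\<sigma> # \<Delta>\<close> yields one over
  \<open>\<Delta>\<close> only if \<open>\<sigma>\<close> has an element. For a power type,
  comprehension with \<open>Bot\<close> gives the empty set.\<close>

lemma types_inhabited: "derives \<Delta> \<Gamma> (Exists \<sigma> (Eq \<sigma> (Var 0) (Var 0)))"
proof (induction \<sigma> arbitrary: \<Delta> \<Gamma>)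
  case Nat show ?case by (rule derives_ExistsI_simple[of _ "Con CZero"]) simp
next
  case Real show ?case by (rule derives_ExistsI_simple[of _ "Con CRZero"]) simp
next
  case (Fun \<sigma> \<tau>)
  show ?case
    by (rule derives.ExistsE[OF Fun.IH(2)])
      (auto simp: flift_def intro: derives_ExistsI_simple[of _ "Lam \<sigma> (Var (Suc 0))"])
next
  case (Prod \<sigma> \<tau>)
  have 1: "derives (\<tau> # \<sigma> # \<Delta>) \<Gamma>' (Exists (Prod \<sigma> \<tau>) (Eq (Prod \<sigma> \<tau>) (Var 0) (Var 0)))" for \<Gamma>'
    by (rule derives_ExistsI_simple[of _ "App (App (Con (CPair \<sigma> \<tau>)) (Var (Suc 0))) (Var 0)"]) auto
  have 2: "derives (\<sigma> # \<Delta>) \<Gamma>' (Exists (Prod \<sigma> \<tau>) (Eq (Prod \<sigma> \<tau>) (Var 0) (Var 0)))" for \<Gamma>'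
    by (rule derives.ExistsE[OF Prod.IH(2)]) (auto simp: flift_def intro: 1)
  show ?case
    by (rule derives.ExistsE[OF Prod.IH(1)]) (auto simp: flift_def intro: 2)
next
  case (Pow \<sigma>)
  show ?case
    by (rule derives.ExistsE[OF derives.Ax[OF axiom.comprehension[of \<sigma> \<Delta> Bot]]])
      (auto simp: flift_def intro: derives_ExistsI_simple[of _ "Var 0"])
qed

lemma derives_strengthen: "derives \<Delta> {} p \<Longrightarrow> fok (\<lambda>_. None) p \<Longrightarrow> derives [] {} p"
proof (induction \<Delta>)
  case (Cons \<sigma> \<Delta>)
  have "flift p = fsub Var p" unfolding flift_def using Cons.prems(2) by (rule fok_cong_on) simp
  then have "derives (\<sigma> # \<Delta>) (insert (Eq \<sigma> (Var 0) (Var 0)) (flift ` {})) (flift p)"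
    using Cons.prems(1) derives_mono by auto
  moreover have "wff \<Delta> p" unfolding wff_fok using Cons.prems(2) by (rule fok_mono) (simp add: map_le_def)
  ultimately have "derives \<Delta> {} p" using derives.ExistsE[OF types_inhabited] by blast
  then show ?case using Cons by blast
qed

text \<open>Contrapositive: an underivable closed formula is omitted by some saturated theory. This
  theory is at once the instance required by the locale and the world that fails to force the
  formula.\<close>

lemma derives_of_forcing:
  assumes "fok (\<lambda>_. None) p" "consistent \<Longrightarrow> (\<And>w. forc w Var p)"
  shows "derives [] {} p"
proof (rule ccontr)
  assume n: "\<not> derives [] {} p"
  have ok: "fok (rctx 0) p" using assms(1) by (rule fok_mono) (auto simp: map_le_def)
  have "\<not> prv {} p"
  proof
    assume "prv {} p"
    then obtain m where "derives (ctx m) {} p" by (auto simp: prv_def)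
    then show False using n assms(1) derives_strengthen by blast
  qed
  then obtain T where T: "saturated (Suc 0) T" "p \<notin> T" using saturated_extension[of "{}" 0 p] ok by auto
  then interpret consistent by unfold_locales blast
  define w where "w = Abs_world (Suc 0, T)"
  have w: "Rep_world w = (Suc 0, T)" unfolding w_def using T by (simp add: Abs_world_inverse)
  have "fok (\<lambda>i. tyw w (Var i)) p" using assms(1) by (rule fok_mono) (auto simp: map_le_def)
  then have "p \<in> Th w" using truth[of w Var p] assms(2) consistent_axioms by simp
  with T w show False by (simp add: Th_def)
qed

section \<open>Values of terms at a world\<close>

text \<open>Lambdas stay in the shape \<open>sub \<rho> (Lam ...)\<close>, to which the beta rules
  for values below apply.\<close>

lemmas [simp del] = sub.simps(4)

text \<open>These closed step terms are what \<open>+\<^sub>N\<close>, \<open>predN\<close>,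
  \<open>-\<^sub>N\<close> and \<open>natR\<close> expand to; naming them keeps arithmetic terms
  folded during simplification.\<close>

definition ADDSTEP :: tm where "ADDSTEP = Lam Nat (Lam Nat (App (Con CSuc) (Var 0)))"
definition PREDSTEP :: tm where "PREDSTEP = Lam Nat (Lam Nat (Var 1))"
definition MONSTEP :: tm where
  "MONSTEP = Lam Nat (Lam Nat (App (App (App (Con (CRec Nat)) (Con CZero)) PREDSTEP) (Var 0)))"
definition NATSTEP :: tm where "NATSTEP = Lam Nat (Lam Real (App (App (Con CRAdd) (Var 0)) (Con CROne)))"

definition addT :: "tm \<Rightarrow> tm \<Rightarrow> tm" where "addT s t = App (App (App (Con (CRec Nat)) s) ADDSTEP) t"
definition predT :: "tm \<Rightarrow> tm" where "predT t = App (App (App (Con (CRec Nat)) (Con CZero)) PREDSTEP) t"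
definition monT :: "tm \<Rightarrow> tm \<Rightarrow> tm" where "monT s t = App (App (App (Con (CRec Nat)) s) MONSTEP) t"
definition natT :: "tm \<Rightarrow> tm" where "natT t = App (App (App (Con (CRec Real)) (Con CRZero)) NATSTEP) t"

abbreviation Z :: tm where "Z \<equiv> Con CZero"
abbreviation S :: "tm \<Rightarrow> tm" where "S t \<equiv> App (Con CSuc) t"

lemma closed_steps [simp]: "sub \<rho> ADDSTEP = ADDSTEP" "sub \<rho> PREDSTEP = PREDSTEP"
  "sub \<rho> MONSTEP = MONSTEP" "sub \<rho> NATSTEP = NATSTEP"
  by (simp_all add: ADDSTEP_def PREDSTEP_def MONSTEP_def NATSTEP_def sub.simps(4))

lemma tyc_steps [simp]: "tyc C ADDSTEP = Some (Fun Nat (Fun Nat Nat))" "tyc C PREDSTEP = Some (Fun Nat (Fun Nat Nat))"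
  "tyc C MONSTEP = Some (Fun Nat (Fun Nat Nat))" "tyc C NATSTEP = Some (Fun Nat (Fun Real Real))"
  by (simp_all add: ADDSTEP_def PREDSTEP_def MONSTEP_def NATSTEP_def)

lemma tyw_steps [simp]: "tyw w ADDSTEP = Some (Fun Nat (Fun Nat Nat))" "tyw w PREDSTEP = Some (Fun Nat (Fun Nat Nat))"
  "tyw w MONSTEP = Some (Fun Nat (Fun Nat Nat))" "tyw w NATSTEP = Some (Fun Nat (Fun Real Real))"
  by (simp_all add: tyw_def)

lemma sub_arith [simp]: "sub \<rho> (addT s t) = addT (sub \<rho> s) (sub \<rho> t)" "sub \<rho> (predT t) = predT (sub \<rho> t)"
  "sub \<rho> (monT s t) = monT (sub \<rho> s) (sub \<rho> t)" "sub \<rho> (natT t) = natT (sub \<rho> t)"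
  by (simp_all add: addT_def predT_def monT_def natT_def)

lemma tyc_arith [simp]:
  "tyc C s = Some Nat \<Longrightarrow> tyc C t = Some Nat \<Longrightarrow> tyc C (addT s t) = Some Nat"
  "tyc C t = Some Nat \<Longrightarrow> tyc C (predT t) = Some Nat"
  "tyc C s = Some Nat \<Longrightarrow> tyc C t = Some Nat \<Longrightarrow> tyc C (monT s t) = Some Nat"
  "tyc C t = Some Nat \<Longrightarrow> tyc C (natT t) = Some Real"
  by (simp_all add: addT_def predT_def monT_def natT_def)

lemma tyw_arith [simp]:
  "tyw w s = Some Nat \<Longrightarrow> tyw w t = Some Nat \<Longrightarrow> tyw w (addT s t) = Some Nat"
  "tyw w t = Some Nat \<Longrightarrow> tyw w (predT t) = Some Nat"
  "tyw w s = Some Nat \<Longrightarrow> tyw w t = Some Nat \<Longrightarrow> tyw w (monT s t) = Some Nat"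
  "tyw w t = Some Nat \<Longrightarrow> tyw w (natT t) = Some Real"
  by (simp_all add: tyw_def)

lemma arith_btm: "(s +\<^sub>N t) d = addT (s d) (t d)" "predN t d = predT (t d)" "(s -\<^sub>N t) d = monT (s d) (t d)"
  "natR t d = natT (t d)"
  by (simp_all add: bdefs addT_def predT_def monT_def natT_def ADDSTEP_def PREDSTEP_def MONSTEP_def NATSTEP_def)

lemmas unfold_btm = bvar_def bcon_def bapp_def blam_def ball_def bex_def bimp_def bconj_def bdisj_def
  bnot_def biff_def beq_def bmem_def bless_def close_def arith_btm leN_def lessN_def

text \<open>At every world there are countably infinitely many classes of terms of type \<open>Nat\<close> and of type
  \<open>Real\<close> modulo provable equality, so fixed types can index them at all worlds at once. This turns
  provable equality into equality and avoids carrier sets.\<close>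

datatype nidx = NI nat
datatype ridx = RI nat

context consistent
begin

definition cls :: "world \<Rightarrow> ty \<Rightarrow> tm \<Rightarrow> tm set" where "cls w \<sigma> t = {s. Eq \<sigma> s t \<in> Th w}"
definition clss :: "world \<Rightarrow> ty \<Rightarrow> tm set set" where "clss w \<sigma> = cls w \<sigma> ` {t. tyw w t = Some \<sigma>}"

lemma cls_eq: "tyw w s = Some \<sigma> \<Longrightarrow> tyw w t = Some \<sigma> \<Longrightarrow> cls w \<sigma> s = cls w \<sigma> t \<longleftrightarrow> Eq \<sigma> s t \<in> Th w"
  using Eq_refl Eq_sym Eq_trans unfolding cls_def by blast

lemma countable_clss: "countable (clss w \<sigma>)"
  unfolding clss_def by simp

section \<open>There are infinitely many classes of numbers of either type\<close>

lemma forc_fun_axioms: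
  "forc w \<rho> (close (\<^bold>\<forall>\<^bsub>Nat\<^esub> \<lambda>n. \<^bold>\<not> (sucN n =\<^bsub>Nat\<^esub> 0\<^sub>N)))"
  "forc w \<rho> (close (\<^bold>\<forall>\<^bsub>Nat\<^esub> \<lambda>m. \<^bold>\<forall>\<^bsub>Nat\<^esub> \<lambda>n. sucN m =\<^bsub>Nat\<^esub> sucN n \<^bold>\<longrightarrow> m =\<^bsub>Nat\<^esub> n))"
  "forc w \<rho> (close (\<^bold>\<forall>\<^bsub>\<sigma>\<^esub> \<lambda>a. \<^bold>\<forall>\<^bsub>Fun Nat (Fun \<sigma> \<sigma>)\<^esub> \<lambda>g. recN \<sigma> a g 0\<^sub>N =\<^bsub>\<sigma>\<^esub> a))"
  "forc w \<rho> (close (\<^bold>\<forall>\<^bsub>\<sigma>\<^esub> \<lambda>a. \<^bold>\<forall>\<^bsub>Fun Nat (Fun \<sigma> \<sigma>)\<^esub> \<lambda>g. \<^bold>\<forall>\<^bsub>Nat\<^esub> \<lambda>n.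
    recN \<sigma> a g (sucN n) =\<^bsub>\<sigma>\<^esub> g \<cdot> n \<cdot> recN \<sigma> a g n))"
     apply (rule axiom_forc[OF axiom.suc_not_zero]; simp add: bdefs)
    apply (rule axiom_forc[OF axiom.suc_inj]; simp add: bdefs)
   apply (rule axiom_forc[OF axiom.rec_zero]; simp add: bdefs)
  apply (rule axiom_forc[OF axiom.rec_suc]; simp add: bdefs eval_nat_numeral)
  done

lemma suc_not_zero_Th: "tyw w t = Some Nat \<Longrightarrow> Eq Nat (S t) Z \<notin> Th w"
  using forc_fun_axioms(1)[of w Var] by (simp add: bdefs) (meson wle_refl)

lemma suc_inj_Th: "Eq Nat (S s) (S t) \<in> Th w \<Longrightarrow> tyw w s = Some Nat \<Longrightarrow> tyw w t = Some Nat \<Longrightarrow> Eq Nat s t \<in> Th w"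
  using forc_fun_axioms(2)[of w Var] by (simp add: bdefs) (meson wle_refl)

lemma rec_zero_Th: "tyw w a = Some \<sigma> \<Longrightarrow> tyw w g = Some (Fun Nat (Fun \<sigma> \<sigma>)) \<Longrightarrow>
   Eq \<sigma> (App (App (App (Con (CRec \<sigma>)) a) g) Z) a \<in> Th w"
  using forc_fun_axioms(3)[of w Var \<sigma>] by (simp add: bdefs) (meson wle_refl)

lemma rec_suc_Th: "tyw w a = Some \<sigma> \<Longrightarrow> tyw w g = Some (Fun Nat (Fun \<sigma> \<sigma>)) \<Longrightarrow> tyw w n = Some Nat \<Longrightarrow>
   Eq \<sigma> (App (App (App (Con (CRec \<sigma>)) a) g) (S n)) (App (App g n) (App (App (App (Con (CRec \<sigma>)) a) g) n)) \<in> Th w"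
  using forc_fun_axioms(4)[of w Var \<sigma>] by (simp add: bdefs) (meson wle_refl)

lemma infinite_clssI:
  fixes f :: "nat \<Rightarrow> tm"
  assumes "\<And>n. tyw w (f n) = Some \<sigma>" "\<And>m n. m < n \<Longrightarrow> Eq \<sigma> (f m) (f n) \<notin> Th w"
  shows "infinite (clss w \<sigma>)"
proof -
  have "inj (\<lambda>n::nat. cls w \<sigma> (f n))"
  proof (rule injI)
    fix m n assume "cls w \<sigma> (f m) = cls w \<sigma> (f n)"
    then have "Eq \<sigma> (f m) (f n) \<in> Th w" "Eq \<sigma> (f n) (f m) \<in> Th w" using cls_eq assms(1) Eq_sym by blast+
    then show "m = n" using assms(2) by (meson linorder_neqE_nat)
  qed
  then have "infinite (range (\<lambda>n::nat. cls w \<sigma> (f n)))" using range_inj_infinite by blast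
  moreover have "range (\<lambda>n::nat. cls w \<sigma> (f n)) \<subseteq> clss w \<sigma>" using assms(1) by (auto simp: clss_def)
  ultimately show ?thesis using finite_subset by blast
qed

lemma infinite_Nat: "infinite (clss w Nat)"
proof (rule infinite_clssI[where f="\<lambda>n. (S ^^ n) Z"])
  show t: "tyw w ((S ^^ n) Z) = Some Nat" for n by (induction n) auto
  show "Eq Nat ((S ^^ m) Z) ((S ^^ n) Z) \<notin> Th w" if "m < n" for m n using that
  proof (induction m arbitrary: n)
    case 0
    then obtain k where "n = Suc k" using gr0_conv_Suc by auto
    then show ?case using suc_not_zero_Th[OF t[of k]] Eq_sym[of Nat Z] by auto
  next
    case (Suc m)
    then obtain k where "n = Suc k" "m < k" by (metis Suc_less_eq2)
    then show ?case using suc_inj_Th[of "(S ^^ m) Z" "(S ^^ k) Z" w] t Suc.IH by auto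
  qed
qed

lemma real_axioms_fok: "p \<in> real_axioms \<Longrightarrow> fok (\<lambda>_. None) p"
  unfolding real_axioms_def by (auto simp: bdefs)

lemma real_axioms_forc: "p \<in> real_axioms \<Longrightarrow> forc w Var p"
  by (rule axiom_forc) (auto intro: axiom.real real_axioms_closed real_axioms_fok)

lemma real_axioms_mem: "x \<in> {
     \<^bold>\<forall>\<^bsub>Real\<^esub> \<lambda>x. \<^bold>\<forall>\<^bsub>Real\<^esub> \<lambda>y. \<^bold>\<forall>\<^bsub>Real\<^esub> \<lambda>z. (x +\<^sub>R y) +\<^sub>R z =\<^bsub>Real\<^esub> x +\<^sub>R (y +\<^sub>R z),
     \<^bold>\<forall>\<^bsub>Real\<^esub> \<lambda>x. \<^bold>\<forall>\<^bsub>Real\<^esub> \<lambda>y. x +\<^sub>R y =\<^bsub>Real\<^esub> y +\<^sub>R x,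
     \<^bold>\<forall>\<^bsub>Real\<^esub> \<lambda>x. 0\<^sub>R +\<^sub>R x =\<^bsub>Real\<^esub> x,
     \<^bold>\<forall>\<^bsub>Real\<^esub> \<lambda>x. x +\<^sub>R negR x =\<^bsub>Real\<^esub> 0\<^sub>R,
     \<^bold>\<forall>\<^bsub>Real\<^esub> \<lambda>x. \<^bold>\<forall>\<^bsub>Real\<^esub> \<lambda>y. \<^bold>\<forall>\<^bsub>Real\<^esub> \<lambda>z. (x *\<^sub>R y) *\<^sub>R z =\<^bsub>Real\<^esub> x *\<^sub>R (y *\<^sub>R z),
     \<^bold>\<forall>\<^bsub>Real\<^esub> \<lambda>x. \<^bold>\<forall>\<^bsub>Real\<^esub> \<lambda>y. x *\<^sub>R y =\<^bsub>Real\<^esub> y *\<^sub>R x,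
     \<^bold>\<forall>\<^bsub>Real\<^esub> \<lambda>x. 1\<^sub>R *\<^sub>R x =\<^bsub>Real\<^esub> x,
     \<^bold>\<forall>\<^bsub>Real\<^esub> \<lambda>x. \<^bold>\<forall>\<^bsub>Real\<^esub> \<lambda>y. \<^bold>\<forall>\<^bsub>Real\<^esub> \<lambda>z. x *\<^sub>R (y +\<^sub>R z) =\<^bsub>Real\<^esub> x *\<^sub>R y +\<^sub>R x *\<^sub>R z,
     \<^bold>\<forall>\<^bsub>Real\<^esub> \<lambda>x. x <\<^sub>R 0\<^sub>R \<^bold>\<or> 0\<^sub>R <\<^sub>R x \<^bold>\<longrightarrow> (\<^bold>\<exists>\<^bsub>Real\<^esub> \<lambda>y. x *\<^sub>R y =\<^bsub>Real\<^esub> 1\<^sub>R),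
     0\<^sub>R <\<^sub>R 1\<^sub>R,
     \<^bold>\<forall>\<^bsub>Real\<^esub> \<lambda>x. \<^bold>\<forall>\<^bsub>Real\<^esub> \<lambda>y. \<^bold>\<not> (x <\<^sub>R y \<^bold>\<and> y <\<^sub>R x),
     \<^bold>\<forall>\<^bsub>Real\<^esub> \<lambda>x. \<^bold>\<forall>\<^bsub>Real\<^esub> \<lambda>y. x <\<^sub>R y \<^bold>\<longrightarrow> (\<^bold>\<forall>\<^bsub>Real\<^esub> \<lambda>z. x <\<^sub>R z \<^bold>\<or> z <\<^sub>R y),
     \<^bold>\<forall>\<^bsub>Real\<^esub> \<lambda>x. \<^bold>\<forall>\<^bsub>Real\<^esub> \<lambda>y. \<^bold>\<not> (x <\<^sub>R y \<^bold>\<or> y <\<^sub>R x) \<^bold>\<longrightarrow> x =\<^bsub>Real\<^esub> y,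
     \<^bold>\<forall>\<^bsub>Real\<^esub> \<lambda>x. \<^bold>\<forall>\<^bsub>Real\<^esub> \<lambda>y. \<^bold>\<forall>\<^bsub>Real\<^esub> \<lambda>z. x <\<^sub>R y \<^bold>\<longrightarrow> x +\<^sub>R z <\<^sub>R y +\<^sub>R z,
     \<^bold>\<forall>\<^bsub>Real\<^esub> \<lambda>x. \<^bold>\<forall>\<^bsub>Real\<^esub> \<lambda>y. 0\<^sub>R <\<^sub>R x \<^bold>\<and> 0\<^sub>R <\<^sub>R y \<^bold>\<longrightarrow> 0\<^sub>R <\<^sub>R x *\<^sub>R y,
     \<^bold>\<forall>\<^bsub>Real\<^esub> \<lambda>x. \<^bold>\<forall>\<^bsub>Real\<^esub> \<lambda>y. absR x <\<^sub>R y \<^bold>\<longleftrightarrow> x <\<^sub>R y \<^bold>\<and> negR x <\<^sub>R y,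
     \<^bold>\<forall>\<^bsub>Real\<^esub> \<lambda>x. \<^bold>\<exists>\<^bsub>Nat\<^esub> \<lambda>n. x <\<^sub>R natR n} \<Longrightarrow> forc w Var (close x)"
  by (rule real_axioms_forc, unfold real_axioms_def, rule imageI) blast

lemma less_add_Th: "Less x y \<in> Th w \<Longrightarrow> tyw w z = Some Real \<Longrightarrow>
   Less (App (App (Con CRAdd) x) z) (App (App (Con CRAdd) y) z) \<in> Th w"
proof -
  assume a: "Less x y \<in> Th w" "tyw w z = Some Real"
  have "tyw w x = Some Real" "tyw w y = Some Real" using Th_fok[OF a(1)] by (simp_all add: tyw_def)
  moreover have "forc w Var (close (\<^bold>\<forall>\<^bsub>Real\<^esub> \<lambda>x. \<^bold>\<forall>\<^bsub>Real\<^esub> \<lambda>y. \<^bold>\<forall>\<^bsub>Real\<^esub> \<lambda>z. x <\<^sub>R y \<^bold>\<longrightarrow> x +\<^sub>R z <\<^sub>R y +\<^sub>R z))"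
    by (rule real_axioms_mem) blast
  ultimately show ?thesis using a by (simp add: unfold_btm) (meson wle_refl)
qed

lemma less_asym_Th: "Less x y \<in> Th w \<Longrightarrow> Less y x \<notin> Th w"
proof -
  assume a: "Less x y \<in> Th w"
  have "tyw w x = Some Real" "tyw w y = Some Real" using Th_fok[OF a(1)] by (simp_all add: tyw_def)
  moreover have "forc w Var (close (\<^bold>\<forall>\<^bsub>Real\<^esub> \<lambda>x. \<^bold>\<forall>\<^bsub>Real\<^esub> \<lambda>y. \<^bold>\<not> (x <\<^sub>R y \<^bold>\<and> y <\<^sub>R x)))"
    by (rule real_axioms_mem) blast
  ultimately show ?thesis using a by (simp add: unfold_btm) (meson wle_refl)
qed

lemma less_cotrans_Th: "Less x y \<in> Th w \<Longrightarrow> tyw w z = Some Real \<Longrightarrow> Less x z \<in> Th w \<or> Less z y \<in> Th w"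
proof -
  assume a: "Less x y \<in> Th w" "tyw w z = Some Real"
  have "tyw w x = Some Real" "tyw w y = Some Real" using Th_fok[OF a(1)] by (simp_all add: tyw_def)
  moreover have "forc w Var (close (\<^bold>\<forall>\<^bsub>Real\<^esub> \<lambda>x. \<^bold>\<forall>\<^bsub>Real\<^esub> \<lambda>y. x <\<^sub>R y \<^bold>\<longrightarrow> (\<^bold>\<forall>\<^bsub>Real\<^esub> \<lambda>z. x <\<^sub>R z \<^bold>\<or> z <\<^sub>R y)))"
    by (rule real_axioms_mem) blast
  ultimately show ?thesis using a by (simp add: unfold_btm) (meson wle_refl)
qed

text \<open>Comparing \<open>z\<close> with \<open>x < y\<close> leaves \<open>x < z\<close> or
  \<open>z < y\<close>, and the latter contradicts \<open>y < z\<close>.\<close>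

lemma less_trans_Th: "Less x y \<in> Th w \<Longrightarrow> Less y z \<in> Th w \<Longrightarrow> Less x z \<in> Th w"
proof -
  assume a: "Less x y \<in> Th w" "Less y z \<in> Th w"
  have "tyw w z = Some Real" using Th_fok[OF a(2)] by (simp add: tyw_def)
  with a show ?thesis using less_cotrans_Th less_asym_Th by blast
qed

lemma forc_subst_Less: "Eq Real s s' \<in> Th w \<Longrightarrow> Eq Real t t' \<in> Th w \<Longrightarrow> Less s t \<in> Th w \<Longrightarrow> Less s' t' \<in> Th w"
  using forc_Eq_subst[of Real s s' w "\<lambda>_. t" "Less (Var 0) (Var 1)"] forc_Eq_subst[of Real t t' w "\<lambda>_. s'" "Less (Var 1) (Var 0)"]
    Eq_ty[of Real s s' w] Eq_ty[of Real t t' w] by simp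

text \<open>The sums of ones increase strictly, so they are pairwise unequal.\<close>

lemma infinite_Real: "infinite (clss w Real)"
proof -
  let ?f = "\<lambda>n. ((\<lambda>t. App (App (Con CRAdd) t) (Con CROne)) ^^ n) (Con CRZero)"
  have t: "tyw w (?f n) = Some Real" for n by (induction n) auto
  have z1: "Less (Con CRZero) (Con CROne) \<in> Th w"
    using real_axioms_mem[of "0\<^sub>R <\<^sub>R 1\<^sub>R" w] by (simp add: unfold_btm)
  have zr: "Eq Real (App (App (Con CRAdd) (Con CRZero)) x) x \<in> Th w" if "tyw w x = Some Real" for x
  proof -
    have "forc w Var (close (\<^bold>\<forall>\<^bsub>Real\<^esub> \<lambda>x. 0\<^sub>R +\<^sub>R x =\<^bsub>Real\<^esub> x))" by (rule real_axioms_mem) blast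
    then show ?thesis using that by (simp add: unfold_btm)
  qed
  have s: "Less (?f n) (?f (Suc n)) \<in> Th w" for n
  proof (induction n)
    case 0
    show ?case using forc_subst_Less[OF Eq_refl Eq_sym[OF zr[of "Con CROne"]] z1] by simp
  next
    case (Suc n)
    then show ?case using less_add_Th by simp
  qed
  have l: "Less (?f m) (?f n) \<in> Th w" if "m < n" for m n
    using that s less_trans_Th by (induction rule: less_Suc_induct) blast+
  show ?thesis
  proof (rule infinite_clssI[where f="?f"])
    show "Eq Real (?f m) (?f n) \<notin> Th w" if "m < n" for m n
      using l[OF that] less_asym_Th forc_subst_Less Eq_refl[OF t] by blast
  qed (rule t)
qed

text \<open>On an infinite countable set \<open>to_nat_on\<close> is a bijection, so every number is
  the index of some class.\<close>

definition idx :: "world \<Rightarrow> ty \<Rightarrow> tm \<Rightarrow> nat" where "idx w \<sigma> t = to_nat_on (clss w \<sigma>) (cls w \<sigma> t)"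

lemma idx_eq: "infinite (clss w \<sigma>) \<Longrightarrow> tyw w s = Some \<sigma> \<Longrightarrow> tyw w t = Some \<sigma> \<Longrightarrow> idx w \<sigma> s = idx w \<sigma> t \<longleftrightarrow> Eq \<sigma> s t \<in> Th w"
  unfolding idx_def using cls_eq countable_clss
  by (metis (mono_tags, lifting) clss_def imageI mem_Collect_eq to_nat_on_inj)

lemma idx_surj: "infinite (clss w \<sigma>) \<Longrightarrow> \<exists>t. tyw w t = Some \<sigma> \<and> idx w \<sigma> t = i"
proof -
  assume "infinite (clss w \<sigma>)"
  then have "bij_betw (to_nat_on (clss w \<sigma>)) (clss w \<sigma>) UNIV" using countable_clss to_nat_on_infinite by blast
  then obtain c where "c \<in> clss w \<sigma>" "to_nat_on (clss w \<sigma>) c = i" by (metis UNIV_I bij_betw_imp_surj_on imageE)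
  then show ?thesis by (auto simp: clss_def idx_def)
qed

definition nval :: "world \<Rightarrow> tm \<Rightarrow> nidx" where "nval w t = NI (idx w Nat t)"
definition rval :: "world \<Rightarrow> tm \<Rightarrow> ridx" where "rval w t = RI (idx w Real t)"
text \<open>An index has no meaning across worlds: the same \<open>x\<close> may name unrelated
  classes at \<open>w\<close> and at a later \<open>w'\<close>. A value is transported through its
  representative, as \<open>nval w' (nrep w x)\<close>.\<close>

definition nrep :: "world \<Rightarrow> nidx \<Rightarrow> tm" where "nrep w x = (SOME t. tyw w t = Some Nat \<and> nval w t = x)"
definition rrep :: "world \<Rightarrow> ridx \<Rightarrow> tm" where "rrep w x = (SOME t. tyw w t = Some Real \<and> rval w t = x)"

lemma nval_surj: "\<exists>t. tyw w t = Some Nat \<and> nval w t = x"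
  using idx_surj[OF infinite_Nat] by (cases x) (simp add: nval_def)
lemma rval_surj: "\<exists>t. tyw w t = Some Real \<and> rval w t = x"
  using idx_surj[OF infinite_Real] by (cases x) (simp add: rval_def)

lemma nrep [simp]: "tyw w (nrep w x) = Some Nat" "nval w (nrep w x) = x"
  using someI_ex[OF nval_surj[of w x]] by (simp_all add: nrep_def)
lemma rrep [simp]: "tyw w (rrep w x) = Some Real" "rval w (rrep w x) = x"
  using someI_ex[OF rval_surj[of w x]] by (simp_all add: rrep_def)

lemma rep_mono [simp]: "w \<sqsubseteq> w' \<Longrightarrow> tyw w' (nrep w x) = Some Nat" "w \<sqsubseteq> w' \<Longrightarrow> tyw w' (rrep w y) = Some Real"
  using tyw_mono[of w "nrep w x"] tyw_mono[of w "rrep w y"] by simp_all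

lemma Eq_nval [simp]: "tyw w s = Some Nat \<Longrightarrow> tyw w t = Some Nat \<Longrightarrow> Eq Nat s t \<in> Th w \<longleftrightarrow> nval w s = nval w t"
  using idx_eq[OF infinite_Nat] by (simp add: nval_def)
lemma Eq_rval [simp]: "tyw w s = Some Real \<Longrightarrow> tyw w t = Some Real \<Longrightarrow> Eq Real s t \<in> Th w \<longleftrightarrow> rval w s = rval w t"
  using idx_eq[OF infinite_Real] by (simp add: rval_def)

lemma nval_eqI: "Eq Nat s t \<in> Th w \<Longrightarrow> nval w s = nval w t"
  using Eq_nval Eq_ty by blast
lemma rval_eqI: "Eq Real s t \<in> Th w \<Longrightarrow> rval w s = rval w t"
  using Eq_rval Eq_ty by blast
lemma nval_mono: "nval w s = nval w t \<Longrightarrow> w \<sqsubseteq> w' \<Longrightarrow> tyw w s = Some Nat \<Longrightarrow> tyw w t = Some Nat \<Longrightarrow> nval w' s = nval w' t"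
  by (rule nval_eqI) (auto simp: wle_def simp flip: Eq_nval)
lemma rval_mono: "rval w s = rval w t \<Longrightarrow> w \<sqsubseteq> w' \<Longrightarrow> tyw w s = Some Real \<Longrightarrow> tyw w t = Some Real \<Longrightarrow> rval w' s = rval w' t"
  by (rule rval_eqI) (auto simp: wle_def simp flip: Eq_rval)

section \<open>Function terms as maps on values\<close>

lemma ex_nval: "(\<exists>t. tyw w t = Some Nat \<and> P (nval w t)) \<longleftrightarrow> (\<exists>x. P x)"
  by (metis nrep)
definition fnn :: "world \<Rightarrow> tm \<Rightarrow> nidx \<Rightarrow> nidx" where "fnn w f x = nval w (App f (nrep w x))"
definition fnr :: "world \<Rightarrow> tm \<Rightarrow> nidx \<Rightarrow> ridx" where "fnr w f x = rval w (App f (nrep w x))"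
definition fnnn :: "world \<Rightarrow> tm \<Rightarrow> nidx \<Rightarrow> nidx \<Rightarrow> nidx" where
  "fnnn w f x y = nval w (App (App f (nrep w x)) (nrep w y))"
definition fnrr :: "world \<Rightarrow> tm \<Rightarrow> nidx \<Rightarrow> ridx \<Rightarrow> ridx" where
  "fnrr w f x y = rval w (App (App f (nrep w x)) (rrep w y))"
definition frr :: "world \<Rightarrow> tm \<Rightarrow> ridx \<Rightarrow> ridx" where "frr w f x = rval w (App f (rrep w x))"
definition frrr :: "world \<Rightarrow> tm \<Rightarrow> ridx \<Rightarrow> ridx \<Rightarrow> ridx" where
  "frrr w f x y = rval w (App (App f (rrep w x)) (rrep w y))"

lemma nval_App [simp]: "tyw w f = Some (Fun Nat Nat) \<Longrightarrow> tyw w t = Some Nat \<Longrightarrow> nval w (App f t) = fnn w f (nval w t)"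
  unfolding fnn_def by (rule nval_eqI, rule Eq_App[where \<sigma>=Nat]) (simp_all add: Eq_refl)
lemma rval_App [simp]: "tyw w f = Some (Fun Nat Real) \<Longrightarrow> tyw w t = Some Nat \<Longrightarrow> rval w (App f t) = fnr w f (nval w t)"
  unfolding fnr_def by (rule rval_eqI, rule Eq_App[where \<sigma>=Nat]) (simp_all add: Eq_refl)
lemma fnn_App [simp]: "tyw w f = Some (Fun Nat (Fun Nat Nat)) \<Longrightarrow> tyw w t = Some Nat \<Longrightarrow> fnn w (App f t) y = fnnn w f (nval w t) y"
  unfolding fnn_def fnnn_def by (rule nval_eqI, rule Eq_App[where \<sigma>=Nat], rule Eq_App[where \<sigma>=Nat]) (simp_all add: Eq_refl)
lemma rval_App_rr [simp]: "tyw w f = Some (Fun Real Real) \<Longrightarrow> tyw w t = Some Real \<Longrightarrow> rval w (App f t) = frr w f (rval w t)"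
  unfolding frr_def by (rule rval_eqI, rule Eq_App[where \<sigma>=Real]) (simp_all add: Eq_refl)
lemma frr_App_n [simp]: "tyw w f = Some (Fun Nat (Fun Real Real)) \<Longrightarrow> tyw w s = Some Nat \<Longrightarrow>
   frr w (App f s) y = fnrr w f (nval w s) y"
  unfolding fnrr_def frr_def by (rule rval_eqI, rule Eq_App[where \<sigma>=Real], rule Eq_App[where \<sigma>=Nat]) (simp_all add: Eq_refl)
lemma frr_App_r [simp]: "tyw w f = Some (Fun Real (Fun Real Real)) \<Longrightarrow> tyw w s = Some Real \<Longrightarrow>
   frr w (App f s) y = frrr w f (rval w s) y"
  unfolding frrr_def frr_def by (rule rval_eqI, rule Eq_App[where \<sigma>=Real], rule Eq_App[where \<sigma>=Real]) (simp_all add: Eq_refl)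

lemma fnn_beta [simp]: "tyc (econs (Some Nat) (\<lambda>i. tyw w (\<rho> i))) b = Some Nat \<Longrightarrow>
   fnn w (sub \<rho> (Lam Nat b)) x = nval w (sub (econs (nrep w x) \<rho>) b)"
  unfolding fnn_def by (intro nval_eqI Eq_beta nrep)
lemma fnr_beta [simp]: "tyc (econs (Some Nat) (\<lambda>i. tyw w (\<rho> i))) b = Some Real \<Longrightarrow>
   fnr w (sub \<rho> (Lam Nat b)) x = rval w (sub (econs (nrep w x) \<rho>) b)"
  unfolding fnr_def by (intro rval_eqI Eq_beta nrep)

lemma Eq_beta2:
  assumes "tyc (econs (Some \<sigma>') (econs (Some \<sigma>) (\<lambda>i. tyw w (\<rho> i)))) b = Some \<tau>" "tyw w s = Some \<sigma>" "tyw w s' = Some \<sigma>'"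
  shows "Eq \<tau> (App (App (sub \<rho> (Lam \<sigma> (Lam \<sigma>' b))) s) s') (sub (econs s' (econs s \<rho>)) b) \<in> Th w"
proof -
  have "Eq (Fun \<sigma>' \<tau>) (App (sub \<rho> (Lam \<sigma> (Lam \<sigma>' b))) s) (sub (econs s \<rho>) (Lam \<sigma>' b)) \<in> Th w"
    by (rule Eq_beta) (use assms in auto)
  then have "Eq \<tau> (App (App (sub \<rho> (Lam \<sigma> (Lam \<sigma>' b))) s) s') (App (sub (econs s \<rho>) (Lam \<sigma>' b)) s') \<in> Th w"
    by (rule Eq_App) (use assms Eq_refl in auto)
  moreover have "Eq \<tau> (App (sub (econs s \<rho>) (Lam \<sigma>' b)) s') (sub (econs s' (econs s \<rho>)) b) \<in> Th w"
    by (rule Eq_beta) (use assms in auto)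
  ultimately show ?thesis by (rule Eq_trans)
qed

lemma fnnn_beta [simp]: "tyc (econs (Some Nat) (econs (Some Nat) (\<lambda>i. tyw w (\<rho> i)))) b = Some Nat \<Longrightarrow>
   fnnn w (sub \<rho> (Lam Nat (Lam Nat b))) x y = nval w (sub (econs (nrep w y) (econs (nrep w x) \<rho>)) b)"
  unfolding fnnn_def by (intro nval_eqI Eq_beta2 nrep)
lemma fnrr_beta [simp]: "tyc (econs (Some Real) (econs (Some Nat) (\<lambda>i. tyw w (\<rho> i)))) b = Some Real \<Longrightarrow>
   fnrr w (sub \<rho> (Lam Nat (Lam Real b))) x y = rval w (sub (econs (rrep w y) (econs (nrep w x) \<rho>)) b)"
  unfolding fnrr_def by (intro rval_eqI Eq_beta2 nrep rrep)

section \<open>Recursion equations of arithmetic on values\<close>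

definition nzero :: "world \<Rightarrow> nidx" where "nzero w = nval w Z"
definition nsuc :: "world \<Rightarrow> nidx \<Rightarrow> nidx" where "nsuc w = fnn w (Con CSuc)"
definition nadd :: "world \<Rightarrow> nidx \<Rightarrow> nidx \<Rightarrow> nidx" where "nadd w x y = nval w (addT (nrep w x) (nrep w y))"
definition npred :: "world \<Rightarrow> nidx \<Rightarrow> nidx" where "npred w x = nval w (predT (nrep w x))"
definition nmon :: "world \<Rightarrow> nidx \<Rightarrow> nidx \<Rightarrow> nidx" where "nmon w x y = nval w (monT (nrep w x) (nrep w y))"

lemma nval_Z [simp]: "nval w Z = nzero w" by (simp add: nzero_def)
lemma fnn_Suc [simp]: "fnn w (Con CSuc) = nsuc w" by (simp add: nsuc_def)

lemma nval_addT [simp]: "tyw w s = Some Nat \<Longrightarrow> tyw w t = Some Nat \<Longrightarrow> nval w (addT s t) = nadd w (nval w s) (nval w t)"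
  unfolding nadd_def addT_def by (rule nval_eqI, rule Eq_App[where \<sigma>=Nat], rule Eq_App[where \<sigma>="Fun Nat (Fun Nat Nat)"], rule Eq_App[where \<sigma>=Nat]) (simp_all add: Eq_refl)
lemma nval_monT [simp]: "tyw w s = Some Nat \<Longrightarrow> tyw w t = Some Nat \<Longrightarrow> nval w (monT s t) = nmon w (nval w s) (nval w t)"
  unfolding nmon_def monT_def by (rule nval_eqI, rule Eq_App[where \<sigma>=Nat], rule Eq_App[where \<sigma>="Fun Nat (Fun Nat Nat)"], rule Eq_App[where \<sigma>=Nat]) (simp_all add: Eq_refl)
lemma nval_predT [simp]: "tyw w t = Some Nat \<Longrightarrow> nval w (predT t) = npred w (nval w t)"
  unfolding npred_def predT_def by (rule nval_eqI, rule Eq_App[where \<sigma>=Nat], rule Eq_App[where \<sigma>="Fun Nat (Fun Nat Nat)"], rule Eq_App[where \<sigma>=Nat]) (simp_all add: Eq_refl)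

lemma nval_rec0 [simp]: "tyw w a = Some Nat \<Longrightarrow> tyw w g = Some (Fun Nat (Fun Nat Nat)) \<Longrightarrow>
   fnn w (App (App (Con (CRec Nat)) a) g) (nzero w) = nval w a"
  using rec_zero_Th[of w a Nat g] by simp
lemma nval_recS [simp]: "tyw w a = Some Nat \<Longrightarrow> tyw w g = Some (Fun Nat (Fun Nat Nat)) \<Longrightarrow>
   fnn w (App (App (Con (CRec Nat)) a) g) (nsuc w x) = fnnn w g x (fnn w (App (App (Con (CRec Nat)) a) g) x)"
  using rec_suc_Th[of w a Nat g "nrep w x"] by simp
lemma rval_rec0 [simp]: "tyw w a = Some Real \<Longrightarrow> tyw w g = Some (Fun Nat (Fun Real Real)) \<Longrightarrow>
   fnr w (App (App (Con (CRec Real)) a) g) (nzero w) = rval w a"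
  using rec_zero_Th[of w a Real g] by simp
lemma rval_recS [simp]: "tyw w a = Some Real \<Longrightarrow> tyw w g = Some (Fun Nat (Fun Real Real)) \<Longrightarrow>
   fnr w (App (App (Con (CRec Real)) a) g) (nsuc w x) = fnrr w g x (fnr w (App (App (Con (CRec Real)) a) g) x)"
  using rec_suc_Th[of w a Real g "nrep w x"] by simp

lemma step_values [simp]: "fnnn w ADDSTEP x y = nsuc w y" "fnnn w PREDSTEP x y = x" "fnnn w MONSTEP x y = npred w y"
proof -
  show "fnnn w ADDSTEP x y = nsuc w y" "fnnn w PREDSTEP x y = x"
    using fnnn_beta[of w Var "S (Var 0)" x y] fnnn_beta[of w Var "Var 1" x y] by (simp_all add: ADDSTEP_def PREDSTEP_def)
  have "MONSTEP = sub Var (Lam Nat (Lam Nat (predT (Var 0))))" by (simp add: MONSTEP_def predT_def)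
  then show "fnnn w MONSTEP x y = npred w y" using fnnn_beta[of w Var "predT (Var 0)" x y] by simp
qed

lemma nadd_rec [simp]: "nadd w x (nzero w) = x" "nadd w x (nsuc w y) = nsuc w (nadd w x y)"
proof -
  have *: "nadd w x y = fnn w (App (App (Con (CRec Nat)) (nrep w x)) ADDSTEP) y" for y
    using nval_addT[of w "nrep w x" "nrep w y"] by (simp add: addT_def)
  show "nadd w x (nzero w) = x" "nadd w x (nsuc w y) = nsuc w (nadd w x y)" by (simp_all add: *)
qed

lemma npred_rec [simp]: "npred w (nzero w) = nzero w" "npred w (nsuc w y) = y"
proof -
  have *: "npred w y = fnn w (App (App (Con (CRec Nat)) Z) PREDSTEP) y" for y
    using nval_predT[of w "nrep w y"] by (simp add: predT_def)
  show "npred w (nzero w) = nzero w" "npred w (nsuc w y) = y" by (simp_all add: *)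
qed

lemma nmon_rec [simp]: "nmon w x (nzero w) = x" "nmon w x (nsuc w y) = npred w (nmon w x y)"
proof -
  have *: "nmon w x y = fnn w (App (App (Con (CRec Nat)) (nrep w x)) MONSTEP) y" for y
    using nval_monT[of w "nrep w x" "nrep w y"] by (simp add: monT_def)
  show "nmon w x (nzero w) = x" "nmon w x (nsuc w y) = npred w (nmon w x y)" by (simp_all add: *)
qed

end

section \<open>Arithmetic of the natural numbers at a world\<close>

context consistent
begin

lemma nsuc_inj [simp]: "nsuc w x = nsuc w y \<longleftrightarrow> x = y"
  using suc_inj_Th[of "nrep w x" "nrep w y" w] by auto

lemma nsuc_not_zero [simp]: "nsuc w x \<noteq> nzero w" "nzero w \<noteq> nsuc w x"
  using suc_not_zero_Th[of w "nrep w x"] by auto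

lemma nzero_nadd [simp]: "nadd w (nzero w) x = x"
proof -
  have "forc w (econs (nrep w x) (\<lambda>_. Z)) (Eq Nat (addT Z (Var 0)) (Var 0))"
    by (rule forc_induct) simp_all
  then show ?thesis by simp
qed

lemma nsuc_nadd [simp]: "nadd w (nsuc w y) x = nsuc w (nadd w y x)"
proof -
  have "forc w (econs (nrep w x) (\<lambda>_. nrep w y)) (Eq Nat (addT (S (Var 1)) (Var 0)) (S (addT (Var 1) (Var 0))))"
    by (rule forc_induct) simp_all
  then show ?thesis by simp
qed

lemma nadd_comm: "nadd w x y = nadd w y x"
proof -
  have "forc w (econs (nrep w x) (\<lambda>_. nrep w y)) (Eq Nat (addT (Var 1) (Var 0)) (addT (Var 0) (Var 1)))"
    by (rule forc_induct) simp_all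
  then show ?thesis by simp
qed

lemma nadd_assoc: "nadd w (nadd w x y) z = nadd w x (nadd w y z)"
proof -
  have "forc w (econs (nrep w z) (econs (nrep w y) (\<lambda>_. nrep w x)))
     (Eq Nat (addT (addT (Var 2) (Var 1)) (Var 0)) (addT (Var 2) (addT (Var 1) (Var 0))))"
    by (rule forc_induct) simp_all
  then show ?thesis by simp
qed

lemma nzero_nmon [simp]: "nmon w (nzero w) x = nzero w"
proof -
  have "forc w (econs (nrep w x) (\<lambda>_. Z)) (Eq Nat (monT Z (Var 0)) Z)"
    by (rule forc_induct) simp_all
  then show ?thesis by simp
qed

lemma nmon_nsuc_nsuc: "nmon w (nsuc w y) (nsuc w x) = nmon w y x"
proof -
  have "forc w (econs (nrep w x) (\<lambda>_. nrep w y)) (Eq Nat (monT (S (Var 1)) (S (Var 0))) (monT (Var 1) (Var 0)))"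
    by (rule forc_induct) simp_all
  then show ?thesis by simp
qed

lemma nadd_nmon [simp]: "nmon w (nadd w x y) y = x"
proof -
  have "forc w (econs (nrep w y) (\<lambda>_. nrep w x)) (Eq Nat (monT (addT (Var 1) (Var 0)) (Var 0)) (Var 1))"
    by (rule forc_induct) (simp_all add: nmon_nsuc_nsuc del: nmon_rec(2))
  then show ?thesis by simp
qed

lemma nadd_nmon' [simp]: "nmon w (nadd w y x) y = x"
  by (metis nadd_nmon nadd_comm)

lemma nadd_cancel [simp]: "nadd w x z = nadd w y z \<longleftrightarrow> x = y" "nadd w z x = nadd w z y \<longleftrightarrow> x = y"
  by (metis nadd_nmon) (metis nadd_nmon')

text \<open>Induction proves the disjunction inside the theory, and a world forces a disjunction
  only by forcing one side of it. Comparability in \<open>nle_total'\<close> is obtained in the same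
  way.\<close>

lemma nidx_cases: "x = nzero w \<or> (\<exists>y. x = nsuc w y)"
proof -
  have "forc w (econs (nrep w x) (\<lambda>_. Z)) (Disj (Eq Nat (Var 0) Z) (Exists Nat (Eq Nat (Var 1) (S (Var 0)))))"
    by (rule forc_induct) (auto intro: nrep)
  then show ?thesis by auto
qed

section \<open>The order of the natural numbers\<close>

definition nle :: "world \<Rightarrow> nidx \<Rightarrow> nidx \<Rightarrow> bool" where "nle w x y \<longleftrightarrow> (\<exists>k. nadd w x k = y)"
definition nless :: "world \<Rightarrow> nidx \<Rightarrow> nidx \<Rightarrow> bool" where "nless w x y \<longleftrightarrow> nle w (nsuc w x) y"

lemma forc_nle [simp]: "tyw w s = Some Nat \<Longrightarrow> tyw w u = Some Nat \<Longrightarrow>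
    (\<exists>t. tyw w t = Some Nat \<and> Eq Nat (addT s t) u \<in> Th w) \<longleftrightarrow> nle w (nval w s) (nval w u)"
  using ex_nval[of w "\<lambda>k. nadd w (nval w s) k = nval w u"] by (auto simp: nle_def)

lemma nle_total': "nle w x y \<or> (\<exists>k. nadd w y (nsuc w k) = x)"
proof -
  have "forc w (econs (nrep w y) (\<lambda>_. nrep w x)) (Disj (Exists Nat (Eq Nat (addT (Var 2) (Var 0)) (Var 1)))
     (Exists Nat (Eq Nat (addT (Var 1) (S (Var 0))) (Var 2))))"
  proof (rule forc_induct)
    show "forc w (econs Z (\<lambda>_. nrep w x)) (Disj (Exists Nat (Eq Nat (addT (Var 2) (Var 0)) (Var 1)))
     (Exists Nat (Eq Nat (addT (Var 1) (S (Var 0))) (Var 2))))"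
    proof (cases "x = nzero w")
      case True
      then have "\<exists>t. tyw w t = Some Nat \<and> nadd w x (nval w t) = nzero w" by (intro exI[of _ Z]) simp
      then show ?thesis using True by (auto simp: nle_def)
    next
      case False
      then obtain z where "x = nsuc w z" using nidx_cases by blast
      then have "\<exists>t. tyw w t = Some Nat \<and> nsuc w (nval w t) = x" by (intro exI[of _ "nrep w z"]) simp
      then show ?thesis by auto
    qed
    fix w' t assume a: "w \<sqsubseteq> w'" "tyw w' t = Some Nat"
      "forc w' (econs t (\<lambda>_. nrep w x)) (Disj (Exists Nat (Eq Nat (addT (Var 2) (Var 0)) (Var 1)))
     (Exists Nat (Eq Nat (addT (Var 1) (S (Var 0))) (Var 2))))"
    let ?x = "nval w' (nrep w x)"
    from a(3) consider k where "nadd w' ?x k = nval w' t" | k where "nadd w' (nval w' t) (nsuc w' k) = ?x"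
      using a by (auto simp: nle_def)
    then have "(\<exists>k. nadd w' ?x k = nsuc w' (nval w' t)) \<or> (\<exists>k. nadd w' (nsuc w' (nval w' t)) (nsuc w' k) = ?x)"
    proof cases
      case (1 k)
      then show ?thesis by (metis nadd_rec(2))
    next
      case (2 k)
      then show ?thesis using nidx_cases[of k w'] by (metis nadd_rec nsuc_nadd)
    qed
    then have "(\<exists>s. tyw w' s = Some Nat \<and> nadd w' ?x (nval w' s) = nsuc w' (nval w' t))
      \<or> (\<exists>s. tyw w' s = Some Nat \<and> nadd w' (nsuc w' (nval w' t)) (nsuc w' (nval w' s)) = ?x)"
      unfolding ex_nval[where P="\<lambda>k. nadd w' ?x k = nsuc w' (nval w' t)"]
        ex_nval[where P="\<lambda>k. nadd w' (nsuc w' (nval w' t)) (nsuc w' k) = ?x"] .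
    then show "forc w' (econs (S t) (\<lambda>_. nrep w x)) (Disj (Exists Nat (Eq Nat (addT (Var 2) (Var 0)) (Var 1)))
     (Exists Nat (Eq Nat (addT (Var 1) (S (Var 0))) (Var 2))))" using a(1,2) by (auto simp: nle_def)
  qed simp_all
  then show ?thesis by (auto simp: nle_def)
qed

lemma nless_alt: "nless w x y \<longleftrightarrow> (\<exists>k. nadd w x (nsuc w k) = y)"
  by (simp add: nless_def nle_def)

lemma nle_total: "nle w x y \<or> nless w y x"
  using nle_total' nless_alt by blast

lemma nadd_eq_self: "nadd w x k = x \<longleftrightarrow> k = nzero w"
  by (metis nadd_cancel(2) nadd_rec(1))

lemma nadd_eq_0: "nadd w x k = nzero w \<longleftrightarrow> x = nzero w \<and> k = nzero w"
  by (metis nadd_rec nidx_cases nsuc_not_zero(1))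

sublocale N: linorder "nle w" "nless w" for w
proof
  fix x y z
  show r: "nle w x x" for x unfolding nle_def using nadd_rec(1) by blast
  show t: "nle w x z" if "nle w x y" "nle w y z" for x y z using that unfolding nle_def by (metis nadd_assoc)
  show as: "x = y" if "nle w x y" "nle w y x" for x y
    using that unfolding nle_def by (metis nadd_assoc nadd_eq_self nadd_eq_0)
  have ns: "\<not> nle w (nsuc w x) x" for x
    by (metis nadd_rec nadd_eq_self nle_def nsuc_nadd nsuc_not_zero(1))
  have ls: "nle w x (nsuc w x)" for x unfolding nle_def by (metis nadd_rec)
  show "nless w x y \<longleftrightarrow> nle w x y \<and> \<not> nle w y x"
    using nle_total[of w y x] ns t ls unfolding nless_def by blast
  show "nle w x y \<or> nle w y x" using nle_total[of w x y] ls t unfolding nless_def by blast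
qed

lemma nle_nzero [simp]: "nle w (nzero w) x" by (simp add: nle_def)
lemma nle_nzero_iff [simp]: "nle w x (nzero w) \<longleftrightarrow> x = nzero w"
  using N.order_antisym nle_nzero N.order_refl by metis
lemma nless_nzero [simp]: "\<not> nless w x (nzero w)"
  using nle_nzero N.not_le by blast
lemma nle_nsuc_nsuc [simp]: "nle w (nsuc w x) (nsuc w y) \<longleftrightarrow> nle w x y" by (simp add: nle_def)
lemma nless_nsuc_nsuc [simp]: "nless w (nsuc w x) (nsuc w y) \<longleftrightarrow> nless w x y" by (simp add: nless_def)
lemma nless_nsuc_iff: "nless w x (nsuc w y) \<longleftrightarrow> nle w x y" by (simp add: nless_def)
lemma nsuc_nle_iff: "nle w (nsuc w x) y \<longleftrightarrow> nless w x y" by (simp add: nless_def)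
lemma nless_nsuc [simp]: "nless w x (nsuc w x)" by (simp add: nless_nsuc_iff)
lemma nle_nsuc [simp]: "nle w x (nsuc w x)" by (simp add: N.less_imp_le)
lemma nzero_nless: "nless w (nzero w) x \<longleftrightarrow> x \<noteq> nzero w" using N.not_le nle_nzero_iff by blast
lemma nle_nadd [simp]: "nle w x (nadd w x y)" "nle w y (nadd w x y)"
  unfolding nle_def using nadd_comm by blast+
lemma nle_nadd_cancel [simp]: "nle w (nadd w x y) (nadd w x z) \<longleftrightarrow> nle w y z" "nle w (nadd w y x) (nadd w z x) \<longleftrightarrow> nle w y z"
  by (auto simp: nle_def nadd_assoc) (metis nadd_assoc nadd_comm nadd_cancel(1))+
lemma nmon_eq_0 [simp]: "nmon w x y = nzero w \<longleftrightarrow> nle w x y"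
proof
  assume a: "nmon w x y = nzero w"
  show "nle w x y"
  proof (rule ccontr)
    assume "\<not> nle w x y"
    then obtain k where "x = nadd w y (nsuc w k)" using nle_total'[of w x y] by auto
    with a have "nsuc w k = nzero w" using nadd_nmon' by metis
    then show False by simp
  qed
next
  assume "nle w x y"
  then obtain k where y: "y = nadd w x k" by (auto simp: nle_def)
  have "forc w (econs (nrep w k) (\<lambda>_. nrep w x)) (Eq Nat (monT (Var 1) (addT (Var 1) (Var 0))) Z)"
  proof (rule forc_induct)
    have "nmon w (nadd w x (nzero w)) x = nzero w" for w x by (metis nadd_nmon')
    then have *: "nmon w x x = nzero w" for w x by simp
    then show "forc w (econs Z (\<lambda>_. nrep w x)) (Eq Nat (monT (Var 1) (addT (Var 1) (Var 0))) Z)" by simp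
  qed simp_all
  with y show "nmon w x y = nzero w" by simp
qed

lemma nadd_nmon_le [simp]: "nle w x y \<Longrightarrow> nadd w y (nmon w x y) = y"
  by (metis nmon_eq_0 nadd_rec(1))

lemma nmon_nadd: "nle w y x \<Longrightarrow> nadd w y (nmon w x y) = x"
  by (auto simp: nle_def)

text \<open>For a decidable predicate, induction is sound at a single world: provably, either the predicate
  holds or there is a failing step, and in the second case the world itself contains that step.\<close>

lemma decidable_induct:
  assumes f: "tyw w f = Some (Fun Nat Nat)" and 0: "fnn w f (nzero w) = nzero w"
    and S: "\<And>x. fnn w f x = nzero w \<Longrightarrow> fnn w f (nsuc w x) = nzero w"
  shows "fnn w f x = nzero w"
proof -
  let ?p = "Disj (Eq Nat (App (Var 1) (Var 0)) Z)
     (Exists Nat (Exists Nat (Conj (Eq Nat (App (Var 3) (Var 1)) Z) (Eq Nat (App (Var 3) (S (Var 1))) (S (Var 0))))))"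
  have "forc w (econs (nrep w x) (\<lambda>_. f)) ?p"
  proof (rule forc_induct)
    show "forc w (econs Z (\<lambda>_. f)) ?p" using f 0 by simp
    fix w' t assume a: "w \<sqsubseteq> w'" "tyw w' t = Some Nat" "forc w' (econs t (\<lambda>_. f)) ?p"
    have f': "tyw w' f = Some (Fun Nat Nat)" using f a(1) tyw_mono by blast
    show "forc w' (econs (S t) (\<lambda>_. f)) ?p"
    proof (cases "fnn w' f (nsuc w' (nval w' t)) = nzero w'")
      case True then show ?thesis using a(2) f' by simp
    next
      case False
      then obtain k where k: "fnn w' f (nsuc w' (nval w' t)) = nsuc w' k" using nidx_cases by blast
      from a(3) show ?thesis
      proof (subst (asm) forc.simps(6), elim disjE)
        assume "forc w' (econs t (\<lambda>_. f)) (Eq Nat (App (Var 1) (Var 0)) Z)"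
        then have "\<exists>s. tyw w' s = Some Nat \<and> (\<exists>u. tyw w' u = Some Nat \<and> fnn w' f (nval w' s) = nzero w' \<and>
            fnn w' f (nsuc w' (nval w' s)) = nsuc w' (nval w' u))"
          using k a(2) f' by (intro exI[of _ t]) (auto intro!: exI[of _ "nrep w' k"])
        then show ?thesis using f' by auto
      qed auto
    qed
  qed (use f in simp_all)
  then show ?thesis using f S by (auto split: if_splits)
qed

section \<open>Definable functions and decidable predicates at a world\<close>

text \<open>\<open>decidable_induct\<close> needs its predicate as the zero set of a function term
  at \<open>w\<close>. The closure rules that follow assemble this term, so that proofs only have to
  chain introduction rules.\<close>

definition dfn :: "world \<Rightarrow> (nidx \<Rightarrow> nidx) \<Rightarrow> bool" where
  "dfn w T \<longleftrightarrow> (\<exists>f. tyw w f = Some (Fun Nat Nat) \<and> (\<forall>x. fnn w f x = T x))"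

definition dec :: "world \<Rightarrow> (nidx \<Rightarrow> bool) \<Rightarrow> bool" where
  "dec w P \<longleftrightarrow> (\<exists>T. dfn w T \<and> (\<forall>x. P x \<longleftrightarrow> T x = nzero w))"

lemma dfnI: "tyw w f = Some (Fun Nat Nat) \<Longrightarrow> (\<And>x. fnn w f x = T x) \<Longrightarrow> dfn w T"
  by (auto simp: dfn_def)

lemma dfn_id [intro!]: "dfn w (\<lambda>x. x)"
  by (rule dfnI[of w "sub (\<lambda>_. Z) (Lam Nat (Var 0))"]) (simp_all add: tyw_sub)

lemma dfn_const [intro!]: "dfn w (\<lambda>x. c)"
  by (rule dfnI[of w "sub (\<lambda>_. nrep w c) (Lam Nat (Var 1))"]) (simp_all add: tyw_sub)

lemma dfn_comp [intro]:
  assumes "tyw w f = Some (Fun Nat Nat)" "dfn w T" shows "dfn w (\<lambda>x. fnn w f (T x))"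
proof -
  obtain g where "tyw w g = Some (Fun Nat Nat)" "\<forall>x. fnn w g x = T x" using assms(2) by (auto simp: dfn_def)
  then show ?thesis using assms(1)
    by (intro dfnI[of w "sub (econs f (\<lambda>_. g)) (Lam Nat (App (Var 1) (App (Var 2) (Var 0))))"]) (simp_all add: tyw_sub)
qed

lemma dfn_comp2 [intro]:
  assumes "tyw w f = Some (Fun Nat (Fun Nat Nat))" "dfn w T" "dfn w U" shows "dfn w (\<lambda>x. fnnn w f (T x) (U x))"
proof -
  obtain g h where "tyw w g = Some (Fun Nat Nat)" "\<forall>x. fnn w g x = T x" "tyw w h = Some (Fun Nat Nat)" "\<forall>x. fnn w h x = U x"
    using assms(2,3) by (auto simp: dfn_def)
  then show ?thesis using assms(1)
    by (intro dfnI[of w "sub (econs f (econs g (\<lambda>_. h))) (Lam Nat (App (App (Var 1) (App (Var 2) (Var 0))) (App (Var 3) (Var 0))))"])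
      (simp_all add: tyw_sub)
qed

lemma dfn_nsuc [intro!]: "dfn w T \<Longrightarrow> dfn w (\<lambda>x. nsuc w (T x))"
  using dfn_comp[of w "Con CSuc" T] by simp

lemma dfn_nadd [intro!]: assumes "dfn w T" "dfn w U" shows "dfn w (\<lambda>x. nadd w (T x) (U x))"
proof -
  obtain g h where "tyw w g = Some (Fun Nat Nat)" "\<forall>x. fnn w g x = T x" "tyw w h = Some (Fun Nat Nat)" "\<forall>x. fnn w h x = U x"
    using assms by (auto simp: dfn_def)
  then show ?thesis
    by (intro dfnI[of w "sub (econs g (\<lambda>_. h)) (Lam Nat (addT (App (Var 1) (Var 0)) (App (Var 2) (Var 0))))"])
      (simp_all add: tyw_sub)
qed

lemma dfn_nmon [intro!]: assumes "dfn w T" "dfn w U" shows "dfn w (\<lambda>x. nmon w (T x) (U x))"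
proof -
  obtain g h where "tyw w g = Some (Fun Nat Nat)" "\<forall>x. fnn w g x = T x" "tyw w h = Some (Fun Nat Nat)" "\<forall>x. fnn w h x = U x"
    using assms by (auto simp: dfn_def)
  then show ?thesis
    by (intro dfnI[of w "sub (econs g (\<lambda>_. h)) (Lam Nat (monT (App (Var 1) (Var 0)) (App (Var 2) (Var 0))))"])
      (simp_all add: tyw_sub)
qed

lemma decI: "dfn w T \<Longrightarrow> (\<And>x. P x \<longleftrightarrow> T x = nzero w) \<Longrightarrow> dec w P"
  by (auto simp: dec_def)

lemma dec_nle [intro!]: "dfn w T \<Longrightarrow> dfn w U \<Longrightarrow> dec w (\<lambda>x. nle w (T x) (U x))"
  by (rule decI[of w "\<lambda>x. nmon w (T x) (U x)"]) auto

lemma dec_nless [intro!]: "dfn w T \<Longrightarrow> dfn w U \<Longrightarrow> dec w (\<lambda>x. nless w (T x) (U x))"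
  unfolding nless_def by auto

lemma dec_conj [intro!]: assumes "dec w P" "dec w Q" shows "dec w (\<lambda>x. P x \<and> Q x)"
proof -
  obtain T U where "dfn w T" "\<forall>x. P x \<longleftrightarrow> T x = nzero w" "dfn w U" "\<forall>x. Q x \<longleftrightarrow> U x = nzero w" using assms by (auto simp: dec_def)
  then show ?thesis by (intro decI[of w "\<lambda>x. nadd w (T x) (U x)"]) (auto simp: nadd_eq_0)
qed

lemma dec_not [intro!]: assumes "dec w P" shows "dec w (\<lambda>x. \<not> P x)"
proof -
  obtain T where T: "dfn w T" "\<forall>x. P x \<longleftrightarrow> T x = nzero w" using assms by (auto simp: dec_def)
  show ?thesis by (rule decI[of w "\<lambda>x. nmon w (nsuc w (nzero w)) (T x)"]) (use T in \<open>auto simp: nsuc_nle_iff nzero_nless\<close>)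
qed

lemma dec_imp [intro!]: "dec w P \<Longrightarrow> dec w Q \<Longrightarrow> dec w (\<lambda>x. P x \<longrightarrow> Q x)"
  using dec_not[OF dec_conj[OF _ dec_not], of w P Q] by simp

lemma dec_disj [intro!]: "dec w P \<Longrightarrow> dec w Q \<Longrightarrow> dec w (\<lambda>x. P x \<or> Q x)"
  using dec_not[OF dec_conj[OF dec_not dec_not], of w P Q] by simp

text \<open>Premises and conclusion concern the single world \<open>w\<close>, so facts about
  monotone sequences can be proved as for ordinary numbers.\<close>

lemma dec_induct [case_names dec zero suc]:
  assumes "dec w P" "P (nzero w)" "\<And>x. P x \<Longrightarrow> P (nsuc w x)"
  shows "P x"
proof -
  obtain f where "tyw w f = Some (Fun Nat Nat)" "\<forall>x. P x \<longleftrightarrow> fnn w f x = nzero w"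
    using assms(1) unfolding dec_def dfn_def by force
  then show ?thesis using decidable_induct[of w f x] assms(2,3) by auto
qed

end

section \<open>Real numbers at a world\<close>

context consistent
begin

lemma forc_all1: "forc w \<rho> (Forall \<sigma> p) \<Longrightarrow> tyw w x = Some \<sigma> \<Longrightarrow> forc w (econs x \<rho>) p"
  by simp

lemma forc_all2: "forc w \<rho> (Forall \<sigma> (Forall \<tau> p)) \<Longrightarrow> tyw w x = Some \<sigma> \<Longrightarrow> tyw w y = Some \<tau> \<Longrightarrow>
   forc w (econs y (econs x \<rho>)) p"
  by (rule forc_all1, rule forc_all1)

lemma forc_all3: "forc w \<rho> (Forall \<sigma> (Forall \<tau> (Forall \<upsilon> p))) \<Longrightarrow> tyw w x = Some \<sigma> \<Longrightarrow> tyw w y = Some \<tau> \<Longrightarrow>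
   tyw w z = Some \<upsilon> \<Longrightarrow> forc w (econs z (econs y (econs x \<rho>))) p"
  by (rule forc_all1, rule forc_all2)

definition rzero :: "world \<Rightarrow> ridx" where "rzero w = rval w (Con CRZero)"
definition rone :: "world \<Rightarrow> ridx" where "rone w = rval w (Con CROne)"
definition radd :: "world \<Rightarrow> ridx \<Rightarrow> ridx \<Rightarrow> ridx" where "radd w = frrr w (Con CRAdd)"
definition rmul :: "world \<Rightarrow> ridx \<Rightarrow> ridx \<Rightarrow> ridx" where "rmul w = frrr w (Con CRMul)"
definition rneg :: "world \<Rightarrow> ridx \<Rightarrow> ridx" where "rneg w = frr w (Con CRNeg)"
definition rsub :: "world \<Rightarrow> ridx \<Rightarrow> ridx \<Rightarrow> ridx" where "rsub w x y = radd w x (rneg w y)"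
definition rabs :: "world \<Rightarrow> ridx \<Rightarrow> ridx" where "rabs w = frr w (Con CRAbs)"
definition rless :: "world \<Rightarrow> ridx \<Rightarrow> ridx \<Rightarrow> bool" where "rless w x y \<longleftrightarrow> Less (rrep w x) (rrep w y) \<in> Th w"
definition rnat :: "world \<Rightarrow> nidx \<Rightarrow> ridx" where "rnat w x = rval w (natT (nrep w x))"

lemma real_values [simp]: "rval w (Con CRZero) = rzero w" "rval w (Con CROne) = rone w"
  "frrr w (Con CRAdd) = radd w" "frrr w (Con CRMul) = rmul w" "frr w (Con CRNeg) = rneg w" "frr w (Con CRAbs) = rabs w"
  by (simp_all add: rzero_def rone_def radd_def rmul_def rneg_def rabs_def)

lemma Less_rval [simp]: "tyw w s = Some Real \<Longrightarrow> tyw w t = Some Real \<Longrightarrow> Less s t \<in> Th w \<longleftrightarrow> rless w (rval w s) (rval w t)"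
  unfolding rless_def
  using forc_subst_Less[of s "rrep w (rval w s)" w t "rrep w (rval w t)"]
    forc_subst_Less[of "rrep w (rval w s)" s w "rrep w (rval w t)" t] by auto

lemma rless_mono: "rless w (rval w s) (rval w t) \<Longrightarrow> w \<sqsubseteq> w' \<Longrightarrow> tyw w s = Some Real \<Longrightarrow> tyw w t = Some Real \<Longrightarrow>
   rless w' (rval w' s) (rval w' t)"
  using Less_rval[of w s t] Less_rval[of w' s t] tyw_mono[of w s Real w'] tyw_mono[of w t Real w']
  by (auto simp: wle_def simp del: Less_rval)

lemma radd_assoc: "radd w (radd w x y) z = radd w x (radd w y z)"
  using forc_all3[OF real_axioms_mem[of "\<^bold>\<forall>\<^bsub>Real\<^esub> \<lambda>x. \<^bold>\<forall>\<^bsub>Real\<^esub> \<lambda>y. \<^bold>\<forall>\<^bsub>Real\<^esub> \<lambda>z. (x +\<^sub>R y) +\<^sub>R z =\<^bsub>Real\<^esub> x +\<^sub>R (y +\<^sub>R z)" w, unfolded unfold_btm],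
    of "rrep w x" "rrep w y" "rrep w z"] by (simp add: unfold_btm)

lemma radd_comm: "radd w x y = radd w y x"
  using forc_all2[OF real_axioms_mem[of "\<^bold>\<forall>\<^bsub>Real\<^esub> \<lambda>x. \<^bold>\<forall>\<^bsub>Real\<^esub> \<lambda>y. x +\<^sub>R y =\<^bsub>Real\<^esub> y +\<^sub>R x" w, unfolded unfold_btm],
    of "rrep w x" "rrep w y"] by (simp add: unfold_btm)

lemma radd_0: "radd w (rzero w) x = x"
  using forc_all1[OF real_axioms_mem[of "\<^bold>\<forall>\<^bsub>Real\<^esub> \<lambda>x. 0\<^sub>R +\<^sub>R x =\<^bsub>Real\<^esub> x" w, unfolded unfold_btm],
    of "rrep w x"] by (simp add: unfold_btm)

lemma radd_neg: "radd w x (rneg w x) = rzero w"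
  using forc_all1[OF real_axioms_mem[of "\<^bold>\<forall>\<^bsub>Real\<^esub> \<lambda>x. x +\<^sub>R negR x =\<^bsub>Real\<^esub> 0\<^sub>R" w, unfolded unfold_btm],
    of "rrep w x"] by (simp add: unfold_btm)

lemma rmul_assoc: "rmul w (rmul w x y) z = rmul w x (rmul w y z)"
  using forc_all3[OF real_axioms_mem[of "\<^bold>\<forall>\<^bsub>Real\<^esub> \<lambda>x. \<^bold>\<forall>\<^bsub>Real\<^esub> \<lambda>y. \<^bold>\<forall>\<^bsub>Real\<^esub> \<lambda>z. (x *\<^sub>R y) *\<^sub>R z =\<^bsub>Real\<^esub> x *\<^sub>R (y *\<^sub>R z)" w, unfolded unfold_btm],
    of "rrep w x" "rrep w y" "rrep w z"] by (simp add: unfold_btm)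

lemma rmul_comm: "rmul w x y = rmul w y x"
  using forc_all2[OF real_axioms_mem[of "\<^bold>\<forall>\<^bsub>Real\<^esub> \<lambda>x. \<^bold>\<forall>\<^bsub>Real\<^esub> \<lambda>y. x *\<^sub>R y =\<^bsub>Real\<^esub> y *\<^sub>R x" w, unfolded unfold_btm],
    of "rrep w x" "rrep w y"] by (simp add: unfold_btm)

lemma rmul_1: "rmul w (rone w) x = x"
  using forc_all1[OF real_axioms_mem[of "\<^bold>\<forall>\<^bsub>Real\<^esub> \<lambda>x. 1\<^sub>R *\<^sub>R x =\<^bsub>Real\<^esub> x" w, unfolded unfold_btm],
    of "rrep w x"] by (simp add: unfold_btm)

lemma rmul_radd: "rmul w x (radd w y z) = radd w (rmul w x y) (rmul w x z)"
  using forc_all3[OF real_axioms_mem[of "\<^bold>\<forall>\<^bsub>Real\<^esub> \<lambda>x. \<^bold>\<forall>\<^bsub>Real\<^esub> \<lambda>y. \<^bold>\<forall>\<^bsub>Real\<^esub> \<lambda>z. x *\<^sub>R (y +\<^sub>R z) =\<^bsub>Real\<^esub> x *\<^sub>R y +\<^sub>R x *\<^sub>R z" w, unfolded unfold_btm],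
    of "rrep w x" "rrep w y" "rrep w z"] by (simp add: unfold_btm)

lemma rless_zero_one: "rless w (rzero w) (rone w)"
  using real_axioms_mem[of "0\<^sub>R <\<^sub>R 1\<^sub>R" w] by (simp add: unfold_btm)

lemma rless_asym: "rless w x y \<Longrightarrow> \<not> rless w y x"
  unfolding rless_def by (rule less_asym_Th)

lemma rless_irrefl [simp]: "\<not> rless w x x"
  using rless_asym by blast

lemma rless_cotrans: "rless w x y \<Longrightarrow> rless w x z \<or> rless w z y"
  unfolding rless_def by (erule less_cotrans_Th) simp

lemma rless_trans: "rless w x y \<Longrightarrow> rless w y z \<Longrightarrow> rless w x z"
  unfolding rless_def by (rule less_trans_Th)

lemma rless_radd: "rless w x y \<Longrightarrow> rless w (radd w x z) (radd w y z)"
  using less_add_Th[of "rrep w x" "rrep w y" w "rrep w z"] by simp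

lemma rless_rmul: "rless w (rzero w) x \<Longrightarrow> rless w (rzero w) y \<Longrightarrow> rless w (rzero w) (rmul w x y)"
proof -
  assume a: "rless w (rzero w) x" "rless w (rzero w) y"
  let ?p = "Conj (Less (Con CRZero) (Var 1)) (Less (Con CRZero) (Var 0))"
  let ?q = "Less (Con CRZero) (App (App (Con CRMul) (Var 1)) (Var 0))"
  have "forc w Var (Forall Real (Forall Real (Imp ?p ?q)))"
    using real_axioms_mem[of "\<^bold>\<forall>\<^bsub>Real\<^esub> \<lambda>x. \<^bold>\<forall>\<^bsub>Real\<^esub> \<lambda>y. 0\<^sub>R <\<^sub>R x \<^bold>\<and> 0\<^sub>R <\<^sub>R y \<^bold>\<longrightarrow> 0\<^sub>R <\<^sub>R x *\<^sub>R y" w] by (simp add: unfold_btm del: forc.simps)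
  from forc_all2[OF this, of "rrep w x" "rrep w y"]
  have "forc w (econs (rrep w y) (econs (rrep w x) Var)) ?p \<longrightarrow> forc w (econs (rrep w y) (econs (rrep w x) Var)) ?q"
    unfolding forc.simps(7) using wle_refl rrep by blast
  then show ?thesis using a by simp
qed

lemma rless_rabs: "rless w (rabs w x) y \<longleftrightarrow> rless w x y \<and> rless w (rneg w x) y"
proof -
  have "forc w (econs (rrep w y) (econs (rrep w x) Var))
     (Iff (Less (App (Con CRAbs) (Var 1)) (Var 0)) (Conj (Less (Var 1) (Var 0)) (Less (App (Con CRNeg) (Var 1)) (Var 0))))"
    by (rule forc_all2[where \<sigma>=Real and \<tau>=Real])
      (use real_axioms_mem[of "\<^bold>\<forall>\<^bsub>Real\<^esub> \<lambda>x. \<^bold>\<forall>\<^bsub>Real\<^esub> \<lambda>y. absR x <\<^sub>R y \<^bold>\<longleftrightarrow> x <\<^sub>R y \<^bold>\<and> negR x <\<^sub>R y" w] in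
        \<open>simp_all add: unfold_btm del: forc.simps\<close>)
  then have "forc w (econs (rrep w y) (econs (rrep w x) Var)) (Less (App (Con CRAbs) (Var 1)) (Var 0)) \<longleftrightarrow>
    forc w (econs (rrep w y) (econs (rrep w x) Var)) (Conj (Less (Var 1) (Var 0)) (Less (App (Con CRNeg) (Var 1)) (Var 0)))"
    unfolding forc.simps(5,7) using wle_refl by blast
  then show ?thesis by simp
qed

text \<open>Tightness is an axiom about a negation, so apartness has to be refuted at all later
  worlds; its failure at \<open>w\<close> alone does not make two reals equal.\<close>

lemma rval_tight:
  assumes "tyw w s = Some Real" "tyw w t = Some Real"
    "\<And>w'. w \<sqsubseteq> w' \<Longrightarrow> \<not> rless w' (rval w' s) (rval w' t) \<and> \<not> rless w' (rval w' t) (rval w' s)"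
  shows "rval w s = rval w t"
proof -
  have "forc w (econs t (econs s Var)) (Imp (Imp (Disj (Less (Var 1) (Var 0)) (Less (Var 0) (Var 1))) Bot) (Eq Real (Var 1) (Var 0)))"
    by (rule forc_all2[where \<sigma>=Real and \<tau>=Real])
      (use assms real_axioms_mem[of "\<^bold>\<forall>\<^bsub>Real\<^esub> \<lambda>x. \<^bold>\<forall>\<^bsub>Real\<^esub> \<lambda>y. \<^bold>\<not> (x <\<^sub>R y \<^bold>\<or> y <\<^sub>R x) \<^bold>\<longrightarrow> x =\<^bsub>Real\<^esub> y" w] in
        \<open>simp_all add: unfold_btm del: forc.simps\<close>)
  moreover have "forc w (econs t (econs s Var)) (Imp (Disj (Less (Var 1) (Var 0)) (Less (Var 0) (Var 1))) Bot)"
    using assms(3) tyw_mono[OF assms(1)] tyw_mono[OF assms(2)] by auto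
  ultimately have "forc w (econs t (econs s Var)) (Eq Real (Var 1) (Var 0))" unfolding forc.simps(7) using wle_refl by blast
  then show ?thesis using assms(1,2) by simp
qed

lemma rinverse: "rless w (rzero w) x \<Longrightarrow> \<exists>y. rmul w x y = rone w"
proof -
  assume a: "rless w (rzero w) x"
  have "forc w (econs (rrep w x) Var) (Imp (Disj (Less (Var 0) (Con CRZero)) (Less (Con CRZero) (Var 0)))
     (Exists Real (Eq Real (App (App (Con CRMul) (Var 1)) (Var 0)) (Con CROne))))"
    by (rule forc_all1[where \<sigma>=Real])
      (use real_axioms_mem[of "\<^bold>\<forall>\<^bsub>Real\<^esub> \<lambda>x. x <\<^sub>R 0\<^sub>R \<^bold>\<or> 0\<^sub>R <\<^sub>R x \<^bold>\<longrightarrow> (\<^bold>\<exists>\<^bsub>Real\<^esub> \<lambda>y. x *\<^sub>R y =\<^bsub>Real\<^esub> 1\<^sub>R)" w] in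
        \<open>simp_all add: unfold_btm del: forc.simps\<close>)
  moreover have "forc w (econs (rrep w x) Var) (Disj (Less (Var 0) (Con CRZero)) (Less (Con CRZero) (Var 0)))" using a by simp
  ultimately have "forc w (econs (rrep w x) Var) (Exists Real (Eq Real (App (App (Con CRMul) (Var 1)) (Var 0)) (Con CROne)))"
    unfolding forc.simps(7) using wle_refl by blast
  then show ?thesis by auto
qed

lemma rval_natT [simp]: "tyw w t = Some Nat \<Longrightarrow> rval w (natT t) = rnat w (nval w t)"
  unfolding rnat_def natT_def
  by (rule rval_eqI, rule Eq_App[where \<sigma>=Nat], rule Eq_App[where \<sigma>="Fun Nat (Fun Real Real)"]) (simp_all add: Eq_refl)

lemma fnrr_NATSTEP [simp]: "fnrr w NATSTEP x y = radd w y (rone w)"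
  using fnrr_beta[of w Var "App (App (Con CRAdd) (Var 0)) (Con CROne)" x y] by (simp add: NATSTEP_def)

lemma rnat_rec [simp]: "rnat w (nzero w) = rzero w" "rnat w (nsuc w x) = radd w (rnat w x) (rone w)"
proof -
  have *: "rnat w x = fnr w (App (App (Con (CRec Real)) (Con CRZero)) NATSTEP) x" for x
    using rval_natT[of w "nrep w x"] by (simp add: natT_def)
  show "rnat w (nzero w) = rzero w" "rnat w (nsuc w x) = radd w (rnat w x) (rone w)" by (simp_all add: *)
qed

lemma archimedean: "\<exists>n. rless w x (rnat w n)"
proof -
  have "forc w (econs (rrep w x) Var) (Exists Nat (Less (Var 1) (natT (Var 0))))"
    using forc_all1[OF real_axioms_mem[of "\<^bold>\<forall>\<^bsub>Real\<^esub> \<lambda>x. \<^bold>\<exists>\<^bsub>Nat\<^esub> \<lambda>n. x <\<^sub>R natR n" w, unfolded unfold_btm],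
      of "rrep w x"] by (simp add: unfold_btm)
  then show ?thesis by auto
qed

text \<open>The ring axioms hold at each world separately, so Isabelle's ring rules are available
  for values.\<close>

sublocale R: comm_ring_1 where times = "rmul w" and one = "rone w" and plus = "radd w" and zero = "rzero w"
  and minus = "rsub w" and uminus = "rneg w" for w
proof
  fix a b c
  show "radd w (rneg w a) a = rzero w" by (simp add: radd_comm radd_neg)
  show "rmul w (radd w a b) c = radd w (rmul w a c) (rmul w b c)" by (metis rmul_comm rmul_radd)
  show "rzero w \<noteq> rone w" using rless_zero_one[of w] by auto
qed (metis radd_assoc radd_comm radd_0 rmul_assoc rmul_comm rmul_1 rsub_def)+

section \<open>Induction for equations between reals\<close>

lemma nval_stable:
  assumes "w \<sqsubseteq> w'" "tyw w s = Some Nat" "tyw w t = Some Nat"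
  shows "nval w' s = nval w' t \<longleftrightarrow> nval w s = nval w t"
proof
  assume e: "nval w' s = nval w' t"
  \<comment> \<open>A strict inequality is witnessed by an equation with a successor, and equations
    persist. As the order is total, an equation that holds later already holds at
    \<open>w\<close>.\<close>
  have no: False if l: "nless w (nval w s) (nval w t)" and e: "nval w' s = nval w' t"
     and t: "tyw w s = Some Nat" "tyw w t = Some Nat" for s t
  proof -
    obtain k where "nadd w (nval w s) (nsuc w k) = nval w t" using l nless_alt by blast
    then have "nval w (addT s (S (nrep w k))) = nval w t" using t by simp
    then have "nval w' (addT s (S (nrep w k))) = nval w' t" by (rule nval_mono) (use assms(1) t in auto)
    then have "nadd w' (nval w' s) (nsuc w' (nval w' (nrep w k))) = nval w' s" using assms(1) e tyw_mono[OF t(1) assms(1)] tyw_mono[OF t(2) assms(1)] by simp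
    then show False using nadd_eq_self nsuc_not_zero(1) by blast
  qed
  show "nval w s = nval w t" using no[of s t] no[of t s] e assms by (metis N.less_linear)
qed (use assms nval_mono in blast)

text \<open>Equations between reals are not decided at a world, so \<open>dec_induct\<close> does
  not apply and the step must hold at every later world. The guard, the zero set of the function
  term \<open>c\<close>, confines the induction to part of the naturals: an initial segment in
  \<open>truncated_before\<close>, a final one in \<open>truncated_after\<close>.\<close>

lemma guarded_real_induct:
  assumes ty: "tyw w c = Some (Fun Nat Nat)" "tyw w f = Some (Fun Nat Real)" "tyw w g = Some (Fun Nat Real)"
    and 0: "fnn w c (nzero w) = nzero w \<Longrightarrow> fnr w f (nzero w) = fnr w g (nzero w)"
    and S: "\<And>w' x. w \<sqsubseteq> w' \<Longrightarrow> (fnn w' c x = nzero w' \<Longrightarrow> fnr w' f x = fnr w' g x) \<Longrightarrow> fnn w' c (nsuc w' x) = nzero w' \<Longrightarrow>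
        fnr w' f (nsuc w' x) = fnr w' g (nsuc w' x)"
    and x: "fnn w c x = nzero w"
  shows "fnr w f x = fnr w g x"
proof -
  let ?\<rho> = "econs c (econs f (\<lambda>_. g))"
  let ?p = "Imp (Eq Nat (App (Var 1) (Var 0)) Z) (Eq Real (App (Var 2) (Var 0)) (App (Var 3) (Var 0)))"
  have ty': "tyw w' c = Some (Fun Nat Nat) \<and> tyw w' f = Some (Fun Nat Real) \<and> tyw w' g = Some (Fun Nat Real)" if "w \<sqsubseteq> w'" for w'
    using ty that tyw_mono by blast
  have "forc w (econs (nrep w x) ?\<rho>) ?p"
  proof (rule forc_induct)
    show "forc w (econs Z ?\<rho>) ?p"
    proof (subst forc.simps(7), intro allI impI)
      fix w' assume a: "w \<sqsubseteq> w'" "forc w' (econs Z ?\<rho>) (Eq Nat (App (Var 1) (Var 0)) Z)"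
      have "nval w' (App c Z) = nval w' Z" using a ty'[OF a(1)] by simp
      \<comment> \<open>The guard at \<open>w'\<close> is pulled back to \<open>w\<close>, where the
        base case is known, and the resulting equation is pushed forward again.\<close>
      then have "nval w (App c Z) = nval w Z" using nval_stable[OF a(1), of "App c Z" Z] ty by simp
      then have "rval w (App f Z) = rval w (App g Z)" using 0 ty by simp
      then have "rval w' (App f Z) = rval w' (App g Z)" by (rule rval_mono) (use a ty in auto)
      then show "forc w' (econs Z ?\<rho>) (Eq Real (App (Var 2) (Var 0)) (App (Var 3) (Var 0)))" using ty'[OF a(1)] by simp
    qed
    fix w' t assume a: "w \<sqsubseteq> w'" "tyw w' t = Some Nat" "forc w' (econs t ?\<rho>) ?p"
    show "forc w' (econs (S t) ?\<rho>) ?p"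
    proof (subst forc.simps(7), intro allI impI)
      fix w'' assume b: "w' \<sqsubseteq> w''" "forc w'' (econs (S t) ?\<rho>) (Eq Nat (App (Var 1) (Var 0)) Z)"
      have c: "w \<sqsubseteq> w''" "tyw w'' t = Some Nat" using a b wle_trans tyw_mono by blast+
      have "forc w'' (econs t ?\<rho>) ?p" using a(3) by (rule forc_mono) (use ty'[OF a(1)] a b in auto)
      then have "forc w'' (econs t ?\<rho>) (Eq Nat (App (Var 1) (Var 0)) Z) \<longrightarrow> forc w'' (econs t ?\<rho>) (Eq Real (App (Var 2) (Var 0)) (App (Var 3) (Var 0)))"
        unfolding forc.simps(7) using wle_refl by blast
      then have "fnn w'' c (nval w'' t) = nzero w'' \<Longrightarrow> fnr w'' f (nval w'' t) = fnr w'' g (nval w'' t)"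
        using ty'[OF c(1)] c(2) by simp
      then have "fnr w'' f (nsuc w'' (nval w'' t)) = fnr w'' g (nsuc w'' (nval w'' t))"
        using S[OF c(1), of "nval w'' t"] b(2) ty'[OF c(1)] c(2) by simp
      then show "forc w'' (econs (S t) ?\<rho>) (Eq Real (App (Var 2) (Var 0)) (App (Var 3) (Var 0)))"
        using ty'[OF c(1)] c(2) by simp
    qed
  qed (use ty in simp_all)
  then have "forc w (econs (nrep w x) ?\<rho>) (Eq Nat (App (Var 1) (Var 0)) Z) \<longrightarrow> forc w (econs (nrep w x) ?\<rho>) (Eq Real (App (Var 2) (Var 0)) (App (Var 3) (Var 0)))"
    unfolding forc.simps(7) using wle_refl by blast
  then show ?thesis using ty x by simp
qed

lemma real_induct:
  assumes "tyw w f = Some (Fun Nat Real)" "tyw w g = Some (Fun Nat Real)"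
    "fnr w f (nzero w) = fnr w g (nzero w)"
    "\<And>w' x. w \<sqsubseteq> w' \<Longrightarrow> fnr w' f x = fnr w' g x \<Longrightarrow> fnr w' f (nsuc w' x) = fnr w' g (nsuc w' x)"
  shows "fnr w f x = fnr w g x"
proof (rule guarded_real_induct[of w "sub (\<lambda>_. Z) (Lam Nat Z)"])
  have v: "fnn w' (sub (\<lambda>_. Z) (Lam Nat Z)) x = nzero w'" for w' x by simp
  show "tyw w (sub (\<lambda>_. Z) (Lam Nat Z)) = Some (Fun Nat Nat)" by (rule tyw_sub) simp
  fix w' x assume "w \<sqsubseteq> w'" "fnn w' (sub (\<lambda>_. Z) (Lam Nat Z)) x = nzero w' \<Longrightarrow> fnr w' f x = fnr w' g x"
  then show "fnr w' f (nsuc w' x) = fnr w' g (nsuc w' x)" using assms(4) v by blast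
qed (use assms in simp_all)

section \<open>Consequences of the ordered field axioms\<close>

lemma rless_add_left: "rless w y z \<Longrightarrow> rless w (radd w x y) (radd w x z)"
  by (metis rless_radd radd_comm)

lemma rless_add_cancel [simp]: "rless w (radd w x z) (radd w y z) \<longleftrightarrow> rless w x y" "rless w (radd w z x) (radd w z y) \<longleftrightarrow> rless w x y"
proof -
  show 1: "rless w (radd w x z) (radd w y z) \<longleftrightarrow> rless w x y" for x y z
    using rless_radd[of w "radd w x z" "radd w y z" "rneg w z"] rless_radd[of w x y z]
    by (metis radd_assoc radd_neg radd_comm radd_0)
  show "rless w (radd w z x) (radd w z y) \<longleftrightarrow> rless w x y" using 1[of x z y] by (metis radd_comm)
qed

lemma rless_neg: "rless w (rneg w x) (rneg w y) \<longleftrightarrow> rless w y x"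
proof -
  have "rless w (radd w (rneg w x) (radd w x y)) (radd w (rneg w y) (radd w x y)) \<longleftrightarrow> rless w (rneg w x) (rneg w y)"
    by (rule rless_add_cancel(1))
  moreover have "radd w (rneg w x) (radd w x y) = y" "radd w (rneg w y) (radd w x y) = x"
    by (metis radd_assoc radd_comm radd_neg radd_0)+
  ultimately show ?thesis by simp
qed

lemma rneg_less_0: "rless w (rzero w) x \<Longrightarrow> rless w (rneg w x) (rzero w)"
  using rless_neg[of w x "rzero w"] by simp

text \<open>The absolute value is axiomatised only through upper bounds, so the equations come from
  tightness: a strict inequality in either direction would put some number below itself.\<close>

lemma rabs_of_pos:
  assumes "rless w (rzero w) x" shows "rabs w x = x" "rabs w (rneg w x) = x"
proof -
  let ?t = "rrep w x"
  have *: "rless w' (rzero w') (rval w' ?t)" if "w \<sqsubseteq> w'" for w'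
    using rless_mono[of w "Con CRZero" ?t w'] assms that by simp
  have n: "rless w' (rneg w' y) y" if "rless w' (rzero w') y" for w' y
    using that rneg_less_0 rless_trans by blast
  have no: "\<not> rless w' (rabs w' y) y \<and> \<not> rless w' y (rabs w' y)
     \<and> \<not> rless w' (rabs w' (rneg w' y)) y \<and> \<not> rless w' y (rabs w' (rneg w' y))" if p: "rless w' (rzero w') y" for w' y
  proof (intro conjI notI)
    show False if "rless w' (rabs w' y) y" using that rless_rabs[of w' y y] by simp
    show False if "rless w' y (rabs w' y)"
      using that rless_rabs[of w' y "rabs w' y"] rless_trans[OF n[OF p] that] by simp
    show False if "rless w' (rabs w' (rneg w' y)) y" using that rless_rabs[of w' "rneg w' y" y] by simp
    show False if "rless w' y (rabs w' (rneg w' y))"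
      using that rless_rabs[of w' "rneg w' y" "rabs w' (rneg w' y)"] rless_trans[OF n[OF p] that] by simp
  qed
  have "rval w (App (Con CRAbs) ?t) = rval w ?t"
    by (rule rval_tight) (use no[OF *] in simp_all)
  then show "rabs w x = x" by simp
  have "rval w (App (Con CRAbs) (App (Con CRNeg) ?t)) = rval w ?t"
    by (rule rval_tight) (use no[OF *] in simp_all)
  then show "rabs w (rneg w x) = x" by simp
qed

lemma rabs_0 [simp]: "rabs w (rzero w) = rzero w"
proof -
  have "rval w (App (Con CRAbs) (Con CRZero)) = rval w (Con CRZero)"
  proof (rule rval_tight)
    fix w' show "\<not> rless w' (rval w' (App (Con CRAbs) (Con CRZero))) (rval w' (Con CRZero)) \<and>
         \<not> rless w' (rval w' (Con CRZero)) (rval w' (App (Con CRAbs) (Con CRZero)))"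
      using rless_rabs[of w' "rzero w'"] by (auto dest: rless_asym)
  qed simp_all
  then show ?thesis by simp
qed

lemma rless_rmul_left: "rless w (rzero w) z \<Longrightarrow> rless w x y \<Longrightarrow> rless w (rmul w z x) (rmul w z y)"
proof -
  assume a: "rless w (rzero w) z" "rless w x y"
  have "rless w (rzero w) (rsub w y x)" using rless_radd[OF a(2), of "rneg w x"] by simp
  then have "rless w (rzero w) (rmul w z (rsub w y x))" by (rule rless_rmul[OF a(1)])
  then have "rless w (rzero w) (rsub w (rmul w z y) (rmul w z x))" by (simp add: R.right_diff_distrib)
  from rless_radd[OF this, of "rmul w z x"] show ?thesis by simp
qed

lemma rnat_pos: "rless w (rzero w) (rnat w (nsuc w x))"
proof -
  have "forc w (econs (nrep w x) (\<lambda>_. Z)) (Less (Con CRZero) (natT (S (Var 0))))"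
  proof (rule forc_induct)
    fix w' t assume "w \<sqsubseteq> w'" "tyw w' t = Some Nat" "forc w' (econs t (\<lambda>_. Z)) (Less (Con CRZero) (natT (S (Var 0))))"
    then have "rless w' (rzero w') (radd w' (rnat w' (nval w' t)) (rone w'))" "tyw w' t = Some Nat" by auto
    moreover from rless_add_left[OF rless_zero_one[of w'], of "radd w' (rnat w' (nval w' t)) (rone w')"]
    have "rless w' (radd w' (rnat w' (nval w' t)) (rone w')) (radd w' (radd w' (rnat w' (nval w' t)) (rone w')) (rone w'))" by simp
    ultimately show "forc w' (econs (S t) (\<lambda>_. Z)) (Less (Con CRZero) (natT (S (Var 0))))" using rless_trans by auto
  qed (simp_all add: rless_zero_one)
  then show ?thesis by simp
qed

lemma rnat_nadd: "rnat w (nadd w x y) = radd w (rnat w x) (rnat w y)"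
proof -
  have "forc w (econs (nrep w y) (\<lambda>_. nrep w x)) (Eq Real (natT (addT (Var 1) (Var 0))) (App (App (Con CRAdd) (natT (Var 1))) (natT (Var 0))))"
    by (rule forc_induct) (simp_all add: radd_assoc)
  then show ?thesis by simp
qed

lemma rnat_less: "nless w x y \<Longrightarrow> rless w (rnat w x) (rnat w y)"
proof -
  assume "nless w x y"
  then obtain k where y: "y = nadd w x (nsuc w k)" unfolding nless_alt by blast
  show ?thesis using rless_add_left[OF rnat_pos[of w k], of "rnat w x"] unfolding y rnat_nadd by simp
qed

text \<open>The ordered field axioms do not say that inverses of positive numbers are positive; for
  natural numbers this follows by cotransitivity, peeling off one summand \<open>y\<close> at a time.\<close>

lemma rinverse_rnat_pos: "rless w (rzero w) (rmul w (rnat w x) y) \<Longrightarrow> rless w (rzero w) y"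
proof -
  assume a: "rless w (rzero w) (rmul w (rnat w x) y)"
  let ?p = "Imp (Less (Con CRZero) (App (App (Con CRMul) (natT (Var 0))) (Var 1))) (Less (Con CRZero) (Var 1))"
  have "forc w (econs (nrep w x) (\<lambda>_. rrep w y)) ?p"
  proof (rule forc_induct)
    fix w' t assume b: "w \<sqsubseteq> w'" "tyw w' t = Some Nat" "forc w' (econs t (\<lambda>_. rrep w y)) ?p"
    show "forc w' (econs (S t) (\<lambda>_. rrep w y)) ?p"
    proof (subst forc.simps(7), intro allI impI)
      fix w'' assume c: "w' \<sqsubseteq> w''" "forc w'' (econs (S t) (\<lambda>_. rrep w y)) (Less (Con CRZero) (App (App (Con CRMul) (natT (Var 0))) (Var 1)))"
      have d: "w \<sqsubseteq> w''" "tyw w'' t = Some Nat" using b c wle_trans tyw_mono by blast+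
      let ?y = "rval w'' (rrep w y)" and ?n = "rnat w'' (nval w'' t)"
      have "rless w'' (rzero w'') (radd w'' (rmul w'' ?n ?y) ?y)" using c(2) d by (simp add: R.distrib_right)
      then consider "rless w'' (rzero w'') ?y" | "rless w'' ?y (radd w'' (rmul w'' ?n ?y) ?y)" using rless_cotrans by blast
      then show "forc w'' (econs (S t) (\<lambda>_. rrep w y)) (Less (Con CRZero) (Var 1))"
      proof cases
        case 1 then show ?thesis using d by simp
      next
        case 2
        then have "rless w'' (radd w'' (rzero w'') ?y) (radd w'' (rmul w'' ?n ?y) ?y)" by (simp add: radd_0)
        then have "rless w'' (rzero w'') (rmul w'' ?n ?y)" unfolding rless_add_cancel .
        then have "forc w'' (econs t (\<lambda>_. rrep w y)) (Less (Con CRZero) (App (App (Con CRMul) (natT (Var 0))) (Var 1)))" using d by simp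
        then have "forc w'' (econs t (\<lambda>_. rrep w y)) (Less (Con CRZero) (Var 1))" using b(3) c(1) unfolding forc.simps(7) by blast
        then show ?thesis by simp
      qed
    qed
  qed auto
  moreover have "forc w (econs (nrep w x) (\<lambda>_. rrep w y)) (Less (Con CRZero) (App (App (Con CRMul) (natT (Var 0))) (Var 1)))" using a by simp
  ultimately have "forc w (econs (nrep w x) (\<lambda>_. rrep w y)) (Less (Con CRZero) (Var 1))" unfolding forc.simps(7) using wle_refl by blast
  then show ?thesis by simp
qed

end

section \<open>Series at a world\<close>

definition PSstep :: "tm \<Rightarrow> tm" where
  "PSstep a = sub (econs a (\<lambda>_. Z)) (Lam Nat (Lam Real (App (App (Con CRAdd) (Var 0)) (App (Var 2) (S (Var 1))))))"
text \<open>Maps \<open>n\<close> to \<open>a 1 + ... + a n\<close>: index 0 is skipped, as in the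
  object-level \<open>sumR\<close> started at 1.\<close>

definition PS :: "tm \<Rightarrow> tm" where "PS a = App (App (Con (CRec Real)) (Con CRZero)) (PSstep a)"

context consistent
begin

lemma tyw_PSstep [simp]: "tyw w a = Some (Fun Nat Real) \<Longrightarrow> tyw w (PSstep a) = Some (Fun Nat (Fun Real Real))"
  unfolding PSstep_def by (rule tyw_sub) simp

lemma tyw_PS [simp]: "tyw w a = Some (Fun Nat Real) \<Longrightarrow> tyw w (PS a) = Some (Fun Nat Real)"
  by (simp add: PS_def)

lemma PS_rec [simp]:
  assumes "tyw w a = Some (Fun Nat Real)"
  shows "fnr w (PS a) (nzero w) = rzero w" "fnr w (PS a) (nsuc w x) = radd w (fnr w (PS a) x) (fnr w a (nsuc w x))"
proof -
  have "fnrr w (PSstep a) x y = radd w y (fnr w a (nsuc w x))" for x y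
    unfolding PSstep_def using assms by simp
  then show "fnr w (PS a) (nzero w) = rzero w" "fnr w (PS a) (nsuc w x) = radd w (fnr w (PS a) x) (fnr w a (nsuc w x))"
    using assms by (simp_all add: PS_def)
qed

text \<open>Only the values of the step term \<open>g\<close> are prescribed, so the lemma covers
  both the partial sums in \<open>series_converges\<close> and the single brackets in
  \<open>bracketing\<close>.\<close>

lemma segment_sum:
  assumes ty: "tyw w r = Some (Fun Nat Real)" "tyw w m = Some Nat" "nval w m = nsuc w m0"
    and g: "tyw w g = Some (Fun Nat (Fun Real Real))"
    and gv: "\<And>w' j y. w \<sqsubseteq> w' \<Longrightarrow> fnrr w' g j y = radd w' y (fnr w' r (nadd w' (nval w' m) j))"
  shows "radd w (fnr w (PS r) m0) (fnr w (App (App (Con (CRec Real)) (Con CRZero)) g) x) = fnr w (PS r) (nadd w m0 x)"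
proof -
  let ?R = "App (App (Con (CRec Real)) (Con CRZero)) g"
  let ?\<rho> = "econs ?R (econs (PS r) (\<lambda>_. nrep w m0))"
  let ?f = "sub ?\<rho> (Lam Nat (App (App (Con CRAdd) (App (Var 2) (Var 3))) (App (Var 1) (Var 0))))"
  let ?g = "sub ?\<rho> (Lam Nat (App (Var 2) (addT (Var 3) (Var 0))))"
  have tr: "tyw w' r = Some (Fun Nat Real) \<and> tyw w' g = Some (Fun Nat (Fun Real Real)) \<and> tyw w' m = Some Nat" if "w \<sqsubseteq> w'" for w'
    using that ty g tyw_mono by blast
  have fv: "fnr w' ?f y = radd w' (fnr w' (PS r) (nval w' (nrep w m0))) (fnr w' ?R y)"
    and gv': "fnr w' ?g y = fnr w' (PS r) (nadd w' (nval w' (nrep w m0)) y)" if "w \<sqsubseteq> w'" for w' y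
    using tr[OF that] that by simp_all
  have mv: "nval w' m = nsuc w' (nval w' (nrep w m0))" if "w \<sqsubseteq> w'" for w'
    using nval_mono[of w m "S (nrep w m0)" w'] ty that by simp
  have "fnr w ?f x = fnr w ?g x"
  proof (rule real_induct)
    show "tyw w ?f = Some (Fun Nat Real)" "tyw w ?g = Some (Fun Nat Real)" using tr[of w] by (auto intro!: tyw_sub)
    show "fnr w ?f (nzero w) = fnr w ?g (nzero w)" unfolding fv[OF wle_refl] gv'[OF wle_refl] using tr[of w] by simp
    fix w' y assume a: "w \<sqsubseteq> w'" "fnr w' ?f y = fnr w' ?g y"
    then have "radd w' (fnr w' (PS r) (nval w' (nrep w m0))) (fnr w' ?R y) = fnr w' (PS r) (nadd w' (nval w' (nrep w m0)) y)"
      using fv gv' by metis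
    then have "fnr w' (PS r) (nsuc w' (nadd w' (nval w' (nrep w m0)) y)) =
       radd w' (fnr w' (PS r) (nval w' (nrep w m0))) (fnr w' ?R (nsuc w' y))"
      using tr[OF a(1)] mv[OF a(1)] gv[OF a(1), of y] by (simp add: radd_assoc[symmetric])
    then show "fnr w' ?f (nsuc w' y) = fnr w' ?g (nsuc w' y)" unfolding fv[OF a(1)] gv'[OF a(1)] by simp
  qed
  then show ?thesis using fv[of w x] gv'[of w x] by simp
qed

text \<open>The bound \<open>N\<close> is a term because it must serve all later worlds, where its
  value has to be recomputed.\<close>

definition tends :: "world \<Rightarrow> tm \<Rightarrow> tm \<Rightarrow> bool" where
  "tends w x l \<longleftrightarrow> (\<forall>w' e. w \<sqsubseteq> w' \<longrightarrow> tyw w' e = Some Real \<longrightarrow> rless w' (rzero w') (rval w' e) \<longrightarrow>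
     (\<exists>N. tyw w' N = Some Nat \<and> (\<forall>w'' n. w' \<sqsubseteq> w'' \<longrightarrow> nle w'' (nval w'' N) n \<longrightarrow>
        rless w'' (rabs w'' (rsub w'' (fnr w'' x n) (rval w'' l))) (rval w'' e))))"

definition conv :: "world \<Rightarrow> tm \<Rightarrow> bool" where
  "conv w r \<longleftrightarrow> (\<exists>l. tyw w l = Some Real \<and> tends w (PS r) l)"

text \<open>By transitivity of \<open>\<sqsubseteq>\<close> the nested world quantifiers of forcing
  collapse to the two in \<open>tends\<close>. The entries \<open>t1\<close>, \<open>t2\<close>,
  \<open>t3\<close> stand for the index, the bound and the tolerance.\<close>

lemma forc_seq_tendsto:
  assumes x: "\<And>w' t1 t2 t3. w \<sqsubseteq> w' \<Longrightarrow> tyw w' (sub (econs t1 (econs t2 (econs t3 \<rho>))) X) = Some (Fun Nat Real)"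
      "\<And>w' t1 t2 t3 n. w \<sqsubseteq> w' \<Longrightarrow> tyw w' t1 = Some Nat \<Longrightarrow> tyw w' t2 = Some Nat \<Longrightarrow> tyw w' t3 = Some Real \<Longrightarrow> fnr w' (sub (econs t1 (econs t2 (econs t3 \<rho>))) X) n = fnr w' r n"
    and l: "\<And>t1 t2 t3. sub (econs t1 (econs t2 (econs t3 \<rho>))) L = l" "tyw w l = Some Real"
  shows "forc w \<rho> (Forall Real (Imp (Less (Con CRZero) (Var 0)) (Exists Nat (Forall Nat
     (Imp (Exists Nat (Eq Nat (addT (Var 2) (Var 0)) (Var 1)))
       (Less (App (Con CRAbs) (App (App (Con CRAdd) (App X (Var 0))) (App (Con CRNeg) L))) (Var 2))))))) \<longleftrightarrow> tends w r l"
  (is "forc w \<rho> (Forall Real (Imp ?A (Exists Nat (Forall Nat (Imp ?B ?C))))) \<longleftrightarrow> _")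
proof -
  have l': "tyw w' l = Some Real" if "w \<sqsubseteq> w'" for w' using l(2) that tyw_mono by blast
  have A: "forc w' (econs e \<rho>) ?A \<longleftrightarrow> rless w' (rzero w') (rval w' e)" if "tyw w' e = Some Real" for w' e
    using that by simp
  have B: "forc w' (econs n (econs N (econs e \<rho>))) ?B \<longleftrightarrow> nle w' (nval w' N) (nval w' n)"
    if "tyw w' n = Some Nat" "tyw w' N = Some Nat" for w' n N e
    using that by simp
  have C: "forc w' (econs n (econs N (econs e \<rho>))) ?C \<longleftrightarrow>
       rless w' (rabs w' (rsub w' (fnr w' r (nval w' n)) (rval w' l))) (rval w' e)"
    if "w \<sqsubseteq> w'" "tyw w' n = Some Nat" "tyw w' e = Some Real" "tyw w' N = Some Nat" for w' n N e
    using that x[OF that(1)] l'[OF that(1)] by (simp add: l(1))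
  show ?thesis
  proof
    assume f: "forc w \<rho> (Forall Real (Imp ?A (Exists Nat (Forall Nat (Imp ?B ?C)))))"
    show "tends w r l" unfolding tends_def
    proof (intro allI impI)
      fix w' e assume a: "w \<sqsubseteq> w'" "tyw w' e = Some Real" "rless w' (rzero w') (rval w' e)"
      then have "forc w' (econs e \<rho>) (Exists Nat (Forall Nat (Imp ?B ?C)))"
        using f A[OF a(2)] unfolding forc.simps(7,8) using wle_refl by blast
      then obtain N where N: "tyw w' N = Some Nat" "forc w' (econs N (econs e \<rho>)) (Forall Nat (Imp ?B ?C))" by auto
      show "\<exists>N. tyw w' N = Some Nat \<and> (\<forall>w'' n. w' \<sqsubseteq> w'' \<longrightarrow> nle w'' (nval w'' N) n \<longrightarrow>
        rless w'' (rabs w'' (rsub w'' (fnr w'' r n) (rval w'' l))) (rval w'' e))"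
      proof (intro exI[of _ N] conjI allI impI)
        fix w'' n assume b: "w' \<sqsubseteq> w''" "nle w'' (nval w'' N) n"
        have t: "w \<sqsubseteq> w''" "tyw w'' N = Some Nat" "tyw w'' e = Some Real" using a N b tyw_mono wle_trans by blast+
        have "forc w'' (econs (nrep w'' n) (econs N (econs e \<rho>))) (Imp ?B ?C)"
          using N(2) b(1) unfolding forc.simps(8) by simp
        then show "rless w'' (rabs w'' (rsub w'' (fnr w'' r n) (rval w'' l))) (rval w'' e)"
          using B[of w'' "nrep w'' n" N e] C[of w'' "nrep w'' n" e N] t b(2) unfolding forc.simps(7) using wle_refl nrep by metis
      qed (rule N(1))
    qed
  next
    assume f: "tends w r l"
    show "forc w \<rho> (Forall Real (Imp ?A (Exists Nat (Forall Nat (Imp ?B ?C)))))"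
    proof (subst forc.simps(8), intro allI impI, subst forc.simps(7), intro allI impI)
      fix w1 e w' assume a: "w \<sqsubseteq> w1" "tyw w1 e = Some Real" "w1 \<sqsubseteq> w'" "forc w' (econs e \<rho>) ?A"
      then have a': "w \<sqsubseteq> w'" "tyw w' e = Some Real" using wle_trans tyw_mono by blast+
      then obtain N where N: "tyw w' N = Some Nat" "\<And>w'' n. w' \<sqsubseteq> w'' \<Longrightarrow> nle w'' (nval w'' N) n \<Longrightarrow>
        rless w'' (rabs w'' (rsub w'' (fnr w'' r n) (rval w'' l))) (rval w'' e)"
        using f A a(4) unfolding tends_def by blast
      have "forc w' (econs N (econs e \<rho>)) (Forall Nat (Imp ?B ?C))"
      proof (subst forc.simps(8), intro allI impI, subst forc.simps(7), intro allI impI)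
        fix w2 n w'' assume b: "w' \<sqsubseteq> w2" "tyw w2 n = Some Nat" "w2 \<sqsubseteq> w''" "forc w'' (econs n (econs N (econs e \<rho>))) ?B"
        have t: "w' \<sqsubseteq> w''" using b wle_trans by blast
        then have t': "w \<sqsubseteq> w''" "tyw w'' N = Some Nat" "tyw w'' e = Some Real" "tyw w'' n = Some Nat" using a' N(1) b tyw_mono wle_trans by blast+
        show "forc w'' (econs n (econs N (econs e \<rho>))) ?C"
          using N(2)[OF t] B[of w'' n N e] C[of w'' n e N] t' b(4) by blast
      qed
      then show "forc w' (econs e \<rho>) (Exists Nat (Forall Nat (Imp ?B ?C)))" using N(1) by auto
    qed
  qed
qed

text \<open>\<open>A\<close> ends up below seven binders: the limit, the tolerance, the bound and
  the index of the convergence statement, the lambda of the partial sums, and the two lambdas of the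
  recursion in \<open>sumR\<close>.\<close>

lemma forc_series_converges:
  assumes A: "\<And>t1 t2 t3 t4 t5 t6 t7. sub (econs t1 (econs t2 (econs t3 (econs t4 (econs t5 (econs t6 (econs t7 \<rho>))))))) (A (Suc (Suc (Suc (Suc (Suc (Suc (Suc d)))))))) = r"
    and T: "\<And>w' c1 c2 c3 c4 c5 c6 c7. w \<sqsubseteq> w' \<Longrightarrow> tyc (econs c1 (econs c2 (econs c3 (econs c4 (econs c5 (econs c6 (econs c7 (\<lambda>i. tyw w' (\<rho> i)))))))))
       (A (Suc (Suc (Suc (Suc (Suc (Suc (Suc d)))))))) = Some (Fun Nat Real)"
    and r: "tyw w r = Some (Fun Nat Real)"
  shows "forc w \<rho> (series_converges A d) \<longleftrightarrow> conv w r"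
proof -
  let ?A = "A (Suc (Suc (Suc (Suc (Suc (Suc (Suc d)))))))"
  let ?G = "Lam Nat (Lam Real (App (App (Con CRAdd) (Var 0)) (App ?A (addT (S Z) (Var 1)))))"
  let ?X = "Lam Nat (App (App (App (Con (CRec Real)) (Con CRZero)) ?G) (monT (S (Var 0)) (S Z)))"
  have u: "series_converges A d = Exists Real (Forall Real (Imp (Less (Con CRZero) (Var 0)) (Exists Nat (Forall Nat
     (Imp (Exists Nat (Eq Nat (addT (Var 2) (Var 0)) (Var 1)))
       (Less (App (Con CRAbs) (App (App (Con CRAdd) (App ?X (Var 0))) (App (Con CRNeg) (Var 3)))) (Var 2)))))))"
    by (simp add: series_converges_def seq_tendsto_def sumR_def recN_def unfold_btm)
  have "forc w (econs l \<rho>) (Forall Real (Imp (Less (Con CRZero) (Var 0)) (Exists Nat (Forall Nat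
     (Imp (Exists Nat (Eq Nat (addT (Var 2) (Var 0)) (Var 1)))
       (Less (App (Con CRAbs) (App (App (Con CRAdd) (App ?X (Var 0))) (App (Con CRNeg) (Var 3)))) (Var 2))))))) \<longleftrightarrow> tends w (PS r) l"
    if l: "tyw w l = Some Real" for l
  proof (rule forc_seq_tendsto)
    fix w' t1 t2 t3 n assume w': "w \<sqsubseteq> w'"
    have r': "tyw w'' r = Some (Fun Nat Real)" if "w \<sqsubseteq> w''" for w'' using r that tyw_mono by blast
    show "tyw w' (sub (econs t1 (econs t2 (econs t3 (econs l \<rho>)))) ?X) = Some (Fun Nat Real)"
      using T[OF w'] by (intro tyw_sub) simp
    let ?\<rho> = "econs (nrep w' n) (econs t1 (econs t2 (econs t3 (econs l \<rho>))))"
    assume t: "tyw w' t1 = Some Nat" "tyw w' t2 = Some Nat" "tyw w' t3 = Some Real"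
    have "radd w' (fnr w' (PS r) (nzero w')) (fnr w' (App (App (Con (CRec Real)) (Con CRZero)) (sub ?\<rho> ?G)) n) = fnr w' (PS r) (nadd w' (nzero w') n)"
    proof (rule segment_sum)
      show "tyw w' (sub ?\<rho> ?G) = Some (Fun Nat (Fun Real Real))" using T[OF w'] by (intro tyw_sub) simp
      fix w'' j y assume w'': "w' \<sqsubseteq> w''"
      then have "w \<sqsubseteq> w''" using w' wle_trans by blast
      then show "fnrr w'' (sub ?\<rho> ?G) j y = radd w'' y (fnr w'' r (nadd w'' (nval w'' (S Z)) j))"
        using T[of w''] r'[of w''] by (simp add: A)
    qed (use r'[OF w'] in simp_all)
    then show "fnr w' (sub (econs t1 (econs t2 (econs t3 (econs l \<rho>)))) ?X) n = fnr w' (PS r) n"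
      using T[OF w'] r'[OF w'] by (simp add: A tyw_sub)
  qed (use l in simp_all)
  then show ?thesis unfolding u conv_def forc.simps(9) by blast
qed

end

section \<open>The terms of the construction\<close>

definition KR :: tm where "KR = Lam Real (Lam Nat (Lam Real (Var 2)))"
definition KN :: tm where "KN = Lam Nat (Lam Nat (Lam Nat (Var 2)))"
text \<open>A conditional by recursion with constant step: zero selects \<open>y\<close>, any
  successor selects \<open>x\<close>. Here nonzero means true, whereas in \<open>dec\<close> zero
  does.\<close>

definition ifr :: "tm \<Rightarrow> tm \<Rightarrow> tm \<Rightarrow> tm" where "ifr n x y = App (App (App (Con (CRec Real)) y) (App KR x)) n"
definition ifn :: "tm \<Rightarrow> tm \<Rightarrow> tm \<Rightarrow> tm" where "ifn n x y = App (App (App (Con (CRec Nat)) y) (App KN x)) n"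

lemma sub_if [simp]: "sub \<rho> (ifr n x y) = ifr (sub \<rho> n) (sub \<rho> x) (sub \<rho> y)" "sub \<rho> (ifn n x y) = ifn (sub \<rho> n) (sub \<rho> x) (sub \<rho> y)"
  by (simp_all add: ifr_def ifn_def KR_def KN_def sub.simps(4) eval_nat_numeral)

lemma tyc_if [simp]:
  "tyc C n = Some Nat \<Longrightarrow> tyc C x = Some Real \<Longrightarrow> tyc C y = Some Real \<Longrightarrow> tyc C (ifr n x y) = Some Real"
  "tyc C n = Some Nat \<Longrightarrow> tyc C x = Some Nat \<Longrightarrow> tyc C y = Some Nat \<Longrightarrow> tyc C (ifn n x y) = Some Nat"
  by (simp_all add: ifr_def ifn_def KR_def KN_def)

lemma tyw_if [simp]:
  "tyw w n = Some Nat \<Longrightarrow> tyw w x = Some Real \<Longrightarrow> tyw w y = Some Real \<Longrightarrow> tyw w (ifr n x y) = Some Real"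
  "tyw w n = Some Nat \<Longrightarrow> tyw w x = Some Nat \<Longrightarrow> tyw w y = Some Nat \<Longrightarrow> tyw w (ifn n x y) = Some Nat"
  by (simp_all add: tyw_def)

text \<open>The maximum of \<open>m\<close> and \<open>t\<close> is written
  \<open>m + (t - m)\<close> with truncated subtraction.\<close>

definition runmax :: "tm \<Rightarrow> tm" where
  "runmax s = App (App (Con (CRec Nat)) (App s Z))
     (sub (econs s (\<lambda>_. Z)) (Lam Nat (Lam Nat (addT (Var 0) (monT (App (Var 2) (S (Var 1))) (Var 0))))))"

text \<open>Stage \<open>k\<close> of the series is the block of indices from \<open>stage_start k\<close> to \<open>stage_start (k + 1) - 1\<close>;
  it has length \<open>k + 2\<close>, and \<open>stage n\<close> is the stage to which \<open>n\<close> belongs.\<close>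

definition stage_start :: tm where
  "stage_start = App (App (Con (CRec Nat)) Z) (sub (\<lambda>_. Z) (Lam Nat (Lam Nat (addT (Var 0) (S (S (Var 1)))))))"

definition stage :: tm where
  "stage = App (App (Con (CRec Nat)) Z) (sub (\<lambda>_. stage_start)
     (Lam Nat (Lam Nat (addT (Var 0) (monT (S Z) (monT (App (Var 2) (S (Var 0))) (S (Var 1))))))))"

definition parity :: tm where
  "parity = App (App (Con (CRec Nat)) Z) (sub (\<lambda>_. Z) (Lam Nat (Lam Nat (monT (S Z) (Var 0)))))"

definition zseq :: "tm \<Rightarrow> tm \<Rightarrow> tm" where
  "zseq m v = sub (econs m (econs v (econs stage (\<lambda>_. parity)))) (Lam Nat
     (ifr (App (Var 4) (Var 0))
       (ifr (monT (App (Var 1) (S (App (Var 3) (Var 0)))) (App (Var 1) (App (Var 3) (Var 0)))) (App (Var 2) (App (Var 3) (Var 0))) (Con CRZero))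
       (Con CRZero)))"

definition differences :: "tm \<Rightarrow> tm" where
  "differences z = sub (\<lambda>_. z) (Lam Nat (App (App (Con CRAdd) (App (Var 1) (Var 0))) (App (Con CRNeg) (App (Var 1) (predT (Var 0))))))"

text \<open>A sum in place of a maximum: all that is asked of it is an upper bound for
  \<open>f 1\<close>, ..., \<open>f n\<close>, see \<open>sumN_ge\<close>.\<close>

definition sumN :: "tm \<Rightarrow> tm" where
  "sumN f = App (App (Con (CRec Nat)) Z) (sub (\<lambda>_. f) (Lam Nat (Lam Nat (addT (Var 0) (App (Var 2) (S (Var 1)))))))"

text \<open>The number \<open>q\<close> of the overview, where \<open>i\<close> inverts the
  permutation: every index from 1 to \<open>stage_start x\<close> has its position within
  \<open>cover i x\<close>. The summand \<open>x\<close> makes the result at least \<open>x\<close>,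
  so that bracket ends increase.\<close>

definition cover :: "tm \<Rightarrow> tm" where
  "cover i = sub (econs (sumN i) (\<lambda>_. stage_start)) (Lam Nat (addT (Var 0) (App (Var 1) (App (Var 2) (Var 0)))))"

text \<open>The number \<open>Q\<close> of the overview: a bound for the values of \<open>p\<close>
  on positions 1 to \<open>cover i x\<close>. Again the summand \<open>x\<close> forces a value of
  at least \<open>x\<close>, so a search never moves back.\<close>

definition reach :: "tm \<Rightarrow> tm \<Rightarrow> tm" where
  "reach p i = sub (econs (sumN p) (\<lambda>_. cover i)) (Lam Nat (addT (Var 0) (App (Var 1) (App (Var 2) (Var 0)))))"

definition search_step :: "tm \<Rightarrow> tm \<Rightarrow> tm" where
  "search_step m q = sub (econs m (\<lambda>_. q)) (Lam Nat (Lam Nat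
     (ifn (monT (App (Var 2) (S (App (Var 3) (Var 0)))) (App (Var 2) (Var 0))) (S (App (Var 3) (Var 0))) (Var 0))))"

definition search :: "tm \<Rightarrow> tm \<Rightarrow> tm" where
  "search m q = sub (\<lambda>_. search_step m q) (Lam Nat (App (App (Con (CRec Nat)) (Var 0)) (Var 1)))"

text \<open>Counted from 0. The search for the end of bracket \<open>k\<close> runs \<open>k\<close>
  rounds from the current start, used as a stage number; its outcome cannot lie below that start.
  The successor passes from the end of one bracket to the start of the next.\<close>

definition bracket_start :: "tm \<Rightarrow> tm \<Rightarrow> tm" where
  "bracket_start c g = App (App (Con (CRec Nat)) (S Z))
     (sub (econs c (\<lambda>_. g)) (Lam Nat (Lam Nat (S (App (Var 2) (App (App (Var 3) (Var 0)) (Var 1)))))))"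

text \<open>Bracketing maps are read on the positive integers, so the sequence counted from 0 is
  shifted by one.\<close>

definition bracket_fun :: "tm \<Rightarrow> tm" where
  "bracket_fun f = sub (\<lambda>_. f) (Lam Nat (App (Var 1) (predT (Var 0))))"

text \<open>The sequence in \<open>S\<close> to which pseudoboundedness is applied.\<close>

definition search_max :: "tm \<Rightarrow> tm \<Rightarrow> tm \<Rightarrow> tm" where
  "search_max m g f = sub (econs m (econs g (\<lambda>_. f))) (Lam Nat (App (Var 1) (App (App (Var 2) (App (Var 3) (Var 0))) (Var 0))))"

definition rearranged :: "tm \<Rightarrow> tm \<Rightarrow> tm" where
  "rearranged a p = sub (econs a (\<lambda>_. p)) (Lam Nat (App (Var 1) (App (Var 2) (Var 0))))"

text \<open>The rearranged series with every term of original index above \<open>r\<close> replaced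
  by 0. Raising \<open>r\<close> inserts the terms one by one in their original order, which
  compares the two orders of summation by plain induction.\<close>

definition truncated :: "tm \<Rightarrow> tm \<Rightarrow> tm \<Rightarrow> tm" where
  "truncated a p r = sub (econs a (econs p (\<lambda>_. r))) (Lam Nat
     (ifr (monT (S (Var 3)) (App (Var 2) (Var 0))) (App (Var 1) (App (Var 2) (Var 0))) (Con CRZero)))"

context consistent
begin

section \<open>Values of the terms of the construction\<close>

lemma rval_ifr [simp]:
  assumes "tyw w n = Some Nat" "tyw w x = Some Real" "tyw w y = Some Real"
  shows "rval w (ifr n x y) = (if nval w n = nzero w then rval w y else rval w x)"
proof -
  have ty: "tyw w KR = Some (Fun Real (Fun Nat (Fun Real Real)))" by (simp add: tyw_def KR_def)
  \<comment> \<open>\<open>KR\<close> has three lambdas while the value rules contract two, so the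
    outermost one is removed by hand.\<close>
  have "Eq (Fun Nat (Fun Real Real)) (App (sub Var KR) x) (sub (econs x Var) (Lam Nat (Lam Real (Var 2)))) \<in> Th w"
    unfolding KR_def by (rule Eq_beta) (use assms in simp_all)
  then have "Eq Real (App (App (App KR x) (nrep w i)) (rrep w r)) (App (App (sub (econs x Var) (Lam Nat (Lam Real (Var 2)))) (nrep w i)) (rrep w r)) \<in> Th w" for i r
    by (intro Eq_App[where \<sigma>=Real] Eq_App[where \<sigma>=Nat] Eq_refl) simp_all
  then have "fnrr w (App KR x) i r = fnrr w (sub (econs x Var) (Lam Nat (Lam Real (Var 2)))) i r" for i r
    unfolding fnrr_def by (rule rval_eqI)
  then have "fnrr w (App KR x) i r = rval w x" for i r using assms by simp
  then show ?thesis using nidx_cases[of "nval w n" w] assms ty by (auto simp: ifr_def)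
qed

lemma nval_ifn [simp]:
  assumes "tyw w n = Some Nat" "tyw w x = Some Nat" "tyw w y = Some Nat"
  shows "nval w (ifn n x y) = (if nval w n = nzero w then nval w y else nval w x)"
proof -
  have ty: "tyw w KN = Some (Fun Nat (Fun Nat (Fun Nat Nat)))" by (simp add: tyw_def KN_def)
  have "Eq (Fun Nat (Fun Nat Nat)) (App (sub Var KN) x) (sub (econs x Var) (Lam Nat (Lam Nat (Var 2)))) \<in> Th w"
    unfolding KN_def by (rule Eq_beta) (use assms in simp_all)
  then have "Eq Nat (App (App (App KN x) (nrep w i)) (nrep w r)) (App (App (sub (econs x Var) (Lam Nat (Lam Nat (Var 2)))) (nrep w i)) (nrep w r)) \<in> Th w" for i r
    by (intro Eq_App[where \<sigma>=Nat] Eq_refl) simp_all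
  then have "fnnn w (App KN x) i r = fnnn w (sub (econs x Var) (Lam Nat (Lam Nat (Var 2)))) i r" for i r
    unfolding fnnn_def by (rule nval_eqI)
  then have "fnnn w (App KN x) i r = nval w x" for i r using assms by simp
  then show ?thesis using nidx_cases[of "nval w n" w] assms ty by (auto simp: ifn_def)
qed

lemma runmax [simp]:
  assumes "tyw w s = Some (Fun Nat Nat)"
  shows "tyw w (runmax s) = Some (Fun Nat Nat)" "fnn w (runmax s) (nzero w) = fnn w s (nzero w)"
   "fnn w (runmax s) (nsuc w x) = nadd w (fnn w (runmax s) x) (nmon w (fnn w s (nsuc w x)) (fnn w (runmax s) x))"
  using assms unfolding runmax_def by (simp_all add: tyw_sub)

lemma stage_start [simp]: "tyw w stage_start = Some (Fun Nat Nat)" "fnn w stage_start (nzero w) = nzero w"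
  "fnn w stage_start (nsuc w x) = nsuc w (nsuc w (nadd w (fnn w stage_start x) x))"
  unfolding stage_start_def by (simp_all add: tyw_sub)

lemma stage [simp]: "tyw w stage = Some (Fun Nat Nat)" "fnn w stage (nzero w) = nzero w"
  "fnn w stage (nsuc w x) = nadd w (fnn w stage x) (nmon w (nsuc w (nzero w)) (nmon w (fnn w stage_start (nsuc w (fnn w stage x))) (nsuc w x)))"
  unfolding stage_def by (simp_all add: tyw_sub del: stage_start(3) nmon_rec)

lemma parity [simp]: "tyw w parity = Some (Fun Nat Nat)" "fnn w parity (nzero w) = nzero w"
  "fnn w parity (nsuc w x) = nmon w (nsuc w (nzero w)) (fnn w parity x)"
  unfolding parity_def by (simp_all add: tyw_sub)

lemma zseq [simp]:
  assumes "tyw w m = Some (Fun Nat Nat)" "tyw w v = Some (Fun Nat Real)"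
  shows "tyw w (zseq m v) = Some (Fun Nat Real)"
    "fnr w (zseq m v) x = (if fnn w parity x = nzero w \<or> nle w (fnn w m (nsuc w (fnn w stage x))) (fnn w m (fnn w stage x))
       then rzero w else fnr w v (fnn w stage x))"
  using assms unfolding zseq_def by (simp_all add: tyw_sub)

lemma differences [simp]:
  assumes "tyw w z = Some (Fun Nat Real)"
  shows "tyw w (differences z) = Some (Fun Nat Real)"
    "fnr w (differences z) x = rsub w (fnr w z x) (fnr w z (npred w x))"
  using assms unfolding differences_def by (simp_all add: tyw_sub)

lemma sumN [simp]:
  assumes "tyw w f = Some (Fun Nat Nat)"
  shows "tyw w (sumN f) = Some (Fun Nat Nat)" "fnn w (sumN f) (nzero w) = nzero w"
    "fnn w (sumN f) (nsuc w x) = nadd w (fnn w (sumN f) x) (fnn w f (nsuc w x))"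
  using assms unfolding sumN_def by (simp_all add: tyw_sub)

lemma cover [simp]:
  assumes "tyw w i = Some (Fun Nat Nat)"
  shows "tyw w (cover i) = Some (Fun Nat Nat)" "fnn w (cover i) x = nadd w x (fnn w (sumN i) (fnn w stage_start x))"
  using assms unfolding cover_def by (simp_all add: tyw_sub)

lemma reach [simp]:
  assumes "tyw w p = Some (Fun Nat Nat)" "tyw w i = Some (Fun Nat Nat)"
  shows "tyw w (reach p i) = Some (Fun Nat Nat)" "fnn w (reach p i) x = nadd w x (fnn w (sumN p) (fnn w (cover i) x))"
  using assms unfolding reach_def by (simp_all add: tyw_sub del: cover(2))

lemma search [simp]:
  assumes "tyw w m = Some (Fun Nat Nat)" "tyw w q = Some (Fun Nat Nat)"
  shows "tyw w (search m q) = Some (Fun Nat (Fun Nat Nat))" "fnnn w (search m q) r (nzero w) = r"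
    "fnnn w (search m q) r (nsuc w i) = (let x = fnnn w (search m q) r i in
       if nle w (fnn w m (nsuc w (fnn w q x))) (fnn w m x) then x else nsuc w (fnn w q x))"
proof -
  let ?s = "search_step m q"
  have ts: "tyw w ?s = Some (Fun Nat (Fun Nat Nat))" unfolding search_step_def using assms by (intro tyw_sub) simp
  have vs: "fnnn w ?s i x = (if nle w (fnn w m (nsuc w (fnn w q x))) (fnn w m x) then x else nsuc w (fnn w q x))" for i x
    unfolding search_step_def using assms by simp
  show t: "tyw w (search m q) = Some (Fun Nat (Fun Nat Nat))" unfolding search_def using ts by (intro tyw_sub) simp
  have "Eq (Fun Nat Nat) (App (search m q) (nrep w r)) (App (App (Con (CRec Nat)) (nrep w r)) ?s) \<in> Th w"
    using Eq_beta[of Nat w "\<lambda>_. ?s" "App (App (Con (CRec Nat)) (Var 0)) (Var 1)" "Fun Nat Nat" "nrep w r"] ts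
    unfolding search_def by simp
  then have "Eq Nat (App (App (search m q) (nrep w r)) (nrep w i)) (App (App (App (Con (CRec Nat)) (nrep w r)) ?s) (nrep w i)) \<in> Th w" for i
    by (rule Eq_App[OF _ Eq_refl]) simp
  then have *: "fnnn w (search m q) r i = fnn w (App (App (Con (CRec Nat)) (nrep w r)) ?s) i" for i
    unfolding fnnn_def fnn_def by (rule nval_eqI)
  show "fnnn w (search m q) r (nzero w) = r"
    "fnnn w (search m q) r (nsuc w i) = (let x = fnnn w (search m q) r i in
       if nle w (fnn w m (nsuc w (fnn w q x))) (fnn w m x) then x else nsuc w (fnn w q x))"
    unfolding * using ts vs by (simp_all add: Let_def)
qed

lemma bracket_start [simp]:
  assumes "tyw w c = Some (Fun Nat Nat)" "tyw w g = Some (Fun Nat (Fun Nat Nat))"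
  shows "tyw w (bracket_start c g) = Some (Fun Nat Nat)" "fnn w (bracket_start c g) (nzero w) = nsuc w (nzero w)"
    "fnn w (bracket_start c g) (nsuc w k) = nsuc w (fnn w c (fnnn w g (fnn w (bracket_start c g) k) k))"
  using assms unfolding bracket_start_def by (simp_all add: tyw_sub)

lemma bracket_fun [simp]:
  assumes "tyw w f = Some (Fun Nat Nat)"
  shows "tyw w (bracket_fun f) = Some (Fun Nat Nat)" "fnn w (bracket_fun f) x = fnn w f (npred w x)"
  using assms unfolding bracket_fun_def by (simp_all add: tyw_sub)

lemma search_max [simp]:
  assumes "tyw w m = Some (Fun Nat Nat)" "tyw w g = Some (Fun Nat (Fun Nat Nat))" "tyw w f = Some (Fun Nat Nat)"
  shows "tyw w (search_max m g f) = Some (Fun Nat Nat)" "fnn w (search_max m g f) x = fnn w m (fnnn w g (fnn w f x) x)"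
  using assms unfolding search_max_def by (simp_all add: tyw_sub)

lemma rearranged [simp]:
  assumes "tyw w a = Some (Fun Nat Real)" "tyw w p = Some (Fun Nat Nat)"
  shows "tyw w (rearranged a p) = Some (Fun Nat Real)" "fnr w (rearranged a p) x = fnr w a (fnn w p x)"
  using assms unfolding rearranged_def by (simp_all add: tyw_sub)

lemma truncated [simp]:
  assumes "tyw w a = Some (Fun Nat Real)" "tyw w p = Some (Fun Nat Nat)" "tyw w r = Some Nat"
  shows "tyw w (truncated a p r) = Some (Fun Nat Real)"
    "fnr w (truncated a p r) x = (if nle w (fnn w p x) (nval w r) then fnr w a (fnn w p x) else rzero w)"
  using assms unfolding truncated_def by (auto simp: tyw_sub nsuc_nle_iff N.not_less)

end

section \<open>Properties of the construction\<close>

context consistent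
begin

text \<open>Subtraction from 1 tests for zero. Hence \<open>stage\<close> moves on exactly when the
  next stage has begun, and \<open>parity\<close> alternates.\<close>

lemma nmon_one: "nmon w (nsuc w (nzero w)) y = (if y = nzero w then nsuc w (nzero w) else nzero w)"
proof (cases "y = nzero w")
  case False
  then obtain k where "y = nsuc w k" using nidx_cases by blast
  then show ?thesis by (simp add: nmon_nsuc_nsuc del: nmon_rec(2))
qed simp

lemma stage_start_less: "nless w (fnn w stage_start x) (fnn w stage_start (nsuc w x))"
  by (simp add: nless_nsuc_iff N.le_less_trans[OF nle_nadd(1) nless_nsuc] N.less_imp_le)

lemma stage_start_mono: "nle w x y \<Longrightarrow> nle w (fnn w stage_start x) (fnn w stage_start y)"
proof -
  assume "nle w x y"
  then obtain k where y: "y = nadd w x k" by (auto simp: nle_def)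
  have "nle w (fnn w stage_start x) (fnn w stage_start (nadd w x k))"
  proof (induction k rule: dec_induct[where w=w])
    case dec show ?case by (intro dec_nle dfn_comp dfn_nadd dfn_const dfn_id) simp
  next
    case (suc k)
    then show ?case using N.order_trans[OF suc N.less_imp_le[OF stage_start_less]] by (simp only: nadd_rec)
  qed simp
  then show ?thesis by (simp add: y)
qed

lemma stage_start_ge: "nle w x (fnn w stage_start x)"
proof (induction x rule: dec_induct[where w=w])
  case dec show ?case by (intro dec_nle dfn_comp dfn_id) simp
next
  case (suc x)
  then show ?case using N.le_less_trans[OF suc stage_start_less] by (simp only: nless_def)
qed simp

lemma stage_bounds: "nle w (fnn w stage_start (fnn w stage x)) x \<and> nless w x (fnn w stage_start (nsuc w (fnn w stage x)))"
proof (induction x rule: dec_induct[where w=w])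
  case dec show ?case by (intro dec_nle dec_nless dec_conj dfn_comp dfn_id dfn_nsuc) simp_all
next
  case zero
  show ?case by (simp add: nzero_nless)
next
  case (suc x)
  show ?case
  proof (cases "nle w (fnn w stage_start (nsuc w (fnn w stage x))) (nsuc w x)")
    case True
    then have e: "fnn w stage (nsuc w x) = nsuc w (fnn w stage x)" by (simp only: stage nmon_one nmon_eq_0) simp
    have "nle w (nsuc w x) (fnn w stage_start (nsuc w (fnn w stage x)))" using suc by (simp only: nless_def)
    then have "nless w (nsuc w x) (fnn w stage_start (nsuc w (nsuc w (fnn w stage x))))"
      using stage_start_less N.le_less_trans by blast
    with True show ?thesis by (simp only: e)
  next
    case False
    then have e: "fnn w stage (nsuc w x) = fnn w stage x" by (simp only: stage nmon_one nmon_eq_0) simp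
    show ?thesis using False suc N.order_trans[OF _ nle_nsuc] unfolding e N.not_le by blast
  qed
qed

lemma stage_ge: "nle w (fnn w stage_start m) x \<Longrightarrow> nle w m (fnn w stage x)"
proof (rule ccontr)
  assume a: "nle w (fnn w stage_start m) x" "\<not> nle w m (fnn w stage x)"
  then have "nle w (nsuc w (fnn w stage x)) m" by (simp add: nsuc_nle_iff N.not_le)
  from stage_start_mono[OF this] have "nless w x (fnn w stage_start m)" using stage_bounds N.less_le_trans by blast
  with a show False using N.not_le by blast
qed

lemma stage_le: "nle w (fnn w stage x) x"
  using stage_start_ge stage_bounds N.order_trans by blast

lemma stage_eq: "nle w (fnn w stage_start k) x \<Longrightarrow> nless w x (fnn w stage_start (nsuc w k)) \<Longrightarrow> fnn w stage x = k"
proof -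
  assume a: "nle w (fnn w stage_start k) x" "nless w x (fnn w stage_start (nsuc w k))"
  have "\<not> nless w k (fnn w stage x)"
  proof
    assume "nless w k (fnn w stage x)"
    then have "nle w (fnn w stage_start (nsuc w k)) (fnn w stage_start (fnn w stage x))"
      unfolding nless_def by (rule stage_start_mono)
    with a(2) stage_bounds show False using N.not_le N.order_trans by blast
  qed
  then show ?thesis using stage_ge[OF a(1)] N.order_antisym N.not_le by blast
qed

lemma parity_suc: "fnn w parity (nsuc w x) = nzero w \<longleftrightarrow> fnn w parity x \<noteq> nzero w"
  by (simp only: parity nmon_one) simp

section \<open>Running maxima, bounds by sums, and the search\<close>

lemma runmax_suc:
  assumes "tyw w s = Some (Fun Nat Nat)"
  shows "fnn w (runmax s) (nsuc w x) = fnn w (runmax s) x \<or>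
     fnn w (runmax s) (nsuc w x) = fnn w s (nsuc w x) \<and> nless w (fnn w (runmax s) x) (fnn w s (nsuc w x))"
proof (cases "nle w (fnn w s (nsuc w x)) (fnn w (runmax s) x)")
  case True
  then show ?thesis using assms by simp
next
  case False
  then show ?thesis using assms nmon_nadd[OF N.less_imp_le] by (simp add: N.not_le)
qed

lemma runmax_mono:
  assumes s: "tyw w s = Some (Fun Nat Nat)" and le: "nle w x y"
  shows "nle w (fnn w (runmax s) x) (fnn w (runmax s) y)"
proof -
  obtain k where y: "y = nadd w x k" using le by (auto simp: nle_def)
  have "nle w (fnn w (runmax s) x) (fnn w (runmax s) (nadd w x k))"
  proof (induction k rule: dec_induct[where w=w])
    case dec show ?case by (intro dec_nle dfn_comp dfn_nadd dfn_const dfn_id) (simp add: s)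
  next
    case (suc k)
    have "nle w (fnn w (runmax s) (nadd w x k)) (fnn w (runmax s) (nsuc w (nadd w x k)))" using s by simp
    with suc show ?case using N.order_trans by (simp only: nadd_rec)
  qed simp
  then show ?thesis by (simp add: y)
qed

lemma runmax_ge:
  assumes s: "tyw w s = Some (Fun Nat Nat)"
  shows "nle w (fnn w s x) (fnn w (runmax s) x)"
proof (cases "x = nzero w")
  case False
  then obtain y where x: "x = nsuc w y" using nidx_cases by blast
  show ?thesis
  proof (cases "nle w (fnn w s x) (fnn w (runmax s) y)")
    case True
    then show ?thesis using runmax_mono[OF s, of y x] x N.order_trans nle_nsuc by blast
  next
    case False
    then show ?thesis using s x nmon_nadd[OF N.less_imp_le] by (simp add: N.not_le)
  qed
qed (simp add: s)

lemma sumN_ge: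
  assumes f: "tyw w f = Some (Fun Nat Nat)" and j: "j \<noteq> nzero w" and le: "nle w j n"
  shows "nle w (fnn w f j) (fnn w (sumN f) n)"
proof -
  have "nle w j n \<longrightarrow> nle w (fnn w f j) (fnn w (sumN f) n)"
  proof (induction n rule: dec_induct[where w=w])
    case dec show ?case using f by (intro dec_imp dec_nle dfn_comp dfn_const dfn_id) simp_all
  next
    case zero then show ?case using j by simp
  next
    case (suc n)
    show ?case
    proof
      assume "nle w j (nsuc w n)"
      then consider "nle w j n" | "j = nsuc w n" unfolding N.le_less[of w j "nsuc w n"] nless_nsuc_iff by blast
      then show "nle w (fnn w f j) (fnn w (sumN f) (nsuc w n))"
      proof cases
        case 1
        then have "nle w (fnn w f j) (fnn w (sumN f) n)" using suc by blast
        then show ?thesis using N.order_trans nle_nadd(1) sumN(3)[OF f] by metis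
      qed (use f in simp)
    qed
  qed
  with le show ?thesis by blast
qed

text \<open>A round that does not find a good stage moves to one with a strictly larger maximum. So
  after \<open>i\<close> rounds either the search has stopped or the maximum has grown to at least
  \<open>i\<close>.\<close>

lemma search_good:
  fixes r :: nidx
  assumes t: "tyw w m = Some (Fun Nat Nat)" "tyw w q = Some (Fun Nat Nat)" and q: "\<And>x. nle w x (fnn w q x)"
  defines "X i \<equiv> fnnn w (search m q) r i"
  shows "nle w r (X i) \<and> (nle w (fnn w m (nsuc w (fnn w q (X i)))) (fnn w m (X i)) \<or> nle w i (fnn w m (X i)))"
proof (induction i rule: dec_induct[where w=w])
  case dec
  have "dfn w X" unfolding X_def using t by (intro dfn_comp2 dfn_const dfn_id) simp
  then show ?case using t by (intro dec_conj dec_disj dec_nle dfn_comp dfn_nsuc dfn_const dfn_id)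
next
  case zero then show ?case unfolding X_def using t by simp
next
  case (suc i)
  show ?case
  proof (cases "nle w (fnn w m (nsuc w (fnn w q (X i)))) (fnn w m (X i))")
    case True
    then have "X (nsuc w i) = X i" unfolding X_def using t by (simp add: Let_def)
    with True suc show ?thesis by simp
  next
    case False
    then have e: "X (nsuc w i) = nsuc w (fnn w q (X i))" unfolding X_def using t by (simp add: Let_def)
    have "nle w i (fnn w m (X i))" using False suc by blast
    then have "nless w i (fnn w m (X (nsuc w i)))" using False unfolding e N.not_le by (rule N.le_less_trans)
    moreover have "nle w r (X (nsuc w i))" unfolding e using suc q N.order_trans nle_nsuc by blast
    ultimately show ?thesis by (simp add: nsuc_nle_iff)
  qed
qed

lemma strict_mono_step:
  assumes t: "tyw w f = Some (Fun Nat Nat)" and s: "\<And>x. nless w (fnn w f x) (fnn w f (nsuc w x))" and l: "nless w x y"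
  shows "nless w (fnn w f x) (fnn w f y)"
proof -
  obtain k where y: "y = nadd w x (nsuc w k)" using l unfolding nless_alt by blast
  have "nless w (fnn w f x) (fnn w f (nadd w x (nsuc w k)))"
  proof (induction k rule: dec_induct[where w=w])
    case dec show ?case using t by (intro dec_nless dfn_comp dfn_nadd dfn_nsuc dfn_const dfn_id)
  next
    case zero show ?case using s by simp
  next
    case (suc k) then show ?case using s N.less_trans by (simp only: nadd_rec)
  qed
  then show ?thesis by (simp only: y)
qed

text \<open>Telescoping; the sum starts at 1, so the value at 0 is subtracted and must
  vanish.\<close>

lemma PS_differences:
  assumes z: "tyw w z = Some (Fun Nat Real)" and 0: "fnr w z (nzero w) = rzero w"
  shows "fnr w (PS (differences z)) x = fnr w z x"
proof (rule real_induct)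
  fix w' y assume a: "w \<sqsubseteq> w'" "fnr w' (PS (differences z)) y = fnr w' z y"
  have "tyw w' z = Some (Fun Nat Real)" using z a tyw_mono by blast
  then show "fnr w' (PS (differences z)) (nsuc w' y) = fnr w' z (nsuc w' y)"
    using a by (simp add: radd_comm[of w' "fnr w' z y"])
qed (use z 0 in simp_all)

section \<open>Finite rearrangements\<close>

text \<open>The inverse is carried as a term because \<open>cover\<close> is built from it.
  Bijectivity concerns positive values only, and is required at all later worlds so that it
  persists.\<close>

definition perm_pair :: "world \<Rightarrow> tm \<Rightarrow> tm \<Rightarrow> bool" where
  "perm_pair w p i \<longleftrightarrow> tyw w p = Some (Fun Nat Nat) \<and> tyw w i = Some (Fun Nat Nat) \<and>
    (\<forall>w' x. w \<sqsubseteq> w' \<longrightarrow> x \<noteq> nzero w' \<longrightarrow> fnn w' p x \<noteq> nzero w' \<and> fnn w' i x \<noteq> nzero w' \<and>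
       fnn w' p (fnn w' i x) = x \<and> fnn w' i (fnn w' p x) = x)"

lemma perm_pair_mono: "perm_pair w p i \<Longrightarrow> w \<sqsubseteq> w' \<Longrightarrow> perm_pair w' p i"
  unfolding perm_pair_def using tyw_mono wle_trans by blast

lemma perm_pairD:
  assumes "perm_pair w p i"
  shows "tyw w p = Some (Fun Nat Nat)" "tyw w i = Some (Fun Nat Nat)"
    "x \<noteq> nzero w \<Longrightarrow> fnn w p x \<noteq> nzero w" "x \<noteq> nzero w \<Longrightarrow> fnn w i x \<noteq> nzero w"
    "x \<noteq> nzero w \<Longrightarrow> fnn w p (fnn w i x) = x" "x \<noteq> nzero w \<Longrightarrow> fnn w i (fnn w p x) = x"
  using assms unfolding perm_pair_def by auto

lemma truncated_step:
  assumes a: "tyw w a = Some (Fun Nat Real)" and pp: "perm_pair w p i" and r: "tyw w r = Some Nat"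
    and ne: "fnn w p x \<noteq> nsuc w (nval w r)"
  shows "fnr w (truncated a p (S r)) x = fnr w (truncated a p r) x"
proof -
  have "nle w (fnn w p x) (nsuc w (nval w r)) \<longleftrightarrow> nle w (fnn w p x) (nval w r)"
    using ne N.le_less[of w "fnn w p x" "nsuc w (nval w r)"] nless_nsuc_iff by blast
  then show ?thesis using a r perm_pairD(1)[OF pp] by simp
qed

text \<open>Raising the cutoff by one alters a single term, at position \<open>i (r + 1)\<close>;
  sums that end earlier are unaffected.\<close>

lemma truncated_before:
  assumes a: "tyw w a = Some (Fun Nat Real)" and pp: "perm_pair w p i" and r: "tyw w r = Some Nat"
    and q: "nless w q (fnn w i (nsuc w (nval w r)))"
  shows "fnr w (PS (truncated a p (S r))) q = fnr w (PS (truncated a p r)) q"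
proof (rule guarded_real_induct)
  let ?c = "sub (econs i (\<lambda>_. r)) (Lam Nat (monT (S (Var 0)) (App (Var 1) (S (Var 2)))))"
  have ty: "tyw w' a = Some (Fun Nat Real) \<and> tyw w' p = Some (Fun Nat Nat) \<and> tyw w' i = Some (Fun Nat Nat) \<and> tyw w' r = Some Nat" if "w \<sqsubseteq> w'" for w'
    using that a r perm_pairD[OF pp] tyw_mono by blast
  have c: "fnn w' ?c x = nzero w' \<longleftrightarrow> nless w' x (fnn w' i (nsuc w' (nval w' r)))" if "w \<sqsubseteq> w'" for w' x
    using ty[OF that] by (simp add: nsuc_nle_iff)
  show "tyw w ?c = Some (Fun Nat Nat)" by (rule tyw_sub) (use ty[of w] in simp)
  show "tyw w (PS (truncated a p (S r))) = Some (Fun Nat Real)" "tyw w (PS (truncated a p r)) = Some (Fun Nat Real)"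
    "fnr w (PS (truncated a p (S r))) (nzero w) = fnr w (PS (truncated a p r)) (nzero w)" using ty[of w] by simp_all
  show "fnn w ?c q = nzero w" using q c[of w] by simp
  fix w' x assume b: "w \<sqsubseteq> w'" "fnn w' ?c x = nzero w' \<Longrightarrow> fnr w' (PS (truncated a p (S r))) x = fnr w' (PS (truncated a p r)) x"
     "fnn w' ?c (nsuc w' x) = nzero w'"
  have l: "nless w' (nsuc w' x) (fnn w' i (nsuc w' (nval w' r)))" using b c[OF b(1)] by simp
  then have "nless w' x (fnn w' i (nsuc w' (nval w' r)))" using N.less_trans nless_nsuc by blast
  then have IH: "fnr w' (PS (truncated a p (S r))) x = fnr w' (PS (truncated a p r)) x" using b c[OF b(1)] by blast
  have pp': "perm_pair w' p i" using pp b(1) perm_pair_mono by blast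
  have "fnn w' p (nsuc w' x) \<noteq> nsuc w' (nval w' r)" using l perm_pairD(6)[OF pp', of "nsuc w' x"] by auto
  then have "fnr w' (truncated a p (S r)) (nsuc w' x) = fnr w' (truncated a p r) (nsuc w' x)"
    using truncated_step[OF _ pp'] ty[OF b(1)] by blast
  moreover have "tyw w' (truncated a p (S r)) = Some (Fun Nat Real)" "tyw w' (truncated a p r) = Some (Fun Nat Real)" using ty[OF b(1)] by simp_all
  ultimately show "fnr w' (PS (truncated a p (S r))) (nsuc w' x) = fnr w' (PS (truncated a p r)) (nsuc w' x)"
    using IH by (simp del: truncated(2))
qed

text \<open>Once the position of the original index \<open>r + 1\<close> is passed, the sums differ
  by exactly the inserted term.\<close>

lemma truncated_after:
  assumes a: "tyw w a = Some (Fun Nat Real)" and pp: "perm_pair w p i" and r: "tyw w r = Some Nat"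
    and q: "nle w (fnn w i (nsuc w (nval w r))) q"
  shows "fnr w (PS (truncated a p (S r))) q = radd w (fnr w (PS (truncated a p r)) q) (fnr w a (nsuc w (nval w r)))"
proof -
  let ?c = "sub (econs i (\<lambda>_. r)) (Lam Nat (monT (App (Var 1) (S (Var 2))) (Var 0)))"
  let ?g = "sub (econs (PS (truncated a p r)) (econs a (\<lambda>_. r))) (Lam Nat (App (App (Con CRAdd) (App (Var 1) (Var 0))) (App (Var 2) (S (Var 3)))))"
  have ty: "tyw w' a = Some (Fun Nat Real) \<and> tyw w' p = Some (Fun Nat Nat) \<and> tyw w' i = Some (Fun Nat Nat) \<and> tyw w' r = Some Nat" if "w \<sqsubseteq> w'" for w'
    using that a r perm_pairD[OF pp] tyw_mono by blast
  have c: "fnn w' ?c x = nzero w' \<longleftrightarrow> nle w' (fnn w' i (nsuc w' (nval w' r))) x" if "w \<sqsubseteq> w'" for w' x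
    using ty[OF that] by simp
  have g: "fnr w' ?g x = radd w' (fnr w' (PS (truncated a p r)) x) (fnr w' a (nsuc w' (nval w' r)))" if "w \<sqsubseteq> w'" for w' x
    using ty[OF that] by simp
  have "fnr w (PS (truncated a p (S r))) q = fnr w ?g q"
  proof (rule guarded_real_induct[of w ?c])
    show "tyw w ?c = Some (Fun Nat Nat)" "tyw w ?g = Some (Fun Nat Real)" using ty[of w] by (auto intro!: tyw_sub)
    show "tyw w (PS (truncated a p (S r))) = Some (Fun Nat Real)" using ty[of w] by simp
    show "fnn w ?c q = nzero w" using q c[of w] by simp
    \<comment> \<open>The guard fails at 0, since \<open>i\<close> maps positive indices to positive
      positions.\<close>
    show "fnr w (PS (truncated a p (S r))) (nzero w) = fnr w ?g (nzero w)" if "fnn w ?c (nzero w) = nzero w"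
      using that c[of w] perm_pairD(4)[OF pp, of "nsuc w (nval w r)"] by simp
    fix w' x assume b: "w \<sqsubseteq> w'" "fnn w' ?c x = nzero w' \<Longrightarrow> fnr w' (PS (truncated a p (S r))) x = fnr w' ?g x"
       "fnn w' ?c (nsuc w' x) = nzero w'"
    have pp': "perm_pair w' p i" using pp b(1) perm_pair_mono by blast
    have tt: "tyw w' (truncated a p (S r)) = Some (Fun Nat Real)" "tyw w' (truncated a p r) = Some (Fun Nat Real)" using ty[OF b(1)] by simp_all
    consider (eq) "fnn w' i (nsuc w' (nval w' r)) = nsuc w' x" | (le) "nle w' (fnn w' i (nsuc w' (nval w' r))) x"
      using b(3) c[OF b(1)] N.le_less[of w' _ "nsuc w' x"] nless_nsuc_iff by blast
    then show "fnr w' (PS (truncated a p (S r))) (nsuc w' x) = fnr w' ?g (nsuc w' x)"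
    proof cases
      \<comment> \<open>The inserted term enters here; up to this point the two sums agree by
        \<open>truncated_before\<close>.\<close>
      case eq
      then have px: "fnn w' p (nsuc w' x) = nsuc w' (nval w' r)" using perm_pairD(5)[OF pp', of "nsuc w' (nval w' r)"] by simp
      have "fnr w' (PS (truncated a p (S r))) x = fnr w' (PS (truncated a p r)) x"
        using truncated_before[OF _ pp', of a r x] ty[OF b(1)] eq by simp
      moreover have "fnr w' (truncated a p (S r)) (nsuc w' x) = fnr w' a (nsuc w' (nval w' r))"
        "fnr w' (truncated a p r) (nsuc w' x) = rzero w'"
        using ty[OF b(1)] px by (simp_all add: nsuc_nle_iff)
      ultimately show ?thesis unfolding g[OF b(1)] using tt by (simp del: truncated(2))
    next
      case le
      then have IH: "fnr w' (PS (truncated a p (S r))) x = fnr w' ?g x" using b c[OF b(1)] by blast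
      have "fnn w' p (nsuc w' x) \<noteq> nsuc w' (nval w' r)"
        using le perm_pairD(6)[OF pp', of "nsuc w' x"] by (auto simp: nsuc_nle_iff)
      then have "fnr w' (truncated a p (S r)) (nsuc w' x) = fnr w' (truncated a p r) (nsuc w' x)"
        using truncated_step[OF _ pp'] ty[OF b(1)] by blast
      then show ?thesis using IH tt unfolding g[OF b(1)] by (simp add: R.add_ac del: truncated(2))
    qed
  qed
  then show ?thesis using g[of w q] by simp
qed

text \<open>In \<open>truncated a p r\<close> the cutoff is a parameter of the term. Here it is the
  argument of a function term, as induction on the cutoff requires.\<close>

definition truncated_sums :: "tm \<Rightarrow> tm \<Rightarrow> tm \<Rightarrow> tm" where
  "truncated_sums a p q = sub (econs a (econs p (\<lambda>_. q))) (Lam Nat (App (App (App (Con (CRec Real)) (Con CRZero))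
     (Lam Nat (Lam Real (App (App (Con CRAdd) (Var 0)) (ifr (monT (S (Var 2)) (App (Var 4) (S (Var 1)))) (App (Var 3) (App (Var 4) (S (Var 1)))) (Con CRZero))))))
     (Var 3)))"

lemma truncated_sums:
  assumes a: "tyw w a = Some (Fun Nat Real)" and p: "tyw w p = Some (Fun Nat Nat)" and q: "tyw w q = Some Nat" and r: "tyw w r = Some Nat"
  shows "tyw w (truncated_sums a p q) = Some (Fun Nat Real)"
    "fnr w (truncated_sums a p q) (nval w r) = fnr w (PS (truncated a p r)) (nval w q)"
proof -
  show "tyw w (truncated_sums a p q) = Some (Fun Nat Real)" unfolding truncated_sums_def by (rule tyw_sub) (use a p q in simp)
  let ?\<rho> = "econs (nrep w (nval w r)) (econs a (econs p (\<lambda>_. q)))"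
  let ?G = "sub ?\<rho> (Lam Nat (Lam Real (App (App (Con CRAdd) (Var 0)) (ifr (monT (S (Var 2)) (App (Var 4) (S (Var 1)))) (App (Var 3) (App (Var 4) (S (Var 1)))) (Con CRZero)))))"
  have ty: "tyw w' a = Some (Fun Nat Real) \<and> tyw w' p = Some (Fun Nat Nat) \<and> tyw w' q = Some Nat \<and> tyw w' r = Some Nat" if "w \<sqsubseteq> w'" for w'
    using that a p q r tyw_mono by blast
  have tG: "tyw w' ?G = Some (Fun Nat (Fun Real Real))" if "w \<sqsubseteq> w'" for w' by (rule tyw_sub) (use ty[OF that] that in simp)
  have "fnr w (App (App (Con (CRec Real)) (Con CRZero)) ?G) x = fnr w (PS (truncated a p r)) x" for x
  proof (rule real_induct)
    fix w' y assume b: "w \<sqsubseteq> w'" "fnr w' (App (App (Con (CRec Real)) (Con CRZero)) ?G) y = fnr w' (PS (truncated a p r)) y"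
    have rr: "nval w' (nrep w (nval w r)) = nval w' r" using nval_mono[of w "nrep w (nval w r)" r w'] b(1) r by simp
    have "fnrr w' ?G y u = radd w' u (fnr w' (truncated a p r) (nsuc w' y))" for u
      using ty[OF b(1)] b(1) by (auto simp: rr nsuc_nle_iff N.not_less dest: N.leD)
    then show "fnr w' (App (App (Con (CRec Real)) (Con CRZero)) ?G) (nsuc w' y) = fnr w' (PS (truncated a p r)) (nsuc w' y)"
      using b(2) tG[OF b(1)] ty[OF b(1)] by (simp del: truncated(2) fnrr_beta)
  qed (use ty[of w] tG[of w] in simp_all)
  then show "fnr w (truncated_sums a p q) (nval w r) = fnr w (PS (truncated a p r)) (nval w q)"
    unfolding truncated_sums_def using a p q tG[of w] by simp
qed

text \<open>Induction on the cutoff up to \<open>L\<close>, at fixed length \<open>q\<close>: by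
  \<open>cov\<close> each new index has its position within the first \<open>q\<close>, so
  \<open>truncated_after\<close> adds exactly the corresponding term of \<open>a\<close>.\<close>

lemma PS_truncated:
  assumes a: "tyw w a = Some (Fun Nat Real)" and pp: "perm_pair w p i" and q: "tyw w q = Some Nat" and L: "tyw w L = Some Nat"
    and cov: "\<And>w' j. w \<sqsubseteq> w' \<Longrightarrow> j \<noteq> nzero w' \<Longrightarrow> nle w' j (nval w' L) \<Longrightarrow> nle w' (fnn w' i j) (nval w' q)"
  shows "fnr w (PS (truncated a p L)) (nval w q) = fnr w (PS a) (nval w L)"
proof -
  let ?c = "sub (\<lambda>_. L) (Lam Nat (monT (Var 0) (Var 1)))"
  let ?h = "truncated_sums a p q"
  have ty: "tyw w' a = Some (Fun Nat Real) \<and> tyw w' p = Some (Fun Nat Nat) \<and> tyw w' i = Some (Fun Nat Nat) \<and> tyw w' q = Some Nat \<and> tyw w' L = Some Nat" if "w \<sqsubseteq> w'" for w'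
    using that a q L perm_pairD[OF pp] tyw_mono by blast
  have c: "fnn w' ?c x = nzero w' \<longleftrightarrow> nle w' x (nval w' L)" if "w \<sqsubseteq> w'" for w' x
    using ty[OF that] by simp
  have "fnr w ?h (nval w L) = fnr w (PS a) (nval w L)"
  proof (rule guarded_real_induct[of w ?c])
    show "tyw w ?c = Some (Fun Nat Nat)" using ty[of w] by (auto intro!: tyw_sub)
    show "tyw w ?h = Some (Fun Nat Real)" "tyw w (PS a) = Some (Fun Nat Real)" using ty[of w] truncated_sums(1)[of w a p q q] by simp_all
    show "fnn w ?c (nval w L) = nzero w" using c[of w] by simp
    \<comment> \<open>With cutoff 0 every term is 0, because \<open>p\<close> takes positive values
      at positive indices.\<close>
    have "fnr w (PS (truncated a p Z)) x = fnr w (sub (\<lambda>_. Z) (Lam Nat (Con CRZero))) x" for x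
    proof (rule real_induct)
      show "tyw w (sub (\<lambda>_. Z) (Lam Nat (Con CRZero))) = Some (Fun Nat Real)" by (rule tyw_sub) simp
      fix w' y assume b: "w \<sqsubseteq> w'" "fnr w' (PS (truncated a p Z)) y = fnr w' (sub (\<lambda>_. Z) (Lam Nat (Con CRZero))) y"
      then show "fnr w' (PS (truncated a p Z)) (nsuc w' y) = fnr w' (sub (\<lambda>_. Z) (Lam Nat (Con CRZero))) (nsuc w' y)"
        using ty[OF b(1)] perm_pairD(3)[OF perm_pair_mono[OF pp b(1)], of "nsuc w' y"] by simp
    qed (use ty[of w] in simp_all)
    then show "fnr w ?h (nzero w) = fnr w (PS a) (nzero w)"
      using truncated_sums(2)[of w a p q Z] ty[of w] by simp
    fix w' x assume b: "w \<sqsubseteq> w'" "fnn w' ?c x = nzero w' \<Longrightarrow> fnr w' ?h x = fnr w' (PS a) x" "fnn w' ?c (nsuc w' x) = nzero w'"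
    have l: "nle w' (nsuc w' x) (nval w' L)" using b c[OF b(1)] by blast
    then have IH: "fnr w' ?h x = fnr w' (PS a) x" using b c[OF b(1)] N.order_trans nle_nsuc by blast
    have "nle w' (fnn w' i (nsuc w' x)) (nval w' q)" using cov[OF b(1) _ l] by simp
    then have "fnr w' (PS (truncated a p (S (nrep w' x)))) (nval w' q) =
       radd w' (fnr w' (PS (truncated a p (nrep w' x))) (nval w' q)) (fnr w' a (nsuc w' x))"
      using truncated_after[OF _ perm_pair_mono[OF pp b(1)], of a "nrep w' x" "nval w' q"] ty[OF b(1)] by simp
    moreover have "fnr w' ?h (nsuc w' x) = fnr w' (PS (truncated a p (S (nrep w' x)))) (nval w' q)"
      using truncated_sums(2)[of w' a p q "S (nrep w' x)"] ty[OF b(1)] by simp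
    moreover have "fnr w' ?h x = fnr w' (PS (truncated a p (nrep w' x))) (nval w' q)"
      using truncated_sums(2)[of w' a p q "nrep w' x"] ty[OF b(1)] by simp
    ultimately show "fnr w' ?h (nsuc w' x) = fnr w' (PS a) (nsuc w' x)" using IH ty[OF b(1)] by simp
  qed
  then show ?thesis using truncated_sums(2)[of w a p q L] ty[of w] by simp
qed

text \<open>By \<open>van\<close> the first \<open>q\<close> rearranged terms do not change when cut
  off at \<open>L\<close>; the truncated sum is then put back into original order by
  \<open>PS_truncated\<close>.\<close>

lemma PS_rearranged:
  assumes a: "tyw w a = Some (Fun Nat Real)" and pp: "perm_pair w p i" and q: "tyw w q = Some Nat" and L: "tyw w L = Some Nat"
    and cov: "\<And>w' j. w \<sqsubseteq> w' \<Longrightarrow> j \<noteq> nzero w' \<Longrightarrow> nle w' j (nval w' L) \<Longrightarrow> nle w' (fnn w' i j) (nval w' q)"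
    and van: "\<And>w' j. w \<sqsubseteq> w' \<Longrightarrow> j \<noteq> nzero w' \<Longrightarrow> nle w' j (nval w' q) \<Longrightarrow> nle w' (fnn w' p j) (nval w' L) \<or> fnr w' a (fnn w' p j) = rzero w'"
  shows "fnr w (PS (rearranged a p)) (nval w q) = fnr w (PS a) (nval w L)"
proof -
  let ?c = "sub (\<lambda>_. q) (Lam Nat (monT (Var 0) (Var 1)))"
  have ty: "tyw w' a = Some (Fun Nat Real) \<and> tyw w' p = Some (Fun Nat Nat) \<and> tyw w' q = Some Nat \<and> tyw w' L = Some Nat" if "w \<sqsubseteq> w'" for w'
    using that a q L perm_pairD[OF pp] tyw_mono by blast
  have c: "fnn w' ?c x = nzero w' \<longleftrightarrow> nle w' x (nval w' q)" if "w \<sqsubseteq> w'" for w' x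
    using ty[OF that] by simp
  have "fnr w (PS (rearranged a p)) (nval w q) = fnr w (PS (truncated a p L)) (nval w q)"
  proof (rule guarded_real_induct[of w ?c])
    show "tyw w ?c = Some (Fun Nat Nat)" using ty[of w] by (auto intro!: tyw_sub)
    show "fnn w ?c (nval w q) = nzero w" using c[of w] by simp
    fix w' x assume b: "w \<sqsubseteq> w'" "fnn w' ?c x = nzero w' \<Longrightarrow> fnr w' (PS (rearranged a p)) x = fnr w' (PS (truncated a p L)) x"
      "fnn w' ?c (nsuc w' x) = nzero w'"
    have l: "nle w' (nsuc w' x) (nval w' q)" using b c[OF b(1)] by blast
    then have IH: "fnr w' (PS (rearranged a p)) x = fnr w' (PS (truncated a p L)) x" using b c[OF b(1)] N.order_trans nle_nsuc by blast
    have "fnr w' (rearranged a p) (nsuc w' x) = fnr w' (truncated a p L) (nsuc w' x)"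
      using van[OF b(1) _ l] ty[OF b(1)] by auto
    then show "fnr w' (PS (rearranged a p)) (nsuc w' x) = fnr w' (PS (truncated a p L)) (nsuc w' x)"
      using IH ty[OF b(1)] by (simp del: truncated(2) rearranged(2))
  qed (use ty[of w] in simp_all)
  then show ?thesis using PS_truncated[OF a pp q L cov] by simp
qed

end

section \<open>The series attached to an enumeration\<close>

definition absT :: "tm \<Rightarrow> tm" where
  "absT a = sub (econs a Var) (Lam Nat (App (Con CRAbs) (App (Var 1) (Var 0))))"

text \<open>Copies what the object-level \<open>bracketing\<close> of the rearranged series unfolds
  to in the environment \<open>f\<close>, \<open>p\<close>, \<open>a\<close>, so that
  \<open>forc_bracketing_converges\<close> can identify the two terms.\<close>

definition bracketed :: "tm \<Rightarrow> tm \<Rightarrow> tm \<Rightarrow> tm" where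
  "bracketed a p f = sub (econs f (econs p (econs a Var))) (Lam Nat (App (App (App (Con (CRec Real)) (Con CRZero))
     (Lam Nat (Lam Real (App (App (Con CRAdd) (Var 0)) (App (Lam Nat (App (Var 6) (App (Var 5) (Var 0)))) (addT (App (Var 3) (Var 2)) (Var 1)))))))
     (monT (App (Var 1) (S (Var 0))) (App (Var 1) (Var 0)))))"

context consistent
begin

lemma absT [simp]:
  assumes "tyw w a = Some (Fun Nat Real)"
  shows "tyw w (absT a) = Some (Fun Nat Real)" "fnr w (absT a) x = rabs w (fnr w a x)"
  using assms unfolding absT_def by (simp_all add: tyw_sub)

lemma nless_mono:
  assumes l: "nless w (nval w s) (nval w t)" and w: "w \<sqsubseteq> w'" and t: "tyw w s = Some Nat" "tyw w t = Some Nat"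
  shows "nless w' (nval w' s) (nval w' t)"
proof -
  obtain k where "nadd w (nval w s) (nsuc w k) = nval w t" using l unfolding nless_alt by blast
  then have "nval w (addT s (S (nrep w k))) = nval w t" using t by simp
  then have "nval w' (addT s (S (nrep w k))) = nval w' t" by (rule nval_mono) (use w t in auto)
  then have "nadd w' (nval w' s) (nsuc w' (nval w' (nrep w k))) = nval w' t" using w tyw_mono[OF t(1) w] tyw_mono[OF t(2) w] by simp
  then show ?thesis unfolding nless_alt by blast
qed

lemma nle_mono:
  assumes l: "nle w (nval w s) (nval w t)" and w: "w \<sqsubseteq> w'" and t: "tyw w s = Some Nat" "tyw w t = Some Nat"
  shows "nle w' (nval w' s) (nval w' t)"
  using nless_mono[OF _ w t] nval_mono[OF _ w t] l N.le_less by blast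

section \<open>The reciprocals of the positive integers\<close>

definition recips :: "world \<Rightarrow> tm \<Rightarrow> bool" where
  "recips w v \<longleftrightarrow> tyw w v = Some (Fun Nat Real) \<and>
     (\<forall>w' k. w \<sqsubseteq> w' \<longrightarrow> rmul w' (rnat w' (nsuc w' k)) (fnr w' v k) = rone w')"

text \<open>The field axioms only assert that an inverse exists; it is unique in a ring, so unique
  choice collects the inverses into one function term.\<close>

lemma ex_recips: "\<exists>v. recips w v"
proof -
  let ?p = "Eq Real (App (App (Con CRMul) (natT (S (Var 1)))) (Var 0)) (Con CROne)"
  have "\<exists>f. tyw w f = Some (Fun Nat Real) \<and> (\<forall>w' x. w \<sqsubseteq> w' \<longrightarrow> tyw w' x = Some Nat \<longrightarrow>
     forc w' (econs (App f x) (econs x (\<lambda>_. Z))) ?p)"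
  proof (rule forc_unique_choice)
    fix w' x assume x: "tyw w' x = Some Nat"
    obtain y where "rmul w' (rnat w' (nsuc w' (nval w' x))) y = rone w'" using rinverse[OF rnat_pos] by blast
    then show "\<exists>y. tyw w' y = Some Real \<and> forc w' (econs y (econs x (\<lambda>_. Z))) ?p"
      using x by (intro exI[of _ "rrep w' y"]) simp
  next
    fix w' x y y' assume t: "tyw w' x = Some Nat" "tyw w' y = Some Real" "tyw w' y' = Some Real"
      and f: "forc w' (econs y (econs x (\<lambda>_. Z))) ?p" "forc w' (econs y' (econs x (\<lambda>_. Z))) ?p"
    let ?n = "rnat w' (nsuc w' (nval w' x))"
    have "rmul w' ?n (rval w' y) = rone w'" "rmul w' ?n (rval w' y') = rone w'" using f t by simp_all
    then have "rval w' y' = rval w' y" by (metis rmul_assoc rmul_comm rmul_1)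
    then show "Eq Real y' y \<in> Th w'" using t by simp
  qed simp
  then obtain f where f: "tyw w f = Some (Fun Nat Real)"
    and e: "\<And>w' x. w \<sqsubseteq> w' \<Longrightarrow> tyw w' x = Some Nat \<Longrightarrow> forc w' (econs (App f x) (econs x (\<lambda>_. Z))) ?p" by blast
  have "rmul w' (rnat w' (nsuc w' k)) (fnr w' f k) = rone w'" if "w \<sqsubseteq> w'" for w' k
    using e[OF that, of "nrep w' k"] tyw_mono[OF f that] by simp
  with f show ?thesis unfolding recips_def by blast
qed

lemma recips_mono: "recips w v \<Longrightarrow> w \<sqsubseteq> w' \<Longrightarrow> recips w' v"
  unfolding recips_def using tyw_mono wle_trans by blast

lemma recipsD: "recips w v \<Longrightarrow> tyw w v = Some (Fun Nat Real)" "recips w v \<Longrightarrow> rmul w (rnat w (nsuc w k)) (fnr w v k) = rone w"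
  unfolding recips_def by auto

lemma recips_pos: "recips w v \<Longrightarrow> rless w (rzero w) (fnr w v k)"
  by (rule rinverse_rnat_pos[of w "nsuc w k"]) (simp only: recipsD(2) rless_zero_one)

lemma recips_half: "recips w v \<Longrightarrow> radd w (fnr w v (nsuc w (nzero w))) (fnr w v (nsuc w (nzero w))) = rone w"
  using recipsD(2)[of w v "nsuc w (nzero w)"] by (simp add: R.distrib_right del: R.one_add_one)

text \<open>With \<open>y\<close> the inverse of \<open>e\<close>, \<open>y < n \<le> k\<close>
  gives \<open>1 < e (k + 1)\<close>; multiplying by the positive \<open>v k\<close> gives the
  claim.\<close>

lemma recips_small:
  assumes v: "recips w v" and e: "rless w (rzero w) e" "rmul w e y = rone w" "rless w y (rnat w n)" and k: "nle w n k"
  shows "rless w (fnr w v k) e"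
proof -
  have "nless w n (nsuc w k)" using k by (simp add: nless_nsuc_iff)
  then have "rless w y (rnat w (nsuc w k))" using e(3) rless_trans rnat_less by blast
  then have "rless w (rone w) (rmul w e (rnat w (nsuc w k)))" using rless_rmul_left[OF e(1)] e(2) by metis
  from rless_rmul_left[OF recips_pos[OF v] this, of k]
  have "rless w (fnr w v k) (rmul w (fnr w v k) (rmul w e (rnat w (nsuc w k))))" by simp
  moreover have "rmul w (fnr w v k) (rmul w e (rnat w (nsuc w k))) = e"
    using recipsD(2)[OF v, of k] by (metis rmul_assoc rmul_comm rmul_1)
  ultimately show ?thesis by simp
qed

section \<open>Convergence of the series, and the sums of its absolute values\<close>

definition aseq :: "tm \<Rightarrow> tm \<Rightarrow> tm" where "aseq s v = differences (zseq (runmax s) v)"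

lemma aseq_ty: "tyw w s = Some (Fun Nat Nat) \<Longrightarrow> recips w v \<Longrightarrow> tyw w (aseq s v) = Some (Fun Nat Real)"
  using recipsD(1)[of w v] by (simp add: aseq_def)

lemma PS_aseq: "tyw w s = Some (Fun Nat Nat) \<Longrightarrow> recips w v \<Longrightarrow> fnr w (PS (aseq s v)) x = fnr w (zseq (runmax s) v) x"
  unfolding aseq_def using recipsD(1)[of w v] by (intro PS_differences) simp_all

lemma conv_aseq:
  assumes s: "tyw w s = Some (Fun Nat Nat)" and v: "recips w v"
  shows "conv w (aseq s v)"
  unfolding conv_def
proof (intro exI[of _ "Con CRZero"] conjI)
  show "tends w (PS (aseq s v)) (Con CRZero)"
    unfolding tends_def
  proof (intro allI impI)
    fix w' e assume a: "w \<sqsubseteq> w'" "tyw w' e = Some Real" "rless w' (rzero w') (rval w' e)"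
    obtain y where y: "rmul w' (rval w' e) y = rone w'" using rinverse a(3) by blast
    obtain n where n: "rless w' y (rnat w' n)" using archimedean by blast
    \<comment> \<open>From the start of stage \<open>n\<close> on, a partial sum is 0 or the
      reciprocal of a number larger than \<open>n\<close>, while \<open>n\<close> exceeds the
      inverse of the tolerance.\<close>
    let ?N = "App stage_start (nrep w' n)"
    have "rless w'' (rabs w'' (rsub w'' (fnr w'' (PS (aseq s v)) x) (rval w'' (Con CRZero)))) (rval w'' e)"
      if b: "w' \<sqsubseteq> w''" "nle w'' (nval w'' ?N) x" for w'' x
    proof -
      have w: "w \<sqsubseteq> w''" using a b wle_trans by blast
      have s': "tyw w'' s = Some (Fun Nat Nat)" and v': "recips w'' v" and e': "tyw w'' e = Some Real"
        using s v w b a tyw_mono recips_mono by blast+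
      let ?n = "nval w'' (nrep w' n)" and ?y = "rval w'' (rrep w' y)"
      have e0: "rless w'' (rzero w'') (rval w'' e)" using rless_mono[of w' "Con CRZero" e w''] a b by simp
      have y': "rmul w'' (rval w'' e) ?y = rone w''"
        using rval_mono[of w' "App (App (Con CRMul) e) (rrep w' y)" "Con CROne" w''] y a b e' by simp
      have n': "rless w'' ?y (rnat w'' ?n)" using rless_mono[of w' "rrep w' y" "natT (nrep w' n)" w''] n b by simp
      have "nle w'' ?n (fnn w'' stage x)" using b by (intro stage_ge) simp
      from recips_small[OF v' e0 y' n' this] have small: "rless w'' (fnr w'' v (fnn w'' stage x)) (rval w'' e)" .
      show ?thesis using small e0 rabs_of_pos(1)[OF recips_pos[OF v']] recipsD(1)[OF v'] s' by (simp add: PS_aseq[OF s' v'])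
    qed
    then show "\<exists>N. tyw w' N = Some Nat \<and> (\<forall>w'' n. w' \<sqsubseteq> w'' \<longrightarrow> nle w'' (nval w'' N) n \<longrightarrow>
        rless w'' (rabs w'' (rsub w'' (fnr w'' (PS (aseq s v)) n) (rval w'' (Con CRZero)))) (rval w'' e))"
      by (intro exI[of _ ?N]) simp
  qed
qed simp

text \<open>At a jump the partial sums alternate between 0 and \<open>v k\<close> throughout the
  stage, so every step contributes \<open>v k\<close>. Offset \<open>k + 1\<close> is the last one
  inside a block of length \<open>k + 2\<close>; there the contributions add up to 1.\<close>

lemma jump_sum:
  assumes s: "tyw w s = Some (Fun Nat Nat)" and v: "recips w v"
    and jump: "nless w (fnn w (runmax s) k) (fnn w (runmax s) (nsuc w k))" and i: "nle w i (nsuc w k)"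
  shows "fnr w (PS (absT (aseq s v))) (nadd w (fnn w stage_start k) i) =
     radd w (fnr w (PS (absT (aseq s v))) (fnn w stage_start k)) (rmul w (rnat w i) (fnr w v k))"
proof -
  let ?k = "nrep w k" and ?A = "PS (absT (aseq s v))"
  let ?c = "sub (\<lambda>_. ?k) (Lam Nat (monT (Var 0) (S (Var 1))))"
  let ?\<rho> = "econs ?A (econs (App stage_start ?k) (\<lambda>_. App v ?k))"
  let ?f = "sub ?\<rho> (Lam Nat (App (Var 1) (addT (Var 2) (Var 0))))"
  let ?g = "sub ?\<rho> (Lam Nat (App (App (Con CRAdd) (App (Var 1) (Var 2))) (App (App (Con CRMul) (natT (Var 0))) (Var 3))))"
  have ty: "tyw w' s = Some (Fun Nat Nat) \<and> recips w' v \<and> tyw w' v = Some (Fun Nat Real) \<and> tyw w' (aseq s v) = Some (Fun Nat Real)" if "w \<sqsubseteq> w'" for w'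
    using that s v recips_mono tyw_mono recipsD(1) aseq_ty by blast
  have c: "fnn w' ?c x = nzero w' \<longleftrightarrow> nle w' x (nsuc w' (nval w' ?k))" if "w \<sqsubseteq> w'" for w' x
    using that by (simp del: nmon_rec)
  have f: "fnr w' ?f x = fnr w' ?A (nadd w' (fnn w' stage_start (nval w' ?k)) x)" if "w \<sqsubseteq> w'" for w' x
    using that ty[OF that] by simp
  have g: "fnr w' ?g x = radd w' (fnr w' ?A (fnn w' stage_start (nval w' ?k))) (rmul w' (rnat w' x) (fnr w' v (nval w' ?k)))" if "w \<sqsubseteq> w'" for w' x
    using that ty[OF that] by simp
  have "fnr w ?f i = fnr w ?g i"
  proof (rule guarded_real_induct[of w ?c])
    show "tyw w ?c = Some (Fun Nat Nat)" "tyw w ?f = Some (Fun Nat Real)" "tyw w ?g = Some (Fun Nat Real)"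
      using ty[of w] by (auto intro!: tyw_sub)
    show "fnn w ?c i = nzero w" using c[of w] i by simp
    show "fnr w ?f (nzero w) = fnr w ?g (nzero w)" unfolding f[OF wle_refl] g[OF wle_refl] by simp
    fix w' x assume b: "w \<sqsubseteq> w'" "fnn w' ?c x = nzero w' \<Longrightarrow> fnr w' ?f x = fnr w' ?g x" "fnn w' ?c (nsuc w' x) = nzero w'"
    let ?K = "nval w' ?k" and ?M = "fnn w' (runmax s)"
    let ?p = "fnn w' stage_start ?K"
    have t: "tyw w' s = Some (Fun Nat Nat)" "recips w' v" "tyw w' v = Some (Fun Nat Real)" "tyw w' (aseq s v) = Some (Fun Nat Real)"
      using ty[OF b(1)] by auto
    have l: "nle w' x ?K" using b(3) c[OF b(1)] by simp
    then have IH: "fnr w' ?A (nadd w' ?p x) = radd w' (fnr w' ?A ?p) (rmul w' (rnat w' x) (fnr w' v ?K))"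
      using b(2) c[OF b(1)] f[OF b(1)] g[OF b(1)] N.order_trans nle_nsuc by metis
    have j: "nless w' (?M ?K) (?M (nsuc w' ?K))"
      using nless_mono[of w "App (runmax s) ?k" "App (runmax s) (S ?k)" w'] jump b(1) s t by simp
    have st: "fnn w' stage y = ?K" if "nle w' ?p y" "nle w' y (nsuc w' (nadd w' ?p ?K))" for y
      using that by (intro stage_eq) (simp_all add: nless_nsuc_iff)
    have sx: "fnn w' stage (nadd w' ?p x) = ?K" using l by (intro st) (auto intro: N.order_trans[OF _ nle_nsuc])
    have sx': "fnn w' stage (nsuc w' (nadd w' ?p x)) = ?K" using l by (intro st) (auto intro: N.order_trans[OF _ nle_nsuc])
    have nj: "\<not> nle w' (?M (nsuc w' ?K)) (?M ?K)" using j N.not_le by blast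
    have zx: "fnr w' (zseq (runmax s) v) (nadd w' ?p x) = (if fnn w' parity (nadd w' ?p x) = nzero w' then rzero w' else fnr w' v ?K)"
      "fnr w' (zseq (runmax s) v) (nsuc w' (nadd w' ?p x)) = (if fnn w' parity (nsuc w' (nadd w' ?p x)) = nzero w' then rzero w' else fnr w' v ?K)"
      using t nj by (simp_all only: zseq runmax sx sx') simp_all
    have "rabs w' (fnr w' (aseq s v) (nsuc w' (nadd w' ?p x))) = fnr w' v ?K"
    proof -
      have "fnr w' (aseq s v) (nsuc w' (nadd w' ?p x)) =
         rsub w' (fnr w' (zseq (runmax s) v) (nsuc w' (nadd w' ?p x))) (fnr w' (zseq (runmax s) v) (nadd w' ?p x))"
        unfolding aseq_def using t by (simp del: zseq(2))
      \<comment> \<open>Exactly one of two consecutive indices is odd, so the difference is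
        \<open>v k\<close> or its negative.\<close>
      then show ?thesis unfolding zx parity_suc using rabs_of_pos[OF recips_pos[OF t(2)], of ?K] by auto
    qed
    then have "fnr w' ?A (nsuc w' (nadd w' ?p x)) = radd w' (fnr w' ?A (nadd w' ?p x)) (fnr w' v ?K)" using t by simp
    then show "fnr w' ?f (nsuc w' x) = fnr w' ?g (nsuc w' x)"
      unfolding f[OF b(1)] g[OF b(1)] using IH by (simp add: R.distrib_right radd_assoc)
  qed
  then show ?thesis unfolding f[OF wle_refl] g[OF wle_refl] by simp
qed

lemma bounded_of_absolutely_convergent:
  assumes s: "tyw w s = Some (Fun Nat Nat)" and v: "recips w v" and c: "conv w (absT (aseq s v))"
  shows "\<exists>N. tyw w N = Some Nat \<and> (\<forall>w' x. w \<sqsubseteq> w' \<longrightarrow> nle w' (fnn w' s x) (nval w' N))"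
proof -
  \<comment> \<open>The tolerance is \<open>v 1\<close>, that is 1/2: two sums beyond
    \<open>N\<close> then differ by less than 1, which rules out a jump. The bound for
    \<open>s\<close> is its running maximum at \<open>N\<close>.\<close>
  let ?A = "PS (absT (aseq s v))" and ?e = "App v (S Z)"
  obtain l where l: "tyw w l = Some Real" "tends w ?A l" using c unfolding conv_def by blast
  have "tyw w ?e = Some Real" "rless w (rzero w) (rval w ?e)" using recipsD(1)[OF v] recips_pos[OF v] by simp_all
  then obtain N where N: "tyw w N = Some Nat" "\<And>w' n. w \<sqsubseteq> w' \<Longrightarrow> nle w' (nval w' N) n \<Longrightarrow>
      rless w' (rabs w' (rsub w' (fnr w' ?A n) (rval w' l))) (rval w' ?e)"
    using l(2) wle_refl unfolding tends_def by metis
  have "nle w' (fnn w' s x) (fnn w' (runmax s) (nval w' N))" if w': "w \<sqsubseteq> w'" for w' x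
  proof -
    have t: "tyw w' s = Some (Fun Nat Nat)" "recips w' v" "tyw w' v = Some (Fun Nat Real)" "tyw w' N = Some Nat"
      using w' s v N(1) recips_mono tyw_mono recipsD(1) by blast+
    let ?M = "fnn w' (runmax s)"
    have stop: "nle w' (?M (nsuc w' k)) (?M k)" if k: "nle w' (nval w' N) k" for k
    proof (rule ccontr)
      assume "\<not> nle w' (?M (nsuc w' k)) (?M k)"
      then have j: "nless w' (?M k) (?M (nsuc w' k))" using N.not_le by blast
      let ?p = "fnn w' stage_start k" and ?h = "fnr w' v (nsuc w' (nzero w'))" and ?l = "rval w' l"
      have p: "nle w' (nval w' N) ?p" using k stage_start_ge N.order_trans by blast
      then have p': "nle w' (nval w' N) (nadd w' ?p (nsuc w' k))" using nle_nadd(1) N.order_trans by blast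
      have "fnr w' ?A (nadd w' ?p (nsuc w' k)) = radd w' (fnr w' ?A ?p) (rone w')"
        using jump_sum[OF t(1,2) j N.order_refl] recipsD(2)[OF t(2), of k] by simp
      moreover have "rless w' (rsub w' (fnr w' ?A (nadd w' ?p (nsuc w' k))) ?l) ?h"
        using N(2)[OF w' p'] t unfolding rless_rabs by simp
      moreover have "rless w' (rneg w' (rsub w' (fnr w' ?A ?p) ?l)) ?h"
        using N(2)[OF w' p] t unfolding rless_rabs by simp
      ultimately have a: "rless w' (rsub w' (radd w' (fnr w' ?A ?p) (rone w')) ?l) ?h"
        and b: "rless w' (rsub w' ?l (fnr w' ?A ?p)) ?h" by simp_all
      have "rless w' (radd w' (rsub w' (radd w' (fnr w' ?A ?p) (rone w')) ?l) (rsub w' ?l (fnr w' ?A ?p))) (radd w' ?h ?h)"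
        using rless_trans[OF rless_radd[OF a] rless_add_left[OF b]] .
      moreover have "radd w' (rsub w' (radd w' (fnr w' ?A ?p) (rone w')) ?l) (rsub w' ?l (fnr w' ?A ?p)) = rone w'"
        by (simp add: R.add_diff_eq)
      ultimately show False using recips_half[OF t(2)] by simp
    qed
    have "nle w' (?M x) (?M (nval w' N))"
    proof (cases "nle w' x (nval w' N)")
      case True then show ?thesis using runmax_mono[OF t(1)] by blast
    next
      case False
      then obtain j where x: "x = nadd w' (nval w' N) j" using N.linear[of w' x "nval w' N"] unfolding nle_def by auto
      have "nle w' (?M (nadd w' (nval w' N) j)) (?M (nval w' N))"
      proof (induction j rule: dec_induct[where w=w'])
        case dec show ?case using t by (intro dec_nle dfn_comp dfn_nadd dfn_const dfn_id) simp
      next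
        case (suc j)
        then show ?case using N.order_trans[OF stop[of "nadd w' (nval w' N) j"]] by (simp only: nadd_rec nle_nadd)
      qed simp
      then show ?thesis by (simp add: x)
    qed
    then show ?thesis using runmax_ge[OF t(1)] N.order_trans by blast
  qed
  then have "nle w' (fnn w' s x) (nval w' (App (runmax s) N))" if "w \<sqsubseteq> w'" for w' x
    using that tyw_mono[OF N(1) that] tyw_mono[OF s that] by simp
  then show ?thesis using N(1) s by (intro exI[of _ "App (runmax s) N"]) simp
qed

end

section \<open>Rearrangements of the series\<close>

context consistent
begin

definition memb :: "world \<Rightarrow> tm \<Rightarrow> nidx \<Rightarrow> bool" where "memb w A x \<longleftrightarrow> Mem (nrep w x) A \<in> Th w"

lemma Mem_nval [simp]: "tyw w t = Some Nat \<Longrightarrow> tyw w A = Some (Pow Nat) \<Longrightarrow> Mem t A \<in> Th w \<longleftrightarrow> memb w A (nval w t)"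
  unfolding memb_def
  using forc_Eq_subst[of Nat t "nrep w (nval w t)" w "\<lambda>_. A" "Mem (Var 0) (Var 1)"]
    forc_Eq_subst[of Nat "nrep w (nval w t)" t w "\<lambda>_. A" "Mem (Var 0) (Var 1)"] by auto

lemma nle_one [simp]: "nle w (nsuc w (nzero w)) x \<longleftrightarrow> x \<noteq> nzero w"
  by (simp add: nsuc_nle_iff nzero_nless)

text \<open>The maximum is always one of the terms. Membership is not given by a function term, so
  \<open>forc_induct\<close> is used instead of \<open>dec_induct\<close>.\<close>

lemma runmax_memb:
  assumes s: "tyw w s = Some (Fun Nat Nat)" and A: "tyw w A = Some (Pow Nat)"
    and m: "\<And>w' x. w \<sqsubseteq> w' \<Longrightarrow> memb w' A (fnn w' s x)"
  shows "memb w A (fnn w (runmax s) x)"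
proof -
  have ty: "tyw w' s = Some (Fun Nat Nat) \<and> tyw w' A = Some (Pow Nat)" if "w \<sqsubseteq> w'" for w' using s A that tyw_mono by blast
  have "forc w (econs (nrep w x) (econs (runmax s) (\<lambda>_. A))) (Mem (App (Var 1) (Var 0)) (Var 2))"
  proof (rule forc_induct)
    fix w' t assume b: "w \<sqsubseteq> w'" "tyw w' t = Some Nat" "forc w' (econs t (econs (runmax s) (\<lambda>_. A))) (Mem (App (Var 1) (Var 0)) (Var 2))"
    have t: "tyw w' s = Some (Fun Nat Nat)" "tyw w' A = Some (Pow Nat)" using ty[OF b(1)] by auto
    have "memb w' A (fnn w' (runmax s) (nval w' t))" using b(2,3) t by (simp del: runmax(3))
    then have "memb w' A (fnn w' (runmax s) (nsuc w' (nval w' t)))"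
      using runmax_suc[OF t(1), of "nval w' t"] m[OF b(1), of "nsuc w' (nval w' t)"] by metis
    then show "forc w' (econs (S t) (econs (runmax s) (\<lambda>_. A))) (Mem (App (Var 1) (Var 0)) (Var 2))"
      using b(2) t by (simp del: runmax(3))
  qed (use s A m[of w] in simp_all)
  then show ?thesis using s A by (simp del: runmax(3))
qed

text \<open>Monotonicity squeezes the maxima at the stage of \<open>y\<close> and at the next one
  between those at \<open>x\<close> and \<open>q + 1\<close>, so this stage has no jump.\<close>

lemma zseq_vanishes:
  assumes s: "tyw w s = Some (Fun Nat Nat)" and v: "tyw w v = Some (Fun Nat Real)"
    and good: "nle w (fnn w (runmax s) (nsuc w q)) (fnn w (runmax s) x)"
    and y: "nle w (fnn w stage_start x) y" "nle w (fnn w stage y) q"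
  shows "fnr w (zseq (runmax s) v) y = rzero w"
proof -
  have "nle w (fnn w (runmax s) (nsuc w (fnn w stage y))) (fnn w (runmax s) (nsuc w q))"
    using y(2) by (intro runmax_mono[OF s]) simp
  moreover have "nle w (fnn w (runmax s) x) (fnn w (runmax s) (fnn w stage y))"
    using stage_ge[OF y(1)] by (rule runmax_mono[OF s])
  ultimately have "nle w (fnn w (runmax s) (nsuc w (fnn w stage y))) (fnn w (runmax s) (fnn w stage y))"
    using good N.order_trans by blast
  then show ?thesis using s v by (simp del: runmax(3))
qed

text \<open>The maximum does not grow from stage \<open>x\<close> to beyond
  \<open>reach p i x\<close>, so the terms among the first \<open>cover i x\<close> whose original
  index exceeds \<open>stage_start x\<close> vanish. The sum equals the one up to
  \<open>stage_start x\<close> in original order, which is the value of \<open>zseq\<close>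
  there.\<close>

lemma PS_rearranged_good:
  assumes s: "tyw w s = Some (Fun Nat Nat)" and v: "recips w v" and pp: "perm_pair w p i"
    and good: "nle w (fnn w (runmax s) (nsuc w (fnn w (reach p i) x))) (fnn w (runmax s) x)"
  shows "fnr w (PS (rearranged (aseq s v) p)) (fnn w (cover i) x) = rzero w"
proof -
  let ?x = "nrep w x"
  have ty: "tyw w' s = Some (Fun Nat Nat)" "recips w' v" "tyw w' v = Some (Fun Nat Real)" "perm_pair w' p i"
     "tyw w' p = Some (Fun Nat Nat)" "tyw w' i = Some (Fun Nat Nat)" if "w \<sqsubseteq> w'" for w'
    using that s v pp recips_mono tyw_mono recipsD(1) perm_pair_mono perm_pairD(1,2) by blast+
  have good': "nle w' (fnn w' (runmax s) (nsuc w' (fnn w' (reach p i) (nval w' ?x)))) (fnn w' (runmax s) (nval w' ?x))"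
    if "w \<sqsubseteq> w'" for w'
    using nle_mono[of w "App (runmax s) (S (App (reach p i) ?x))" "App (runmax s) ?x" w'] good that ty[OF that] ty[of w]
    by (simp del: runmax(3) reach(2))
  have qx: "nle w' y (fnn w' (reach p i) y)" if "w \<sqsubseteq> w'" for w' y using ty[OF that] by (simp del: cover(2))
  have "fnr w (PS (rearranged (aseq s v) p)) (nval w (App (cover i) ?x)) = fnr w (PS (aseq s v)) (nval w (App stage_start ?x))"
  proof (rule PS_rearranged[OF _ pp])
    fix w' j assume b: "w \<sqsubseteq> w'" "j \<noteq> nzero w'" "nle w' j (nval w' (App stage_start ?x))"
    then have "nle w' (fnn w' i j) (fnn w' (sumN i) (fnn w' stage_start (nval w' ?x)))"
      using ty[OF b(1)] by (intro sumN_ge) simp_all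
    then show "nle w' (fnn w' i j) (nval w' (App (cover i) ?x))"
      using ty[OF b(1)] b(1) N.order_trans nle_nadd(2) by simp
  next
    fix w' j assume b: "w \<sqsubseteq> w'" "j \<noteq> nzero w'" "nle w' j (nval w' (App (cover i) ?x))"
    note t = ty[OF b(1)]
    let ?X = "nval w' ?x"
    have "nle w' (fnn w' p j) (fnn w' (sumN p) (fnn w' (cover i) ?X))"
      using t b by (intro sumN_ge) simp_all
    then have Q: "nle w' (fnn w' p j) (fnn w' (reach p i) ?X)"
      using t N.order_trans[OF _ nle_nadd(2)] by (simp del: cover(2))
    \<comment> \<open>A term of \<open>aseq\<close> at \<open>y + 1\<close> involves
      \<open>zseq\<close> at \<open>y\<close> as well; lying strictly beyond
      \<open>stage_start x\<close> puts both arguments at or beyond it.\<close>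
    obtain y where y: "fnn w' p j = nsuc w' y" using perm_pairD(3)[OF t(4) b(2)] nidx_cases by blast
    show "nle w' (fnn w' p j) (nval w' (App stage_start ?x)) \<or> fnr w' (aseq s v) (fnn w' p j) = rzero w'"
    proof (cases "nle w' (fnn w' p j) (fnn w' stage_start ?X)")
      case True then show ?thesis using b(1) by simp
    next
      case False
      then have l: "nle w' (fnn w' stage_start ?X) y" unfolding y N.not_le nless_nsuc_iff .
      have yQ: "nle w' (nsuc w' y) (fnn w' (reach p i) ?X)" using Q y by simp
      have "fnr w' (zseq (runmax s) v) (nsuc w' y) = rzero w'" "fnr w' (zseq (runmax s) v) y = rzero w'"
        using l yQ stage_le[of w'] N.order_trans nle_nsuc
        by (intro zseq_vanishes[OF t(1,3) good'[OF b(1)]]; blast)+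
      then have "fnr w' (aseq s v) (nsuc w' y) = rzero w'"
        unfolding aseq_def using t by (simp del: zseq(2))
      then show ?thesis by (simp add: y)
    qed
  qed (use aseq_ty[OF s v] ty[of w] in simp_all)
  moreover have "fnr w (zseq (runmax s) v) (fnn w stage_start x) = rzero w"
  proof (rule zseq_vanishes[OF s recipsD(1)[OF v] good N.order_refl])
    have "fnn w stage (fnn w stage_start x) = x" using stage_start_less by (intro stage_eq) simp_all
    then show "nle w (fnn w stage (fnn w stage_start x)) (fnn w (reach p i) x)" using qx[of w] by simp
  qed
  ultimately show ?thesis using ty[of w] by (simp add: PS_aseq[OF s v] del: zseq(2) cover(2))
qed

section \<open>Brackets of a rearranged series\<close>

lemma bracketed:
  assumes t: "tyw w a = Some (Fun Nat Real)" "tyw w p = Some (Fun Nat Nat)" "tyw w f = Some (Fun Nat Nat)"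
  shows "tyw w (bracketed a p f) = Some (Fun Nat Real)"
    "fnn w f k = nsuc w m \<Longrightarrow> radd w (fnr w (PS (rearranged a p)) m) (fnr w (bracketed a p f) k)
      = fnr w (PS (rearranged a p)) (nadd w m (nmon w (fnn w f (nsuc w k)) (fnn w f k)))"
proof -
  let ?B = "Lam Nat (Lam Real (App (App (Con CRAdd) (Var 0)) (App (Lam Nat (App (Var 6) (App (Var 5) (Var 0)))) (addT (App (Var 3) (Var 2)) (Var 1)))))"
  let ?\<rho> = "econs (nrep w k) (econs f (econs p (econs a Var)))"
  have ty: "tyw w' a = Some (Fun Nat Real)" "tyw w' p = Some (Fun Nat Nat)" "tyw w' f = Some (Fun Nat Nat)" if "w \<sqsubseteq> w'" for w'
    using that t tyw_mono by blast+
  show "tyw w (bracketed a p f) = Some (Fun Nat Real)" unfolding bracketed_def by (rule tyw_sub) (use t in simp)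
  assume m: "fnn w f k = nsuc w m"
  have G: "tyw w (sub ?\<rho> ?B) = Some (Fun Nat (Fun Real Real))" by (rule tyw_sub) (use t in simp)
  have "radd w (fnr w (PS (rearranged a p)) m) (fnr w (App (App (Con (CRec Real)) (Con CRZero)) (sub ?\<rho> ?B)) x)
      = fnr w (PS (rearranged a p)) (nadd w m x)" for x
  proof (rule segment_sum[where m="App f (nrep w k)"])
    fix w' j y assume b: "w \<sqsubseteq> w'"
    show "fnrr w' (sub ?\<rho> ?B) j y = radd w' y (fnr w' (rearranged a p) (nadd w' (nval w' (App f (nrep w k))) j))"
      using ty[OF b] b by (simp add: tyw_sub)
  qed (use t m G in simp_all)
  then show "radd w (fnr w (PS (rearranged a p)) m) (fnr w (bracketed a p f) k)
      = fnr w (PS (rearranged a p)) (nadd w m (nmon w (fnn w f (nsuc w k)) (fnn w f k)))"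
    unfolding bracketed_def using t G by simp
qed

text \<open>Consecutive brackets adjoin, so their first \<open>x\<close> sums add up to the
  rearranged series through the index just before the start \<open>f x\<close>.\<close>

lemma PS_bracketed:
  assumes t: "tyw w a = Some (Fun Nat Real)" "tyw w p = Some (Fun Nat Nat)" "tyw w f = Some (Fun Nat Nat)"
    and f0: "\<And>w'. w \<sqsubseteq> w' \<Longrightarrow> fnn w' f (nzero w') = nsuc w' (nzero w')"
    and f1: "\<And>w' x. w \<sqsubseteq> w' \<Longrightarrow> nless w' (fnn w' f x) (fnn w' f (nsuc w' x))"
  shows "fnr w (PS (bracketed a p (bracket_fun f))) x = fnr w (PS (rearranged a p)) (npred w (fnn w f x))"
proof -
  let ?b = "bracketed a p (bracket_fun f)" and ?r = "PS (rearranged a p)"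
  let ?g = "sub (econs ?r (\<lambda>_. f)) (Lam Nat (App (Var 1) (predT (App (Var 2) (Var 0)))))"
  have tb: "tyw w ?b = Some (Fun Nat Real)" using t by (intro bracketed(1)) simp_all
  have ty: "tyw w' a = Some (Fun Nat Real)" "tyw w' p = Some (Fun Nat Nat)" "tyw w' f = Some (Fun Nat Nat)"
    "tyw w' ?b = Some (Fun Nat Real)" if "w \<sqsubseteq> w'" for w'
    using that t tb tyw_mono by blast+
  have g: "fnr w' ?g y = fnr w' ?r (npred w' (fnn w' f y))" if "w \<sqsubseteq> w'" for w' y using ty[OF that] by simp
  have "fnr w (PS ?b) x = fnr w ?g x"
  proof (rule real_induct)
    show "tyw w (PS ?b) = Some (Fun Nat Real)" "tyw w ?g = Some (Fun Nat Real)" using ty[of w] by (auto intro!: tyw_sub)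
    show "fnr w (PS ?b) (nzero w) = fnr w ?g (nzero w)" unfolding g[OF wle_refl] using ty[of w] f0[of w] by simp
    fix w' y assume b: "w \<sqsubseteq> w'" "fnr w' (PS ?b) y = fnr w' ?g y"
    note t = ty[OF b(1)]
    have "nless w' (nzero w') (fnn w' f y)"
    proof (cases "y = nzero w'")
      case True then show ?thesis using f0[OF b(1)] by simp
    next
      case False
      then obtain u where "y = nsuc w' u" using nidx_cases by blast
      then show ?thesis using f1[OF b(1), of u] N.le_less_trans nle_nzero by blast
    qed
    then obtain m where m: "fnn w' f y = nsuc w' m" using nidx_cases[of "fnn w' f y" w'] by auto
    obtain d where d: "fnn w' f (nsuc w' y) = nadd w' (nsuc w' m) d" using f1[OF b(1), of y] m N.less_imp_le unfolding nle_def by metis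
    have "fnr w' (PS ?b) y = fnr w' ?r m" using b(2) g[OF b(1)] m by simp
    moreover have "radd w' (fnr w' ?r m) (fnr w' ?b (nsuc w' y)) = fnr w' ?r (nadd w' m d)"
      using bracketed(2)[of w' a p "bracket_fun f" "nsuc w' y" m] t m d
      by (simp del: nsuc_nadd nmon_rec)
    ultimately show "fnr w' (PS ?b) (nsuc w' y) = fnr w' ?g (nsuc w' y)"
      unfolding g[OF b(1)] using t d by simp
  qed
  then show ?thesis using g[of w x] by simp
qed

text \<open>The forced meaning of pseudoboundedness, stated for sequences whose value at 0 lies in
  the set as well.\<close>

definition pseudob :: "world \<Rightarrow> tm \<Rightarrow> bool" where
  "pseudob w A \<longleftrightarrow> (\<forall>w' t. w \<sqsubseteq> w' \<longrightarrow> tyw w' t = Some (Fun Nat Nat) \<longrightarrow> (\<forall>w'' x. w' \<sqsubseteq> w'' \<longrightarrow> memb w'' A (fnn w'' t x)) \<longrightarrow>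
     (\<exists>N. tyw w' N = Some Nat \<and> (\<forall>w'' n. w' \<sqsubseteq> w'' \<longrightarrow> nle w'' (nval w'' N) n \<longrightarrow> nless w'' (fnn w'' t n) n)))"

definition bracket_map :: "world \<Rightarrow> tm \<Rightarrow> bool" where
  "bracket_map w f \<longleftrightarrow> tyw w f = Some (Fun Nat Nat) \<and> (\<forall>w'. w \<sqsubseteq> w' \<longrightarrow>
     (\<forall>x. x \<noteq> nzero w' \<longrightarrow> fnn w' f x \<noteq> nzero w') \<and>
     (\<forall>x y. x \<noteq> nzero w' \<longrightarrow> nless w' x y \<longrightarrow> nless w' (fnn w' f x) (fnn w' f y)) \<and>
     fnn w' f (nsuc w' (nzero w')) = nsuc w' (nzero w'))"

text \<open>Pseudoboundedness of \<open>search_max\<close> gives \<open>N\<close> such that from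
  \<open>N\<close> on the maximum found by the search stays below the number of rounds. So those
  searches have stopped at good stages, and the bracketed partial sums are exactly 0.\<close>

lemma convergent_bracketing:
  assumes s: "tyw w s = Some (Fun Nat Nat)" and v: "recips w v" and A: "tyw w A = Some (Pow Nat)"
    and m: "\<And>w' x. w \<sqsubseteq> w' \<Longrightarrow> memb w' A (fnn w' s x)" and pb: "pseudob w A" and pp: "perm_pair w p i"
  shows "\<exists>f. bracket_map w f \<and> conv w (bracketed (aseq s v) p f)"
proof -
  let ?M = "runmax s" and ?c = "cover i" and ?Q = "reach p i"
  define G where "G = search ?M ?Q"
  define F where "F = bracket_start ?c G"
  define X where "X w' k = fnnn w' G (fnn w' F k) k" for w' k
  let ?t = "search_max ?M G F"
  have ty: "tyw w' s = Some (Fun Nat Nat)" "recips w' v" "tyw w' A = Some (Pow Nat)" "perm_pair w' p i"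
     "tyw w' p = Some (Fun Nat Nat)" "tyw w' i = Some (Fun Nat Nat)" "tyw w' (aseq s v) = Some (Fun Nat Real)" if "w \<sqsubseteq> w'" for w'
    using that s v A pp recips_mono tyw_mono perm_pair_mono perm_pairD(1,2) aseq_ty by blast+
  have tG: "tyw w' G = Some (Fun Nat (Fun Nat Nat))" if "w \<sqsubseteq> w'" for w' using ty[OF that] by (simp add: G_def)
  have tF: "tyw w' F = Some (Fun Nat Nat)" if "w \<sqsubseteq> w'" for w' using ty[OF that] tG[OF that] by (simp add: F_def)
  have F0: "fnn w' F (nzero w') = nsuc w' (nzero w')" and F1: "fnn w' F (nsuc w' k) = nsuc w' (fnn w' ?c (X w' k))" if "w \<sqsubseteq> w'" for w' k
    using ty[OF that] tG[OF that] unfolding X_def by (simp_all add: F_def del: cover(2))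
  have Qge: "nle w' y (fnn w' ?Q y)" and cge: "nle w' y (fnn w' ?c y)" if "w \<sqsubseteq> w'" for w' y using ty[OF that] by (simp_all del: cover(2), simp)
  have XG: "nle w' (fnn w' F k) (X w' k) \<and> (nle w' (fnn w' ?M (nsuc w' (fnn w' ?Q (X w' k)))) (fnn w' ?M (X w' k)) \<or> nle w' k (fnn w' ?M (X w' k)))"
    if "w \<sqsubseteq> w'" for w' k
    unfolding X_def G_def using ty[OF that] by (intro search_good Qge[OF that]) (simp_all del: reach(2))
  have Fstep: "nless w' (fnn w' F k) (fnn w' F (nsuc w' k))" if "w \<sqsubseteq> w'" for w' k
    unfolding F1[OF that] nless_nsuc_iff using XG[OF that] cge[OF that] N.order_trans by blast
  have Fpos: "fnn w' F k \<noteq> nzero w'" if w': "w \<sqsubseteq> w'" for w' k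
    using nidx_cases[of k w'] F0[OF w'] F1[OF w'] by auto
  have bm: "bracket_map w (bracket_fun F)"
    unfolding bracket_map_def
  proof (intro conjI allI impI)
    show "tyw w (bracket_fun F) = Some (Fun Nat Nat)" using tF by simp
    fix w' assume w': "w \<sqsubseteq> w'"
    show "fnn w' (bracket_fun F) x \<noteq> nzero w'" for x using tF[OF w'] Fpos[OF w'] by simp
    show "fnn w' (bracket_fun F) (nsuc w' (nzero w')) = nsuc w' (nzero w')" using tF[OF w'] F0[OF w'] by simp
    fix x y assume xy: "x \<noteq> nzero w'" "nless w' x y"
    then obtain x' y' where "x = nsuc w' x'" "y = nsuc w' y'" using nidx_cases nless_nzero by metis
    then show "nless w' (fnn w' (bracket_fun F) x) (fnn w' (bracket_fun F) y)"
      using tF[OF w'] xy by (simp add: strict_mono_step[OF _ Fstep[OF w']])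
  qed
  have "\<exists>N. tyw w N = Some Nat \<and> (\<forall>w' n. w \<sqsubseteq> w' \<longrightarrow> nle w' (nval w' N) n \<longrightarrow> nless w' (fnn w' ?t n) n)"
  proof -
    have tt: "tyw w ?t = Some (Fun Nat Nat)" using ty[of w] tG[of w] tF[of w] by simp
    have "memb w' A (fnn w' ?t x)" if "w \<sqsubseteq> w'" for w' x
    proof -
      have "memb w' A (fnn w' ?M y)" for y
        using ty[OF that] m that wle_trans by (intro runmax_memb) blast+
      then show ?thesis using ty[OF that] tG[OF that] tF[OF that] by simp
    qed
    then show ?thesis using pb tt wle_refl unfolding pseudob_def by blast
  qed
  then obtain N where N: "tyw w N = Some Nat" "\<And>w' n. w \<sqsubseteq> w' \<Longrightarrow> nle w' (nval w' N) n \<Longrightarrow> nless w' (fnn w' ?t n) n" by blast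
  let ?b = "bracketed (aseq s v) p (bracket_fun F)"
  have zero: "fnr w' (PS ?b) n = rzero w'" if w': "w \<sqsubseteq> w'" and n: "nle w' (nval w' (S N)) n" for w' n
  proof -
    have N': "tyw w' N = Some Nat" using N(1) w' tyw_mono by blast
    \<comment> \<open>Because of the shift in \<open>bracket_fun\<close>, \<open>k + 1\<close>
      brackets end at the \<open>cover\<close> of the \<open>k\<close>-th search result; hence the
      threshold \<open>S N\<close>.\<close>
    obtain k where k: "n = nsuc w' k" using n N' nidx_cases[of n w'] by auto
    have "nle w' (nval w' N) k" using n k N' by simp
    then have "\<not> nle w' k (fnn w' ?M (X w' k))"
      using N(2)[OF w'] ty[OF w'] tG[OF w'] tF[OF w'] unfolding X_def N.not_le by simp
    then have "nle w' (fnn w' ?M (nsuc w' (fnn w' ?Q (X w' k)))) (fnn w' ?M (X w' k))" using XG[OF w', of k] by blast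
    then have "fnr w' (PS (rearranged (aseq s v) p)) (fnn w' ?c (X w' k)) = rzero w'"
      using ty[OF w'] by (intro PS_rearranged_good)
    moreover have "fnr w' (PS ?b) n = fnr w' (PS (rearranged (aseq s v) p)) (npred w' (fnn w' F n))"
      using ty[OF w'] tF[OF w'] w' by (intro PS_bracketed) (auto intro: F0 Fstep wle_trans)
    ultimately show ?thesis by (simp only: k F1[OF w'] npred_rec)
  qed
  have "tends w (PS ?b) (Con CRZero)"
    unfolding tends_def
  proof (intro allI impI)
    fix w' e assume a: "w \<sqsubseteq> w'" "tyw w' e = Some Real" "rless w' (rzero w') (rval w' e)"
    show "\<exists>N. tyw w' N = Some Nat \<and> (\<forall>w'' n. w' \<sqsubseteq> w'' \<longrightarrow> nle w'' (nval w'' N) n \<longrightarrow>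
       rless w'' (rabs w'' (rsub w'' (fnr w'' (PS ?b) n) (rval w'' (Con CRZero)))) (rval w'' e))"
    proof (intro exI[of _ "S N"] conjI allI impI)
      show "tyw w' (S N) = Some Nat" using N(1) a tyw_mono[of w N Nat w'] by simp
      fix w'' n assume b: "w' \<sqsubseteq> w''" "nle w'' (nval w'' (S N)) n"
      have w'': "w \<sqsubseteq> w''" using a b wle_trans by blast
      have "rless w'' (rzero w'') (rval w'' e)" using rless_mono[of w' "Con CRZero" e w''] a b by simp
      then show "rless w'' (rabs w'' (rsub w'' (fnr w'' (PS ?b) n) (rval w'' (Con CRZero)))) (rval w'' e)"
        using zero[OF w'' b(2)] by simp
    qed
  qed
  then have "conv w ?b" unfolding conv_def by (intro exI[of _ "Con CRZero"]) simp
  with bm show ?thesis by blast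
qed

end

section \<open>Meaning of the object statements in the canonical model\<close>

lemma up_sub_numeral [simp]: "up_sub s (numeral k) = ren Suc (s (pred_numeral k))"
  by (simp add: up_sub_def numeral_eq_Suc)

context consistent
begin

lemma forc_impD: "forc w \<rho> (Imp p q) \<Longrightarrow> w \<sqsubseteq> w' \<Longrightarrow> forc w' \<rho> p \<Longrightarrow> forc w' \<rho> q"
  by simp

lemma forc_allD: "forc w \<rho> (Forall \<sigma> p) \<Longrightarrow> w \<sqsubseteq> w' \<Longrightarrow> tyw w' x = Some \<sigma> \<Longrightarrow> forc w' (econs x \<rho>) p"
  by simp

lemma forc_absolutely_convergent:
  assumes a: "tyw w a = Some (Fun Nat Real)"
  shows "forc w (econs a \<rho>) (absolutely_convergent (bvar 0) (Suc 0)) \<longleftrightarrow> conv w (absT a)"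
  unfolding absolutely_convergent_def
proof (rule forc_series_converges)
  fix w' assume "w \<sqsubseteq> w'"
  then have "tyw w' a = Some (Fun Nat Real)" using a tyw_mono by blast
  then show "tyc (econs c1 (econs c2 (econs c3 (econs c4 (econs c5 (econs c6 (econs c7 (\<lambda>i. tyw w' (econs a \<rho> i)))))))))
     ((\<^bold>\<lambda>\<^bsub>Nat\<^esub> \<lambda>n. absR (bvar 0 \<cdot> n)) (Suc (Suc (Suc (Suc (Suc (Suc (Suc (Suc 0))))))))) = Some (Fun Nat Real)" for c1 c2 c3 c4 c5 c6 c7
    by (simp add: unfold_btm)
qed (use absT(1)[OF a] in \<open>simp_all add: unfold_btm absT_def sub.simps(4)\<close>)

lemma forc_series_converges_var:
  assumes a: "tyw w a = Some (Fun Nat Real)"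
  shows "forc w (econs a \<rho>) (series_converges (bvar 0) (Suc 0)) \<longleftrightarrow> conv w a"
proof (rule forc_series_converges)
  fix w' assume "w \<sqsubseteq> w'"
  then have "tyw w' a = Some (Fun Nat Real)" using a tyw_mono by blast
  then show "tyc (econs c1 (econs c2 (econs c3 (econs c4 (econs c5 (econs c6 (econs c7 (\<lambda>i. tyw w' (econs a \<rho> i)))))))))
     (bvar 0 (Suc (Suc (Suc (Suc (Suc (Suc (Suc (Suc 0))))))))) = Some (Fun Nat Real)" for c1 c2 c3 c4 c5 c6 c7
    by (simp add: unfold_btm)
qed (use a in \<open>simp_all add: unfold_btm\<close>)

lemma forc_bracketing_converges:
  assumes t: "tyw w a = Some (Fun Nat Real)" "tyw w p = Some (Fun Nat Nat)" "tyw w f = Some (Fun Nat Nat)"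
  shows "forc w (econs f (econs p (econs a \<rho>)))
    (series_converges (bracketing (\<^bold>\<lambda>\<^bsub>Nat\<^esub> \<lambda>n. bvar 0 \<cdot> (bvar 1 \<cdot> n)) (bvar 2)) (Suc (Suc (Suc 0)))) \<longleftrightarrow> conv w (bracketed a p f)"
proof (rule forc_series_converges)
  fix w' assume "w \<sqsubseteq> w'"
  then have "tyw w' a = Some (Fun Nat Real)" "tyw w' p = Some (Fun Nat Nat)" "tyw w' f = Some (Fun Nat Nat)"
    using t tyw_mono by blast+
  then show "tyc (econs c1 (econs c2 (econs c3 (econs c4 (econs c5 (econs c6 (econs c7 (\<lambda>i. tyw w' (econs f (econs p (econs a \<rho>)) i)))))))))
     (bracketing (\<^bold>\<lambda>\<^bsub>Nat\<^esub> \<lambda>n. bvar 0 \<cdot> (bvar 1 \<cdot> n)) (bvar 2) (Suc (Suc (Suc (Suc (Suc (Suc (Suc (Suc (Suc (Suc 0)))))))))))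
      = Some (Fun Nat Real)" for c1 c2 c3 c4 c5 c6 c7
    by (simp add: unfold_btm bracketing_def sumR_def recN_def)
qed (use t bracketed(1)[OF t] in \<open>simp_all add: unfold_btm bracketing_def sumR_def recN_def bracketed_def sub.simps(4) addT_def monT_def ADDSTEP_def MONSTEP_def PREDSTEP_def\<close>)

lemma forc_bracketing_map:
  assumes f: "bracket_map w f"
  shows "forc w (econs f \<rho>) (bracketing_map (bvar 2) (Suc (Suc (Suc 0))))"
proof -
  have ty: "tyw w' f = Some (Fun Nat Nat)" if "w \<sqsubseteq> w'" for w' using f that tyw_mono unfolding bracket_map_def by blast
  have u: "bracketing_map (bvar 2) (Suc (Suc (Suc 0))) = Conj
     (Forall Nat (Imp (Exists Nat (Eq Nat (addT (S Z) (Var 0)) (Var 1))) (Exists Nat (Eq Nat (addT (S Z) (Var 0)) (App (Var 2) (Var 1))))))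
     (Conj (Forall Nat (Forall Nat (Imp (Conj (Exists Nat (Eq Nat (addT (S Z) (Var 0)) (Var 2))) (Exists Nat (Eq Nat (addT (S (Var 2)) (Var 0)) (Var 1))))
         (Exists Nat (Eq Nat (addT (S (App (Var 3) (Var 2))) (Var 0)) (App (Var 3) (Var 1)))))))
       (Eq Nat (App (Var 0) (S Z)) (S Z)))"
    by (simp add: bracketing_map_def pos_def unfold_btm eval_nat_numeral)
  show ?thesis unfolding u forc.simps(5)
  proof (intro conjI)
    show "forc w (econs f \<rho>) (Eq Nat (App (Var 0) (S Z)) (S Z))"
      using f ty[of w] unfolding bracket_map_def by simp
    show "forc w (econs f \<rho>) (Forall Nat (Imp (Exists Nat (Eq Nat (addT (S Z) (Var 0)) (Var 1))) (Exists Nat (Eq Nat (addT (S Z) (Var 0)) (App (Var 2) (Var 1))))))"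
    proof (subst forc.simps(8), intro allI impI, subst forc.simps(7), intro allI impI)
      fix w1 t w' assume a: "w \<sqsubseteq> w1" "tyw w1 t = Some Nat" "w1 \<sqsubseteq> w'" "forc w' (econs t (econs f \<rho>)) (Exists Nat (Eq Nat (addT (S Z) (Var 0)) (Var 1)))"
      have w': "w \<sqsubseteq> w'" "tyw w' t = Some Nat" using a wle_trans tyw_mono by blast+
      then show "forc w' (econs t (econs f \<rho>)) (Exists Nat (Eq Nat (addT (S Z) (Var 0)) (App (Var 2) (Var 1))))"
        using f a(4) ty[OF w'(1)] unfolding bracket_map_def by simp
    qed
    show "forc w (econs f \<rho>) (Forall Nat (Forall Nat (Imp (Conj (Exists Nat (Eq Nat (addT (S Z) (Var 0)) (Var 2))) (Exists Nat (Eq Nat (addT (S (Var 2)) (Var 0)) (Var 1))))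
         (Exists Nat (Eq Nat (addT (S (App (Var 3) (Var 2))) (Var 0)) (App (Var 3) (Var 1)))))))"
    proof (subst forc.simps(8), intro allI impI, subst forc.simps(8), intro allI impI, subst forc.simps(7), intro allI impI)
      fix w1 t w2 u w' assume a: "w \<sqsubseteq> w1" "tyw w1 t = Some Nat" "w1 \<sqsubseteq> w2" "tyw w2 u = Some Nat" "w2 \<sqsubseteq> w'"
       "forc w' (econs u (econs t (econs f \<rho>))) (Conj (Exists Nat (Eq Nat (addT (S Z) (Var 0)) (Var 2))) (Exists Nat (Eq Nat (addT (S (Var 2)) (Var 0)) (Var 1))))"
      have w': "w \<sqsubseteq> w'" "tyw w' t = Some Nat" "tyw w' u = Some Nat" using a wle_trans tyw_mono by blast+
      then have "nval w' t \<noteq> nzero w'" "nless w' (nval w' t) (nval w' u)" using a(6) by (simp_all add: nless_def)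
      then have "nless w' (fnn w' f (nval w' t)) (fnn w' f (nval w' u))" using f w'(1) unfolding bracket_map_def by blast
      then show "forc w' (econs u (econs t (econs f \<rho>))) (Exists Nat (Eq Nat (addT (S (App (Var 3) (Var 2))) (Var 0)) (App (Var 3) (Var 1))))"
        using w' ty[OF w'(1)] by (simp add: nless_def)
    qed
  qed
qed

text \<open>Surjectivity provides preimages and injectivity makes them unique, so unique choice
  yields an inverse as a term.\<close>

lemma forc_permutation:
  assumes p: "tyw w p = Some (Fun Nat Nat)" and f: "forc w (econs p \<rho>) (permutation (bvar 1) (Suc (Suc 0)))"
  shows "\<exists>i. perm_pair w p i"
proof -
  let ?pos = "Exists Nat (Eq Nat (addT (S Z) (Var 0)) (Var 1))"
  have ty: "tyw w' p = Some (Fun Nat Nat)" if "w \<sqsubseteq> w'" for w' using p that tyw_mono by blast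
  have "forc w (econs p \<rho>) (Conj (Forall Nat (Imp ?pos (Exists Nat (Eq Nat (addT (S Z) (Var 0)) (App (Var 2) (Var 1))))))
    (Conj (Forall Nat (Forall Nat (Imp (Conj (Exists Nat (Eq Nat (addT (S Z) (Var 0)) (Var 2))) (Conj ?pos (Eq Nat (App (Var 2) (Var 1)) (App (Var 2) (Var 0)))))
         (Eq Nat (Var 1) (Var 0)))))
      (Forall Nat (Imp ?pos (Exists Nat (Conj ?pos (Eq Nat (App (Var 2) (Var 0)) (Var 1))))))))"
    using f by (simp add: permutation_def pos_def unfold_btm eval_nat_numeral del: forc.simps)
  then have f1: "forc w (econs p \<rho>) (Forall Nat (Imp ?pos (Exists Nat (Eq Nat (addT (S Z) (Var 0)) (App (Var 2) (Var 1))))))"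
    and f2: "forc w (econs p \<rho>) (Forall Nat (Forall Nat (Imp (Conj (Exists Nat (Eq Nat (addT (S Z) (Var 0)) (Var 2))) (Conj ?pos (Eq Nat (App (Var 2) (Var 1)) (App (Var 2) (Var 0)))))
         (Eq Nat (Var 1) (Var 0)))))"
    and f3: "forc w (econs p \<rho>) (Forall Nat (Imp ?pos (Exists Nat (Conj ?pos (Eq Nat (App (Var 2) (Var 0)) (Var 1))))))"
    unfolding forc.simps(5) by blast+
  have pos: "fnn w' p x \<noteq> nzero w'" if "w \<sqsubseteq> w'" "x \<noteq> nzero w'" for w' x
    using forc_impD[OF forc_allD[OF f1 that(1), of "nrep w' x"] wle_refl] that ty[OF that(1)] by simp
  have inj: "x = y" if "w \<sqsubseteq> w'" "x \<noteq> nzero w'" "y \<noteq> nzero w'" "fnn w' p x = fnn w' p y" for w' x y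
    using forc_impD[OF forc_allD[OF forc_allD[OF f2 that(1), of "nrep w' x"] wle_refl, of "nrep w' y"] wle_refl] that ty[OF that(1)] by simp
  have surj: "\<exists>x. x \<noteq> nzero w' \<and> fnn w' p x = y" if "w \<sqsubseteq> w'" "y \<noteq> nzero w'" for w' y
  proof -
    have "forc w' (econs (nrep w' y) (econs p \<rho>)) (Exists Nat (Conj ?pos (Eq Nat (App (Var 2) (Var 0)) (Var 1))))"
      using forc_impD[OF forc_allD[OF f3 that(1), of "nrep w' y"] wle_refl] that ty[OF that(1)] by simp
    then obtain t where "tyw w' t = Some Nat" "forc w' (econs t (econs (nrep w' y) (econs p \<rho>))) (Conj ?pos (Eq Nat (App (Var 2) (Var 0)) (Var 1)))"
      unfolding forc.simps(9) by blast
    then show ?thesis using ty[OF that(1)] by (intro exI[of _ "nval w' t"]) simp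
  qed
  \<comment> \<open>Unique choice asks for a total relation, but permutations are only prescribed on
    positive numbers; 0 is paired with 0.\<close>
  let ?q = "Disj (Conj (Eq Nat (Var 1) Z) (Eq Nat (Var 0) Z)) (Conj ?pos (Conj (Exists Nat (Eq Nat (addT (S Z) (Var 0)) (Var 2))) (Eq Nat (App (Var 2) (Var 0)) (Var 1))))"
  have q: "forc w' (econs y (econs x (\<lambda>_. p))) ?q \<longleftrightarrow> nval w' x = nzero w' \<and> nval w' y = nzero w' \<or>
      nval w' y \<noteq> nzero w' \<and> nval w' x \<noteq> nzero w' \<and> fnn w' p (nval w' y) = nval w' x"
    if "w \<sqsubseteq> w'" "tyw w' x = Some Nat" "tyw w' y = Some Nat" for w' x y
    using that ty[OF that(1)] by simp
  have "\<exists>i. tyw w i = Some (Fun Nat Nat) \<and> (\<forall>w' x. w \<sqsubseteq> w' \<longrightarrow> tyw w' x = Some Nat \<longrightarrow> forc w' (econs (App i x) (econs x (\<lambda>_. p))) ?q)"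
  proof (rule forc_unique_choice)
    fix w' x assume a: "w \<sqsubseteq> w'" "tyw w' x = Some Nat"
    have "\<exists>y. nval w' x = nzero w' \<and> y = nzero w' \<or> y \<noteq> nzero w' \<and> nval w' x \<noteq> nzero w' \<and> fnn w' p y = nval w' x"
      using surj[OF a(1)] by (cases "nval w' x = nzero w'") auto
    then obtain y where y: "nval w' x = nzero w' \<and> y = nzero w' \<or> y \<noteq> nzero w' \<and> nval w' x \<noteq> nzero w' \<and> fnn w' p y = nval w' x" by blast
    then have "forc w' (econs (nrep w' y) (econs x (\<lambda>_. p))) ?q" using q[OF a, of "nrep w' y"] by (simp del: forc.simps)
    then show "\<exists>y. tyw w' y = Some Nat \<and> forc w' (econs y (econs x (\<lambda>_. p))) ?q" using nrep(1) by blast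
  next
    fix w' x y y' assume a: "w \<sqsubseteq> w'" "tyw w' x = Some Nat" "tyw w' y = Some Nat" "tyw w' y' = Some Nat"
       "forc w' (econs y (econs x (\<lambda>_. p))) ?q" "forc w' (econs y' (econs x (\<lambda>_. p))) ?q"
    then show "Eq Nat y' y \<in> Th w'" using q[OF a(1-3)] q[OF a(1,2,4)] inj[OF a(1), of "nval w' y'" "nval w' y"] by auto
  qed (use p in simp)
  then obtain i where i: "tyw w i = Some (Fun Nat Nat)" "\<And>w' x. w \<sqsubseteq> w' \<Longrightarrow> tyw w' x = Some Nat \<Longrightarrow> forc w' (econs (App i x) (econs x (\<lambda>_. p))) ?q" by blast
  have i': "fnn w' i x \<noteq> nzero w' \<and> fnn w' p (fnn w' i x) = x" if "w \<sqsubseteq> w'" "x \<noteq> nzero w'" for w' x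
    using i(2)[OF that(1), of "nrep w' x"] q[OF that(1), of "nrep w' x" "App i (nrep w' x)"] tyw_mono[OF i(1) that(1)] that(2)
    by (simp del: forc.simps)
  have "perm_pair w p i" unfolding perm_pair_def
    using p i(1) pos i' inj by metis
  then show ?thesis ..
qed

lemma forc_weak_permutably_convergent:
  assumes a: "tyw w a = Some (Fun Nat Real)" and c: "conv w a"
    and b: "\<And>w' p i. w \<sqsubseteq> w' \<Longrightarrow> perm_pair w' p i \<Longrightarrow> \<exists>f. bracket_map w' f \<and> conv w' (bracketed a p f)"
  shows "forc w (econs a \<rho>) (weak_permutably_convergent (bvar 0) (Suc 0))"
proof -
  have u: "weak_permutably_convergent (bvar 0) (Suc 0) = Conj (series_converges (bvar 0) (Suc 0))
    (Forall (Fun Nat Nat) (Imp (permutation (bvar 1) (Suc (Suc 0))) (Exists (Fun Nat Nat) (Conj (bracketing_map (bvar 2) (Suc (Suc (Suc 0))))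
      (series_converges (bracketing (\<^bold>\<lambda>\<^bsub>Nat\<^esub> \<lambda>n. bvar 0 \<cdot> (bvar 1 \<cdot> n)) (bvar 2)) (Suc (Suc (Suc 0))))))))"
    by (simp add: weak_permutably_convergent_def bconj_def ball_def bimp_def bex_def numeral_2_eq_2)
  show ?thesis unfolding u forc.simps(5)
  proof (intro conjI)
    show "forc w (econs a \<rho>) (series_converges (bvar 0) (Suc 0))" using forc_series_converges_var[OF a] c by blast
    show "forc w (econs a \<rho>) (Forall (Fun Nat Nat) (Imp (permutation (bvar 1) (Suc (Suc 0))) (Exists (Fun Nat Nat) (Conj (bracketing_map (bvar 2) (Suc (Suc (Suc 0))))
      (series_converges (bracketing (\<^bold>\<lambda>\<^bsub>Nat\<^esub> \<lambda>n. bvar 0 \<cdot> (bvar 1 \<cdot> n)) (bvar 2)) (Suc (Suc (Suc 0))))))))"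
    proof (subst forc.simps(8), intro allI impI, subst forc.simps(7), intro allI impI)
      fix w1 p w' assume d: "w \<sqsubseteq> w1" "tyw w1 p = Some (Fun Nat Nat)" "w1 \<sqsubseteq> w'" "forc w' (econs p (econs a \<rho>)) (permutation (bvar 1) (Suc (Suc 0)))"
      have w': "w \<sqsubseteq> w'" "tyw w' p = Some (Fun Nat Nat)" "tyw w' a = Some (Fun Nat Real)" using a d wle_trans tyw_mono by blast+
      obtain i where "perm_pair w' p i" using forc_permutation[OF w'(2) d(4)] by blast
      then obtain f where f: "bracket_map w' f" "conv w' (bracketed a p f)" using b[OF w'(1)] by blast
      then have tf: "tyw w' f = Some (Fun Nat Nat)" unfolding bracket_map_def by blast
      show "forc w' (econs p (econs a \<rho>)) (Exists (Fun Nat Nat) (Conj (bracketing_map (bvar 2) (Suc (Suc (Suc 0))))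
        (series_converges (bracketing (\<^bold>\<lambda>\<^bsub>Nat\<^esub> \<lambda>n. bvar 0 \<cdot> (bvar 1 \<cdot> n)) (bvar 2)) (Suc (Suc (Suc 0))))))"
        unfolding forc.simps(9) forc.simps(5)
        using tf forc_bracketing_map[OF f(1)] forc_bracketing_converges[OF w'(3,2) tf] f(2) by blast
    qed
  qed
qed

section \<open>Hypotheses and conclusion of BD-N\<close>

lemma forc_inhabited:
  assumes "tyw w A = Some (Pow Nat)" "forc w (econs A \<rho>) (inhabited (bvar 0) (Suc 0))"
  shows "\<exists>x. memb w A x"
  using assms by (auto simp: inhabited_def unfold_btm)

text \<open>A detachable index set turns into an enumeration along all natural numbers: indices
  outside it are sent to the known element \<open>x0\<close>.\<close>

lemma forc_countable:
  assumes A: "tyw w A = Some (Pow Nat)" and f: "forc w (econs A \<rho>) (Defs.countable (bvar 0) (Suc 0))" and x0: "memb w A x0"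
  shows "\<exists>s. tyw w s = Some (Fun Nat Nat) \<and> (\<forall>w' x. w \<sqsubseteq> w' \<longrightarrow> memb w' A (fnn w' s x)) \<and>
    (\<forall>w' x. w \<sqsubseteq> w' \<longrightarrow> memb w' A x \<longrightarrow> (\<exists>n. fnn w' s n = x))"
proof -
  let ?d = "Forall Nat (Disj (Mem (Var 0) (Var 2)) (Imp (Mem (Var 0) (Var 2)) Bot))"
  let ?e = "Forall Nat (Iff (Mem (Var 0) (Var 3)) (Exists Nat (Conj (Mem (Var 0) (Var 3)) (Eq Nat (App (Var 2) (Var 0)) (Var 1)))))"
  have "forc w (econs A \<rho>) (Exists (Pow Nat) (Exists (Fun Nat Nat) (Conj ?d ?e)))"
    using f by (simp add: Defs.countable_def detachable_def unfold_btm eval_nat_numeral del: forc.simps)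
  then obtain D g where D: "tyw w D = Some (Pow Nat)" and g: "tyw w g = Some (Fun Nat Nat)"
    and d: "forc w (econs g (econs D (econs A \<rho>))) ?d" and e: "forc w (econs g (econs D (econs A \<rho>))) ?e"
    unfolding forc.simps(9) forc.simps(5) by blast
  have ty: "tyw w' A = Some (Pow Nat)" "tyw w' D = Some (Pow Nat)" "tyw w' g = Some (Fun Nat Nat)" if "w \<sqsubseteq> w'" for w'
    using A D g that tyw_mono by blast+
  have mem_mono: "memb w'' B (nval w'' t)" if "memb w' B (nval w' t)" "w' \<sqsubseteq> w''" "tyw w' t = Some Nat" "tyw w' B = Some (Pow Nat)" for w' w'' B t
    using that Mem_nval[of w' t B] Mem_nval[of w'' t B] tyw_mono[OF that(3,2)] tyw_mono[OF that(4,2)] by (auto simp: wle_def simp del: Mem_nval)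
  have dec: "memb w' D x \<or> (\<forall>w''. w' \<sqsubseteq> w'' \<longrightarrow> \<not> memb w'' D (nval w'' (nrep w' x)))" if "w \<sqsubseteq> w'" for w' x
    using forc_allD[OF d that, of "nrep w' x"] ty(2)[OF that] tyw_mono[OF ty(2)[OF that]] by simp
  have img: "memb w' A x \<longleftrightarrow> (\<exists>n. memb w' D n \<and> fnn w' g n = x)" if "w \<sqsubseteq> w'" for w' x
  proof -
    let ?r = "econs (nrep w' x) (econs g (econs D (econs A \<rho>)))"
    have "forc w' ?r (Mem (Var 0) (Var 3)) \<longleftrightarrow> forc w' ?r (Exists Nat (Conj (Mem (Var 0) (Var 3)) (Eq Nat (App (Var 2) (Var 0)) (Var 1))))"
      using forc_allD[OF e that, of "nrep w' x"] wle_refl unfolding forc.simps(5,7) by (meson nrep(1))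
    moreover have "(tyw w' t = Some Nat \<and> Mem t D \<in> Th w' \<and> Eq Nat (App g t) (nrep w' x) \<in> Th w') \<longleftrightarrow>
       (tyw w' t = Some Nat \<and> memb w' D (nval w' t) \<and> fnn w' g (nval w' t) = x)" for t
      using ty[OF that] by (cases "tyw w' t = Some Nat") simp_all
    then have "(\<exists>t. tyw w' t = Some Nat \<and> Mem t D \<in> Th w' \<and> Eq Nat (App g t) (nrep w' x) \<in> Th w') \<longleftrightarrow> (\<exists>n. memb w' D n \<and> fnn w' g n = x)"
      using ex_nval[of w' "\<lambda>n. memb w' D n \<and> fnn w' g n = x"] by simp
    ultimately show ?thesis using ty[OF that] by simp
  qed
  \<comment> \<open>The graph of the enumeration; detachability makes the case distinction total at
    every world, and the cases exclude each other.\<close>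
  let ?q = "Disj (Conj (Mem (Var 1) (Var 2)) (Eq Nat (Var 0) (App (Var 3) (Var 1)))) (Conj (Imp (Mem (Var 1) (Var 2)) Bot) (Eq Nat (Var 0) (Var 4)))"
  let ?\<rho> = "econs D (econs g (\<lambda>_. nrep w x0))"
  have q: "forc w' (econs y (econs x ?\<rho>)) ?q \<longleftrightarrow> memb w' D (nval w' x) \<and> nval w' y = fnn w' g (nval w' x) \<or>
      \<not> memb w' D (nval w' x) \<and> nval w' y = nval w' (nrep w x0)"
    if "w \<sqsubseteq> w'" "tyw w' x = Some Nat" "tyw w' y = Some Nat" for w' x y
  proof -
    \<comment> \<open>The negation in the graph speaks of all later worlds; by \<open>dec\<close>,
      an index outside \<open>D\<close> at \<open>w'\<close> never enters \<open>D\<close>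
      later.\<close>
    have "(\<forall>w''. w' \<sqsubseteq> w'' \<longrightarrow> Mem x D \<notin> Th w'') \<longleftrightarrow> \<not> memb w' D (nval w' x)"
    proof
      assume "\<forall>w''. w' \<sqsubseteq> w'' \<longrightarrow> Mem x D \<notin> Th w''"
      then have "Mem x D \<notin> Th w'" using wle_refl by blast
      then show "\<not> memb w' D (nval w' x)" using that(2) ty[OF that(1)] by simp
    next
      assume n: "\<not> memb w' D (nval w' x)"
      show "\<forall>w''. w' \<sqsubseteq> w'' \<longrightarrow> Mem x D \<notin> Th w''"
      proof (intro allI impI)
        fix w'' assume l: "w' \<sqsubseteq> w''"
        have "nval w'' (nrep w' (nval w' x)) = nval w'' x" using nval_mono[of w' "nrep w' (nval w' x)" x w''] l that by simp
        then have "\<not> memb w'' D (nval w'' x)" using dec[OF that(1), of "nval w' x"] n l by metis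
        then show "Mem x D \<notin> Th w''" using tyw_mono[OF that(2) l] tyw_mono[OF ty(2)[OF that(1)] l] by simp
      qed
    qed
    then show ?thesis using that ty[OF that(1)] by simp
  qed
  have "\<exists>s. tyw w s = Some (Fun Nat Nat) \<and> (\<forall>w' x. w \<sqsubseteq> w' \<longrightarrow> tyw w' x = Some Nat \<longrightarrow> forc w' (econs (App s x) (econs x ?\<rho>)) ?q)"
  proof (rule forc_unique_choice)
    fix w' x assume a: "w \<sqsubseteq> w'" "tyw w' x = Some Nat"
    obtain y where "memb w' D (nval w' x) \<and> y = fnn w' g (nval w' x) \<or> \<not> memb w' D (nval w' x) \<and> y = nval w' (nrep w x0)" by blast
    then have "forc w' (econs (nrep w' y) (econs x ?\<rho>)) ?q" using q[OF a, of "nrep w' y"] by (simp del: forc.simps)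
    then show "\<exists>y. tyw w' y = Some Nat \<and> forc w' (econs y (econs x ?\<rho>)) ?q" using nrep(1) by blast
  next
    fix w' x y y' assume a: "w \<sqsubseteq> w'" "tyw w' x = Some Nat" "tyw w' y = Some Nat" "tyw w' y' = Some Nat"
       "forc w' (econs y (econs x ?\<rho>)) ?q" "forc w' (econs y' (econs x ?\<rho>)) ?q"
    then show "Eq Nat y' y \<in> Th w'" using q[OF a(1-3)] q[OF a(1,2,4)] by (auto simp del: forc.simps)
  qed (use D g in simp)
  then obtain s where s: "tyw w s = Some (Fun Nat Nat)" "\<And>w' x. w \<sqsubseteq> w' \<Longrightarrow> tyw w' x = Some Nat \<Longrightarrow> forc w' (econs (App s x) (econs x ?\<rho>)) ?q" by blast
  have sv: "memb w' D x \<and> fnn w' s x = fnn w' g x \<or> \<not> memb w' D x \<and> fnn w' s x = nval w' (nrep w x0)" if "w \<sqsubseteq> w'" for w' x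
    using s(2)[OF that, of "nrep w' x"] q[OF that, of "nrep w' x" "App s (nrep w' x)"] tyw_mono[OF s(1) that] by (simp del: forc.simps)
  have "memb w' A (fnn w' s x)" if "w \<sqsubseteq> w'" for w' x
    using sv[OF that, of x] img[OF that] mem_mono[of w A "nrep w x0" w'] that x0 A by (metis nrep)
  moreover have "\<exists>n. fnn w' s n = x" if "w \<sqsubseteq> w'" "memb w' A x" for w' x
    using sv[OF that(1)] img[OF that(1)] that(2) by metis
  ultimately show ?thesis using s(1) by blast
qed

lemma forc_pseudobounded:
  assumes A: "tyw w A = Some (Pow Nat)" and f: "forc w (econs A \<rho>) (pseudobounded (bvar 0) (Suc 0))"
  shows "pseudob w A"
  unfolding pseudob_def
proof (intro allI impI)
  fix w' t assume t: "w \<sqsubseteq> w'" "tyw w' t = Some (Fun Nat Nat)" "\<forall>w'' x. w' \<sqsubseteq> w'' \<longrightarrow> memb w'' A (fnn w'' t x)"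
  let ?pos = "Exists Nat (Eq Nat (addT (S Z) (Var 0)) (Var 1))"
  let ?g = "Forall Nat (Imp (Exists Nat (Eq Nat (addT (Var 2) (Var 0)) (Var 1))) (Exists Nat (Eq Nat (addT (S (App (Var 3) (Var 1))) (Var 0)) (Var 1))))"
  have "forc w (econs A \<rho>) (Forall (Fun Nat Nat) (Imp (Forall Nat (Imp ?pos (Mem (App (Var 1) (Var 0)) (Var 2)))) (Exists Nat (Conj ?pos ?g))))"
    using f by (simp add: pseudobounded_def pos_def unfold_btm eval_nat_numeral del: forc.simps)
  from forc_impD[OF forc_allD[OF this t(1,2)] wle_refl]
  have i: "forc w' (econs t (econs A \<rho>)) (Forall Nat (Imp ?pos (Mem (App (Var 1) (Var 0)) (Var 2)))) \<Longrightarrow>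
     forc w' (econs t (econs A \<rho>)) (Exists Nat (Conj ?pos ?g))" .
  have ty: "tyw w'' A = Some (Pow Nat)" "tyw w'' t = Some (Fun Nat Nat)" if "w' \<sqsubseteq> w''" for w''
    using A t that tyw_mono wle_trans by blast+
  have "forc w' (econs t (econs A \<rho>)) (Forall Nat (Imp ?pos (Mem (App (Var 1) (Var 0)) (Var 2))))"
  proof (subst forc.simps(8), intro allI impI, subst forc.simps(7), intro allI impI)
    fix w1 x w'' assume a: "w' \<sqsubseteq> w1" "tyw w1 x = Some Nat" "w1 \<sqsubseteq> w''"
    then have w'': "w' \<sqsubseteq> w''" "tyw w'' x = Some Nat" using wle_trans tyw_mono by blast+
    then show "forc w'' (econs x (econs t (econs A \<rho>))) (Mem (App (Var 1) (Var 0)) (Var 2))" using t(3) ty[OF w''(1)] by simp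
  qed
  from i[OF this] obtain N where N: "tyw w' N = Some Nat" "forc w' (econs N (econs t (econs A \<rho>))) ?g"
    unfolding forc.simps(9) forc.simps(5) by blast
  have "nless w'' (fnn w'' t n) n" if "w' \<sqsubseteq> w''" "nle w'' (nval w'' N) n" for w'' n
    using forc_impD[OF forc_allD[OF N(2) that(1), of "nrep w'' n"] wle_refl] that ty[OF that(1)] tyw_mono[OF N(1) that(1)]
    by (simp add: nless_def)
  then show "\<exists>N. tyw w' N = Some Nat \<and> (\<forall>w'' n. w' \<sqsubseteq> w'' \<longrightarrow> nle w'' (nval w'' N) n \<longrightarrow> nless w'' (fnn w'' t n) n)"
    using N(1) by blast
qed

lemma forc_bounded:
  assumes A: "tyw w A = Some (Pow Nat)" and N: "tyw w N = Some Nat"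
    and b: "\<And>w' x. w \<sqsubseteq> w' \<Longrightarrow> memb w' A x \<Longrightarrow> nle w' x (nval w' N)"
  shows "forc w (econs A \<rho>) (bounded (bvar 0) (Suc 0))"
proof -
  have "forc w (econs N (econs A \<rho>)) (Forall Nat (Imp (Mem (Var 0) (Var 2)) (Exists Nat (Eq Nat (addT (Var 1) (Var 0)) (Var 2)))))"
  proof (subst forc.simps(8), intro allI impI, subst forc.simps(7), intro allI impI)
    fix w1 x w' assume a: "w \<sqsubseteq> w1" "tyw w1 x = Some Nat" "w1 \<sqsubseteq> w'" "forc w' (econs x (econs N (econs A \<rho>))) (Mem (Var 0) (Var 2))"
    have w': "w \<sqsubseteq> w'" "tyw w' x = Some Nat" "tyw w' N = Some Nat" "tyw w' A = Some (Pow Nat)" using a A N wle_trans tyw_mono by blast+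
    then have "memb w' A (nval w' x)" using a(4) by simp
    then show "forc w' (econs x (econs N (econs A \<rho>))) (Exists Nat (Eq Nat (addT (Var 1) (Var 0)) (Var 2)))" using b[OF w'(1)] w' by simp
  qed
  moreover have "bounded (bvar 0) (Suc 0) = Exists Nat (Forall Nat (Imp (Mem (Var 0) (Var 2)) (Exists Nat (Eq Nat (addT (Var 1) (Var 0)) (Var 2)))))"
    by (simp add: bounded_def unfold_btm eval_nat_numeral)
  ultimately show ?thesis using N by (simp only: forc.simps(9)) blast
qed

text \<open>The hypothesis is instantiated once, with the series attached to an enumeration of the
  given set, at the world where that set satisfies the premises.\<close>

lemma forc_BD_N:
  assumes star: "forc w \<rho> (weak_permutable_implies_absolute 0)"
  shows "forc w \<rho> (BD_N 0)"
proof -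
  have star': "forc w \<rho> (Forall (Fun Nat Real) (Imp (weak_permutably_convergent (bvar 0) (Suc 0)) (absolutely_convergent (bvar 0) (Suc 0))))"
    using star by (simp only: weak_permutable_implies_absolute_def ball_def bimp_def)
  let ?P = "(\<^bold>\<forall>\<^bsub>Nat\<^esub> \<lambda>x. x \<^bold>\<in> bvar 0 \<^bold>\<longrightarrow> pos x) (Suc 0)"
  have u: "BD_N 0 = Forall (Pow Nat) (Imp (Conj ?P (Conj (inhabited (bvar 0) (Suc 0)) (Conj (Defs.countable (bvar 0) (Suc 0)) (pseudobounded (bvar 0) (Suc 0)))))
     (bounded (bvar 0) (Suc 0)))"
    by (simp only: BD_N_def bconj_def bimp_def ball_def)
  show ?thesis unfolding u
  proof (subst forc.simps(8), intro allI impI, subst forc.simps(7), intro allI impI)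
    fix w1 A w' assume a: "w \<sqsubseteq> w1" "tyw w1 A = Some (Pow Nat)" "w1 \<sqsubseteq> w'"
      and f: "forc w' (econs A \<rho>) (Conj ?P (Conj (inhabited (bvar 0) (Suc 0)) (Conj (Defs.countable (bvar 0) (Suc 0)) (pseudobounded (bvar 0) (Suc 0)))))"
    have w': "w \<sqsubseteq> w'" and A: "tyw w' A = Some (Pow Nat)" using a wle_trans tyw_mono by blast+
    obtain x0 where x0: "memb w' A x0" using forc_inhabited[OF A] f unfolding forc.simps(5) by blast
    obtain s where s: "tyw w' s = Some (Fun Nat Nat)" "\<And>w'' x. w' \<sqsubseteq> w'' \<Longrightarrow> memb w'' A (fnn w'' s x)"
      "\<And>w'' x. w' \<sqsubseteq> w'' \<Longrightarrow> memb w'' A x \<Longrightarrow> \<exists>n. fnn w'' s n = x"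
      using forc_countable[OF A _ x0] f unfolding forc.simps(5) by blast
    have pb: "pseudob w' A" using forc_pseudobounded[OF A] f unfolding forc.simps(5) by blast
    obtain v where v: "recips w' v" using ex_recips by blast
    let ?a = "aseq s v"
    have ta: "tyw w' ?a = Some (Fun Nat Real)" using aseq_ty[OF s(1) v] .
    have "forc w' (econs ?a \<rho>) (weak_permutably_convergent (bvar 0) (Suc 0))"
    proof (rule forc_weak_permutably_convergent[OF ta conv_aseq[OF s(1) v]])
      fix w'' p i assume b: "w' \<sqsubseteq> w''" "perm_pair w'' p i"
      have "pseudob w'' A" using pb b(1) wle_trans unfolding pseudob_def by blast
      then show "\<exists>f. bracket_map w'' f \<and> conv w'' (bracketed ?a p f)"
        using b s(2) wle_trans tyw_mono[OF s(1) b(1)] recips_mono[OF v b(1)] tyw_mono[OF A b(1)]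
        by (intro convergent_bracketing[of w'' s v A p i]) blast+
    qed
    then have "forc w' (econs ?a \<rho>) (absolutely_convergent (bvar 0) (Suc 0))"
      using forc_impD[OF forc_allD[OF star' w' ta] wle_refl] by blast
    then have "conv w' (absT ?a)" using forc_absolutely_convergent[OF ta] by blast
    then obtain N where N: "tyw w' N = Some Nat" "\<And>w'' x. w' \<sqsubseteq> w'' \<Longrightarrow> nle w'' (fnn w'' s x) (nval w'' N)"
      using bounded_of_absolutely_convergent[OF s(1) v] by blast
    show "forc w' (econs A \<rho>) (bounded (bvar 0) (Suc 0))"
      using s(3) N(2) by (intro forc_bounded[OF A N(1)]) metis
  qed
qed

end

theorem theorem4p1:
  shows "BISH_proves (weak_permutable_implies_absolute \<^bold>\<longrightarrow> BD_N)"
  unfolding BISH_proves_def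
proof (rule derives_of_forcing)
  have c: "close (weak_permutable_implies_absolute \<^bold>\<longrightarrow> BD_N) = Imp (weak_permutable_implies_absolute 0) (BD_N 0)"
    by (simp add: close_def bimp_def)
  show "fok (\<lambda>_. None) (close (weak_permutable_implies_absolute \<^bold>\<longrightarrow> BD_N))"
    by (simp add: weak_permutable_implies_absolute_def weak_permutably_convergent_def absolutely_convergent_def
      series_converges_def bracketing_def bracketing_map_def permutation_def seq_tendsto_def sumR_def recN_def pos_def
      BD_N_def inhabited_def Defs.countable_def detachable_def pseudobounded_def bounded_def unfold_btm)
  fix w assume "consistent"
  then interpret consistent .
  show "forc w Var (close (weak_permutable_implies_absolute \<^bold>\<longrightarrow> BD_N))"
    unfolding c using forc_BD_N by simp
qed

end
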